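(* Let $n\ge2$, $j\ge1$, $j\not\equiv0\pmod n$. Let $\gamma(x,t)$ be a solution of the $j$-th central affine curve flow $\gamma_t=gZ_{j,0}(u)e_1$ on $\mathcal{M}_n(\mathbb{R})$, with $g(\cdot,t)$ and $u(\cdot,t)$ the central affine moving frame and curvature of $\gamma(\cdot,t)$. Let $k_1,k_2$ be non-zero real constants and $d(k_1),d(k_2)\in GL(n,\mathbb{R})$ constant matrices with $\det d(k_i)=(-1)^nk_i$. Let $h_i$ be a (real-valued) solution of $(\mathrm{BT})_{u,k_i}$ for $i=1,2$, suppose $h_1\neq h_2$, and set $$\tilde h_1=h_1+\frac{(h_1-h_2)_x}{h_1-h_2},\qquad \tilde h_2=h_2+\frac{(h_1-h_2)_x}{h_1-h_2}.$$ Let $g_i(x,t)=d(k_i)g(x,t)f_{u,h_i}(x,t,0)^{-1}$ and $\gamma_i=g_ie_1$ for $i=1,2$. Then $\tilde h_2*\gamma_1=\tilde h_1*\gamma_2$ is again a solution of the $j$-th central affine curve flow, i.e. $$d(k_2)\,g_1(x,t)\,f_{h_1*u,\tilde h_2}(x,t,0)^{-1}e_1=d(k_1)\,g_2(x,t)\,f_{h_2*u,\tilde h_1}(x,t,0)^{-1}e_1$$ is again a solution of the $j$-th central affine curve flow.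
   Context: $\mathcal{M}_n(\mathbb{R})$ is the set of smooth $\gamma:\mathbb{R}\to\mathbb{R}^n\setminus\{0\}$ with $\det(\gamma,\gamma_x,\ldots,\gamma_x^{(n-1)})=1$. For such $\gamma$ the central affine moving frame $g=(\gamma,\ldots,\gamma_x^{(n-1)})$ satisfies $g_x=g(b+u)$ with $b=\sum_{i=1}^{n-1}e_{i+1,i}$ and central affine curvature $u=\sum_{i=1}^{n-1}u_ie_{in}$, where $\gamma_x^{(n)}=u_1\gamma+\cdots+u_{n-1}\gamma_x^{(n-2)}$. $V_n=\bigoplus_{i=1}^{n-1}\mathbb{R}e_{in}$, $e_1=(1,0,\ldots,0)^t$. A solution of the $j$-th central affine curve flow is a smooth $\gamma(x,t)$ with $\gamma(\cdot,t)\in\mathcal{M}_n(\mathbb{R})$ and $\gamma_t=gZ_{j,0}(u)e_1$. Let $J=e_{1n}\lambda+b$. For smooth $V_n$-valued $u$, let $Y(u,\lambda)=e_{1n}\lambda+\sum_{i\le 0}Y_{1,i}(u)\lambda^i$ be the unique formal series with smooth $sl(n)$-valued coefficients satisfying $Y_x+[J+u,Y]=0$ and $Y^n=\lambda I_n$; its coefficients are differential polynomials in $u$. Write $Y^j=\sum_i Y_{j,i}(u)\lambda^i$. There is a unique strictly upper triangular $\zeta_j(u)$ with $[\partial_x+b+u,\,Y_{j,0}(u)-\zeta_j(u)]\in V_n$, where $[\partial_x+A,B]=B_x+[A,B]$. Set $Z_j(u,\lambda)=\sum_{i\ge0}Y_{j,i}(u)\lambda^i-\zeta_j(u)$ and $Z_{j,0}(u)=Z_j(u,0)$.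 Given functions $u_1,\dots,u_{n-1},h$ of $(x,t)$, define $w=(w_1,\ldots,w_n)^t$ by $w_n=1$, $w_{n-1}=-h$, and $w_{i-1}=-(w_i)_x-hw_i-u_i$ for $i=n-1,\ldots,2$. The system $(\mathrm{BT})_{u,k}$ for $h$ is $$(w_1)_x+h\,w_1+u_1+k=0,\qquad h_t=-\partial_x\big[(Z_j(u,k)\,w)_n\big]$$ (the subscript $n$ is the last component). Set $s_i(u,h)=(w_i)_x-\sum_{m=i+1}^{n}\binom{m-1}{i-1}w_m h_x^{(m-i)}$, $1\le i\le n-1$; $h*u=\sum_{i=1}^{n-1}(u_i+s_i(u,h))e_{in}$; and $f_{u,h}(x,t,\lambda)=J+hI_n+N(u,h)$ where $N$ is strictly upper triangular with $N_{ij}=\binom{j-1}{i-1}h_x^{(j-i)}$ for $1\le i<j<n$ and $N_{in}=u_i+s_i(u,h)+\binom{n-1}{i-1}h_x^{(n-i)}$ for $1\le i\le n-1$. For a solution $\gamma$ with frame $g$ and curvature $u$ and $h$ a solution of $(\mathrm{BT})_{u,k}$, $h*\gamma=d(k)\,g\,f_{u,h}(\cdot,\cdot,0)^{-1}e_1$.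
   Formalization: The equality of the two curves is claimed only when d(k1) and d(k2) commute (it fails otherwise); both curves are shown to be solutions for all d(k1), d(k2). The condition h1 ≠ h2 is taken at every point (x,t), so that the tilde functions are defined. *)

theory Defs
  imports
    "HOL-Analysis.Derivative"
    "HOL-Computational_Algebra.Formal_Laurent_Series"
    "Jordan_Normal_Form.Determinant"
    "Jordan_Normal_Form.Gauss_Jordan_Elimination"
begin

unbundle no fps_syntax

section \<open>Preliminaries\<close>

primrec Ck_on :: "nat \<Rightarrow> 'a::real_normed_vector set \<Rightarrow> ('a \<Rightarrow> real) \<Rightarrow> bool" where
  "Ck_on 0 S f \<longleftrightarrow> continuous_on S f"
| "Ck_on (Suc m) S f \<longleftrightarrow>
     (\<forall>x\<in>S. f differentiable (at x)) \<and> (\<forall>v. Ck_on m S (\<lambda>x. frechet_derivative f (at x) v))"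

text \<open>Only used for open \<open>S\<close>.\<close>

definition smooth_fun_on :: "'a::real_normed_vector set \<Rightarrow> ('a \<Rightarrow> real) \<Rightarrow> bool" where
  "smooth_fun_on S f \<longleftrightarrow> (\<forall>m. Ck_on m S f)"

text \<open>
  Matrices of the library are indexed from 0. The formulas below are written with indices
  from \<open>1\<close> to \<open>n\<close>; \<open>mat1\<close> performs the shift. Likewise, the components
  \<open>u 1, \<dots>, u (n-1)\<close> of a \<open>V\<^sub>n\<close>-valued function are given by
  \<open>u :: nat \<Rightarrow> real \<Rightarrow> real\<close>.
\<close>

definition mat1 :: "nat \<Rightarrow> (nat \<Rightarrow> nat \<Rightarrow> 'a) \<Rightarrow> 'a mat" where
  "mat1 n F = mat n n (\<lambda>(i, j). F (Suc i) (Suc j))"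

definition mat_inv :: "real mat \<Rightarrow> real mat" where
  "mat_inv A = the (mat_inverse A)"

definition mat_deriv :: "nat \<Rightarrow> (real \<Rightarrow> real mat) \<Rightarrow> real \<Rightarrow> real mat" where
  "mat_deriv n A x = mat n n (\<lambda>(r, c). deriv (\<lambda>y. A y $$ (r, c)) x)"

section \<open>Central affine curves\<close>

text \<open>Column \<open>c\<close> (counted from 0) is the \<open>c\<close>-th derivative of the curve.\<close>

definition frame :: "nat \<Rightarrow> (real \<Rightarrow> real vec) \<Rightarrow> real \<Rightarrow> real mat" where
  "frame n \<gamma> x = mat n n (\<lambda>(r, c). (deriv ^^ c) (\<lambda>y. \<gamma> y $ r) x)"

definition central_affine_curves :: "nat \<Rightarrow> (real \<Rightarrow> real vec) set" where
  "central_affine_curves n =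
    {\<gamma>. (\<forall>x. \<gamma> x \<in> carrier_vec n \<and> \<gamma> x \<noteq> 0\<^sub>v n) \<and>
        (\<forall>r<n. smooth_fun_on UNIV (\<lambda>x. \<gamma> x $ r)) \<and>
        (\<forall>x. det (frame n \<gamma> x) = 1)}"

text \<open>
  The coefficients in \<open>\<gamma>\<^sup>(\<^sup>n\<^sup>) = u\<^sub>1 \<gamma> + \<dots> + u\<^sub>n\<^sub>-\<^sub>1 \<gamma>\<^sup>(\<^sup>n\<^sup>-\<^sup>2\<^sup>)\<close>, which are unique for curves in
  \<open>central_affine_curves n\<close>. The unused indices are set to 0.
\<close>

definition curvature :: "nat \<Rightarrow> (real \<Rightarrow> real vec) \<Rightarrow> nat \<Rightarrow> real \<Rightarrow> real" where
  "curvature n \<gamma> = (THE u.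
     (\<forall>i x. i \<notin> {1..<n} \<longrightarrow> u i x = 0) \<and>
     (\<forall>x. \<forall>r<n. (deriv ^^ n) (\<lambda>y. \<gamma> y $ r) x =
        (\<Sum>i = 1..<n. u i x * (deriv ^^ (i - 1)) (\<lambda>y. \<gamma> y $ r) x)))"

definition b_plus_u :: "nat \<Rightarrow> (nat \<Rightarrow> real \<Rightarrow> real) \<Rightarrow> real \<Rightarrow> real mat" where
  "b_plus_u n u x = mat1 n (\<lambda>i j.
     (if i = j + 1 then 1 else 0) + (if j = n \<and> i < n then u i x else 0))"

definition V_space :: "nat \<Rightarrow> real mat set" where
  "V_space n = {A \<in> carrier_mat n n. \<exists>v.
     A = mat1 n (\<lambda>i j. if j = n \<and> i < n then v i else 0)}"

section \<open>The central affine curve flows\<close>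

text \<open>
  Formal series in \<open>\<lambda>\<close> with finitely many positive powers are Laurent series in \<open>\<lambda>\<^sup>-\<^sup>1\<close>: the
  indeterminate \<open>fls_X\<close> stands for \<open>\<lambda>\<^sup>-\<^sup>1\<close>, so that \<open>\<lambda>\<close> is \<open>fls_X_inv\<close> and the coefficient of
  \<open>\<lambda>\<^sup>i\<close> has index \<open>- i\<close>.
\<close>

definition lam_coeff :: "int \<Rightarrow> real fls mat \<Rightarrow> real mat" where
  "lam_coeff i A = map_mat (\<lambda>a. fls_nth a (- i)) A"

definition J_series :: "nat \<Rightarrow> real fls mat" where
  "J_series n = mat1 n (\<lambda>i j.
     (if i = 1 \<and> j = n then fls_X_inv else 0) + (if i = j + 1 then 1 else 0))"

definition u_series :: "nat \<Rightarrow> (nat \<Rightarrow> real \<Rightarrow> real) \<Rightarrow> real \<Rightarrow> real fls mat" where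
  "u_series n u x = mat1 n (\<lambda>i j. if j = n \<and> i < n then fls_const (u i x) else 0)"

definition Y_series :: "nat \<Rightarrow> (nat \<Rightarrow> real \<Rightarrow> real) \<Rightarrow> real \<Rightarrow> real fls mat" where
  "Y_series n u = (THE Y.
     (\<forall>x. Y x \<in> carrier_mat n n) \<and>
     (\<forall>x. lam_coeff 1 (Y x) = mat1 n (\<lambda>i j. if i = 1 \<and> j = n then 1 else 0)) \<and>
     (\<forall>x. \<forall>i>1. lam_coeff i (Y x) = 0\<^sub>m n n) \<and>
     (\<forall>i. \<forall>r<n. \<forall>c<n. smooth_fun_on UNIV (\<lambda>x. lam_coeff i (Y x) $$ (r, c))) \<and>
     (\<forall>i x. (\<Sum>r<n. lam_coeff i (Y x) $$ (r, r)) = 0) \<and>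
     (\<forall>i x. mat_deriv n (\<lambda>y. lam_coeff i (Y y)) x
        + lam_coeff i ((J_series n + u_series n u x) * Y x - Y x * (J_series n + u_series n u x))
        = 0\<^sub>m n n) \<and>
     (\<forall>x. Y x ^\<^sub>m n = fls_X_inv \<cdot>\<^sub>m 1\<^sub>m n))"

definition Y_coeff ::
    "nat \<Rightarrow> nat \<Rightarrow> int \<Rightarrow> (nat \<Rightarrow> real \<Rightarrow> real) \<Rightarrow> real \<Rightarrow> real mat" where
  "Y_coeff n j i u x = lam_coeff i (Y_series n u x ^\<^sub>m j)"

definition zeta :: "nat \<Rightarrow> nat \<Rightarrow> (nat \<Rightarrow> real \<Rightarrow> real) \<Rightarrow> real \<Rightarrow> real mat" where
  "zeta n j u = (THE \<zeta>.
     (\<forall>x. \<zeta> x \<in> carrier_mat n n) \<and>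
     (\<forall>r<n. \<forall>c<n. smooth_fun_on UNIV (\<lambda>x. \<zeta> x $$ (r, c))) \<and>
     (\<forall>x. \<forall>r<n. \<forall>c\<le>r. \<zeta> x $$ (r, c) = 0) \<and>
     (\<forall>x. mat_deriv n (\<lambda>y. Y_coeff n j 0 u y - \<zeta> y) x
        + (b_plus_u n u x * (Y_coeff n j 0 u x - \<zeta> x)
           - (Y_coeff n j 0 u x - \<zeta> x) * b_plus_u n u x) \<in> V_space n))"

text \<open>
  \<open>Z\<^sub>j(u, \<lambda>)\<close> at a real value \<open>l\<close> of \<open>\<lambda>\<close>. As \<open>Y\<close> has degree 1 in \<open>\<lambda>\<close>, the power \<open>Y\<^sup>j\<close> has no
  coefficients with index above \<open>j\<close>, and the sum over all \<open>i \<ge> 0\<close> is the sum over \<open>i \<le> j\<close>.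
\<close>

definition Z_at ::
    "nat \<Rightarrow> nat \<Rightarrow> (nat \<Rightarrow> real \<Rightarrow> real) \<Rightarrow> real \<Rightarrow> real \<Rightarrow> real mat" where
  "Z_at n j u l x =
     mat n n (\<lambda>(r, c). \<Sum>i\<le>j. Y_coeff n j (int i) u x $$ (r, c) * l ^ i) - zeta n j u x"

text \<open>
  Solutions are defined for \<open>x\<close> in \<open>\<real>\<close> and \<open>t\<close> in an open set \<open>T\<close> of times; values at other
  times are irrelevant.
\<close>

definition curve_flow_solution ::
    "nat \<Rightarrow> nat \<Rightarrow> real set \<Rightarrow> (real \<Rightarrow> real \<Rightarrow> real vec) \<Rightarrow> bool" where
  "curve_flow_solution n j T \<gamma> \<longleftrightarrow>
     (\<forall>r<n. smooth_fun_on (UNIV \<times> T) (\<lambda>(x, t). \<gamma> x t $ r)) \<and>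
     (\<forall>t\<in>T. (\<lambda>x. \<gamma> x t) \<in> central_affine_curves n) \<and>
     (\<forall>t\<in>T. \<forall>x. \<forall>r<n.
        ((\<lambda>s. \<gamma> x s $ r) has_real_derivative
           ((frame n (\<lambda>x. \<gamma> x t) x * Z_at n j (curvature n (\<lambda>x. \<gamma> x t)) 0 x)
              *\<^sub>v unit_vec n 0) $ r) (at t))"

section \<open>Baecklund transformations\<close>

text \<open>
  The recursion for \<open>w\<^sub>n, w\<^sub>n\<^sub>-\<^sub>1, \<dots>, w\<^sub>1\<close> runs downwards: \<open>w_rec n u h m\<close> is \<open>w\<^sub>n\<^sub>-\<^sub>m\<close>. Here and
  in the definitions up to \<open>f_mat\<close>, \<open>u\<close> and \<open>h\<close> are functions of \<open>x\<close> at a fixed time.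
\<close>

fun w_rec :: "nat \<Rightarrow> (nat \<Rightarrow> real \<Rightarrow> real) \<Rightarrow> (real \<Rightarrow> real) \<Rightarrow> nat \<Rightarrow> real \<Rightarrow> real" where
  "w_rec n u h 0 = (\<lambda>x. 1)"
| "w_rec n u h (Suc 0) = (\<lambda>x. - h x)"
| "w_rec n u h (Suc (Suc m)) =
     (\<lambda>x. - deriv (w_rec n u h (Suc m)) x - h x * w_rec n u h (Suc m) x - u (n - Suc m) x)"

definition w_fun :: "nat \<Rightarrow> (nat \<Rightarrow> real \<Rightarrow> real) \<Rightarrow> (real \<Rightarrow> real) \<Rightarrow> nat \<Rightarrow> real \<Rightarrow> real" where
  "w_fun n u h i = w_rec n u h (n - i)"

definition w_vec :: "nat \<Rightarrow> (nat \<Rightarrow> real \<Rightarrow> real) \<Rightarrow> (real \<Rightarrow> real) \<Rightarrow> real \<Rightarrow> real vec" where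
  "w_vec n u h x = vec n (\<lambda>i. w_fun n u h (Suc i) x)"

definition s_fun :: "nat \<Rightarrow> (nat \<Rightarrow> real \<Rightarrow> real) \<Rightarrow> (real \<Rightarrow> real) \<Rightarrow> nat \<Rightarrow> real \<Rightarrow> real" where
  "s_fun n u h i x = deriv (w_fun n u h i) x
     - (\<Sum>m = i+1..n. real ((m - 1) choose (i - 1)) * w_fun n u h m x * (deriv ^^ (m - i)) h x)"

definition star_u ::
    "nat \<Rightarrow> (real \<Rightarrow> real) \<Rightarrow> (nat \<Rightarrow> real \<Rightarrow> real) \<Rightarrow> nat \<Rightarrow> real \<Rightarrow> real" where
  "star_u n h u i x = (if i \<in> {1..<n} then u i x + s_fun n u h i x else 0)"

definition f_mat ::
    "nat \<Rightarrow> (nat \<Rightarrow> real \<Rightarrow> real) \<Rightarrow> (real \<Rightarrow> real) \<Rightarrow> real \<Rightarrow> real \<Rightarrow> real mat" where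
  "f_mat n u h x l = mat1 n (\<lambda>i j.
     (if i = 1 \<and> j = n then l else 0) + (if i = j + 1 then 1 else 0) +
     (if i = j then h x else 0) +
     (if i < j \<and> j < n then real ((j - 1) choose (i - 1)) * (deriv ^^ (j - i)) h x else 0) +
     (if i < j \<and> j = n then u i x + s_fun n u h i x
        + real ((n - 1) choose (i - 1)) * (deriv ^^ (n - i)) h x else 0))"

text \<open>\<open>u t\<close> is the \<open>V\<^sub>n\<close>-valued function of \<open>x\<close> at time \<open>t\<close>.\<close>

definition BT_solution ::
    "nat \<Rightarrow> nat \<Rightarrow> real set \<Rightarrow> (real \<Rightarrow> nat \<Rightarrow> real \<Rightarrow> real) \<Rightarrow> real \<Rightarrow>
     (real \<Rightarrow> real \<Rightarrow> real) \<Rightarrow> bool" where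
  "BT_solution n j T u k h \<longleftrightarrow>
     smooth_fun_on (UNIV \<times> T) (\<lambda>(x, t). h x t) \<and>
     (\<forall>t\<in>T. \<forall>x.
        deriv (w_fun n (u t) (\<lambda>y. h y t) 1) x + h x t * w_fun n (u t) (\<lambda>y. h y t) 1 x
          + u t 1 x + k = 0) \<and>
     (\<forall>t\<in>T. \<forall>x.
        ((\<lambda>s. h x s) has_real_derivative
           - deriv (\<lambda>y. (Z_at n j (u t) k y *\<^sub>v w_vec n (u t) (\<lambda>z. h z t) y) $ (n - 1)) x) (at t))"

text \<open>\<open>h * \<gamma>\<close>, with \<open>d\<close> the constant matrix \<open>d(k)\<close>.\<close>

definition star_curve ::
    "nat \<Rightarrow> real mat \<Rightarrow> (real \<Rightarrow> real \<Rightarrow> real) \<Rightarrow> (real \<Rightarrow> real \<Rightarrow> real vec) \<Rightarrow>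
     real \<Rightarrow> real \<Rightarrow> real vec" where
  "star_curve n d h \<gamma> x t =
     (d * frame n (\<lambda>y. \<gamma> y t) x
        * mat_inv (f_mat n (curvature n (\<lambda>y. \<gamma> y t)) (\<lambda>y. h y t) x 0)) *\<^sub>v unit_vec n 0"

end

theory Submission
  imports "HOL-Analysis.Henstock_Kurzweil_Integration" "HOL-Library.Function_Algebras" Defs
begin

text \<open>
  A matrix \<open>P(x, \<lambda>)\<close>, built from a formal eigenfunction of \<open>\<partial>\<^sup>n - \<Sum> u\<^sub>i \<partial>\<^sup>i\<^sup>-\<^sup>1\<close>, conjugates \<open>\<partial>\<^sub>x + J + u\<close>
  to \<open>\<partial>\<^sub>x + J\<close>. As whatever commutes with \<open>\<partial>\<^sub>x + J\<close> is constant and commutes with \<open>J\<close>, the series \<open>Y\<close>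
  exists, is unique and equals \<open>P\<^sup>-\<^sup>1 J P\<close>.
  The Riccati equation for \<open>h\<close> says that \<open>f = f\<^sub>u\<^sub>,\<^sub>h\<close> intertwines \<open>\<partial>\<^sub>x + J + u\<close> with
  \<open>\<partial>\<^sub>x + J + h*u\<close>; hence \<open>f Y(u) = Y(h*u) f\<close>, and the polynomial parts show that
  \<open>f Z(u) - Z(h*u) f\<close> does not depend on \<open>\<lambda>\<close>. Evaluating it on \<open>w\<close>, where \<open>f w = (\<lambda> - k) e\<^sub>1\<close>, at
  \<open>\<lambda> = k\<close> and at \<open>\<lambda> = 0\<close> shows that \<open>h*\<gamma> = -k\<^sup>-\<^sup>1 d(k) g w\<close> solves the curve flow.
  For two solutions \<open>h\<^sub>1\<close>, \<open>h\<^sub>2\<close> with vectors \<open>w\<^sub>1\<close>, \<open>w\<^sub>2\<close>, the vector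
  \<open>f\<^sub>u\<^sub>,\<^sub>h\<^sub>1(k\<^sub>2) w\<^sub>2 / (h\<^sub>1 - h\<^sub>2)\<close> is the one that belongs to the second transformation of \<open>h\<^sub>1*u\<close>, and the
  resulting curve is \<open>d(k\<^sub>2) d(k\<^sub>1) g (w\<^sub>1/k\<^sub>1 - w\<^sub>2/k\<^sub>2) / (h\<^sub>1 - h\<^sub>2)\<close>.
\<close>

unbundle no vec_syntax and no fps_syntax

section \<open>Smooth functions\<close>

text \<open>The data come from a factorisation. For L = \<partial>^n - \<Sum> u_i \<partial>^(i-1),
  the recursion for w together with the Riccati equation says L - k = (\<partial> + h) W with the
  monic operator W = \<Sum> w_i \<partial>^(i-1). The matrix f expresses the first factor in the
  frames: d times the old curve is (\<partial> + h) applied to the new one, while W applied to the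
  old curve gives -k times the new one, up to d. Hence the constant -1/k, and hence w in the kernel
  of f at \<lambda> = k. Two obstacles shape the proof. \<open>Y_series\<close>, \<open>zeta\<close>
  and \<open>curvature\<close> are definite descriptions, so existence and uniqueness must be
  settled before any property is available. And Y is built with antiderivatives in x at each fixed
  time, which says nothing about how Z depends on t. Therefore Z is differentiated only in x; time
  derivatives are taken of the frame, u, h, w and f, which are jointly smooth, and their evolution
  equations rest on exchanging mixed partial derivatives.\<close>

lemma Ck_on_cong:
  assumes "open S" "\<And>x. x \<in> S \<Longrightarrow> f x = g x" "Ck_on m S f"
  shows "Ck_on m S g"
  using assms(2,3)
proof (induction m arbitrary: f g)
  case 0
  then show ?case using continuous_on_cong by force
next
  case (Suc m)
  have D: "(g has_derivative D) (at x) \<longleftrightarrow> (f has_derivative D) (at x)" if "x \<in> S" for x D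
    using has_derivative_transform_within_open[OF _ assms(1) that]
      Suc.prems(1) by metis
  have "frechet_derivative f (at x) = frechet_derivative g (at x)" if "x \<in> S" for x
    unfolding frechet_derivative_def using D[OF that] by simp
  moreover have "g differentiable (at x)" if "x \<in> S" for x
    using Suc.prems(2) D[OF that] that unfolding differentiable_def by (metis Ck_on.simps(2) differentiable_def)
  ultimately show ?case
    using Suc.prems(2) Suc.IH[of "\<lambda>x. frechet_derivative f (at x) _" "\<lambda>x. frechet_derivative g (at x) _"]
    by auto
qed

lemma smooth_fun_on_cong:
  assumes "open S" "\<And>x. x \<in> S \<Longrightarrow> f x = g x" "smooth_fun_on S f"
  shows "smooth_fun_on S g"
  using assms Ck_on_cong unfolding smooth_fun_on_def by blast

lemma Ck_on_SucD: "Ck_on (Suc m) S f \<Longrightarrow> Ck_on m S f"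
proof (induction m arbitrary: f)
  case 0
  then show ?case
    by (auto intro!: continuous_at_imp_continuous_on differentiable_imp_continuous_within)
next
  case (Suc m)
  then show ?case by (metis Ck_on.simps(2))
qed

text \<open>Allows inductions on the order to be replaced by one unfolding, since all orders remain
  available after a derivative has been taken.\<close>

lemma smooth_fun_on_iff:
  "smooth_fun_on S f \<longleftrightarrow> (\<forall>x\<in>S. f differentiable (at x)) \<and>
     (\<forall>v. smooth_fun_on S (\<lambda>x. frechet_derivative f (at x) v))"
  unfolding smooth_fun_on_def
  by (metis Ck_on.simps(2) Ck_on_SucD)

lemma smooth_fun_on_diff: "smooth_fun_on S f \<Longrightarrow> x \<in> S \<Longrightarrow> f differentiable (at x)"
  using smooth_fun_on_iff by blast

lemma smooth_fun_on_fderiv: "smooth_fun_on S f \<Longrightarrow> smooth_fun_on S (\<lambda>x. frechet_derivative f (at x) v)"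
  using smooth_fun_on_iff by blast

lemma smooth_fun_on_continuous: "smooth_fun_on S f \<Longrightarrow> continuous_on S f"
  unfolding smooth_fun_on_def by (metis Ck_on.simps(1))

lemma smooth_fun_on_const [simp, intro]: "smooth_fun_on S (\<lambda>x. c)"
proof -
  have "Ck_on m S (\<lambda>x. c)" for m c
    by (induction m arbitrary: c) (auto simp: frechet_derivative_const)
  then show ?thesis by (simp add: smooth_fun_on_def)
qed

lemma Ck_on_add:
  assumes "open S"
  shows "Ck_on m S f \<Longrightarrow> Ck_on m S g \<Longrightarrow> Ck_on m S (\<lambda>x. f x + g x)"
proof (induction m arbitrary: f g)
  case 0
  then show ?case by (auto intro: continuous_intros)
next
  case (Suc m)
  have "Ck_on m S (\<lambda>x. frechet_derivative (\<lambda>x. f x + g x) (at x) v)" for v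
  proof (rule Ck_on_cong[OF assms])
    show "Ck_on m S (\<lambda>x. frechet_derivative f (at x) v + frechet_derivative g (at x) v)"
      using Suc by auto
    show "frechet_derivative f (at x) v + frechet_derivative g (at x) v =
        frechet_derivative (\<lambda>x. f x + g x) (at x) v" if "x \<in> S" for x
    proof -
      have "((\<lambda>x. f x + g x) has_derivative
          (\<lambda>v. frechet_derivative f (at x) v + frechet_derivative g (at x) v)) (at x)"
        using Suc.prems that by (intro has_derivative_add) (auto simp: frechet_derivative_works[symmetric])
      then show ?thesis using frechet_derivative_at by metis
    qed
  qed
  then show ?case using Suc.prems by auto
qed

lemma Ck_on_mult:
  assumes "open S"
  shows "Ck_on m S f \<Longrightarrow> Ck_on m S g \<Longrightarrow> Ck_on m S (\<lambda>x. f x * g x)"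
proof (induction m arbitrary: f g)
  case 0
  then show ?case by (auto intro: continuous_intros)
next
  case (Suc m)
  have "Ck_on m S (\<lambda>x. frechet_derivative (\<lambda>x. f x * g x) (at x) v)" for v
  proof (rule Ck_on_cong[OF assms])
    show "Ck_on m S (\<lambda>x. f x * frechet_derivative g (at x) v + frechet_derivative f (at x) v * g x)"
      using Suc Ck_on_SucD[OF Suc.prems(1)] Ck_on_SucD[OF Suc.prems(2)] by (intro Ck_on_add[OF assms]) auto
    show "f x * frechet_derivative g (at x) v + frechet_derivative f (at x) v * g x =
        frechet_derivative (\<lambda>x. f x * g x) (at x) v" if "x \<in> S" for x
    proof -
      have "((\<lambda>x. f x * g x) has_derivative
          (\<lambda>v. f x * frechet_derivative g (at x) v + frechet_derivative f (at x) v * g x)) (at x)"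
        using Suc.prems that by (intro has_derivative_mult) (auto simp: frechet_derivative_works[symmetric])
      then show ?thesis using frechet_derivative_at by metis
    qed
  qed
  then show ?case using Suc.prems by auto
qed

lemma smooth_fun_on_add:
  "open S \<Longrightarrow> smooth_fun_on S f \<Longrightarrow> smooth_fun_on S g \<Longrightarrow> smooth_fun_on S (\<lambda>x. f x + g x)"
  by (simp add: smooth_fun_on_def Ck_on_add)

lemma smooth_fun_on_mult:
  "open S \<Longrightarrow> smooth_fun_on S f \<Longrightarrow> smooth_fun_on S g \<Longrightarrow> smooth_fun_on S (\<lambda>x. f x * g x)"
  by (simp add: smooth_fun_on_def Ck_on_mult)

lemma smooth_fun_on_minus:
  "open S \<Longrightarrow> smooth_fun_on S f \<Longrightarrow> smooth_fun_on S (\<lambda>x. - f x)"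
  using smooth_fun_on_mult[of S "\<lambda>x. -1" f] by simp

lemma smooth_fun_on_sub:
  "open S \<Longrightarrow> smooth_fun_on S f \<Longrightarrow> smooth_fun_on S g \<Longrightarrow> smooth_fun_on S (\<lambda>x. f x - g x)"
  using smooth_fun_on_add[of S f "\<lambda>x. - g x"] by (simp add: smooth_fun_on_minus)

lemma smooth_fun_on_sum:
  "open S \<Longrightarrow> (\<And>i. i \<in> A \<Longrightarrow> smooth_fun_on S (f i)) \<Longrightarrow> smooth_fun_on S (\<lambda>x. \<Sum>i\<in>A. f i x)"
  by (induction A rule: infinite_finite_induct) (auto intro: smooth_fun_on_add)

lemma smooth_fun_on_prod:
  "open S \<Longrightarrow> (\<And>i. i \<in> A \<Longrightarrow> smooth_fun_on S (f i)) \<Longrightarrow> smooth_fun_on S (\<lambda>x. \<Prod>i\<in>A. f i x)"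
  by (induction A rule: infinite_finite_induct) (auto intro: smooth_fun_on_mult)

text \<open>The derivative of 1/f is, up to sign, f' times two copies of 1/f. With f smooth of all
  orders, the induction on m therefore only meets the same inverse one order lower.\<close>

lemma Ck_on_inverse:
  assumes "open S" "smooth_fun_on S f" "\<And>x. x \<in> S \<Longrightarrow> f x \<noteq> 0"
  shows "Ck_on m S (\<lambda>x. inverse (f x))"
proof (induction m)
  case 0
  then show ?case using smooth_fun_on_continuous[OF assms(2)] assms(3)
    by (auto intro: continuous_intros)
next
  case (Suc m)
  have D: "((\<lambda>x. inverse (f x)) has_derivative
       (\<lambda>v. - (inverse (f x) * frechet_derivative f (at x) v * inverse (f x)))) (at x)" if "x \<in> S" for x
    using Deriv.has_derivative_inverse[where f = f, OF assms(3)[OF that]] frechet_derivative_works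
      smooth_fun_on_diff[OF assms(2) that] by blast
  have "Ck_on m S (\<lambda>x. frechet_derivative (\<lambda>x. inverse (f x)) (at x) v)" for v
  proof (rule Ck_on_cong[OF assms(1)])
    have "Ck_on m S (\<lambda>x. frechet_derivative f (at x) v)"
      using smooth_fun_on_fderiv[OF assms(2)] by (simp add: smooth_fun_on_def)
    moreover have "Ck_on m S (\<lambda>x. -1)"
      using smooth_fun_on_const smooth_fun_on_def by blast
    ultimately show "Ck_on m S (\<lambda>x. (-1) * (inverse (f x) * frechet_derivative f (at x) v * inverse (f x)))"
      using Suc by (intro Ck_on_mult[OF assms(1)])
    show "(-1) * (inverse (f x) * frechet_derivative f (at x) v * inverse (f x)) =
        frechet_derivative (\<lambda>x. inverse (f x)) (at x) v" if "x \<in> S" for x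
      using frechet_derivative_at[OF D[OF that]] by (metis mult_minus1)
  qed
  then show ?case using D by (auto simp: differentiable_def)
qed

lemma smooth_fun_on_divide:
  assumes "open S" "smooth_fun_on S f" "smooth_fun_on S g" "\<And>x. x \<in> S \<Longrightarrow> g x \<noteq> 0"
  shows "smooth_fun_on S (\<lambda>x. f x / g x)"
  unfolding divide_inverse
  using smooth_fun_on_mult[OF assms(1,2)] Ck_on_inverse[OF assms(1,3,4)] smooth_fun_on_def by blast

section \<open>Functions of one variable: derivatives and antiderivatives\<close>

lemma frechet_derivative_eq_deriv:
  fixes f :: "real \<Rightarrow> real"
  assumes "f differentiable (at x)"
  shows "frechet_derivative f (at x) v = deriv f x * v"
proof -
  obtain D where "(f has_real_derivative D) (at x)"
    using assms real_differentiable_def by blast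
  then show ?thesis using frechet_derivative_at DERIV_imp_deriv
    by (metis has_field_derivative_def)
qed

lemma smooth_deriv:
  assumes "smooth_fun_on UNIV (f :: real \<Rightarrow> real)"
  shows "smooth_fun_on UNIV (deriv f)"
  using smooth_fun_on_fderiv[OF assms, of 1] smooth_fun_on_diff[OF assms]
  by (simp add: frechet_derivative_eq_deriv)

lemma smooth_has_deriv:
  assumes "smooth_fun_on S (f :: real \<Rightarrow> real)" "x \<in> S"
  shows "(f has_real_derivative deriv f x) (at x)"
  using smooth_fun_on_diff[OF assms] DERIV_imp_deriv real_differentiable_def by blast

lemma smoothI_deriv:
  assumes "\<And>x. (f has_real_derivative f' x) (at x)" "smooth_fun_on UNIV f'"
  shows "smooth_fun_on UNIV f"
proof -
  have "f differentiable (at x)" for x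
    using assms(1) real_differentiable_def by blast
  moreover have "frechet_derivative f (at x) v = f' x * v" for x v
    using frechet_derivative_eq_deriv[OF calculation] DERIV_imp_deriv[OF assms(1)] by simp
  ultimately show ?thesis
    using assms(2) by (subst smooth_fun_on_iff) (auto intro: smooth_fun_on_mult)
qed

lemma smooth_funpow_deriv:
  "smooth_fun_on UNIV (f :: real \<Rightarrow> real) \<Longrightarrow> smooth_fun_on UNIV ((deriv ^^ m) f)"
  by (induction m) (auto intro: smooth_deriv)

lemma smooth_antiderivative:
  fixes f :: "real \<Rightarrow> real"
  assumes "smooth_fun_on UNIV f"
  shows "\<exists>F. smooth_fun_on UNIV F \<and> (\<forall>x. (F has_real_derivative f x) (at x))"
proof -
  have cont: "continuous_on UNIV f" using smooth_fun_on_continuous[OF assms] .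
  define F where "F x = (if x \<ge> 0 then integral {0..x} f else - integral {x..0} f)" for x
  have "(F has_real_derivative f x) (at x)" for x
  proof -
    \<comment> \<open>A base point to the left of both 0 and x: on [a, b] the two cases of F merge
      into a single integral from a, up to a constant.\<close>
    define a where "a = - \<bar>x\<bar> - 1"
    define b where "b = \<bar>x\<bar> + 1"
    have a: "a < x" "a \<le> 0" and b: "x < b" by (auto simp: a_def b_def)
    have int: "f integrable_on {c..d}" for c d
      by (intro integrable_continuous_interval continuous_on_subset[OF cont]) auto
    have F: "F y = integral {a..y} f - integral {a..0} f" if "y \<in> {a..b}" for y
    proof (cases "y \<ge> 0")
      case True
      then show ?thesis using Henstock_Kurzweil_Integration.integral_combine[of a 0 y f] int that
        a by (simp add: F_def)
    next
      case False
      then show ?thesis using Henstock_Kurzweil_Integration.integral_combine[of a y 0 f] int that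
        by (auto simp: F_def a_def)
    qed
    have "((\<lambda>y. integral {a..y} f) has_real_derivative f x) (at x within {a..b})"
      by (intro integral_has_real_derivative continuous_on_subset[OF cont]) (auto simp: a_def b_def)
    then have "((\<lambda>y. integral {a..y} f) has_real_derivative f x) (at x)"
      using at_within_interior[of x "{a..b}"] a b by simp
    then have "((\<lambda>y. integral {a..y} f - integral {a..0} f) has_real_derivative f x) (at x)"
      by (auto intro!: derivative_eq_intros)
    moreover have "eventually (\<lambda>y. y \<in> {a<..<b}) (nhds x)"
      by (intro eventually_nhds_in_open) (auto simp: a_def b_def)
    then have "eventually (\<lambda>y. integral {a..y} f - integral {a..0} f = F y) (nhds x)"
      by eventually_elim (use F in auto)
    ultimately show ?thesis
      by (subst (asm) DERIV_cong_ev[OF refl _ refl]) auto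
  qed
  then show ?thesis using smoothI_deriv assms by blast
qed

section \<open>Functions of x and t: slices, partial and mixed derivatives\<close>

lemma smooth_slice:
  assumes "open T" "t \<in> T" "smooth_fun_on (UNIV \<times> T) F"
  shows "smooth_fun_on UNIV (\<lambda>x :: real. F (x, t :: real))"
proof -
  have "Ck_on m (UNIV \<times> T) F \<Longrightarrow> Ck_on m UNIV (\<lambda>x. F (x, t))" for m
  proof (induction m arbitrary: F)
    case 0
    have "continuous_on UNIV (F \<circ> (\<lambda>x. (x, t)))"
      using 0 assms(2) by (intro continuous_on_compose) (auto intro!: continuous_intros elim: continuous_on_subset)
    then show ?case by (simp add: o_def)
  next
    case (Suc m)
    have D: "((\<lambda>x. F (x, t)) has_derivative (\<lambda>v. frechet_derivative F (at (x, t)) (v, 0))) (at x)" for x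
    proof -
      have "(F has_derivative frechet_derivative F (at (x, t))) (at (x, t))"
        using Suc.prems assms(2) by (auto simp: frechet_derivative_works[symmetric])
      moreover have "((\<lambda>x. (x, t)) has_derivative (\<lambda>v. (v, 0))) (at x)"
        by (auto intro!: derivative_eq_intros)
      ultimately show ?thesis
        using has_derivative_compose by blast
    qed
    have "(\<lambda>x. frechet_derivative (\<lambda>x. F (x, t)) (at x) v) = (\<lambda>x. frechet_derivative F (at (x, t)) (v, 0))" for v
      using frechet_derivative_at[OF D] by metis
    moreover have "Ck_on m UNIV (\<lambda>x. frechet_derivative F (at (x, t)) (v, 0))" for v
      using Suc.IH[of "\<lambda>z. frechet_derivative F (at z) (v, 0)"] Suc.prems by simp
    moreover have "(\<lambda>x. F (x, t)) differentiable (at x)" for x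
      using D differentiable_def by blast
    ultimately show ?case by simp
  qed
  then show ?thesis using assms by (simp add: smooth_fun_on_def)
qed

abbreviation smooth2 :: "real set \<Rightarrow> (real \<Rightarrow> real \<Rightarrow> real) \<Rightarrow> bool" where
  "smooth2 T f \<equiv> smooth_fun_on (UNIV \<times> T) (\<lambda>(x, t). f x t)"

lemma open_UNIV_Times: "open T \<Longrightarrow> open (UNIV \<times> T)"
  by (simp add: open_Times)

context
  fixes T :: "real set"
  assumes T: "open T"
begin

lemma smooth2_cong:
  "(\<And>x t. t \<in> T \<Longrightarrow> f x t = g x t) \<Longrightarrow> smooth2 T f \<Longrightarrow> smooth2 T g"
  using smooth_fun_on_cong[OF open_UNIV_Times[OF T], of "\<lambda>(x, t). f x t" "\<lambda>(x, t). g x t"] by auto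

lemma smooth2_add: "smooth2 T f \<Longrightarrow> smooth2 T g \<Longrightarrow> smooth2 T (\<lambda>x t. f x t + g x t)"
  using smooth_fun_on_add[OF open_UNIV_Times[OF T], of "\<lambda>(x, t). f x t" "\<lambda>(x, t). g x t"] by (simp add: case_prod_unfold)

lemma smooth2_sub: "smooth2 T f \<Longrightarrow> smooth2 T g \<Longrightarrow> smooth2 T (\<lambda>x t. f x t - g x t)"
  using smooth_fun_on_sub[OF open_UNIV_Times[OF T], of "\<lambda>(x, t). f x t" "\<lambda>(x, t). g x t"] by (simp add: case_prod_unfold)

lemma smooth2_minus: "smooth2 T f \<Longrightarrow> smooth2 T (\<lambda>x t. - f x t)"
  using smooth_fun_on_minus[OF open_UNIV_Times[OF T], of "\<lambda>(x, t). f x t"] by (simp add: case_prod_unfold)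

lemma smooth2_mult: "smooth2 T f \<Longrightarrow> smooth2 T g \<Longrightarrow> smooth2 T (\<lambda>x t. f x t * g x t)"
  using smooth_fun_on_mult[OF open_UNIV_Times[OF T], of "\<lambda>(x, t). f x t" "\<lambda>(x, t). g x t"] by (simp add: case_prod_unfold)

lemma smooth2_divide:
  "smooth2 T f \<Longrightarrow> smooth2 T g \<Longrightarrow> (\<And>x t. t \<in> T \<Longrightarrow> g x t \<noteq> 0) \<Longrightarrow> smooth2 T (\<lambda>x t. f x t / g x t)"
  using smooth_fun_on_divide[OF open_UNIV_Times[OF T], of "\<lambda>(x, t). f x t" "\<lambda>(x, t). g x t"]
  by (force simp: case_prod_unfold)

lemma smooth2_const: "smooth2 T (\<lambda>x t. c)"
  by (simp add: case_prod_unfold)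

lemma smooth2_sum: "(\<And>i. i \<in> A \<Longrightarrow> smooth2 T (f i)) \<Longrightarrow> smooth2 T (\<lambda>x t. \<Sum>i\<in>A. f i x t)"
  using smooth_fun_on_sum[OF open_UNIV_Times[OF T], of A "\<lambda>i (x, t). f i x t"]
  by (simp add: case_prod_unfold)

lemma smooth2_slice: "smooth2 T f \<Longrightarrow> t \<in> T \<Longrightarrow> smooth_fun_on UNIV (\<lambda>x. f x t)"
  using smooth_slice[OF T] by fastforce

text \<open>Partial derivatives are Frechet derivatives in the directions (1, 0) and (0, 1), and
  those are smooth again by the definition of smoothness; \<open>smooth2_dx\<close> and
  \<open>smooth2_dt\<close> rest on this.\<close>

lemma smooth2_partials:
  assumes "smooth2 T f" "t \<in> T"
  shows "((\<lambda>y. f y t) has_real_derivative frechet_derivative (\<lambda>(x, t). f x t) (at (x, t)) (1, 0)) (at x)"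
    and "((\<lambda>s. f x s) has_real_derivative frechet_derivative (\<lambda>(x, t). f x t) (at (x, t)) (0, 1)) (at t)"
proof -
  let ?F = "\<lambda>(x, t). f x t"
  have D: "(?F has_derivative frechet_derivative ?F (at (x, t))) (at (x, t))"
    using smooth_fun_on_diff[OF assms(1), of "(x, t)"] assms(2) unfolding frechet_derivative_works by simp
  then have lin: "linear (frechet_derivative ?F (at (x, t)))"
    by (rule has_derivative_linear)
  have "((\<lambda>x. (x, t)) has_derivative (\<lambda>v. (v, 0))) (at x)"
    by (auto intro!: derivative_eq_intros)
  then have "((\<lambda>y. ?F (y, t)) has_derivative (\<lambda>v. frechet_derivative ?F (at (x, t)) (v, 0))) (at x)"
    by (rule has_derivative_compose) (rule D)
  moreover have "(\<lambda>v. frechet_derivative ?F (at (x, t)) (v, 0)) = (*) (frechet_derivative ?F (at (x, t)) (1, 0))"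
  proof
    show "frechet_derivative ?F (at (x, t)) (v, 0) = frechet_derivative ?F (at (x, t)) (1, 0) * v" for v
      using linear_scale[OF lin, of v "(1, 0)"] by (simp del: case_prod_conv)
  qed
  ultimately show "((\<lambda>y. f y t) has_real_derivative frechet_derivative ?F (at (x, t)) (1, 0)) (at x)"
    unfolding has_field_derivative_def by simp
  have "((\<lambda>s. (x, s)) has_derivative (\<lambda>v. (0, v))) (at t)"
    by (auto intro!: derivative_eq_intros)
  then have "((\<lambda>s. ?F (x, s)) has_derivative (\<lambda>v. frechet_derivative ?F (at (x, t)) (0, v))) (at t)"
    by (rule has_derivative_compose) (rule D)
  moreover have "(\<lambda>v. frechet_derivative ?F (at (x, t)) (0, v)) = (*) (frechet_derivative ?F (at (x, t)) (0, 1))"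
  proof
    show "frechet_derivative ?F (at (x, t)) (0, v) = frechet_derivative ?F (at (x, t)) (0, 1) * v" for v
      using linear_scale[OF lin, of v "(0, 1)"] by (simp del: case_prod_conv)
  qed
  ultimately show "((\<lambda>s. f x s) has_real_derivative frechet_derivative ?F (at (x, t)) (0, 1)) (at t)"
    unfolding has_field_derivative_def by simp
qed

lemma smooth2_DERIV_x:
  "smooth2 T f \<Longrightarrow> t \<in> T \<Longrightarrow> ((\<lambda>y. f y t) has_real_derivative deriv (\<lambda>y. f y t) x) (at x)"
  unfolding DERIV_deriv_iff_real_differentiable real_differentiable_def
  by (rule exI, rule smooth2_partials(1))

lemma smooth2_DERIV_t:
  "smooth2 T f \<Longrightarrow> t \<in> T \<Longrightarrow> ((\<lambda>s. f x s) has_real_derivative deriv (\<lambda>s. f x s) t) (at t)"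
  unfolding DERIV_deriv_iff_real_differentiable real_differentiable_def
  by (rule exI, rule smooth2_partials(2))

lemma smooth2_dx:
  assumes "smooth2 T f"
  shows "smooth2 T (\<lambda>x t. deriv (\<lambda>y. f y t) x)"
proof (rule smooth2_cong)
  show "smooth2 T (\<lambda>x t. frechet_derivative (\<lambda>(x, t). f x t) (at (x, t)) (1, 0))"
    using smooth_fun_on_fderiv[OF assms] by (simp add: case_prod_unfold)
qed (rule DERIV_imp_deriv[OF smooth2_partials(1)[OF assms], symmetric])

lemma smooth2_dt:
  assumes "smooth2 T f"
  shows "smooth2 T (\<lambda>x t. deriv (\<lambda>s. f x s) t)"
proof (rule smooth2_cong)
  show "smooth2 T (\<lambda>x t. frechet_derivative (\<lambda>(x, t). f x t) (at (x, t)) (0, 1))"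
    using smooth_fun_on_fderiv[OF assms] by (simp add: case_prod_unfold)
qed (rule DERIV_imp_deriv[OF smooth2_partials(2)[OF assms], symmetric])

lemma smooth2_funpow_dx:
  "smooth2 T f \<Longrightarrow> smooth2 T (\<lambda>x t. (deriv ^^ m) (\<lambda>y. f y t) x)"
proof (induction m)
  case (Suc m)
  from smooth2_dx[OF Suc.IH[OF Suc.prems]] show ?case by simp
qed simp

text \<open>
  Differentiate \<open>f b s - f a s = integral {a..b} (\<lambda>y. \<partial>\<^sub>x f y s)\<close> under the integral sign in \<open>s\<close>, then
  with respect to \<open>b\<close>.
\<close>

lemma smooth2_mixed:
  assumes f: "smooth2 T f" and t: "t \<in> T"
  shows "((\<lambda>s. deriv (\<lambda>y. f y s) x) has_real_derivative deriv (\<lambda>y. deriv (\<lambda>s. f y s) t) x) (at t)"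
proof -
  define fx where "fx = (\<lambda>x t. deriv (\<lambda>y. f y t) x)"
  define fxt where "fxt = (\<lambda>x t. deriv (\<lambda>s. fx x s) t)"
  have fx: "smooth2 T fx" and fxt: "smooth2 T fxt"
    unfolding fxt_def fx_def by (intro smooth2_dx smooth2_dt f)+
  obtain e where e: "e > 0" "ball t e \<subseteq> T"
    using T t openE by blast
  have cont: "continuous_on {a..b} (\<lambda>y. g y s)" if "smooth2 T g" "s \<in> T" for a b g s
    using smooth_fun_on_continuous[OF smooth2_slice[OF that]] continuous_on_subset by blast
  \<comment> \<open>Any base point to the left of x would do.\<close>
  define a where "a = x - 1"
  have int: "integral {a..b} (\<lambda>y. fx y s) = f b s - f a s" if "s \<in> T" "a \<le> b" for b s
  proof -
    have "((\<lambda>y. fx y s) has_integral f b s - f a s) {a..b}"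
      using that smooth2_DERIV_x[OF f that(1)]
      by (intro fundamental_theorem_of_calculus)
        (auto simp: fx_def has_real_derivative_iff_has_vector_derivative[symmetric] intro: has_field_derivative_at_within)
    then show ?thesis by (simp add: integral_unique)
  qed
  have ft: "deriv (\<lambda>s. f b s) t = deriv (\<lambda>s. f a s) t + integral {a..b} (\<lambda>y. fxt y t)" if "a \<le> b" for b
  proof -
    have "((\<lambda>s. integral (cbox a b) (\<lambda>y. fx y s)) has_field_derivative integral (cbox a b) (\<lambda>y. fxt y t))
        (at t within ball t e)"
    proof (rule leibniz_rule_field_derivative)
      show "((\<lambda>s. fx y s) has_field_derivative fxt y s) (at s within ball t e)"
        if "s \<in> ball t e" "y \<in> cbox a b" for s y
        unfolding fxt_def
        by (rule has_field_derivative_at_within, rule smooth2_DERIV_t[OF fx]) (use that e in auto)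
      show "(\<lambda>y. fx y s) integrable_on cbox a b" if "s \<in> ball t e" for s
        using that e cont[OF fx] by (auto intro!: integrable_continuous_interval)
      have "continuous_on (UNIV \<times> T) (\<lambda>(x, t). fxt x t)"
        using smooth_fun_on_continuous[OF fxt] .
      then have "continuous_on (ball t e \<times> cbox a b) ((\<lambda>(x, t). fxt x t) \<circ> prod.swap)"
        using e by (intro continuous_on_compose continuous_on_swap) (auto elim!: continuous_on_subset)
      then show "continuous_on (ball t e \<times> cbox a b) (\<lambda>(s, y). fxt y s)"
        by (simp add: case_prod_unfold o_def)
    qed (use e in auto)
    then have "((\<lambda>s. integral {a..b} (\<lambda>y. fx y s)) has_field_derivative integral {a..b} (\<lambda>y. fxt y t)) (at t)"
      using e at_within_open[of t "ball t e"] by simp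
    then have 1: "((\<lambda>s. f b s - f a s) has_field_derivative integral {a..b} (\<lambda>y. fxt y t)) (at t)"
      by (rule has_field_derivative_transform_within_open[OF _ T t]) (use int that in auto)
    have 2: "((\<lambda>s. f b s - f a s) has_field_derivative deriv (\<lambda>s. f b s) t - deriv (\<lambda>s. f a s) t) (at t)"
      by (intro DERIV_diff smooth2_DERIV_t f t)
    show ?thesis using DERIV_unique[OF 1 2] by simp
  qed
  have "((\<lambda>b. integral {a..b} (\<lambda>y. fxt y t)) has_real_derivative fxt x t) (at x within {a..x+1})"
    by (intro integral_has_real_derivative cont fxt t) (auto simp: a_def)
  then have "((\<lambda>b. integral {a..b} (\<lambda>y. fxt y t)) has_real_derivative fxt x t) (at x)"
    using at_within_interior[of x "{a..x+1}"] by (simp add: a_def)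
  from DERIV_add[OF DERIV_const this]
  have D: "((\<lambda>b. deriv (\<lambda>s. f a s) t + integral {a..b} (\<lambda>y. fxt y t)) has_real_derivative fxt x t) (at x)"
    by simp
  have "((\<lambda>b. deriv (\<lambda>s. f b s) t) has_real_derivative fxt x t) (at x)"
  proof (rule has_field_derivative_transform_within_open[OF D, of "{a<..}"])
    show "deriv (f a) t + integral {a..b} (\<lambda>y. fxt y t) = deriv (f b) t" if "b \<in> {a<..}" for b
      using ft[of b] that by simp
  qed (simp_all add: a_def)
  then have "deriv (\<lambda>y. deriv (\<lambda>s. f y s) t) x = fxt x t"
    by (rule DERIV_imp_deriv)
  then show ?thesis
    using smooth2_DERIV_t[OF fx t, of x] by (simp only: fx_def fxt_def)
qed

end

section \<open>Matrices of Laurent series with smooth coefficients\<close>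

text \<open>The convolution formula runs between subdegrees, which vary with x when the factors do.
  Bounds N and M common to all x give a fixed finite range, so that coefficients of products can be
  differentiated in x term by term.\<close>

lemma fls_times_nth_bounds:
  fixes f g :: "'a :: comm_ring_1 fls"
  assumes "\<And>i. i < N \<Longrightarrow> fls_nth f i = 0" "\<And>i. i < M \<Longrightarrow> fls_nth g i = 0"
  shows "fls_nth (f * g) k = (\<Sum>i = N..k - M. fls_nth f i * fls_nth g (k - i))"
proof (cases "f = 0 \<or> g = 0")
  case True
  then show ?thesis by auto
next
  case False
  have "N \<le> fls_subdegree f" "M \<le> fls_subdegree g"
    using False assms nth_fls_subdegree_nonzero by (meson linorder_not_le)+
  then have sub: "{fls_subdegree f..k - fls_subdegree g} \<subseteq> {N..k - M}" by auto
  show ?thesis unfolding fls_times_nth(2)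
  proof (rule sum.mono_neutral_left)
    show "\<forall>i\<in>{N..k - M} - {fls_subdegree f..k - fls_subdegree g}. fls_nth f i * fls_nth g (k - i) = 0"
    proof
      fix i assume "i \<in> {N..k - M} - {fls_subdegree f..k - fls_subdegree g}"
      then have "i < fls_subdegree f \<or> k - i < fls_subdegree g" by auto
      then show "fls_nth f i * fls_nth g (k - i) = 0" by auto
    qed
  qed (use sub in auto)
qed

text \<open>The bound N is uniform in x. With a bound depending on x, the x-derivatives of the
  coefficients might fail to form a Laurent series.\<close>

definition sfls :: "(real \<Rightarrow> real fls) \<Rightarrow> bool" where
  "sfls a \<longleftrightarrow> (\<exists>N. \<forall>x. \<forall>i<N. fls_nth (a x) i = 0) \<and> (\<forall>i. smooth_fun_on UNIV (\<lambda>x. fls_nth (a x) i))"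

definition fD :: "(real \<Rightarrow> real fls) \<Rightarrow> real \<Rightarrow> real fls" where
  "fD a x = Abs_fls (\<lambda>i. deriv (\<lambda>y. fls_nth (a y) i) x)"

lemma sfls_smooth: "sfls a \<Longrightarrow> smooth_fun_on UNIV (\<lambda>x. fls_nth (a x) i)"
  by (simp add: sfls_def)

lemma fls_nth_fD: "sfls a \<Longrightarrow> fls_nth (fD a x) i = deriv (\<lambda>y. fls_nth (a y) i) x"
proof -
  assume "sfls a"
  then obtain N where N: "\<And>x i. i < N \<Longrightarrow> fls_nth (a x) i = 0" unfolding sfls_def by blast
  show ?thesis unfolding fD_def
    by (rule nth_Abs_fls_lower_bound[of N]) (use N in simp)
qed

lemma sfls_const: "sfls (\<lambda>x. c)"
  unfolding sfls_def by (auto intro!: exI[of _ "fls_subdegree c"])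

lemma sfls_fls_const: "smooth_fun_on UNIV f \<Longrightarrow> sfls (\<lambda>x. fls_const (f x))"
  apply (auto simp: sfls_def intro!: exI[of _ 0])
  subgoal for i by (cases "i = 0") auto
  done

lemma sfls_add:
  assumes "sfls a" "sfls b"
  shows "sfls (\<lambda>x. a x + b x)"
proof -
  obtain N M where "\<And>x i. i < N \<Longrightarrow> fls_nth (a x) i = 0" "\<And>x i. i < M \<Longrightarrow> fls_nth (b x) i = 0"
    using assms unfolding sfls_def by blast
  then have "\<forall>x. \<forall>i<min N M. fls_nth (a x + b x) i = 0" by simp
  moreover have "smooth_fun_on UNIV (\<lambda>x. fls_nth (a x + b x) i)" for i
    using assms by (simp add: smooth_fun_on_add sfls_smooth)
  ultimately show ?thesis unfolding sfls_def by blast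
qed

lemma sfls_sum: "(\<And>i. i \<in> A \<Longrightarrow> sfls (a i)) \<Longrightarrow> sfls (\<lambda>x. \<Sum>i\<in>A. a i x)"
  by (induction A rule: infinite_finite_induct) (auto intro: sfls_add sfls_const)

lemma sfls_mult:
  assumes "sfls a" "sfls b"
  shows "sfls (\<lambda>x. a x * b x)"
proof -
  obtain N M where N: "\<And>x i. i < N \<Longrightarrow> fls_nth (a x) i = 0" and M: "\<And>x i. i < M \<Longrightarrow> fls_nth (b x) i = 0"
    using assms unfolding sfls_def by blast
  have nth: "fls_nth (a x * b x) k = (\<Sum>i = N..k - M. fls_nth (a x) i * fls_nth (b x) (k - i))" for x k
    using N M by (rule fls_times_nth_bounds)
  have "\<forall>x. \<forall>i<N + M. fls_nth (a x * b x) i = 0" by (simp add: nth)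
  moreover have "smooth_fun_on UNIV (\<lambda>x. fls_nth (a x * b x) k)" for k
    unfolding nth using assms by (intro smooth_fun_on_sum smooth_fun_on_mult sfls_smooth) auto
  ultimately show ?thesis unfolding sfls_def by blast
qed

lemma sfls_prod: "(\<And>i. i \<in> A \<Longrightarrow> sfls (a i)) \<Longrightarrow> sfls (\<lambda>x. \<Prod>i\<in>A. a i x)"
  by (induction A rule: infinite_finite_induct) (auto intro: sfls_mult sfls_const)

lemma fD_const: "fD (\<lambda>x. c) = (\<lambda>x. 0)"
  by (rule ext, rule fls_eqI) (simp add: fls_nth_fD sfls_const)

lemma fD_add: "sfls a \<Longrightarrow> sfls b \<Longrightarrow> fD (\<lambda>x. a x + b x) x = fD a x + fD b x"
proof (rule fls_eqI)
  fix i assume ab: "sfls a" "sfls b"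
  have "((\<lambda>y. fls_nth (a y) i + fls_nth (b y) i) has_real_derivative
      deriv (\<lambda>y. fls_nth (a y) i) x + deriv (\<lambda>y. fls_nth (b y) i) x) (at x)"
    using ab by (intro DERIV_add smooth_has_deriv[of UNIV] sfls_smooth) auto
  from DERIV_imp_deriv[OF this] show "fls_nth (fD (\<lambda>x. a x + b x) x) i = fls_nth (fD a x + fD b x) i"
    using ab by (simp add: fls_nth_fD sfls_add)
qed

lemma fD_sum: "finite A \<Longrightarrow> (\<And>i. i \<in> A \<Longrightarrow> sfls (a i)) \<Longrightarrow> fD (\<lambda>x. \<Sum>i\<in>A. a i x) x = (\<Sum>i\<in>A. fD (a i) x)"
  by (induction A rule: finite_induct) (simp_all add: fD_const fD_add sfls_sum)

lemma fD_mult: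
  assumes "sfls a" "sfls b"
  shows "fD (\<lambda>x. a x * b x) x = fD a x * b x + a x * fD b x"
proof (rule fls_eqI)
  fix k
  obtain N M where N: "\<And>x i. i < N \<Longrightarrow> fls_nth (a x) i = 0" and M: "\<And>x i. i < M \<Longrightarrow> fls_nth (b x) i = 0"
    using assms unfolding sfls_def by blast
  have N': "fls_nth (fD a x) i = 0" if "i < N" for x i
    using N[OF that] by (simp add: fls_nth_fD[OF assms(1)])
  have M': "fls_nth (fD b x) i = 0" if "i < M" for x i
    using M[OF that] by (simp add: fls_nth_fD[OF assms(2)])
  have D: "((\<lambda>x. \<Sum>i = N..k - M. fls_nth (a x) i * fls_nth (b x) (k - i)) has_real_derivative
     (\<Sum>i = N..k - M. fls_nth (a x) i * fls_nth (fD b x) (k - i) + fls_nth (fD a x) i * fls_nth (b x) (k - i))) (at x)"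
    unfolding fls_nth_fD[OF assms(1)] fls_nth_fD[OF assms(2)]
    by (intro DERIV_sum DERIV_mult' smooth_has_deriv[of UNIV] sfls_smooth assms UNIV_I)
  have "fls_nth (fD (\<lambda>x. a x * b x) x) k = deriv (\<lambda>x. \<Sum>i = N..k - M. fls_nth (a x) i * fls_nth (b x) (k - i)) x"
    unfolding fls_nth_fD[OF sfls_mult[OF assms]] using fls_times_nth_bounds[of N "a _" M "b _", OF N M] by simp
  also have "\<dots> = fls_nth (fD a x * b x + a x * fD b x) k"
    unfolding DERIV_imp_deriv[OF D] fls_plus_nth fls_times_nth_bounds[of N "fD a x" M "b x", OF N' M, simplified]
      fls_times_nth_bounds[of N "a x" M "fD b x", OF N M', simplified] by (simp add: sum.distrib)
  finally show "fls_nth (fD (\<lambda>x. a x * b x) x) k = fls_nth (fD a x * b x + a x * fD b x) k" .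
qed

section \<open>Matrices of series: product rule, determinant, adjugate\<close>

definition smat :: "nat \<Rightarrow> (real \<Rightarrow> real fls mat) \<Rightarrow> bool" where
  "smat n A \<longleftrightarrow> (\<forall>x. A x \<in> carrier_mat n n) \<and> (\<forall>r<n. \<forall>c<n. sfls (\<lambda>x. A x $$ (r, c)))"

definition mD :: "nat \<Rightarrow> (real \<Rightarrow> real fls mat) \<Rightarrow> real \<Rightarrow> real fls mat" where
  "mD n A x = mat n n (\<lambda>(r, c). fD (\<lambda>y. A y $$ (r, c)) x)"

lemma smat_carrier [simp]: "smat n A \<Longrightarrow> A x \<in> carrier_mat n n"
  by (simp add: smat_def)

lemma mD_carrier [simp]: "mD n A x \<in> carrier_mat n n"
  by (simp add: mD_def)

lemma mD_index [simp]: "r < n \<Longrightarrow> c < n \<Longrightarrow> mD n A x $$ (r, c) = fD (\<lambda>y. A y $$ (r, c)) x"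
  by (simp add: mD_def)

lemma mat_mult_index:
  fixes A B :: "'a :: comm_ring_1 mat"
  assumes "A \<in> carrier_mat n n" "B \<in> carrier_mat n n" "r < n" "c < n"
  shows "(A * B) $$ (r, c) = (\<Sum>s<n. A $$ (r, s) * B $$ (s, c))"
  using assms by (auto simp: scalar_prod_def lessThan_atLeast0)

lemma smat_mult:
  assumes "smat n A" "smat n B"
  shows "smat n (\<lambda>x. A x * B x)"
  unfolding smat_def
proof (intro conjI allI impI)
  fix r c assume rc: "r < n" "c < n"
  show "sfls (\<lambda>x. (A x * B x) $$ (r, c))"
    unfolding mat_mult_index[OF smat_carrier[OF assms(1)] smat_carrier[OF assms(2)] rc]
    using assms rc by (intro sfls_sum sfls_mult) (auto simp: smat_def)
qed (use assms in \<open>auto simp: smat_def intro: mult_carrier_mat\<close>)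

lemma smat_const: "C \<in> carrier_mat n n \<Longrightarrow> smat n (\<lambda>x. C)"
  by (simp add: smat_def sfls_const)

lemma smat_pow: "smat n A \<Longrightarrow> smat n (\<lambda>x. A x ^\<^sub>m k)"
proof (induction k)
  case 0
  then have "dim_row (A x) = n" for x using smat_carrier by (metis carrier_matD(1))
  then show ?case by (simp add: smat_const)
next
  case (Suc k)
  then show ?case by (simp add: smat_mult)
qed

lemma mD_mult:
  assumes "smat n A" "smat n B"
  shows "mD n (\<lambda>x. A x * B x) x = mD n A x * B x + A x * mD n B x"
proof (rule eq_matI)
  have C: "A y \<in> carrier_mat n n" "B y \<in> carrier_mat n n" for y
    using assms by auto
  have C': "mD n A x * B x \<in> carrier_mat n n" "A x * mD n B x \<in> carrier_mat n n"
    by (rule mult_carrier_mat[OF mD_carrier C(2)], rule mult_carrier_mat[OF C(1) mD_carrier])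
  show "dim_row (mD n (\<lambda>x. A x * B x) x) = dim_row (mD n A x * B x + A x * mD n B x)"
    "dim_col (mD n (\<lambda>x. A x * B x) x) = dim_col (mD n A x * B x + A x * mD n B x)"
    using carrier_matD[OF add_carrier_mat[OF C'(2)]] carrier_matD[OF mD_carrier] by simp_all
  fix r c assume "r < dim_row (mD n A x * B x + A x * mD n B x)" "c < dim_col (mD n A x * B x + A x * mD n B x)"
  then have rc: "r < n" "c < n" using C' by auto
  have *: "sfls (\<lambda>x. A x $$ (r, s))" "sfls (\<lambda>x. B x $$ (s, c))" if "s < n" for s
    using assms rc that by (auto simp: smat_def)
  have "mD n (\<lambda>x. A x * B x) x $$ (r, c) = fD (\<lambda>x. \<Sum>s<n. A x $$ (r, s) * B x $$ (s, c)) x"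
    using rc by (simp only: mD_index mat_mult_index[OF C])
  also have "\<dots> = (\<Sum>s<n. fD (\<lambda>x. A x $$ (r, s)) x * B x $$ (s, c) + A x $$ (r, s) * fD (\<lambda>x. B x $$ (s, c)) x)"
    by (subst fD_sum) (auto intro!: sum.cong sfls_mult fD_mult *)
  also have "\<dots> = (mD n A x * B x) $$ (r, c) + (A x * mD n B x) $$ (r, c)"
    using rc by (simp add: mat_mult_index[OF mD_carrier C(2)] mat_mult_index[OF C(1) mD_carrier] sum.distrib
        del: index_mult_mat)
  also have "\<dots> = (mD n A x * B x + A x * mD n B x) $$ (r, c)"
    using rc C' by (subst index_add_mat) auto
  finally show "mD n (\<lambda>x. A x * B x) x $$ (r, c) = \<dots>" .
qed

lemma mD_const: "C \<in> carrier_mat n n \<Longrightarrow> mD n (\<lambda>x. C) x = 0\<^sub>m n n"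
  by (intro eq_matI) (auto simp: mD_def fD_const)

lemma sfls_det:
  assumes "smat n A"
  shows "sfls (\<lambda>x. det (A x))"
  unfolding det_def'[OF smat_carrier[OF assms]]
  by (intro sfls_sum sfls_mult sfls_prod sfls_const)
    (use assms in \<open>auto simp: smat_def permutes_in_image\<close>)

lemma smat_adj:
  assumes "smat n A"
  shows "smat n (\<lambda>x. adj_mat (A x))"
proof -
  have "sfls (\<lambda>x. adj_mat (A x) $$ (r, c))" if "r < n" "c < n" for r c
  proof -
    have "smat (n - 1) (\<lambda>x. mat_delete (A x) c r)"
      unfolding smat_def
    proof (intro conjI allI impI)
      fix r' c' assume "r' < n - 1" "c' < n - 1"
      then show "sfls (\<lambda>x. mat_delete (A x) c r $$ (r', c'))"
        using assms that carrier_matD[OF smat_carrier[OF assms]]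
        by (auto simp: mat_delete_def smat_def)
    qed (use carrier_matD[OF smat_carrier[OF assms]] in \<open>auto simp: mat_delete_def\<close>)
    then have "sfls (\<lambda>x. (-1) ^ (c + r) * det (mat_delete (A x) c r))"
      by (intro sfls_mult sfls_const sfls_det)
    then show ?thesis
      using carrier_matD[OF smat_carrier[OF assms]] that by (simp add: adj_mat_def cofactor_def)
  qed
  then show ?thesis using adj_mat(1)[OF smat_carrier[OF assms]] by (simp add: smat_def)
qed

text \<open>Laurent series in \<open>\<lambda>\<^sup>-\<^sup>1\<close> without positive powers of \<open>\<lambda>\<close>.\<close>

definition integral_fls :: "real fls \<Rightarrow> bool" where
  "integral_fls a \<longleftrightarrow> (\<forall>i<0. fls_nth a i = 0)"

lemma integral_fls_mult:
  assumes "integral_fls a" "integral_fls b"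
  shows "integral_fls (a * b)" "fls_nth (a * b) 0 = fls_nth a 0 * fls_nth b 0"
  using assms fls_times_nth_bounds[of 0 a 0 b] unfolding integral_fls_def by auto

lemma integral_fls_sum:
  "(\<And>i. i \<in> A \<Longrightarrow> integral_fls (a i)) \<Longrightarrow> integral_fls (\<Sum>i\<in>A. a i)"
  unfolding integral_fls_def by (simp add: fls_nth_sum)

lemma integral_fls_prod:
  "(\<And>i. i \<in> A \<Longrightarrow> integral_fls (a i)) \<Longrightarrow>
    integral_fls (\<Prod>i\<in>A. a i) \<and> fls_nth (\<Prod>i\<in>A. a i) 0 = (\<Prod>i\<in>A. fls_nth (a i) 0)"
  by (induction A rule: infinite_finite_induct)
    (auto simp: integral_fls_mult, auto simp: integral_fls_def)

lemma integral_fls_signof: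
  "integral_fls (signof p)" "fls_nth (of_int (sign p)) 0 = real_of_int (sign p)"
  by (auto simp: integral_fls_def sign_def)

text \<open>Evaluation at \<lambda> = \<infinity> is a ring homomorphism on series without positive
  powers of \<lambda>, hence it commutes with determinants.\<close>

lemma integral_fls_det:
  assumes "A \<in> carrier_mat n n" "\<And>r c. r < n \<Longrightarrow> c < n \<Longrightarrow> integral_fls (A $$ (r, c))"
  shows "integral_fls (det A)" "fls_nth (det A) 0 = det (mat n n (\<lambda>(r, c). fls_nth (A $$ (r, c)) 0))"
proof -
  have *: "integral_fls (\<Prod>i = 0..<n. A $$ (i, p i)) \<and>
      fls_nth (\<Prod>i = 0..<n. A $$ (i, p i)) 0 = (\<Prod>i = 0..<n. fls_nth (A $$ (i, p i)) 0)"
    if "p permutes {0..<n}" for p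
    by (rule integral_fls_prod) (use assms(2) permutes_in_image[OF that] in auto)
  show "integral_fls (det A)" unfolding det_def'[OF assms(1)]
    by (intro integral_fls_sum integral_fls_mult integral_fls_signof) (use * in auto)
  have "fls_nth (det A) 0 = (\<Sum>p \<in> {p. p permutes {0..<n}}. signof p * (\<Prod>i = 0..<n. fls_nth (A $$ (i, p i)) 0))"
    unfolding det_def'[OF assms(1)] fls_nth_sum
    by (intro sum.cong) (auto simp: * integral_fls_mult(2) integral_fls_signof)
  also have "\<dots> = det (mat n n (\<lambda>(r, c). fls_nth (A $$ (r, c)) 0))"
    by (subst det_def'[of _ n]) (auto intro!: sum.cong prod.cong simp: permutes_in_image)
  finally show "fls_nth (det A) 0 = det (mat n n (\<lambda>(r, c). fls_nth (A $$ (r, c)) 0))" .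
qed

lemma integral_fls_inverse:
  assumes "integral_fls a" "fls_nth a 0 = 1"
  shows "integral_fls (inverse a)" "a * inverse a = 1"
proof -
  have "a \<noteq> 0" using assms(2) by force
  then show "a * inverse a = 1" by simp
  have "fls_subdegree a = 0"
    using assms unfolding integral_fls_def
    by (intro fls_subdegree_eqI) auto
  then show "integral_fls (inverse a)"
    unfolding integral_fls_def by (simp add: fls_inverse_subdegree_base_nonzero assms(2))
qed

text \<open>As the leading coefficient is 1, each coefficient of the inverse is a polynomial in
  coefficients of a and in earlier coefficients of the inverse; smoothness follows by strong
  induction, without division.\<close>

lemma sfls_inverse:
  assumes a: "sfls a" and i: "\<And>x. integral_fls (a x)" and 1: "\<And>x. fls_nth (a x) 0 = 1"
  shows "sfls (\<lambda>x. inverse (a x))"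
proof -
  note i' = integral_fls_inverse[OF i 1]
  have ai: "fls_nth (a x) k = 0" if "k < 0" for x k
    using i that unfolding integral_fls_def by blast
  have bi: "fls_nth (inverse (a x)) k = 0" if "k < 0" for x k
    using i'(1) that unfolding integral_fls_def by blast
  have rec: "fls_nth (inverse (a x)) (int k) = (if k = 0 then 1 else 0) -
      (\<Sum>i = 1..int k. fls_nth (a x) i * fls_nth (inverse (a x)) (int k - i))" for x k
  proof -
    have "(if k = 0 then 1 else 0) = fls_nth (a x * inverse (a x)) (int k)"
      by (simp add: i'(2))
    also have "\<dots> = (\<Sum>i = 0..int k. fls_nth (a x) i * fls_nth (inverse (a x)) (int k - i))"
      using fls_times_nth_bounds[of 0 "a x" 0 "inverse (a x)" "int k"] ai bi by simp
    also have "{0..int k} = insert 0 {1..int k}" by auto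
    finally show ?thesis by (simp add: 1)
  qed
  have "smooth_fun_on UNIV (\<lambda>x. fls_nth (inverse (a x)) (int k))" for k
  proof (induction k rule: less_induct)
    case (less k)
    have "smooth_fun_on UNIV (\<lambda>x. fls_nth (a x) i * fls_nth (inverse (a x)) (int k - i))"
      if "i \<in> {1..int k}" for i
    proof -
      have "int k - i = int (nat (int k - i))" using that by simp
      moreover have "nat (int k - i) < k" using that by auto
      ultimately have "smooth_fun_on UNIV (\<lambda>x. fls_nth (inverse (a x)) (int k - i))"
        using less.IH by metis
      then show ?thesis by (intro smooth_fun_on_mult sfls_smooth[OF a]) auto
    qed
    then show ?case
      unfolding rec by (intro smooth_fun_on_sub smooth_fun_on_sum smooth_fun_on_const) auto
  qed
  moreover have "smooth_fun_on UNIV (\<lambda>x. fls_nth (inverse (a x)) k)" if "k < 0" for k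
    using bi[OF that] by simp
  ultimately have "smooth_fun_on UNIV (\<lambda>x. fls_nth (inverse (a x)) k)" for k
    by (metis int_nat_eq nat_0_le not_le)
  then show ?thesis
    unfolding sfls_def using bi by blast
qed

section \<open>Dressing\<close>

text \<open>
  A column vector \<open>v\<close> of Laurent series in \<open>\<lambda>\<^sup>-\<^sup>1\<close> is identified with the single series
  \<open>\<Sum>\<^sub>r v\<^sub>r(\<mu>\<^sup>n) \<mu>\<^sup>r\<close> in \<open>\<mu>\<close>, where \<open>\<mu>\<^sup>n = \<lambda>\<close>, given by its family of coefficients indexed by \<open>int\<close>.
  Multiplication by \<open>J\<close> becomes multiplication by \<open>\<mu>\<close>, and \<open>shiftD\<close> is the operator \<open>\<partial>\<^sub>x + \<mu>\<close>.
\<close>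

definition shiftD :: "(int \<Rightarrow> real \<Rightarrow> real) \<Rightarrow> int \<Rightarrow> real \<Rightarrow> real" where
  "shiftD a d x = deriv (a d) x + a (d - 1) x"

lemma shiftD_pow_Suc: "(shiftD ^^ Suc c) a d = (\<lambda>x. deriv ((shiftD ^^ c) a d) x + (shiftD ^^ c) a (d - 1) x)"
  by (rule ext) (simp add: shiftD_def)

abbreviation smooth_fam :: "(int \<Rightarrow> real \<Rightarrow> real) \<Rightarrow> bool" where
  "smooth_fam a \<equiv> \<forall>d. smooth_fun_on UNIV (a d)"

lemma smooth_shiftD: "smooth_fam a \<Longrightarrow> smooth_fam (shiftD a)"
  unfolding shiftD_def by (auto intro!: smooth_fun_on_add smooth_deriv)

lemma smooth_shiftD_pow: "smooth_fam a \<Longrightarrow> smooth_fam ((shiftD ^^ c) a)"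
  by (induction c) (simp, metis funpow.simps(2) o_apply smooth_shiftD)

lemma shiftD_pow_local:
  "(\<And>e. e \<ge> d - int c \<Longrightarrow> a e = b e) \<Longrightarrow> (shiftD ^^ c) a d = (shiftD ^^ c) b d"
proof (induction c arbitrary: d)
  case (Suc c)
  have "(shiftD ^^ c) a d = (shiftD ^^ c) b d" "(shiftD ^^ c) a (d - 1) = (shiftD ^^ c) b (d - 1)"
    by (intro Suc.IH Suc.prems; simp)+
  then show ?case by (simp only: shiftD_pow_Suc)
qed simp

lemma shiftD_pow_zero: "(shiftD ^^ c) (\<lambda>d x. 0) = (\<lambda>d x. 0)"
proof (induction c)
  case (Suc c)
  then show ?case by (intro ext) (simp only: shiftD_pow_Suc deriv_const add_0)
qed simp

lemma shiftD_pow_vanish: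
  assumes "\<And>e. e > D \<Longrightarrow> a e = (\<lambda>x. 0)" "d > D + int c"
  shows "(shiftD ^^ c) a d = (\<lambda>x. 0)"
  using shiftD_pow_local[of d c a "\<lambda>d x. 0"] assms by (simp add: shiftD_pow_zero)

lemma shiftD_pow_top:
  assumes "\<And>e. e > D \<Longrightarrow> a e = (\<lambda>x. 0)"
  shows "(shiftD ^^ c) a (D + int c) = a D"
proof (induction c)
  case (Suc c)
  have "(shiftD ^^ c) a (D + int (Suc c)) = (\<lambda>x. 0)"
    by (rule shiftD_pow_vanish[OF assms]) auto
  moreover have "D + int (Suc c) - 1 = D + int c" by simp
  ultimately show ?case using Suc
    by (simp only: shiftD_pow_Suc[of c a "D + int (Suc c)"])
      (simp add: shiftD_pow_vanish[OF assms])
qed simp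

text \<open>The part of \<open>(\<partial>\<^sub>x + \<mu>)\<^sup>c a\<close> beyond \<open>\<mu>\<^sup>c a + c \<mu>\<^sup>c\<^sup>-\<^sup>1 \<partial>\<^sub>x a\<close>.\<close>

definition shiftD_rest :: "nat \<Rightarrow> (int \<Rightarrow> real \<Rightarrow> real) \<Rightarrow> int \<Rightarrow> real \<Rightarrow> real" where
  "shiftD_rest c a d x = (shiftD ^^ c) a d x - a (d - int c) x - real c * deriv (a (d - int c + 1)) x"

lemma smooth_shiftD_rest: "smooth_fam a \<Longrightarrow> smooth_fun_on UNIV (shiftD_rest c a d)"
  unfolding shiftD_rest_def
  by (intro smooth_fun_on_sub smooth_fun_on_mult smooth_deriv) (use smooth_shiftD_pow in auto)

lemma shiftD_rest_Suc:
  assumes "smooth_fam a"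
  shows "shiftD_rest (Suc c) a d x = deriv (shiftD_rest c a d) x
    + real c * deriv (deriv (a (d - int c + 1))) x + shiftD_rest c a (d - 1) x"
proof -
  let ?b = "a (d - int c + 1)"
  note D = smooth_has_deriv[of UNIV, OF _ UNIV_I]
  have "((\<lambda>y. (shiftD ^^ c) a d y - a (d - int c) y - real c * deriv ?b y) has_real_derivative
      deriv ((shiftD ^^ c) a d) x - deriv (a (d - int c)) x - real c * deriv (deriv ?b) x) (at x)"
    using assms smooth_shiftD_pow[OF assms] by (intro DERIV_diff DERIV_cmult D smooth_deriv) auto
  from DERIV_imp_deriv[OF this]
  have "deriv (shiftD_rest c a d) x =
      deriv ((shiftD ^^ c) a d) x - deriv (a (d - int c)) x - real c * deriv (deriv ?b) x"
    unfolding shiftD_rest_def .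
  then show ?thesis
    by (simp add: shiftD_rest_def shiftD_def algebra_simps)
qed

text \<open>Only coefficients strictly above the two extracted ones enter. In the eigenvalue
  equation this leaves a single unknown in each degree, and it enters through its
  derivative.\<close>

lemma shiftD_rest_local:
  assumes "smooth_fam a" "smooth_fam b"
  shows "(\<And>e. e \<ge> d - int c + 2 \<Longrightarrow> a e = b e) \<Longrightarrow> shiftD_rest c a d = shiftD_rest c b d"
proof (induction c arbitrary: d)
  case 0
  then show ?case by (simp add: shiftD_rest_def fun_eq_iff)
next
  case (Suc c)
  have "shiftD_rest c a d = shiftD_rest c b d" "shiftD_rest c a (d - 1) = shiftD_rest c b (d - 1)"
    by (intro Suc.IH Suc.prems; simp)+
  moreover have "a (d - int c + 1) = b (d - int c + 1)" by (rule Suc.prems) simp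
  ultimately show ?case
    using assms by (intro ext) (simp add: shiftD_rest_Suc)
qed

text \<open>Every term of the remainder contains an x-derivative of a coefficient above the
  extracted ones.\<close>

lemma shiftD_rest_const:
  assumes "smooth_fam a"
  shows "(\<And>e. e \<ge> d - int c + 2 \<Longrightarrow> deriv (a e) = (\<lambda>x. 0)) \<Longrightarrow> shiftD_rest c a d = (\<lambda>x. 0)"
proof (induction c arbitrary: d)
  case 0
  then show ?case by (simp add: shiftD_rest_def fun_eq_iff)
next
  case (Suc c)
  have "shiftD_rest c a d = (\<lambda>x. 0)" "shiftD_rest c a (d - 1) = (\<lambda>x. 0)"
    by (intro Suc.IH Suc.prems; simp)+
  moreover have "deriv (a (d - int c + 1)) = (\<lambda>x. 0)" by (rule Suc.prems) simp
  ultimately show ?case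
    using assms by (intro ext) (simp add: shiftD_rest_Suc)
qed

text \<open>
  The formal eigenfunction \<open>e\<^sup>\<mu>\<^sup>x \<Sum>\<^sub>m s\<^sub>m \<mu>\<^sup>-\<^sup>m\<close> of \<open>\<partial>\<^sup>n - \<Sum> u\<^sub>i \<partial>\<^sup>i\<^sup>-\<^sup>1\<close> for the eigenvalue \<open>\<mu>\<^sup>n\<close>; each
  \<open>s\<^sub>m\<close> is an antiderivative of an expression in the previous ones.
\<close>

lemma formal_eigenfunction:
  fixes u :: "nat \<Rightarrow> real \<Rightarrow> real"
  assumes n: "n \<ge> 1" and u: "\<And>i. i \<in> {1..<n} \<Longrightarrow> smooth_fun_on UNIV (u i)"
  obtains a where "smooth_fam a" "\<And>d. d > 0 \<Longrightarrow> a d = (\<lambda>x. 0)" "a 0 = (\<lambda>x. 1)"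
    "\<And>d x. (shiftD ^^ n) a d x = a (d - int n) x + (\<Sum>i = 1..<n. u i x * (shiftD ^^ (i - 1)) a d x)"
proof -
  \<comment> \<open>Only s_0, ..., s_(m-1) survive, so \<open>G m s\<close> depends on earlier terms
    alone.\<close>
  define trunc :: "nat \<Rightarrow> (nat \<Rightarrow> real \<Rightarrow> real) \<Rightarrow> int \<Rightarrow> real \<Rightarrow> real" where
    "trunc m s d = (if - int m < d \<and> d \<le> 0 then s (nat (- d)) else (\<lambda>x. 0))" for m s d
  \<comment> \<open>At degree d = n - 1 - m the terms \<open>a (d - n)\<close> on both sides of the
    equation cancel and s_m occurs only in n s_m'; solving for s_m' gives G.\<close>
  define G where "G m s x = ((\<Sum>i = 1..<n. u i x * (shiftD ^^ (i - 1)) (trunc m s) (int n - 1 - int m) x)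
      - shiftD_rest n (trunc m s) (int n - 1 - int m) x) / real n" for m s x
  define Q where "Q s m r \<longleftrightarrow> smooth_fun_on UNIV r \<and> (\<forall>x. (r has_real_derivative G m s x) (at x)) \<and>
      (m = 0 \<longrightarrow> r = (\<lambda>x. 1))" for s m r
  have "\<exists>s. \<forall>m. Q s m (s m)"
  \<comment> \<open>The constants of integration are free, so the sequence is obtained by dependent
    choice.\<close>
  proof (rule dependent_wf_choice[OF wf_less_than])
    fix s s' :: "nat \<Rightarrow> real \<Rightarrow> real" and m r
    assume "\<And>z. (z, m) \<in> less_than \<Longrightarrow> s z = s' z"
    then have "trunc m s = trunc m s'" by (auto simp: trunc_def fun_eq_iff)
    then show "Q s m r = Q s' m r" by (simp add: Q_def G_def)
  next
    fix m :: nat and s :: "nat \<Rightarrow> real \<Rightarrow> real"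
    assume *: "\<And>y. (y, m) \<in> less_than \<Longrightarrow> Q s y (s y)"
    show "\<exists>r. Q s m r"
    proof (cases "m = 0")
      case True
      then have "trunc m s = (\<lambda>d x. 0)" by (auto simp: trunc_def fun_eq_iff)
      then have "G m s x = 0" for x
        by (simp add: G_def shiftD_pow_zero shiftD_rest_def)
      then show ?thesis using True by (auto simp: Q_def intro!: exI[of _ "\<lambda>x. 1"])
    next
      case False
      have "smooth_fam (trunc m s)"
        using * by (auto simp: trunc_def Q_def)
      then have "smooth_fun_on UNIV (G m s)"
        unfolding G_def using n
        by (intro smooth_fun_on_divide smooth_fun_on_sub smooth_fun_on_sum smooth_fun_on_mult
            smooth_shiftD_rest smooth_fun_on_const u) (use smooth_shiftD_pow in auto)
      from smooth_antiderivative[OF this] show ?thesis using False by (auto simp: Q_def)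
    qed
  qed
  then obtain s where s: "\<And>m. smooth_fun_on UNIV (s m)" "\<And>m x. (s m has_real_derivative G m s x) (at x)"
    "s 0 = (\<lambda>x. 1)" unfolding Q_def by blast
  define a where "a d = (if d \<le> 0 then s (nat (- d)) else (\<lambda>x. 0))" for d :: int
  have smooth: "smooth_fam a" using s(1) by (simp add: a_def)
  have trunc_a: "trunc m s e = a e" if "e > - int m" for m e
    using that by (auto simp: trunc_def a_def)
  have smooth_trunc: "smooth_fam (trunc m s)" for m using s(1) by (simp add: trunc_def)
  have expand: "(shiftD ^^ n) a d x = a (d - int n) x + real n * deriv (a (d - int n + 1)) x + shiftD_rest n a d x" for d x
    by (simp add: shiftD_rest_def)
  have "(shiftD ^^ n) a d x = a (d - int n) x + (\<Sum>i = 1..<n. u i x * (shiftD ^^ (i - 1)) a d x)" for d x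
  proof (cases "d \<ge> int n")
    case True
    have z: "a e = (\<lambda>x. 0)" if "e > 0" for e using that by (simp add: a_def)
    have "shiftD_rest n a d = shiftD_rest n (\<lambda>d x. 0) d"
      by (rule shiftD_rest_local) (use smooth True z in auto)
    then have "shiftD_rest n a d = (\<lambda>x. 0)"
      by (intro ext) (simp add: shiftD_rest_def shiftD_pow_zero)
    moreover have "(shiftD ^^ (i - 1)) a d = (\<lambda>x. 0)" if "i \<in> {1..<n}" for i
      by (rule shiftD_pow_vanish[of 0]) (use z that True in auto)
    ultimately show ?thesis using True z[of "d - int n + 1"] by (simp add: expand)
  next
    case False
    define m where "m = nat (int n - 1 - d)"
    have m: "d = int n - 1 - int m" using False by (simp add: m_def)
    have "shiftD_rest n (trunc m s) d = shiftD_rest n a d"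
      by (rule shiftD_rest_local) (use smooth smooth_trunc m trunc_a in auto)
    moreover have "(shiftD ^^ (i - 1)) (trunc m s) d = (shiftD ^^ (i - 1)) a d" if "i \<in> {1..<n}" for i
      by (rule shiftD_pow_local) (use trunc_a that m in auto)
    ultimately have "G m s x = ((\<Sum>i = 1..<n. u i x * (shiftD ^^ (i - 1)) a d x) - shiftD_rest n a d x) / real n"
      unfolding G_def m[symmetric] by simp
    moreover have "deriv (a (d - int n + 1)) x = G m s x"
      using DERIV_imp_deriv[OF s(2)[of m x]] m by (simp add: a_def)
    ultimately show ?thesis using n by (simp add: expand)
  qed
  then show thesis using that[of a] smooth s(3) by (auto simp: a_def)
qed

section \<open>The dictionary between columns and series in \<mu>\<close>

text \<open>Writing d = r + n q with 0 \<le> r < n, this is the coefficient of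
  \<open>\<lambda>\<^sup>q\<close> in row r, that is, of \<open>\<mu>\<^sup>d\<close> in the series
  of column c.\<close>

definition hcol :: "nat \<Rightarrow> (real \<Rightarrow> real fls mat) \<Rightarrow> nat \<Rightarrow> int \<Rightarrow> real \<Rightarrow> real" where
  "hcol n A c d x = fls_nth (A x $$ (nat (d mod int n), c)) (- (d div int n))"

lemma hcol_eq: "r < n \<Longrightarrow> hcol n A c (int r - int n * i) x = fls_nth (A x $$ (r, c)) i"
proof -
  assume "r < n"
  then have "(int r - int n * i) mod int n = int r" "(int r - int n * i) div int n = - i"
    using mod_mult_self2[of "int r" "int n" "-i"] div_mult_self2[of "int n" "int r" "-i"] by auto
  then show ?thesis by (simp add: hcol_def)
qed

lemma hcol_ind:
  assumes "n \<ge> 1" "\<And>r i. r < n \<Longrightarrow> P (int r - int n * i)"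
  shows "P d"
proof -
  have "d = int (nat (d mod int n)) - int n * (- (d div int n))"
    using assms(1) by (simp add: algebra_simps)
  moreover have "nat (d mod int n) < n"
    using assms(1) by (simp add: nat_less_iff)
  ultimately show ?thesis using assms(2) by metis
qed

lemma mat1_index [simp]: "r < n \<Longrightarrow> c < n \<Longrightarrow> mat1 n F $$ (r, c) = F (Suc r) (Suc c)"
  by (simp add: mat1_def)

lemma mat1_carrier [simp]: "mat1 n F \<in> carrier_mat n n"
  by (simp add: mat1_def)

lemma J_series_carrier [simp]: "J_series n \<in> carrier_mat n n"
  by (simp add: J_series_def)

lemma u_series_carrier [simp]: "u_series n u x \<in> carrier_mat n n"
  by (simp add: u_series_def)

lemma J_mult_index:
  assumes "A \<in> carrier_mat n n" "r < n" "c < n"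
  shows "(J_series n * A) $$ (r, c) = (if r = 0 then fls_X_inv * A $$ (n - 1, c) else A $$ (r - 1, c))"
proof -
  have "(J_series n * A) $$ (r, c) = (\<Sum>s<n. if s = (if r = 0 then n - 1 else r - 1) then
      (if r = 0 then fls_X_inv * A $$ (n - 1, c) else A $$ (r - 1, c)) else 0)"
    using assms unfolding mat_mult_index[OF J_series_carrier assms]
    by (intro sum.cong) (auto simp: J_series_def)
  then show ?thesis using assms by auto
qed

lemma mult_J_index:
  assumes "A \<in> carrier_mat n n" "r < n" "c < n"
  shows "(A * J_series n) $$ (r, c) = (if c = n - 1 then fls_X_inv * A $$ (r, 0) else A $$ (r, c + 1))"
proof -
  have "(A * J_series n) $$ (r, c) = (\<Sum>s<n. if s = (if c = n - 1 then 0 else c + 1) then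
      (if c = n - 1 then fls_X_inv * A $$ (r, 0) else A $$ (r, c + 1)) else 0)"
    using assms unfolding mat_mult_index[OF assms(1) J_series_carrier assms(2,3)]
    by (intro sum.cong) (auto simp: J_series_def)
  then show ?thesis using assms by auto
qed

lemma mult_u_index:
  assumes "A \<in> carrier_mat n n" "r < n" "c < n"
  shows "(A * u_series n u x) $$ (r, c) =
    (if c = n - 1 then \<Sum>i = 1..<n. A $$ (r, i - 1) * fls_const (u i x) else 0)"
proof -
  have "(A * u_series n u x) $$ (r, c) =
      (\<Sum>s<n. if c = n - 1 \<and> Suc s < n then A $$ (r, s) * fls_const (u (Suc s) x) else 0)"
    using assms unfolding mat_mult_index[OF assms(1) u_series_carrier assms(2,3)]
    by (intro sum.cong) (auto simp: u_series_def)
  also have "\<dots> = (if c = n - 1 then \<Sum>s<n - 1. A $$ (r, s) * fls_const (u (Suc s) x) else 0)"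
    using assms by (auto intro!: sum.mono_neutral_cong_right split: if_splits)
  also have "(\<Sum>s<n - 1. A $$ (r, s) * fls_const (u (Suc s) x)) = (\<Sum>i = 1..<n. A $$ (r, i - 1) * fls_const (u i x))"
    by (rule sum.reindex_bij_witness[of _ "\<lambda>i. i - 1" Suc]) auto
  finally show ?thesis .
qed

lemma hcol_J_mult:
  assumes "\<And>x. A x \<in> carrier_mat n n" "c < n"
  shows "hcol n (\<lambda>x. J_series n * A x) c d x = hcol n A c (d - 1) x"
proof (rule hcol_ind[of n "\<lambda>d. hcol n (\<lambda>x. J_series n * A x) c d x = hcol n A c (d - 1) x"])
  fix r i assume r: "r < n"
  show "hcol n (\<lambda>x. J_series n * A x) c (int r - int n * i) x = hcol n A c (int r - int n * i - 1) x"
  proof (cases "r = 0")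
    case True
    then have "hcol n A c (int r - int n * i - 1) x = hcol n A c (int (n - 1) - int n * (i + 1)) x"
      using r by (intro arg_cong[of _ _ "\<lambda>d. hcol n A c d x"]) (simp add: algebra_simps of_nat_diff)
    also have "\<dots> = fls_nth (A x $$ (n - 1, c)) (i + 1)"
      by (rule hcol_eq) (use r in auto)
    also have "\<dots> = fls_nth ((J_series n * A x) $$ (r, c)) i"
      using r True assms by (simp add: J_mult_index fls_X_inv_times_conv_shift del: index_mult_mat)
    finally show ?thesis using hcol_eq[OF r] by simp
  next
    case False
    then have "hcol n A c (int r - int n * i - 1) x = hcol n A c (int (r - 1) - int n * i) x"
      using r by (intro arg_cong[of _ _ "\<lambda>d. hcol n A c d x"]) (simp add: algebra_simps of_nat_diff)
    also have "\<dots> = fls_nth (A x $$ (r - 1, c)) i"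
      by (rule hcol_eq) (use r in auto)
    also have "\<dots> = fls_nth ((J_series n * A x) $$ (r, c)) i"
      using r False assms by (simp add: J_mult_index del: index_mult_mat)
    finally show ?thesis using hcol_eq[OF r] by simp
  qed
qed (use assms in auto)

lemma hcol_mD:
  assumes "smat n A" "n \<ge> 1" "c < n"
  shows "hcol n (mD n A) c d x = deriv (hcol n A c d) x"
proof -
  have "nat (d mod int n) < n" using assms(2) by (simp add: nat_less_iff)
  then show ?thesis using assms by (simp add: hcol_def[abs_def] fls_nth_fD smat_def)
qed

text \<open>The columns move cyclically, and the wrap-around at the last one costs a factor
  \<lambda> = \<open>\<mu>\<^sup>n\<close>.\<close>

lemma hcol_mult_J:
  assumes "\<And>x. A x \<in> carrier_mat n n" "c < n"
  shows "hcol n (\<lambda>x. A x * J_series n) c d x =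
    (if c = n - 1 then hcol n A 0 (d - int n) x else hcol n A (c + 1) d x)"
proof (rule hcol_ind[of n])
  fix r i assume r: "r < n"
  have *: "hcol n (\<lambda>x. A x * J_series n) c (int r - int n * i) x = fls_nth ((A x * J_series n) $$ (r, c)) i"
    by (rule hcol_eq[OF r])
  show "hcol n (\<lambda>x. A x * J_series n) c (int r - int n * i) x =
    (if c = n - 1 then hcol n A 0 (int r - int n * i - int n) x else hcol n A (c + 1) (int r - int n * i) x)"
  proof (cases "c = n - 1")
    case True
    have "hcol n A 0 (int r - int n * i - int n) x = hcol n A 0 (int r - int n * (i + 1)) x"
      by (intro arg_cong[of _ _ "\<lambda>d. hcol n A 0 d x"]) (simp add: algebra_simps)
    also have "\<dots> = fls_nth (A x $$ (r, 0)) (i + 1)"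
      by (rule hcol_eq[OF r])
    finally show ?thesis unfolding * using True r assms
      by (simp add: mult_J_index fls_X_inv_times_conv_shift del: index_mult_mat)
  next
    case False
    then show ?thesis unfolding * using r assms
      by (simp add: mult_J_index hcol_eq del: index_mult_mat)
  qed
qed (use assms in auto)

section \<open>Intertwining of connections\<close>

text \<open>As operators, (\<partial> + A) C = C (\<partial> + B).\<close>

definition intertwines ::
  "nat \<Rightarrow> (real \<Rightarrow> real fls mat) \<Rightarrow> (real \<Rightarrow> real fls mat) \<Rightarrow> (real \<Rightarrow> real fls mat) \<Rightarrow> bool" where
  "intertwines n A B C \<longleftrightarrow> (\<forall>x. mD n C x + A x * C x = C x * B x)"

lemma mat_add_swap:
  fixes X Y Z :: "'a :: comm_ring_1 mat"
  shows "X \<in> carrier_mat n m \<Longrightarrow> Y \<in> carrier_mat n m \<Longrightarrow> Z \<in> carrier_mat n m \<Longrightarrow> X + Y + Z = X + Z + Y"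
  by (intro eq_matI) auto

lemma intertwines_comp:
  assumes "smat n C" "smat n E" "\<And>x. A x \<in> carrier_mat n n" "\<And>x. B x \<in> carrier_mat n n" "\<And>x. D x \<in> carrier_mat n n"
    and CE: "intertwines n A B C" "intertwines n B D E"
  shows "intertwines n A D (\<lambda>x. C x * E x)"
  unfolding intertwines_def
proof
  fix x
  note c = smat_carrier[OF assms(1), of x] smat_carrier[OF assms(2), of x] assms(3-5)[of x]
    mD_carrier[of n C x] mD_carrier[of n E x]
  have p: "mD n C x * E x \<in> carrier_mat n n" "C x * mD n E x \<in> carrier_mat n n" "A x * C x * E x \<in> carrier_mat n n"
    "C x * B x * E x \<in> carrier_mat n n"
    using c by (auto intro: mult_carrier_mat[of _ n n _ n])
  have "mD n (\<lambda>x. C x * E x) x + A x * (C x * E x) = mD n C x * E x + C x * mD n E x + A x * C x * E x"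
    using assoc_mult_mat[OF c(3,1,2)] by (simp add: mD_mult[OF assms(1,2)])
  also have "\<dots> = mD n C x * E x + A x * C x * E x + C x * mD n E x"
    using p(1-3) by (rule mat_add_swap)
  also have "mD n C x * E x + A x * C x * E x = (mD n C x + A x * C x) * E x"
    by (rule add_mult_distrib_mat[symmetric]) (use c in \<open>auto intro: mult_carrier_mat\<close>)
  also have "\<dots> = C x * (B x * E x)"
    using CE(1) assoc_mult_mat[OF c(1,4,2)] by (simp add: intertwines_def)
  also have "C x * (B x * E x) + C x * mD n E x = C x * (B x * E x + mD n E x)"
    by (rule mult_add_distrib_mat[symmetric]) (use c in \<open>auto intro: mult_carrier_mat\<close>)
  also have "B x * E x + mD n E x = E x * D x"
    using CE(2) comm_add_mat[OF mult_carrier_mat[OF c(4,2)] c(7)] by (simp add: intertwines_def)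
  finally show "mD n (\<lambda>x. C x * E x) x + A x * (C x * E x) = C x * E x * D x"
    using assoc_mult_mat[OF c(1,2,5)] by simp
qed

lemma intertwines_inverse:
  assumes "smat n P" "smat n Q" "\<And>x. A x \<in> carrier_mat n n" "\<And>x. B x \<in> carrier_mat n n"
    and PQ: "\<And>x. P x * Q x = 1\<^sub>m n" "\<And>x. Q x * P x = 1\<^sub>m n"
    and P: "intertwines n A B P"
  shows "intertwines n B A Q"
  unfolding intertwines_def
proof
  fix x
  note c = smat_carrier[OF assms(1), of x] smat_carrier[OF assms(2), of x] assms(3,4)[of x]
    mD_carrier[of n P x] mD_carrier[of n Q x]
  have 0: "mD n P x * Q x + P x * mD n Q x = 0\<^sub>m n n"
    using mD_mult[OF assms(1,2), of x] by (simp add: PQ mD_const)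
  let ?R = "mD n Q x + B x * Q x"
  have cR: "?R \<in> carrier_mat n n" using c by auto
  have p: "mD n P x * Q x \<in> carrier_mat n n" "P x * mD n Q x \<in> carrier_mat n n" "A x * (P x * Q x) \<in> carrier_mat n n"
    using c by (auto intro: mult_carrier_mat[of _ n n _ n])
  have "P x * ?R = P x * mD n Q x + P x * (B x * Q x)"
    by (rule mult_add_distrib_mat) (use c in \<open>auto intro: mult_carrier_mat\<close>)
  also have "P x * (B x * Q x) = P x * B x * Q x"
    by (rule assoc_mult_mat[symmetric]) (use c in auto)
  also have "P x * B x = mD n P x + A x * P x"
    using P by (simp add: intertwines_def)
  also have "\<dots> * Q x = mD n P x * Q x + A x * P x * Q x"
    by (rule add_mult_distrib_mat) (use c in \<open>auto intro: mult_carrier_mat\<close>)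
  also have "A x * P x * Q x = A x * (P x * Q x)"
    by (rule assoc_mult_mat) (use c in auto)
  also have "P x * mD n Q x + (mD n P x * Q x + A x * (P x * Q x)) =
      P x * mD n Q x + mD n P x * Q x + A x * (P x * Q x)"
    by (rule assoc_add_mat[symmetric, OF p(2,1,3)])
  also have "\<dots> = A x" using c unfolding comm_add_mat[OF p(2,1)] 0 by (simp add: PQ)
  finally have *: "P x * ?R = A x" .
  have "?R = Q x * P x * ?R" using left_mult_one_mat[OF cR] by (simp add: PQ)
  also have "\<dots> = Q x * A x" using assoc_mult_mat[OF c(2,1) cR] * by simp
  finally show "?R = Q x * A x" .
qed

lemma intertwines_pow:
  assumes "smat n C" "\<And>x. A x \<in> carrier_mat n n" "intertwines n A A C"
  shows "intertwines n A A (\<lambda>x. C x ^\<^sub>m k)"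
proof (induction k)
  case 0
  have "dim_row (C x) = n" for x using smat_carrier[OF assms(1), of x] by auto
  then show ?case
    using left_add_zero_mat[OF assms(2)] right_mult_one_mat[OF assms(2)] left_mult_one_mat[OF assms(2)]
    by (simp add: intertwines_def mD_const)
next
  case (Suc k)
  then show ?case
    using intertwines_comp[OF smat_pow[OF assms(1)] assms(1,2,2,2) _ assms(3)] by simp
qed

lemma smat_J: "smat n (\<lambda>x. J_series n)"
  by (rule smat_const) simp

lemma intertwines_J: "intertwines n (\<lambda>x. J_series n) (\<lambda>x. J_series n) (\<lambda>x. J_series n)"
  using left_add_zero_mat[OF mult_carrier_mat[OF J_series_carrier J_series_carrier]]
  by (simp add: intertwines_def mD_const)

text \<open>
  In terms of \<open>\<mu>\<close>, the first column of such a matrix commutes with \<open>(\<partial>\<^sub>x + \<mu>)\<^sup>n\<close> up to \<open>\<mu>\<^sup>n\<close>; comparing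
  coefficients from the top shows that it does not depend on \<open>x\<close>.
\<close>

lemma commutes_J:
  assumes n: "n \<ge> 1" and C: "smat n C" and int: "intertwines n (\<lambda>x. J_series n) (\<lambda>x. J_series n) C"
  shows "J_series n * C x = C x * J_series n"
proof -
  define c where "c = hcol n C"
  have smooth: "smooth_fam (c j)" if "j < n" for j
  proof
    fix d
    have "nat (d mod int n) < n" using n by (simp add: nat_less_iff)
    then show "smooth_fun_on UNIV (c j d)"
      using C that by (simp add: c_def hcol_def[abs_def] smat_def sfls_smooth)
  qed
  have step: "shiftD (c j) d x = (if j = n - 1 then c 0 (d - int n) x else c (j + 1) d x)" if j: "j < n" for j d x
  proof -
    define s where "s = nat (d mod int n)"
    have s: "s < n" using n by (simp add: s_def nat_less_iff)
    have "mD n C x + J_series n * C x = C x * J_series n"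
      using int by (simp add: intertwines_def)
    moreover have "(mD n C x + J_series n * C x) $$ (s, j) = mD n C x $$ (s, j) + (J_series n * C x) $$ (s, j)"
      by (rule index_add_mat(1)) (use carrier_matD[OF mult_carrier_mat[OF J_series_carrier smat_carrier[OF C]]] s j in auto)
    ultimately have "mD n C x $$ (s, j) + (J_series n * C x) $$ (s, j) = (C x * J_series n) $$ (s, j)"
      by metis
    then have "hcol n (mD n C) j d x + hcol n (\<lambda>x. J_series n * C x) j d x = hcol n (\<lambda>x. C x * J_series n) j d x"
      unfolding hcol_def s_def[symmetric] by (simp only: fls_plus_nth[symmetric])
    then show ?thesis
      using j C n by (simp add: hcol_mD hcol_J_mult hcol_mult_J c_def shiftD_def)
  qed
  have pow: "c j = (shiftD ^^ j) (c 0)" if "j < n" for j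
    using that
  proof (induction j)
    case (Suc j)
    then have "c (Suc j) = shiftD (c j)"
      using step[of j] by (intro ext) auto
    then show ?case using Suc by simp
  qed simp
  \<comment> \<open>Going once through all n columns returns to column 0 with a factor
    \<open>\<mu>\<^sup>n\<close>.\<close>
  have top: "(shiftD ^^ n) (c 0) d x = c 0 (d - int n) x" for d x
  proof -
    have "(shiftD ^^ n) (c 0) = shiftD ((shiftD ^^ (n - 1)) (c 0))"
      using n by (cases n) auto
    also have "\<dots> = shiftD (c (n - 1))" using pow[of "n - 1"] n by simp
    finally show ?thesis using step[of "n - 1"] n by simp
  qed
  \<comment> \<open>The positive powers of \<lambda> are bounded uniformly in x, so the degree in
    \<mu> is bounded and the descent has a starting point.\<close>
  obtain D where D: "c 0 d = (\<lambda>x. 0)" if "d > D" for d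
  proof -
    have "\<forall>s. \<exists>N. s < n \<longrightarrow> (\<forall>x. \<forall>i<N. fls_nth (C x $$ (s, 0)) i = 0)"
      using C n by (auto simp: smat_def sfls_def)
    then obtain N where N: "\<And>s x i. s < n \<Longrightarrow> i < N s \<Longrightarrow> fls_nth (C x $$ (s, 0)) i = 0" by metis
    define M where "M = Min (N ` {..<n})"
    have M: "M \<le> N s" if "s < n" for s using that by (simp add: M_def)
    have "c 0 d = (\<lambda>x. 0)" if d: "d > int n * (1 - M)" for d
    proof -
      have s: "nat (d mod int n) < n" using n by (simp add: nat_less_iff)
      have "d div int n \<ge> 1 - M" using d n zdiv_mono1[of "int n * (1 - M)" d "int n"] by simp
      then have "- (d div int n) < N (nat (d mod int n))" using M[OF s] by simp
      then show ?thesis using N[OF s] by (simp add: c_def hcol_def fun_eq_iff)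
    qed
    then show thesis using that by blast
  qed
  have const: "\<forall>e > D - int m. deriv (c 0 e) = (\<lambda>x. 0)" for m
  proof (induction m)
    case 0
    then show ?case using D by simp
  next
    case (Suc m)
    define d where "d = D - int m"
    \<comment> \<open>All coefficients above d are constant by the induction hypothesis, so the
      remainder vanishes; the equation in degree d + n - 1 then reduces to n times the derivative of
      \<open>c 0 d\<close> being 0.\<close>
    have "shiftD_rest n (c 0) (d + int n - 1) = (\<lambda>x. 0)"
      by (rule shiftD_rest_const) (use smooth n Suc in \<open>auto simp: d_def\<close>)
    then have "(shiftD ^^ n) (c 0) (d + int n - 1) x = c 0 (d - 1) x + real n * deriv (c 0 d) x" for x
      using shiftD_rest_def[of n "c 0" "d + int n - 1" x] by (simp add: fun_eq_iff)
    then have d0: "deriv (c 0 d) = (\<lambda>x. 0)" using top[of "d + int n - 1"] n by (simp add: fun_eq_iff)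
    show ?case
    proof (intro allI impI)
      fix e assume "e > D - int (Suc m)"
      then have "e = d \<or> e > D - int m" by (auto simp: d_def)
      then show "deriv (c 0 e) = (\<lambda>x. 0)" using d0 Suc by auto
    qed
  qed
  have const: "deriv (c 0 e) = (\<lambda>x. 0)" for e
    using const[of "nat (D - e + 1)"] by auto
  have "\<forall>e. deriv (c j e) = (\<lambda>x. 0)" if "j < n" for j
    using that
  proof (induction j)
    case (Suc j)
    then have "c (Suc j) e = c j (e - 1)" for e
      using step[of j e] by (intro ext) (auto simp: shiftD_def)
    then show ?case using Suc by simp
  qed (use const in simp)
  then have hz: "hcol n (mD n C) j d x = 0" if "j < n" for j d
    using that hcol_mD[OF C n that] by (simp add: c_def)
  have "mD n C x = 0\<^sub>m n n"
  proof (intro eq_matI fls_eqI)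
    fix r j i assume "r < dim_row (0\<^sub>m n n :: real fls mat)" "j < dim_col (0\<^sub>m n n :: real fls mat)"
    then show "fls_nth (mD n C x $$ (r, j)) i = fls_nth (0\<^sub>m n n $$ (r, j)) i"
      using hcol_eq[of r n "mD n C" j i x] hz by simp
  qed (simp_all add: mD_def)
  moreover have "0\<^sub>m n n + J_series n * C x = J_series n * C x"
    by (rule left_add_zero_mat[OF mult_carrier_mat[OF J_series_carrier smat_carrier[OF C]]])
  ultimately show ?thesis using int by (metis intertwines_def)
qed

section \<open>Leading terms and n-th roots of \<lambda>\<close>

text \<open>Upper unitriangular at \<lambda> = \<infinity>. Such factors preserve the leading term
  \<open>e\<^sub>1\<^sub>n \<lambda>\<close> on either side.\<close>

definition unitri :: "nat \<Rightarrow> real fls mat \<Rightarrow> bool" where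
  "unitri n A \<longleftrightarrow> A \<in> carrier_mat n n \<and> (\<forall>r<n. \<forall>c<n. integral_fls (A $$ (r, c)) \<and>
     (r > c \<longrightarrow> fls_nth (A $$ (r, c)) 0 = 0) \<and> (r = c \<longrightarrow> fls_nth (A $$ (r, c)) 0 = 1))"

lemma integral_mat_mult:
  assumes "A \<in> carrier_mat n n" "B \<in> carrier_mat n n" "r < n" "c < n"
    "\<And>s. s < n \<Longrightarrow> integral_fls (A $$ (r, s))" "\<And>s. s < n \<Longrightarrow> integral_fls (B $$ (s, c))"
  shows "integral_fls ((A * B) $$ (r, c))"
    "fls_nth ((A * B) $$ (r, c)) 0 = (\<Sum>s<n. fls_nth (A $$ (r, s)) 0 * fls_nth (B $$ (s, c)) 0)"
  unfolding mat_mult_index[OF assms(1-4)]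
  by (auto simp: fls_nth_sum integral_fls_mult assms intro!: integral_fls_sum)

lemma unitri_mult:
  assumes "unitri n A" "unitri n B"
  shows "unitri n (A * B)"
  unfolding unitri_def
proof (intro conjI allI impI)
  note c = assms[unfolded unitri_def, THEN conjunct1]
  note A = assms(1)[unfolded unitri_def, THEN conjunct2, rule_format]
  note B = assms(2)[unfolded unitri_def, THEN conjunct2, rule_format]
  show "A * B \<in> carrier_mat n n" using c by auto
  fix r c' assume rc: "r < n" "c' < n"
  note * = integral_mat_mult[OF c rc]
  show "integral_fls ((A * B) $$ (r, c'))"
    by (rule *(1)) (use A B rc in auto)
  have nth: "fls_nth ((A * B) $$ (r, c')) 0 = (\<Sum>s<n. fls_nth (A $$ (r, s)) 0 * fls_nth (B $$ (s, c')) 0)"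
    by (rule *(2)) (use A B rc in auto)
  have z: "fls_nth (A $$ (r, s)) 0 * fls_nth (B $$ (s, c')) 0 = 0" if "s < r \<or> s > c'" "s < n" for s
    using A[of r s] B[of s c'] rc that by auto
  show "fls_nth ((A * B) $$ (r, c')) 0 = 0" if "c' < r"
    unfolding nth using that by (intro sum.neutral ballI z) auto
  show "fls_nth ((A * B) $$ (r, c')) 0 = 1" if "r = c'"
  proof -
    have "(\<Sum>s<n. fls_nth (A $$ (r, s)) 0 * fls_nth (B $$ (s, c')) 0) =
        (\<Sum>s<n. if s = r then fls_nth (A $$ (r, r)) 0 * fls_nth (B $$ (r, c')) 0 else 0)"
    proof (rule sum.cong)
      fix s assume "s \<in> {..<n}"
      then show "fls_nth (A $$ (r, s)) 0 * fls_nth (B $$ (s, c')) 0 =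
          (if s = r then fls_nth (A $$ (r, r)) 0 * fls_nth (B $$ (r, c')) 0 else 0)"
        using z[of s] that by (cases s r rule: linorder_cases) auto
    qed simp
    then show ?thesis unfolding nth using A[of r r] B[of r r] rc that by simp
  qed
qed

text \<open>The common diagonal value m is left open because it is applied both to P, with m = 1,
  and to a sum of n unitriangular matrices, with m = n.\<close>

lemma det_integral_unitri:
  assumes "A \<in> carrier_mat n n" "\<And>r c. r < n \<Longrightarrow> c < n \<Longrightarrow> integral_fls (A $$ (r, c))"
    "\<And>r c. r < n \<Longrightarrow> c < r \<Longrightarrow> fls_nth (A $$ (r, c)) 0 = 0" "\<And>r. r < n \<Longrightarrow> fls_nth (A $$ (r, r)) 0 = m"
  shows "fls_nth (det A) 0 = m ^ n"
proof -
  let ?A = "mat n n (\<lambda>(r, c). fls_nth (A $$ (r, c)) 0)"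
  have "det ?A = prod_list (diag_mat ?A)"
    by (rule det_upper_triangular[of _ n]) (auto simp: upper_triangular_def assms(3))
  also have "diag_mat ?A = replicate n m"
    by (rule nth_equalityI) (auto simp: diag_mat_def assms(4))
  finally show ?thesis by (simp only: integral_fls_det(2)[OF assms(1,2)] prod_list_replicate)
qed

text \<open>The part of \<open>Y = e\<^sub>1\<^sub>n \<lambda> + O(1)\<close> that the coefficients of positive powers of \<open>\<lambda>\<close> encode.\<close>

definition lead_J :: "nat \<Rightarrow> real fls mat \<Rightarrow> bool" where
  "lead_J n M \<longleftrightarrow> M \<in> carrier_mat n n \<and> (\<forall>r<n. \<forall>c<n. (\<forall>i < -1. fls_nth (M $$ (r, c)) i = 0) \<and>
     fls_nth (M $$ (r, c)) (-1) = (if r = 0 \<and> c = n - 1 then 1 else 0))"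

text \<open>The value of A at \<lambda> = \<infinity>, multiplied by
  \<open>e\<^sub>1\<^sub>n\<close>, has its own column 0 as last column; hence the condition on
  column 0. Multiplication from the right involves the last row instead.\<close>

lemma lead_J_mult_left:
  assumes "A \<in> carrier_mat n n" "\<And>r c. r < n \<Longrightarrow> c < n \<Longrightarrow> integral_fls (A $$ (r, c))"
    "\<And>r. r < n \<Longrightarrow> fls_nth (A $$ (r, 0)) 0 = (if r = 0 then 1 else 0)" "lead_J n M"
  shows "lead_J n (A * M)"
  unfolding lead_J_def
proof (intro conjI allI impI)
  have M: "M \<in> carrier_mat n n" using assms(4) by (simp add: lead_J_def)
  then show "A * M \<in> carrier_mat n n" using assms(1) by auto
  fix r c assume rc: "r < n" "c < n"
  have nth: "fls_nth ((A * M) $$ (r, c)) k =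
      (\<Sum>s<n. \<Sum>i = 0..k + 1. fls_nth (A $$ (r, s)) i * fls_nth (M $$ (s, c)) (k - i))" for k
    unfolding mat_mult_index[OF assms(1) M rc] fls_nth_sum
  proof (rule sum.cong)
    fix s assume "s \<in> {..<n}"
    then have s: "s < n" by simp
    show "fls_nth (A $$ (r, s) * M $$ (s, c)) k = (\<Sum>i = 0..k + 1. fls_nth (A $$ (r, s)) i * fls_nth (M $$ (s, c)) (k - i))"
      using fls_times_nth_bounds[of 0 "A $$ (r, s)" "-1" "M $$ (s, c)" k] assms(2)[OF rc(1) s] assms(4) rc s
      by (auto simp: lead_J_def integral_fls_def)
  qed simp
  show "fls_nth ((A * M) $$ (r, c)) i = 0" if "i < -1" for i using that by (simp add: nth)
  have "fls_nth ((A * M) $$ (r, c)) (-1) = (\<Sum>s<n. if s = 0 then fls_nth (A $$ (r, 0)) 0 * (if c = n - 1 then 1 else 0) else 0)"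
    unfolding nth using assms(4) rc by (intro sum.cong) (auto simp: lead_J_def)
  then show "fls_nth ((A * M) $$ (r, c)) (-1) = (if r = 0 \<and> c = n - 1 then 1 else 0)"
    using assms(3)[OF rc(1)] rc by simp
qed

lemma lead_J_mult_right:
  assumes "B \<in> carrier_mat n n" "\<And>r c. r < n \<Longrightarrow> c < n \<Longrightarrow> integral_fls (B $$ (r, c))"
    "\<And>c. c < n \<Longrightarrow> fls_nth (B $$ (n - 1, c)) 0 = (if c = n - 1 then 1 else 0)" "lead_J n M"
  shows "lead_J n (M * B)"
  unfolding lead_J_def
proof (intro conjI allI impI)
  have M: "M \<in> carrier_mat n n" using assms(4) by (simp add: lead_J_def)
  then show "M * B \<in> carrier_mat n n" using assms(1) by auto
  fix r c assume rc: "r < n" "c < n"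
  have nth: "fls_nth ((M * B) $$ (r, c)) k =
      (\<Sum>s<n. \<Sum>i = -1..k. fls_nth (M $$ (r, s)) i * fls_nth (B $$ (s, c)) (k - i))" for k
    unfolding mat_mult_index[OF M assms(1) rc] fls_nth_sum
  proof (rule sum.cong)
    fix s assume "s \<in> {..<n}"
    then have s: "s < n" by simp
    show "fls_nth (M $$ (r, s) * B $$ (s, c)) k = (\<Sum>i = -1..k. fls_nth (M $$ (r, s)) i * fls_nth (B $$ (s, c)) (k - i))"
      using fls_times_nth_bounds[of "-1" "M $$ (r, s)" 0 "B $$ (s, c)" k] assms(2)[OF s rc(2)] assms(4) rc s
      by (auto simp: lead_J_def integral_fls_def)
  qed simp
  show "fls_nth ((M * B) $$ (r, c)) i = 0" if "i < -1" for i using that by (simp add: nth)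
  have "fls_nth ((M * B) $$ (r, c)) (-1) = (\<Sum>s<n. if s = n - 1 then (if r = 0 then 1 else 0) * fls_nth (B $$ (n - 1, c)) 0 else 0)"
    unfolding nth using assms(4) rc by (intro sum.cong) (auto simp: lead_J_def)
  then show "fls_nth ((M * B) $$ (r, c)) (-1) = (if r = 0 \<and> c = n - 1 then 1 else 0)"
    using assms(3)[OF rc(2)] rc by simp
qed

lemma lead_J_J: "lead_J n (J_series n)"
  by (auto simp: lead_J_def J_series_def)

lemma J_pow_index:
  assumes n: "n \<ge> 1"
  shows "k \<le> n \<Longrightarrow> r < n \<Longrightarrow> c < n \<Longrightarrow> (J_series n ^\<^sub>m k) $$ (r, c) =
    (if r = c + k then 1 else if r + n = c + k then fls_X_inv else 0)"
proof (induction k arbitrary: c)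
  case 0
  then show ?case by (auto simp: J_series_def mat1_def)
next
  case (Suc k)
  have "J_series n ^\<^sub>m k \<in> carrier_mat n n" by (rule pow_carrier_mat) simp
  then have "(J_series n ^\<^sub>m Suc k) $$ (r, c) =
      (if c = n - 1 then fls_X_inv * (J_series n ^\<^sub>m k) $$ (r, 0) else (J_series n ^\<^sub>m k) $$ (r, c + 1))"
    using Suc.prems by (simp only: pow_mat.simps mult_J_index)
  then show ?case using Suc.prems Suc.IH[of 0] Suc.IH[of "c + 1"] n by auto
qed

lemma J_pow_n: "n \<ge> 1 \<Longrightarrow> J_series n ^\<^sub>m n = fls_X_inv \<cdot>\<^sub>m 1\<^sub>m n"
  using pow_carrier_mat[OF J_series_carrier, of n n]
    carrier_matD[OF J_series_carrier, of n]
  by (intro eq_matI) (auto simp: J_pow_index)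

lemma unitri_pow: "unitri n A \<Longrightarrow> unitri n (A ^\<^sub>m k)"
proof (induction k)
  case 0
  then have "dim_row A = n" by (auto simp: unitri_def)
  then show ?case by (auto simp: unitri_def integral_fls_def)
qed (simp add: unitri_mult)

lemma pow_mat_Suc_left: "A \<in> carrier_mat n n \<Longrightarrow> A ^\<^sub>m Suc k = A * A ^\<^sub>m k"
proof (induction k)
  case (Suc k)
  then have "A ^\<^sub>m Suc (Suc k) = A * A ^\<^sub>m k * A" by simp
  also have "\<dots> = A * (A ^\<^sub>m k * A)"
    by (rule assoc_mult_mat) (use Suc.prems pow_carrier_mat in auto)
  finally show ?case by simp
qed simp

lemma pow_mat_mult_commute:
  fixes A B :: "'a :: comm_ring_1 mat"
  assumes A: "A \<in> carrier_mat n n" and B: "B \<in> carrier_mat n n" and AB: "A * B = B * A"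
  shows "(A * B) ^\<^sub>m k = A ^\<^sub>m k * B ^\<^sub>m k"
proof -
  note p = pow_carrier_mat[OF A] pow_carrier_mat[OF B]
  have comm: "B ^\<^sub>m k * A = A * B ^\<^sub>m k" for k
  proof (induction k)
    case (Suc k)
    have "B ^\<^sub>m Suc k * A = B ^\<^sub>m k * (B * A)"
      using assoc_mult_mat[OF p(2) B A] by simp
    also have "\<dots> = B ^\<^sub>m k * A * B"
      using assoc_mult_mat[OF p(2) A B] AB by simp
    also have "\<dots> = A * B ^\<^sub>m Suc k"
      using assoc_mult_mat[OF A p(2) B] Suc by simp
    finally show ?case .
  qed (use A B in simp)
  show ?thesis
  proof (induction k)
    case (Suc k)
    have "(A * B) ^\<^sub>m Suc k = A ^\<^sub>m k * B ^\<^sub>m k * (A * B)" using Suc by simp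
    also have "\<dots> = A ^\<^sub>m k * (B ^\<^sub>m k * A * B)"
      using assoc_mult_mat[OF p(1) p(2) mult_carrier_mat[OF A B]] assoc_mult_mat[OF p(2) A B] by simp
    also have "B ^\<^sub>m k * A * B = A * (B ^\<^sub>m k * B)"
      using comm assoc_mult_mat[OF A p(2) B] by simp
    also have "A ^\<^sub>m k * (A * (B ^\<^sub>m k * B)) = A ^\<^sub>m Suc k * B ^\<^sub>m Suc k"
      using assoc_mult_mat[OF p(1) A p(2)[of "Suc k"]] by simp
    finally show ?case .
  qed (use A B in simp)
qed

text \<open>H = 1 + F + ... + F^(n-1) satisfies F H = H because F^n = 1. At \<lambda> = \<infinity>
  it is triangular with diagonal n, so its determinant is not 0 and H can be cancelled.\<close>

lemma unitri_root_of_one: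
  assumes F: "unitri n F" and n: "n \<ge> 1" and pow: "F ^\<^sub>m n = 1\<^sub>m n"
  shows "F = 1\<^sub>m n"
proof -
  have cF: "F \<in> carrier_mat n n" using F by (simp add: unitri_def)
  note p = pow_carrier_mat[OF cF]
  define H where "H = mat n n (\<lambda>(r, c). \<Sum>i<n. (F ^\<^sub>m i) $$ (r, c))"
  have cH: "H \<in> carrier_mat n n" by (simp add: H_def)
  have uF: "integral_fls ((F ^\<^sub>m i) $$ (r, c))" "r > c \<Longrightarrow> fls_nth ((F ^\<^sub>m i) $$ (r, c)) 0 = 0"
    "fls_nth ((F ^\<^sub>m i) $$ (r, r)) 0 = 1" if "r < n" "c < n" for i r c
    using unitri_pow[OF F, of i] that unfolding unitri_def by auto
  have "F * H = H"
  proof (rule eq_matI)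
    fix r c assume "r < dim_row H" "c < dim_col H"
    then have rc: "r < n" "c < n" by (auto simp: H_def)
    have "(F * H) $$ (r, c) = (\<Sum>s<n. \<Sum>i<n. F $$ (r, s) * (F ^\<^sub>m i) $$ (s, c))"
      unfolding mat_mult_index[OF cF cH rc] using rc by (simp add: H_def sum_distrib_left)
    also have "\<dots> = (\<Sum>i<n. (F * F ^\<^sub>m i) $$ (r, c))"
      by (subst sum.swap) (simp only: mat_mult_index[OF cF p rc])
    also have "\<dots> = (\<Sum>i<n. (F ^\<^sub>m Suc i) $$ (r, c))"
      by (simp only: pow_mat_Suc_left[OF cF])
    also have "\<dots> = (\<Sum>i<n. (F ^\<^sub>m i) $$ (r, c))"
    proof -
      have "F ^\<^sub>m 0 = 1\<^sub>m n" using cF by simp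
      then have "(\<Sum>i<n. (F ^\<^sub>m Suc i) $$ (r, c)) - (\<Sum>i<n. (F ^\<^sub>m i) $$ (r, c)) = 0"
        using sum_lessThan_telescope[of "\<lambda>i. (F ^\<^sub>m i) $$ (r, c)" n] pow
        by (simp only: sum_subtractf[symmetric] diff_self)
      then show ?thesis by simp
    qed
    finally show "(F * H) $$ (r, c) = H $$ (r, c)" using rc by (simp add: H_def)
  qed (use cF in \<open>auto simp: H_def\<close>)
  have "fls_nth (det H) 0 = real n ^ n"
    by (rule det_integral_unitri[OF cH]) (use uF in \<open>auto simp: H_def fls_nth_sum intro!: integral_fls_sum\<close>)
  then have det: "det H \<noteq> 0" using n by auto
  have "F * (H * adj_mat H) = H * adj_mat H"
    using \<open>F * H = H\<close> assoc_mult_mat[OF cF cH adj_mat(1)[OF cH]] by simp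
  then have *: "det H \<cdot>\<^sub>m F = det H \<cdot>\<^sub>m 1\<^sub>m n"
    unfolding adj_mat(2)[OF cH] using mult_smult_distrib[OF cF one_carrier_mat] cF by simp
  show ?thesis
  proof (rule eq_matI)
    fix r c assume "r < dim_row (1\<^sub>m n :: real fls mat)" "c < dim_col (1\<^sub>m n :: real fls mat)"
    then show "F $$ (r, c) = 1\<^sub>m n $$ (r, c)"
      using arg_cong[OF *, of "\<lambda>A. A $$ (r, c)"] cF det by (auto split: if_splits)
  qed (use cF in auto)
qed

text \<open>C and J are commuting n-th roots of \<lambda>, so \<open>C J\<^sup>-\<^sup>1\<close> is
  an n-th root of 1. The leading term of C singles out the root 1 and excludes, for instance, -J for
  even n.\<close>

lemma lead_J_root:
  assumes n: "n \<ge> 1" and lead: "lead_J n C" and comm: "J_series n * C = C * J_series n"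
    and pow: "C ^\<^sub>m n = fls_X_inv \<cdot>\<^sub>m 1\<^sub>m n"
  shows "C = J_series n"
proof -
  note cJ = J_series_carrier[of n]
  have cC: "C \<in> carrier_mat n n" using lead by (simp add: lead_J_def)
  \<comment> \<open>The inverse of J, since the n-th power of J is \<lambda>.\<close>
  define K where "K = fls_X \<cdot>\<^sub>m J_series n ^\<^sub>m (n - 1)"
  have cK: "K \<in> carrier_mat n n" using pow_carrier_mat[OF cJ] by (simp add: K_def)
  have sm: "(fls_X :: real fls) \<cdot>\<^sub>m (fls_X_inv \<cdot>\<^sub>m 1\<^sub>m n) = 1\<^sub>m n"
  proof -
    have "(fls_X :: real fls) * fls_X_inv = 1"
      by (rule fls_eqI) (simp add: fls_X_inv_times_conv_shift(2))
    then show ?thesis by (intro eq_matI) auto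
  qed
  have KJ: "K * J_series n = 1\<^sub>m n"
  proof -
    have "J_series n ^\<^sub>m (n - 1) * J_series n = J_series n ^\<^sub>m n" using n by (cases n) auto
    then show ?thesis unfolding K_def
      by (simp add: mult_smult_assoc_mat[OF pow_carrier_mat[OF cJ] cJ] J_pow_n[OF n] sm)
  qed
  define F where "F = C * K"
  have cF: "F \<in> carrier_mat n n" using cC cK by (simp add: F_def)
  have FJ: "F * J_series n = C"
    using assoc_mult_mat[OF cC cK cJ] cC by (simp add: F_def KJ)
  have FJJ: "J_series n * F = F * J_series n"
  proof -
    have "J_series n * (J_series n ^\<^sub>m (n - 1)) = J_series n ^\<^sub>m n"
      using pow_mat_Suc_left[OF cJ, of "n - 1"] n by simp
    then have JK: "J_series n * K = 1\<^sub>m n" unfolding K_def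
      by (simp add: mult_smult_distrib[OF cJ pow_carrier_mat[OF cJ]] J_pow_n[OF n] sm)
    have "J_series n * F = C * (J_series n * K)"
      using assoc_mult_mat[OF cJ cC cK] assoc_mult_mat[OF cC cJ cK] comm by (simp add: F_def)
    then show ?thesis using FJ JK cC by simp
  qed
  have powF: "F ^\<^sub>m n = 1\<^sub>m n"
  proof -
    have "F ^\<^sub>m n * (fls_X_inv \<cdot>\<^sub>m 1\<^sub>m n) = fls_X_inv \<cdot>\<^sub>m 1\<^sub>m n"
      using pow_mat_mult_commute[OF cF cJ FJJ[symmetric], of n] pow by (simp add: FJ J_pow_n[OF n])
    then have "fls_X_inv \<cdot>\<^sub>m (F ^\<^sub>m n) = fls_X_inv \<cdot>\<^sub>m 1\<^sub>m n"
      using mult_smult_distrib[OF pow_carrier_mat[OF cF] one_carrier_mat, of n] right_mult_one_mat[OF pow_carrier_mat[OF cF, of n]] by simp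
    then have "fls_X_inv * (F ^\<^sub>m n) $$ (r, c) = fls_X_inv * 1\<^sub>m n $$ (r, c)" if "r < n" "c < n" for r c
      using that pow_carrier_mat[OF cF, of n] by (metis carrier_matD index_smult_mat(1) one_carrier_mat)
    then have "(F ^\<^sub>m n) $$ (r, c) = 1\<^sub>m n $$ (r, c)" if "r < n" "c < n" for r c
      using that fls_X_inv_nonzero by (metis mult_left_cancel)
    then show ?thesis using pow_carrier_mat[OF cF, of n] by (intro eq_matI) auto
  qed
  \<comment> \<open>In terms of \<open>\<mu>\<close>, column \<open>c\<close> of \<open>F\<close> has degree \<open>c\<close> and leading coefficient 1.\<close>
  have deg: "(\<forall>r<n. \<forall>i. int r - int n * i > int c \<longrightarrow> fls_nth (F $$ (r, c)) i = 0) \<and> fls_nth (F $$ (c, c)) 0 = 1"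
    if "c < n" for c
    using that
  proof (induction c)
    case 0
    have F0: "fls_nth (F $$ (r, 0)) i = fls_nth (C $$ (r, n - 1)) (i - 1)" if r: "r < n" for r i
    proof -
      have "C $$ (r, n - 1) = fls_X_inv * F $$ (r, 0)"
        using mult_J_index[OF cF r, of "n - 1"] FJ n by simp
      then show ?thesis by (simp add: fls_X_inv_times_conv_shift)
    qed
    have *: "i < 0 \<or> i = 0 \<and> r > 0" if "int r - int n * i > int 0" "r < n" for r i
    proof (rule ccontr)
      assume "\<not> ?thesis"
      then have "i \<ge> 1" using that by (cases "i = 0") auto
      then have "int n * i \<ge> int n * 1" by (intro mult_left_mono) auto
      then show False using that by linarith
    qed
    have l: "fls_nth (C $$ (r, n - 1)) (i - 1) = 0" if "i < 0 \<or> i = 0 \<and> r > 0" "r < n" for r i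
      using lead that n unfolding lead_J_def by auto
    have "fls_nth (F $$ (0, 0)) 0 = 1"
      using F0[of 0 0] n lead unfolding lead_J_def by auto
    then show ?case using F0 * l by auto
  next
    case (Suc c)
    have step: "F $$ (r, Suc c) = (if r = 0 then fls_X_inv * F $$ (n - 1, c) else F $$ (r - 1, c))" if "r < n" for r
      using J_mult_index[OF cF that, of c] mult_J_index[OF cF that, of c] Suc.prems n unfolding FJJ by (auto split: if_splits)
    have "fls_nth (F $$ (r, Suc c)) i = 0" if r: "r < n" and i: "int r - int n * i > int (Suc c)" for r i
    proof (cases "r = 0")
      case True
      have "int (n - 1) - int n * (i + 1) > int c" using i True n by (simp add: algebra_simps of_nat_diff)
      then have "fls_nth (F $$ (n - 1, c)) (i + 1) = 0" using Suc n by auto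
      then show ?thesis using step[OF r] True by (simp add: fls_X_inv_times_conv_shift)
    next
      case False
      then have "int (r - 1) - int n * i > int c" using i by (simp add: of_nat_diff)
      then show ?thesis using step[OF r] Suc False r by auto
    qed
    then show ?case using step[OF Suc.prems] Suc by auto
  qed
  have "unitri n F"
    unfolding unitri_def
  proof (intro conjI allI impI cF)
    fix r c assume rc: "r < n" "c < n"
    have "int r - int n * i > int c" if "i < 0" for i
    proof -
      have "int n * i \<le> int n * (-1)" using that by (intro mult_left_mono) auto
      then show ?thesis using rc by simp
    qed
    then show "integral_fls (F $$ (r, c))" using deg[OF rc(2)] rc by (auto simp: integral_fls_def)
    show "fls_nth (F $$ (r, c)) 0 = 0" if "r > c"
      using deg[OF rc(2)] that rc by (metis mult_zero_right of_nat_less_iff diff_zero)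
    show "fls_nth (F $$ (r, c)) 0 = 1" if "r = c" using deg[OF rc(2)] that by simp
  qed
  then have "F = 1\<^sub>m n" using unitri_root_of_one n powF by blast
  then show ?thesis using FJ left_mult_one_mat[OF cJ] by simp
qed

section \<open>The dressing matrix\<close>

text \<open>P is the Wronskian matrix of the formal eigenfunction with the factor
  \<open>e\<^sup>\<mu>\<^sup>x\<close> removed: column c carries (\<partial> + \<mu>)^c a. Right
  multiplication by J passes from one column to the next, and the eigenvalue equation closes up the
  last column. The leading coefficient 1 of a makes P unitriangular at \<lambda> =
  \<infinity>.\<close>

lemma dressing_matrix:
  fixes u :: "nat \<Rightarrow> real \<Rightarrow> real"
  assumes n: "n \<ge> 1" and u: "\<And>i. i \<in> {1..<n} \<Longrightarrow> smooth_fun_on UNIV (u i)"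
  obtains P where "smat n P" "intertwines n (\<lambda>x. J_series n) (\<lambda>x. J_series n + u_series n u x) P" "\<And>x. unitri n (P x)"
proof -
  obtain a where a: "smooth_fam a" "\<And>d. d > 0 \<Longrightarrow> a d = (\<lambda>x. 0)" "a 0 = (\<lambda>x. 1)"
    "\<And>d x. (shiftD ^^ n) a d x = a (d - int n) x + (\<Sum>i = 1..<n. u i x * (shiftD ^^ (i - 1)) a d x)"
    using formal_eigenfunction[of n u] n u by blast
  define P where "P x = mat n n (\<lambda>(r, c). Abs_fls (\<lambda>i. (shiftD ^^ c) a (int r - int n * i) x))" for x
  have cP: "P x \<in> carrier_mat n n" for x by (simp add: P_def)
  have van: "(shiftD ^^ c) a d = (\<lambda>x. 0)" if "d > int c" for c d
    by (rule shiftD_pow_vanish[of 0]) (use that a(2) in auto)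
  have neg: "int r - int n * i > int c" if "i < 0" "r < n" "c < n" for r c i
  proof -
    have "int n * i \<le> int n * (-1)" using that by (intro mult_left_mono) auto
    then show ?thesis using that by simp
  qed
  have nth: "fls_nth (P x $$ (r, c)) i = (shiftD ^^ c) a (int r - int n * i) x" if "r < n" "c < n" for x r c i
  proof -
    have "\<forall>i<0. (shiftD ^^ c) a (int r - int n * i) x = 0"
      using van neg[OF _ that] by simp
    from nth_Abs_fls_lower_bound[OF this] show ?thesis using that by (simp add: P_def)
  qed
  have hcol: "hcol n P c d x = (shiftD ^^ c) a d x" if c: "c < n" for c d x
    by (rule hcol_ind[OF n]) (simp add: hcol_eq nth c)
  have sP: "smat n P"
    unfolding smat_def sfls_def
  proof (intro conjI allI impI cP exI[of _ 0])
    fix r c assume rc: "r < n" "c < n"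
    show "fls_nth (P x $$ (r, c)) i = 0" if "i < 0" for x i
      using van neg[OF that rc] by (simp add: nth rc)
    show "smooth_fun_on UNIV (\<lambda>x. fls_nth (P x $$ (r, c)) i)" for i
      using smooth_shiftD_pow[OF a(1)] by (simp add: nth rc)
  qed
  have uni: "unitri n (P x)" for x
    unfolding unitri_def
  proof (intro conjI allI impI cP)
    fix r c assume rc: "r < n" "c < n"
    show "integral_fls (P x $$ (r, c))"
      unfolding integral_fls_def using van neg[OF _ rc] by (simp add: nth rc)
    show "fls_nth (P x $$ (r, c)) 0 = 0" if "r > c" using van that by (simp add: nth rc)
    show "fls_nth (P x $$ (r, c)) 0 = 1" if "r = c"
      using shiftD_pow_top[of 0 a c] a(2,3) that by (simp add: nth rc)
  qed
  have "mD n P x + J_series n * P x = P x * (J_series n + u_series n u x)" for x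
  proof (intro eq_matI fls_eqI)
    let ?R = "P x * (J_series n + u_series n u x)"
    have c: "P x * J_series n \<in> carrier_mat n n" "P x * u_series n u x \<in> carrier_mat n n" "J_series n * P x \<in> carrier_mat n n"
      using cP[of x] by (auto intro: mult_carrier_mat[of _ n n _ n])
    have R: "?R = P x * J_series n + P x * u_series n u x"
      by (rule mult_add_distrib_mat[OF cP J_series_carrier u_series_carrier])
    show "dim_row (mD n P x + J_series n * P x) = dim_row ?R" "dim_col (mD n P x + J_series n * P x) = dim_col ?R"
      using carrier_matD[OF add_carrier_mat[OF c(3), of "mD n P x"]] carrier_matD[OF add_carrier_mat[OF c(2), of "P x * J_series n"]]
      unfolding R by simp_all
    fix r c' i assume "r < dim_row ?R" "c' < dim_col ?R"
    then have rc: "r < n" "c' < n"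
      using carrier_matD[OF add_carrier_mat[OF c(2), of "P x * J_series n"]] unfolding R by simp_all
    define d where "d = int r - int n * i"
    have "fls_nth ((mD n P x + J_series n * P x) $$ (r, c')) i =
        fls_nth (mD n P x $$ (r, c')) i + fls_nth ((J_series n * P x) $$ (r, c')) i"
      using rc c by (subst index_add_mat) auto
    also have "\<dots> = hcol n (mD n P) c' d x + hcol n (\<lambda>x. J_series n * P x) c' d x"
      unfolding d_def by (simp only: hcol_eq[OF rc(1)])
    also have "\<dots> = (shiftD ^^ Suc c') a d x"
      using hcol_mD[OF sP n rc(2), of d x] hcol_J_mult[of P n c' d x, OF cP rc(2)] hcol[OF rc(2)]
        ext[of "hcol n P c' d", OF hcol[OF rc(2)]]
      unfolding shiftD_pow_Suc by simp
    also have "\<dots> = fls_nth ((P x * J_series n) $$ (r, c')) i + fls_nth ((P x * u_series n u x) $$ (r, c')) i"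
    proof (cases "c' = n - 1")
      case True
      have "fls_nth ((P x * J_series n) $$ (r, c')) i = a (d - int n) x"
        using mult_J_index[OF cP rc] True n rc
        by (simp add: fls_X_inv_times_conv_shift nth d_def algebra_simps)
      moreover have "fls_nth ((P x * u_series n u x) $$ (r, c')) i = (\<Sum>i = 1..<n. u i x * (shiftD ^^ (i - 1)) a d x)"
        unfolding mult_u_index[OF cP rc] using True rc
        by (auto simp: fls_nth_sum nth d_def mult.commute intro!: sum.cong)
      ultimately show ?thesis using True n a(4)[of d x] by simp
    next
      case False
      then show ?thesis
        unfolding mult_u_index[OF cP rc] mult_J_index[OF cP rc] using rc by (simp add: nth d_def del: funpow.simps)
    qed
    also have "\<dots> = fls_nth (?R $$ (r, c')) i"
      unfolding R using rc c by (subst index_add_mat) auto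
    finally show "fls_nth ((mD n P x + J_series n * P x) $$ (r, c')) i = fls_nth (?R $$ (r, c')) i" .
  qed
  then show thesis using that sP uni by (simp add: intertwines_def)
qed

section \<open>The series \<open>Y\<close>\<close>

abbreviation L_series :: "nat \<Rightarrow> (nat \<Rightarrow> real \<Rightarrow> real) \<Rightarrow> real \<Rightarrow> real fls mat" where
  "L_series n u x \<equiv> J_series n + u_series n u x"

abbreviation smooth_u :: "nat \<Rightarrow> (nat \<Rightarrow> real \<Rightarrow> real) \<Rightarrow> bool" where
  "smooth_u n u \<equiv> \<forall>i\<in>{1..<n}. smooth_fun_on UNIV (u i)"

definition is_Y :: "nat \<Rightarrow> (nat \<Rightarrow> real \<Rightarrow> real) \<Rightarrow> (real \<Rightarrow> real fls mat) \<Rightarrow> bool" where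
  "is_Y n u Y \<longleftrightarrow>
     (\<forall>x. Y x \<in> carrier_mat n n) \<and>
     (\<forall>x. lam_coeff 1 (Y x) = mat1 n (\<lambda>i j. if i = 1 \<and> j = n then 1 else 0)) \<and>
     (\<forall>x. \<forall>i>1. lam_coeff i (Y x) = 0\<^sub>m n n) \<and>
     (\<forall>i. \<forall>r<n. \<forall>c<n. smooth_fun_on UNIV (\<lambda>x. lam_coeff i (Y x) $$ (r, c))) \<and>
     (\<forall>i x. (\<Sum>r<n. lam_coeff i (Y x) $$ (r, r)) = 0) \<and>
     (\<forall>i x. mat_deriv n (\<lambda>y. lam_coeff i (Y y)) x
        + lam_coeff i (L_series n u x * Y x - Y x * L_series n u x)
        = 0\<^sub>m n n) \<and>
     (\<forall>x. Y x ^\<^sub>m n = fls_X_inv \<cdot>\<^sub>m 1\<^sub>m n)"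

lemma Y_series_eq_The: "Y_series n u = (THE Y. is_Y n u Y)"
  unfolding Y_series_def is_Y_def ..

lemma lam_coeff_index: "A \<in> carrier_mat n m \<Longrightarrow> r < n \<Longrightarrow> c < m \<Longrightarrow> lam_coeff i A $$ (r, c) = fls_nth (A $$ (r, c)) (- i)"
  by (auto simp: lam_coeff_def)

lemma lam_coeff_carrier: "A \<in> carrier_mat n m \<Longrightarrow> lam_coeff i A \<in> carrier_mat n m"
  by (auto simp: lam_coeff_def)

lemma L_series_carrier [simp]: "L_series n u x \<in> carrier_mat n n"
  by (rule add_carrier_mat) simp

lemma lead_J_iff:
  assumes "Y \<in> carrier_mat n n"
  shows "lead_J n Y \<longleftrightarrow> lam_coeff 1 Y = mat1 n (\<lambda>i j. if i = 1 \<and> j = n then 1 else 0) \<and>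
     (\<forall>i>1. lam_coeff i Y = 0\<^sub>m n n)" (is "_ \<longleftrightarrow> ?R")
proof
  assume l: "lead_J n Y"
  have "lam_coeff 1 Y = mat1 n (\<lambda>i j. if i = 1 \<and> j = n then 1 else 0)"
  proof (rule eq_matI)
    fix r c assume "r < dim_row (mat1 n (\<lambda>i j. if i = 1 \<and> j = n then 1 else (0 :: real)))"
      "c < dim_col (mat1 n (\<lambda>i j. if i = 1 \<and> j = n then 1 else (0 :: real)))"
    then have "r < n" "c < n" by (auto simp: mat1_def)
    then show "lam_coeff 1 Y $$ (r, c) = mat1 n (\<lambda>i j. if i = 1 \<and> j = n then 1 else 0) $$ (r, c)"
      using l by (auto simp: lam_coeff_index[OF assms] lead_J_def)
  qed (use lam_coeff_carrier[OF assms] in \<open>auto simp: mat1_def\<close>)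
  moreover have "lam_coeff i Y = 0\<^sub>m n n" if "i > 1" for i
    using lam_coeff_carrier[OF assms, of i] l that
    by (intro eq_matI) (auto simp: lam_coeff_index[OF assms] lead_J_def)
  ultimately show ?R by blast
next
  assume R: ?R
  show "lead_J n Y"
    unfolding lead_J_def
  proof (intro conjI allI impI assms)
    fix r c assume rc: "r < n" "c < n"
    have "lam_coeff 1 Y $$ (r, c) = (if r = 0 \<and> c = n - 1 then 1 else 0)" using R rc by auto
    then show "fls_nth (Y $$ (r, c)) (- 1) = (if r = 0 \<and> c = n - 1 then 1 else 0)"
      using lam_coeff_index[OF assms rc] by simp
    fix i :: int assume "i < -1"
    then have "lam_coeff (- i) Y $$ (r, c) = 0" using R rc by simp
    then show "fls_nth (Y $$ (r, c)) i = 0" using lam_coeff_index[OF assms rc] by simp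
  qed
qed

lemma is_Y_smat:
  assumes "is_Y n u Y"
  shows "smat n Y" "lead_J n (Y x)"
proof -
  have c: "Y x \<in> carrier_mat n n" for x using assms by (simp add: is_Y_def)
  show l: "lead_J n (Y x)" for x using assms lead_J_iff[OF c] by (auto simp: is_Y_def)
  show "smat n Y"
    unfolding smat_def sfls_def
  proof (intro conjI allI impI c exI[of _ "-1"])
    fix r c' assume rc: "r < n" "c' < n"
    show "fls_nth (Y x $$ (r, c')) i = 0" if "i < -1" for x i
      using l[of x] rc that by (auto simp: lead_J_def)
    show "smooth_fun_on UNIV (\<lambda>x. fls_nth (Y x $$ (r, c')) i)" for i
    proof -
      have "smooth_fun_on UNIV (\<lambda>x. lam_coeff (- i) (Y x) $$ (r, c'))"
        using assms rc by (simp add: is_Y_def)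
      then show ?thesis by (simp add: lam_coeff_index[OF c rc])
    qed
  qed
qed

lemma intertwines_iff_lam_coeff:
  assumes Y: "smat n Y"
  shows "intertwines n (L_series n u) (L_series n u) Y \<longleftrightarrow>
    (\<forall>i x. mat_deriv n (\<lambda>y. lam_coeff i (Y y)) x
        + lam_coeff i (L_series n u x * Y x - Y x * L_series n u x) = 0\<^sub>m n n)"
proof -
  note c = smat_carrier[OF Y]
  have p: "L_series n u x * Y x \<in> carrier_mat n n" "Y x * L_series n u x \<in> carrier_mat n n" for x
    by (rule mult_carrier_mat[OF L_series_carrier c], rule mult_carrier_mat[OF c L_series_carrier])
  have d: "L_series n u x * Y x - Y x * L_series n u x \<in> carrier_mat n n" for x
    by (rule minus_carrier_mat[OF p(2)])
  let ?E = "\<lambda>i x r c. fls_nth (mD n Y x $$ (r, c)) (- i) + fls_nth ((L_series n u x * Y x) $$ (r, c)) (- i)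
        - fls_nth ((Y x * L_series n u x) $$ (r, c)) (- i)"
  have 1: "(mat_deriv n (\<lambda>y. lam_coeff i (Y y)) x
        + lam_coeff i (L_series n u x * Y x - Y x * L_series n u x)) $$ (r, c') = ?E i x r c'"
    if "r < n" "c' < n" for i x r c'
  proof -
    have "(\<lambda>y. lam_coeff i (Y y) $$ (r, c')) = (\<lambda>y. fls_nth (Y y $$ (r, c')) (- i))"
      using lam_coeff_index[OF c that] by auto
    moreover have "(L_series n u x * Y x - Y x * L_series n u x) $$ (r, c') =
        (L_series n u x * Y x) $$ (r, c') - (Y x * L_series n u x) $$ (r, c')"
      by (rule index_minus_mat(1)) (use p that carrier_matD[OF p(2)] in simp_all)
    moreover have "(mat_deriv n (\<lambda>y. lam_coeff i (Y y)) x + lam_coeff i (L_series n u x * Y x - Y x * L_series n u x)) $$ (r, c') =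
        mat_deriv n (\<lambda>y. lam_coeff i (Y y)) x $$ (r, c') + lam_coeff i (L_series n u x * Y x - Y x * L_series n u x) $$ (r, c')"
      by (rule index_add_mat(1)) (use carrier_matD[OF lam_coeff_carrier[OF d]] that in simp_all)
    ultimately show ?thesis
      using that Y by (simp add: mat_deriv_def lam_coeff_index[OF d] fls_nth_fD smat_def del: index_mult_mat)
  qed
  have "(\<forall>i x. mat_deriv n (\<lambda>y. lam_coeff i (Y y)) x
        + lam_coeff i (L_series n u x * Y x - Y x * L_series n u x) = 0\<^sub>m n n) \<longleftrightarrow>
      (\<forall>x. \<forall>r<n. \<forall>c<n. \<forall>i. ?E i x r c = 0)"
  proof
    assume *: "\<forall>i x. mat_deriv n (\<lambda>y. lam_coeff i (Y y)) x
        + lam_coeff i (L_series n u x * Y x - Y x * L_series n u x) = 0\<^sub>m n n"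
    show "\<forall>x. \<forall>r<n. \<forall>c<n. \<forall>i. ?E i x r c = 0"
    proof (intro allI impI)
      fix x r c' i assume rc: "r < n" "c' < n"
      show "?E i x r c' = 0" using 1[OF rc, of i x, symmetric] * rc by simp
    qed
  next
    assume *: "\<forall>x. \<forall>r<n. \<forall>c<n. \<forall>i. ?E i x r c = 0"
    show "\<forall>i x. mat_deriv n (\<lambda>y. lam_coeff i (Y y)) x
        + lam_coeff i (L_series n u x * Y x - Y x * L_series n u x) = 0\<^sub>m n n"
    proof (intro allI eq_matI)
      fix i x r c' assume "r < dim_row (0\<^sub>m n n :: real mat)" "c' < dim_col (0\<^sub>m n n :: real mat)"
      then have rc: "r < n" "c' < n" by auto
      show "(mat_deriv n (\<lambda>y. lam_coeff i (Y y)) x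
        + lam_coeff i (L_series n u x * Y x - Y x * L_series n u x)) $$ (r, c') = 0\<^sub>m n n $$ (r, c')"
        unfolding 1[OF rc] using * rc by simp
    qed (use carrier_matD[OF lam_coeff_carrier[OF d]] in simp_all)
  qed
  also have "\<dots> \<longleftrightarrow> (\<forall>x. \<forall>r<n. \<forall>c<n. mD n Y x $$ (r, c) + (L_series n u x * Y x) $$ (r, c) = (Y x * L_series n u x) $$ (r, c))"
    by (simp only: fls_eq_iff fls_plus_nth) (metis (no_types, opaque_lifting) add.inverse_inverse diff_eq_eq add_0 eq_iff_diff_eq_0)
  also have "\<dots> \<longleftrightarrow> intertwines n (L_series n u) (L_series n u) Y"
  proof -
    have e: "(mD n Y x + L_series n u x * Y x) $$ (r, c') = mD n Y x $$ (r, c') + (L_series n u x * Y x) $$ (r, c')"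
      if "r < n" "c' < n" for x r c'
      by (rule index_add_mat(1)) (use carrier_matD[OF p(1)] that in simp_all)
    show ?thesis unfolding intertwines_def
    proof (intro iffI allI impI)
      fix x assume *: "\<forall>x. \<forall>r<n. \<forall>c<n. mD n Y x $$ (r, c) + (L_series n u x * Y x) $$ (r, c) = (Y x * L_series n u x) $$ (r, c)"
      show "mD n Y x + L_series n u x * Y x = Y x * L_series n u x"
      proof (rule eq_matI)
        fix r c' assume "r < dim_row (Y x * L_series n u x)" "c' < dim_col (Y x * L_series n u x)"
        then have "r < n" "c' < n" using carrier_matD[OF p(2)] by simp_all
        then show "(mD n Y x + L_series n u x * Y x) $$ (r, c') = (Y x * L_series n u x) $$ (r, c')"
          using * e by metis
      qed (use carrier_matD[OF p(1)] carrier_matD[OF p(2)] in simp_all)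
    next
      fix x r c' assume "\<forall>x. mD n Y x + L_series n u x * Y x = Y x * L_series n u x" "r < n" "c' < n"
      then show "mD n Y x $$ (r, c') + (L_series n u x * Y x) $$ (r, c') = (Y x * L_series n u x) $$ (r, c')"
        using e by metis
    qed
  qed
  finally show ?thesis by blast
qed

lemma pow_mat_conj:
  fixes P Q M :: "'a :: comm_ring_1 mat"
  assumes P: "P \<in> carrier_mat n n" and Q: "Q \<in> carrier_mat n n" and M: "M \<in> carrier_mat n n" and PQ: "P * Q = 1\<^sub>m n" "Q * P = 1\<^sub>m n"
  shows "(Q * M * P) ^\<^sub>m k = Q * M ^\<^sub>m k * P"
proof (induction k)
  case 0
  then show ?case using assms by simp
next
  case (Suc k)
  note Mk = pow_carrier_mat[OF M, of k]
  have "(Q * M ^\<^sub>m k * P) * (Q * M * P) = (Q * M ^\<^sub>m k) * (P * (Q * M * P))"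
    using assms Mk by (intro assoc_mult_mat) auto
  also have "P * (Q * M * P) = M * P"
    using assoc_mult_mat[OF P Q mult_carrier_mat[OF M P]] assoc_mult_mat[OF Q M P] PQ M P
    by (simp add: left_mult_one_mat[OF mult_carrier_mat[OF M P]])
  also have "(Q * M ^\<^sub>m k) * (M * P) = Q * (M ^\<^sub>m k * M) * P"
    using assoc_mult_mat[OF mult_carrier_mat[OF Q Mk] M P] assoc_mult_mat[OF Q Mk M] by simp
  finally show ?case using Suc by simp
qed

lemma trace_conj:
  fixes P Q M :: "'a :: comm_ring_1 mat"
  assumes P: "P \<in> carrier_mat n n" and Q: "Q \<in> carrier_mat n n" and M: "M \<in> carrier_mat n n" and PQ: "P * Q = 1\<^sub>m n"
  shows "(\<Sum>r<n. (Q * M * P) $$ (r, r)) = (\<Sum>r<n. M $$ (r, r))"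
proof -
  have MP: "M * P \<in> carrier_mat n n" using M P by auto
  have "(\<Sum>r<n. (Q * M * P) $$ (r, r)) = (\<Sum>r<n. \<Sum>s<n. Q $$ (r, s) * (M * P) $$ (s, r))"
    by (intro sum.cong) (simp_all only: assoc_mult_mat[OF Q M P] mat_mult_index[OF Q MP] lessThan_iff)
  also have "\<dots> = (\<Sum>s<n. \<Sum>r<n. (M * P) $$ (s, r) * Q $$ (r, s))"
    by (subst sum.swap) (simp only: mult.commute)
  also have "\<dots> = (\<Sum>s<n. (M * P * Q) $$ (s, s))"
    by (intro sum.cong) (simp_all only: mat_mult_index[OF MP Q] lessThan_iff)
  also have "M * P * Q = M" using assoc_mult_mat[OF M P Q] PQ M by simp
  finally show ?thesis .
qed

text \<open>\<open>P\<close> conjugates \<open>\<partial>\<^sub>x + J + u\<close> to \<open>\<partial>\<^sub>x + J\<close>, which reduces existence and uniqueness of \<open>Y\<close> to \<open>u = 0\<close>.\<close>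

lemma Y_series_dressing:
  fixes u :: "nat \<Rightarrow> real \<Rightarrow> real"
  assumes n: "n \<ge> 2" and u: "smooth_u n u"
  obtains P Q where "smat n P" "smat n Q" "\<forall>x. P x * Q x = 1\<^sub>m n" "\<forall>x. Q x * P x = 1\<^sub>m n"
    "intertwines n (\<lambda>x. J_series n) (L_series n u) P" "intertwines n (L_series n u) (\<lambda>x. J_series n) Q"
    "Y_series n u = (\<lambda>x. Q x * J_series n * P x)" "is_Y n u (Y_series n u)"
proof -
  note cJ = J_series_carrier[of n]
  obtain P where P: "smat n P" "intertwines n (\<lambda>x. J_series n) (L_series n u) P" "\<And>x. unitri n (P x)"
    using dressing_matrix[of n u] n u by auto
  note cP = smat_carrier[OF P(1)]
  have iP: "integral_fls (P x $$ (r, c))" if "r < n" "c < n" for x r c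
    using P(3)[of x] that by (simp add: unitri_def)
  have detP: "integral_fls (det (P x))" "fls_nth (det (P x)) 0 = 1" for x
    using integral_fls_det(1)[OF cP iP] det_integral_unitri[OF cP iP, of x 1] P(3)[of x] by (auto simp: unitri_def)
  \<comment> \<open>Adjugate over determinant: the determinant has the value 1 at \<lambda> =
    \<infinity>, so dividing by it keeps the coefficients smooth and creates no positive powers of
    \<lambda>.\<close>
  define Q where "Q x = inverse (det (P x)) \<cdot>\<^sub>m adj_mat (P x)" for x
  have inv: "integral_fls (inverse (det (P x)))" "det (P x) * inverse (det (P x)) = 1" for x
    using integral_fls_inverse[OF detP] by auto
  have cQ: "Q x \<in> carrier_mat n n" for x using adj_mat(1)[OF cP] by (simp add: Q_def)
  have sQ: "smat n Q"
    using smat_adj[OF P(1)] cQ carrier_matD[OF adj_mat(1)[OF cP]]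
      sfls_inverse[OF sfls_det[OF P(1)] detP] unfolding smat_def Q_def
    by (auto intro: sfls_mult)
  have inv1: "inverse (det (P x)) \<cdot>\<^sub>m (det (P x) \<cdot>\<^sub>m 1\<^sub>m n) = 1\<^sub>m n" for x
  proof -
    have "inverse (det (P x)) * det (P x) = 1" using inv(2)[of x] by (simp only: mult.commute)
    then show ?thesis by (intro eq_matI) auto
  qed
  have PQ: "P x * Q x = 1\<^sub>m n" for x
    unfolding Q_def mult_smult_distrib[OF cP adj_mat(1)[OF cP]] adj_mat(2)[OF cP] by (rule inv1)
  have QP: "Q x * P x = 1\<^sub>m n" for x
    unfolding Q_def mult_smult_assoc_mat[OF adj_mat(1)[OF cP] cP] adj_mat(3)[OF cP] by (rule inv1)
  have iQ: "integral_fls (Q x $$ (r, c))" if rc: "r < n" "c < n" for x r c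
  proof -
    have "mat_delete (P x) c r \<in> carrier_mat (n - 1) (n - 1)"
      using cP[of x] by (auto simp: mat_delete_def)
    then have "integral_fls (det (mat_delete (P x) c r))"
      by (rule integral_fls_det(1)) (use rc cP[of x] carrier_matD[OF cP, of x] in \<open>auto simp: mat_delete_def intro!: iP\<close>)
    moreover have "integral_fls ((-1) ^ (c + r))"
      by (cases "even (c + r)") (auto simp: integral_fls_def)
    ultimately have "integral_fls (cofactor (P x) c r)"
      by (simp add: cofactor_def integral_fls_mult)
    then show ?thesis using rc carrier_matD[OF cP, of x] carrier_matD[OF adj_mat(1)[OF cP], of x] inv(1)[of x]
      by (simp add: Q_def adj_mat_def integral_fls_mult)
  qed
  \<comment> \<open>Column 0 and the last row at \<lambda> = \<infinity>, as
    \<open>lead_J_mult_left\<close> and \<open>lead_J_mult_right\<close> require them.\<close>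
  have P0: "fls_nth (P x $$ (r, 0)) 0 = (if r = 0 then 1 else 0)"
    and Pn: "fls_nth (P x $$ (n - 1, r)) 0 = (if r = n - 1 then 1 else 0)" if "r < n" for x r
    using P(3)[of x] that n by (auto simp: unitri_def)
  have Q0: "fls_nth (Q x $$ (r, 0)) 0 = (if r = 0 then 1 else 0)" if r: "r < n" for x r
  proof -
    have "fls_nth ((Q x * P x) $$ (r, 0)) 0 = (\<Sum>s<n. fls_nth (Q x $$ (r, s)) 0 * fls_nth (P x $$ (s, 0)) 0)"
      by (rule integral_mat_mult(2)[OF cQ cP r]) (use n iP iQ r in auto)
    also have "\<dots> = (\<Sum>s<n. if s = 0 then fls_nth (Q x $$ (r, 0)) 0 else 0)"
      by (intro sum.cong) (auto simp: P0)
    finally show ?thesis using n r by (auto simp: QP split: if_splits)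
  qed
  have Qn: "fls_nth (Q x $$ (n - 1, r)) 0 = (if r = n - 1 then 1 else 0)" if r: "r < n" for x r
  proof -
    have "fls_nth ((P x * Q x) $$ (n - 1, r)) 0 = (\<Sum>s<n. fls_nth (P x $$ (n - 1, s)) 0 * fls_nth (Q x $$ (s, r)) 0)"
      by (rule integral_mat_mult(2)[OF cP cQ _ r]) (use n iP iQ r in auto)
    also have "\<dots> = (\<Sum>s<n. if s = n - 1 then fls_nth (Q x $$ (n - 1, r)) 0 else 0)"
      using n Pn by (intro sum.cong refl) (auto simp del: One_nat_def)
    finally show ?thesis using n r by (auto simp: PQ split: if_splits)
  qed
  have iwQ: "intertwines n (L_series n u) (\<lambda>x. J_series n) Q"
    by (rule intertwines_inverse[OF P(1) sQ _ _ PQ QP P(2)]) auto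
  define Y where "Y x = Q x * J_series n * P x" for x
  have sQJ: "smat n (\<lambda>x. Q x * J_series n)" by (rule smat_mult[OF sQ smat_J])
  have sY: "smat n Y" unfolding Y_def by (rule smat_mult[OF sQJ P(1)])
  note cY = smat_carrier[OF sY]
  have iwY: "intertwines n (L_series n u) (L_series n u) Y"
    unfolding Y_def
    by (rule intertwines_comp[OF sQJ P(1) _ _ _ intertwines_comp[OF sQ smat_J _ _ _ iwQ intertwines_J] P(2)]) auto
  have lY: "lead_J n (Y x)" for x
    unfolding Y_def
    by (rule lead_J_mult_right[OF cP iP Pn lead_J_mult_left[OF cQ iQ Q0 lead_J_J]])
  have powY: "Y x ^\<^sub>m n = fls_X_inv \<cdot>\<^sub>m 1\<^sub>m n" for x
  proof -
    have "Y x ^\<^sub>m n = Q x * (fls_X_inv \<cdot>\<^sub>m 1\<^sub>m n) * P x"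
      unfolding Y_def using pow_mat_conj[OF cP cQ cJ PQ QP, of x n] J_pow_n[of n] n by simp
    also have "\<dots> = fls_X_inv \<cdot>\<^sub>m (Q x * P x)"
      using mult_smult_distrib[OF cQ one_carrier_mat] mult_smult_assoc_mat[OF cQ cP] right_mult_one_mat[OF cQ] by simp
    finally show ?thesis by (simp add: QP)
  qed
  have trY: "(\<Sum>r<n. lam_coeff i (Y x) $$ (r, r)) = 0" for i x
  proof -
    have "(\<Sum>r<n. Y x $$ (r, r)) = 0"
      unfolding Y_def trace_conj[OF cP cQ cJ PQ] using n by (intro sum.neutral) (auto simp: J_series_def)
    then have "(\<Sum>r<n. fls_nth (Y x $$ (r, r)) (- i)) = 0"
      by (simp only: fls_nth_sum[symmetric] fls_zero_nth)
    then show ?thesis by (simp add: lam_coeff_index[OF cY])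
  qed
  have isY: "is_Y n u Y"
    unfolding is_Y_def
    using cY trY powY lead_J_iff[OF cY] lY iwY[unfolded intertwines_iff_lam_coeff[OF sY]] sY
    by (auto simp: lam_coeff_index[OF cY] smat_def sfls_smooth)
  have unique: "Y' = Y" if Y': "is_Y n u Y'" for Y'
  proof
    fix x
    note sY' = is_Y_smat(1)[OF Y'] and lY' = is_Y_smat(2)[OF Y']
    note cY' = smat_carrier[OF sY']
    have iwY': "intertwines n (L_series n u) (L_series n u) Y'"
      unfolding intertwines_iff_lam_coeff[OF sY'] using Y' by (simp add: is_Y_def)
    \<comment> \<open>A second solution carried back by P: C intertwines \<partial> + J with itself,
      hence commutes with J, and it is an n-th root of \<lambda> with the leading term of J.\<close>
    define C where "C x = P x * Y' x * Q x" for x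
    have sPY: "smat n (\<lambda>x. P x * Y' x)" by (rule smat_mult[OF P(1) sY'])
    have sC: "smat n C" unfolding C_def by (rule smat_mult[OF sPY sQ])
    have "intertwines n (\<lambda>x. J_series n) (\<lambda>x. J_series n) C"
      unfolding C_def
      by (rule intertwines_comp[OF sPY sQ _ _ _ intertwines_comp[OF P(1) sY' _ _ _ P(2) iwY'] iwQ]) auto
    then have comm: "J_series n * C x = C x * J_series n"
      using commutes_J[of n] n sC by auto
    have "lead_J n (C x)"
      unfolding C_def
      by (rule lead_J_mult_right[OF cQ iQ Qn lead_J_mult_left[OF cP iP P0 lY']])
    moreover have "C x ^\<^sub>m n = fls_X_inv \<cdot>\<^sub>m 1\<^sub>m n"
    proof -
      have "C x ^\<^sub>m n = P x * (fls_X_inv \<cdot>\<^sub>m 1\<^sub>m n) * Q x"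
        unfolding C_def using pow_mat_conj[OF cQ cP cY' QP PQ, of x x n] Y' by (simp add: is_Y_def)
      also have "\<dots> = fls_X_inv \<cdot>\<^sub>m (P x * Q x)"
        using mult_smult_distrib[OF cP one_carrier_mat] mult_smult_assoc_mat[OF cP cQ] right_mult_one_mat[OF cP] by simp
      finally show ?thesis by (simp add: PQ)
    qed
    ultimately have CJ: "C x = J_series n"
      using lead_J_root[OF _ _ comm] n by auto
    have "Y x = Q x * (P x * Y' x * Q x) * P x" unfolding Y_def CJ[symmetric] C_def ..
    also have "\<dots> = (Q x * P x) * Y' x * (Q x * P x)"
      using cP[of x] cQ[of x] cY'[of x] by (simp add: assoc_mult_mat[of _ n n _ n _ n] mult_carrier_mat[of _ n n _ n])
    also have "\<dots> = Y' x" using cY'[of x] by (simp add: QP)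
    finally show "Y' x = Y x" ..
  qed
  have "Y_series n u = Y"
    unfolding Y_series_eq_The using isY unique by (rule the_equality)
  then show thesis
    using that[OF P(1) sQ _ _ P(2) iwQ] PQ QP isY by (auto simp: Y_def[abs_def])
qed

text \<open>Both sides of the identity become multiplication by the same matrix commuting with \<open>J\<close> after dressing.\<close>

lemma Y_series_intertwine:
  fixes u ut :: "nat \<Rightarrow> real \<Rightarrow> real"
  assumes n: "n \<ge> 2" and u: "smooth_u n u"
    and ut: "smooth_u n ut"
    and F: "smat n F" "intertwines n (L_series n ut) (L_series n u) F"
  shows "Y_series n ut x * F x = F x * Y_series n u x"
proof -
  note cJ = J_series_carrier[of n] and cF = smat_carrier[OF F(1), of x]
  obtain P Q where P: "smat n P" "smat n Q" "\<forall>x. P x * Q x = 1\<^sub>m n" "\<forall>x. Q x * P x = 1\<^sub>m n"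
    "intertwines n (\<lambda>x. J_series n) (L_series n u) P" "intertwines n (L_series n u) (\<lambda>x. J_series n) Q"
    "Y_series n u = (\<lambda>x. Q x * J_series n * P x)" "is_Y n u (Y_series n u)"
    by (rule Y_series_dressing[of n u, OF n u]) (rule that)
  obtain P' Q' where P': "smat n P'" "smat n Q'" "\<forall>x. P' x * Q' x = 1\<^sub>m n" "\<forall>x. Q' x * P' x = 1\<^sub>m n"
    "intertwines n (\<lambda>x. J_series n) (L_series n ut) P'" "intertwines n (L_series n ut) (\<lambda>x. J_series n) Q'"
    "Y_series n ut = (\<lambda>x. Q' x * J_series n * P' x)" "is_Y n ut (Y_series n ut)"
    by (rule Y_series_dressing[of n ut, OF n ut]) (rule that)
  note c = smat_carrier[OF P(1), of x] smat_carrier[OF P(2), of x] smat_carrier[OF P'(1), of x] smat_carrier[OF P'(2), of x]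
  define C where "C x = P' x * F x * Q x" for x
  have sPF: "smat n (\<lambda>x. P' x * F x)" by (rule smat_mult[OF P'(1) F(1)])
  have sC: "smat n C" unfolding C_def by (rule smat_mult[OF sPF P(2)])
  note cC = smat_carrier[OF sC, of x]
  have "intertwines n (\<lambda>x. J_series n) (\<lambda>x. J_series n) C"
    unfolding C_def
    by (rule intertwines_comp[OF sPF P(2) _ _ _ intertwines_comp[OF P'(1) F(1) _ _ _ P'(5) F(2)] P(6)]) auto
  then have comm: "J_series n * C x = C x * J_series n"
    using commutes_J[of n] n sC by auto
  have FC: "F x = Q' x * C x * P x"
  proof -
    have "Q' x * C x * P x = (Q' x * P' x) * F x * (Q x * P x)"
      unfolding C_def using c cF by (simp add: assoc_mult_mat[of _ n n _ n _ n] mult_carrier_mat[of _ n n _ n])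
    then show ?thesis using cF by (simp add: P(4) P'(4))
  qed
  have "Y_series n ut x * F x = Q' x * J_series n * (P' x * Q' x) * C x * P x"
    unfolding P'(7) FC using c cC cJ by (simp add: assoc_mult_mat[of _ n n _ n _ n] mult_carrier_mat[of _ n n _ n])
  also have "\<dots> = Q' x * (J_series n * C x) * P x"
    using c cC cJ by (simp add: P'(3) right_mult_one_mat[of _ n n] assoc_mult_mat[of _ n n _ n _ n] mult_carrier_mat[of _ n n _ n])
  also have "\<dots> = Q' x * C x * (P x * Q x) * J_series n * P x"
    unfolding comm using c cC cJ by (simp add: P(3) right_mult_one_mat[of _ n n] assoc_mult_mat[of _ n n _ n _ n] mult_carrier_mat[of _ n n _ n])
  also have "\<dots> = F x * Y_series n u x"
    unfolding P(7) FC using c cC cJ by (simp add: assoc_mult_mat[of _ n n _ n _ n] mult_carrier_mat[of _ n n _ n])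
  finally show ?thesis .
qed

section \<open>The matrices \<open>Z\<close>\<close>

text \<open>
  Real matrices and vectors are also used as functions of the (zero-based) indices that vanish
  outside the range; then products and sums satisfy the ring laws without side conditions.
\<close>

definition fm :: "nat \<Rightarrow> 'a mat \<Rightarrow> nat \<Rightarrow> nat \<Rightarrow> 'a :: zero" where
  "fm n A r c = (if r < n \<and> c < n then A $$ (r, c) else 0)"

definition mm :: "nat \<Rightarrow> (nat \<Rightarrow> nat \<Rightarrow> real) \<Rightarrow> (nat \<Rightarrow> 'a \<Rightarrow> real) \<Rightarrow> nat \<Rightarrow> 'a \<Rightarrow> real" where
  "mm n A B r c = (\<Sum>s<n. A r s * B s c)"

definition mv :: "nat \<Rightarrow> (nat \<Rightarrow> nat \<Rightarrow> real) \<Rightarrow> (nat \<Rightarrow> real) \<Rightarrow> nat \<Rightarrow> real" where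
  "mv n A v r = (\<Sum>s<n. A r s * v s)"

lemma mm_assoc: "mm n (mm n A B) C = mm n A (mm n B C)"
proof (intro ext)
  fix r c
  have "mm n (mm n A B) C r c = (\<Sum>s<n. \<Sum>p<n. A r p * (B p s * C s c))"
    by (simp add: mm_def sum_distrib_right mult.assoc)
  also have "\<dots> = mm n A (mm n B C) r c"
    by (subst sum.swap) (simp add: mm_def sum_distrib_left)
  finally show "mm n (mm n A B) C r c = mm n A (mm n B C) r c" .
qed

lemma mv_mm: "mv n (mm n A B) v = mv n A (mv n B v)"
proof (intro ext)
  fix r
  have "mv n (mm n A B) v r = (\<Sum>s<n. \<Sum>p<n. A r p * (B p s * v s))"
    by (simp add: mm_def mv_def sum_distrib_right mult.assoc)
  also have "\<dots> = mv n A (mv n B v) r"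
    by (subst sum.swap) (simp add: mv_def sum_distrib_left)
  finally show "mv n (mm n A B) v r = mv n A (mv n B v) r" .
qed

lemma mm_add_left: "mm n (A + A') B = mm n A B + mm n A' B"
  and mm_add_right: "mm n A (B + B') = mm n A B + mm n A B'"
  and mm_diff_left: "mm n (A - A') B = mm n A B - mm n A' B"
  and mm_diff_right: "mm n A (B - B') = mm n A B - mm n A B'"
  by (intro ext; simp add: mm_def algebra_simps sum.distrib sum_subtractf)+

lemma mv_add_left: "mv n (A + A') v = mv n A v + mv n A' v"
  and mv_add_right: "mv n A (v + v') = mv n A v + mv n A v'"
  and mv_diff_left: "mv n (A - A') v = mv n A v - mv n A' v"
  and mv_diff_right: "mv n A (v - v') = mv n A v - mv n A v'"
  by (intro ext; simp add: mv_def algebra_simps sum.distrib sum_subtractf)+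

lemma mv_scale: "mv n A (\<lambda>s. a * v s) = (\<lambda>r. a * mv n A v r)"
  by (intro ext) (simp add: mv_def sum_distrib_left algebra_simps)

lemma fm_mult: "A \<in> carrier_mat n n \<Longrightarrow> B \<in> carrier_mat n n \<Longrightarrow> fm n (A * B) = mm n (fm n A) (fm n B)"
  by (intro ext) (auto simp: fm_def mm_def mat_mult_index simp del: index_mult_mat)

text \<open>\<open>B_mat n u l\<close> is \<open>J + u\<close> at \<open>\<lambda> = l\<close>, and \<open>E_mat n\<close> is the coefficient \<open>e\<^sub>1\<^sub>n\<close> of \<open>\<lambda>\<close>.\<close>

definition E_mat :: "nat \<Rightarrow> nat \<Rightarrow> nat \<Rightarrow> real" where
  "E_mat n r c = (if r = 0 \<and> c = n - 1 then 1 else 0)"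

definition B_mat :: "nat \<Rightarrow> (nat \<Rightarrow> real) \<Rightarrow> real \<Rightarrow> nat \<Rightarrow> nat \<Rightarrow> real" where
  "B_mat n u l r c = (if r < n \<and> c < n then (if r = 0 \<and> c = n - 1 then l else 0)
     + (if r = Suc c then 1 else 0) + (if c = n - 1 \<and> r < n - 1 then u (Suc r) else 0) else 0)"

lemma B_mat_lam: "n \<ge> 1 \<Longrightarrow> B_mat n u l = B_mat n u 0 + (\<lambda>r c. l * E_mat n r c)"
  by (intro ext) (auto simp: B_mat_def E_mat_def)

lemma mm_E: "n \<ge> 1 \<Longrightarrow> mm n (E_mat n) A r c = (if r = 0 then A (n - 1) c else 0)"
proof -
  assume "n \<ge> 1"
  have "mm n (E_mat n) A r c = (\<Sum>s<n. if s = n - 1 then (if r = 0 then A (n - 1) c else 0) else 0)"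
    unfolding mm_def by (intro sum.cong) (auto simp: E_mat_def)
  then show ?thesis using \<open>n \<ge> 1\<close> by simp
qed

lemma mm_E_right: "n \<ge> 1 \<Longrightarrow> mm n A (E_mat n) r c = (if c = n - 1 then A r 0 else 0)"
proof -
  assume "n \<ge> 1"
  have "mm n A (E_mat n) r c = (\<Sum>s<n. if s = 0 then (if c = n - 1 then A r 0 else 0) else 0)"
    unfolding mm_def by (intro sum.cong) (auto simp: E_mat_def)
  then show ?thesis using \<open>n \<ge> 1\<close> by simp
qed

lemma mm_B_right: "Suc c < n \<Longrightarrow> r < n \<Longrightarrow> mm n A (B_mat n u l) r c = A r (Suc c)"
proof -
  assume c: "Suc c < n" "r < n"
  have "mm n A (B_mat n u l) r c = (\<Sum>s<n. if s = Suc c then A r (Suc c) else 0)"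
    unfolding mm_def using c by (intro sum.cong) (auto simp: B_mat_def)
  then show ?thesis using c by simp
qed

lemma mm_B_left:
  "r < n \<Longrightarrow> mm n (B_mat n u l) A r c =
    (if r = 0 then l * A (n - 1) c else A (r - 1) c) + (if r < n - 1 then u (Suc r) * A (n - 1) c else 0)"
proof -
  assume r: "r < n"
  have "mm n (B_mat n u l) A r c = (\<Sum>s<n. (if s = (if r = 0 then n - 1 else r - 1) then (if r = 0 then l * A (n - 1) c else A (r - 1) c) else 0)
     + (if s = n - 1 then (if r < n - 1 then u (Suc r) * A (n - 1) c else 0) else 0))"
    unfolding mm_def using r by (intro sum.cong) (auto simp: B_mat_def algebra_simps)
  then show ?thesis using r by (simp add: sum.distrib)
qed

lemma mv_B:
  "r < n \<Longrightarrow> mv n (B_mat n u l) v r =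
    (if r = 0 then l * v (n - 1) else v (r - 1)) + (if r < n - 1 then u (Suc r) * v (n - 1) else 0)"
  using mm_B_left[of r n u l "\<lambda>s _. v s"] by (simp add: mm_def mv_def)

lemma mv_first: "n \<ge> 1 \<Longrightarrow> mv n A (\<lambda>r. if r = 0 then a else 0) r = a * A r 0"
proof -
  assume n: "n \<ge> 1"
  have "mv n A (\<lambda>r. if r = 0 then a else 0) r = (\<Sum>s<n. if s = 0 then a * A r 0 else 0)"
    unfolding mv_def by (intro sum.cong) auto
  then show ?thesis using n by simp
qed

lemma mv_E_l:
  assumes n: "n \<ge> 1"
  shows "mv n (\<lambda>r c. l * E_mat n r c) v = (\<lambda>r. if r = 0 then l * v (n - 1) else 0)"
proof
  fix r
  have "mv n (\<lambda>r c. l * E_mat n r c) v r = (\<Sum>s<n. if s = n - 1 then (if r = 0 then l * v (n - 1) else 0) else 0)"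
    unfolding mv_def by (intro sum.cong) (auto simp: E_mat_def)
  then show "mv n (\<lambda>r c. l * E_mat n r c) v r = (if r = 0 then l * v (n - 1) else 0)" using n by simp
qed

lemma mm_outside: "(\<And>r c. \<not> (r < n \<and> c < n) \<Longrightarrow> A r c = 0) \<Longrightarrow> (\<And>r c. \<not> (r < n \<and> c < n) \<Longrightarrow> B r c = 0) \<Longrightarrow>
  \<not> (r < n \<and> c < n) \<Longrightarrow> mm n A B r c = 0"
  by (auto simp: mm_def intro!: sum.neutral)

section \<open>Coefficients of powers of \<lambda>; matrices linear in \<lambda>\<close>

definition coef :: "nat \<Rightarrow> real fls mat \<Rightarrow> int \<Rightarrow> nat \<Rightarrow> nat \<Rightarrow> real" where
  "coef n W m = fm n (lam_coeff m W)"

lemma coef_eq: "W \<in> carrier_mat n n \<Longrightarrow> r < n \<Longrightarrow> c < n \<Longrightarrow> coef n W m r c = fls_nth (W $$ (r, c)) (- m)"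
  by (simp add: coef_def fm_def lam_coeff_index)

lemma coef_outside: "\<not> (r < n \<and> c < n) \<Longrightarrow> coef n W m r c = 0"
  by (auto simp: coef_def fm_def)

text \<open>The common shape of J + u and of f, both of which depend on \<lambda> only through
  \<open>e\<^sub>1\<^sub>n \<lambda>\<close>.\<close>

definition lin :: "nat \<Rightarrow> (nat \<Rightarrow> nat \<Rightarrow> real) \<Rightarrow> real fls mat" where
  "lin n A = mat n n (\<lambda>(r, c). fls_X_inv * fls_const (E_mat n r c) + fls_const (A r c))"

lemma lin_carrier [simp]: "lin n A \<in> carrier_mat n n"
  by (simp add: lin_def)

lemma coef_lin:
  assumes "\<And>r c. \<not> (r < n \<and> c < n) \<Longrightarrow> A r c = 0" "n \<ge> 1"
  shows "coef n (lin n A) m = (if m = 1 then E_mat n else if m = 0 then A else 0)"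
proof (intro ext)
  fix r c
  show "coef n (lin n A) m r c = (if m = 1 then E_mat n else if m = 0 then A else 0) r c"
  proof (cases "r < n \<and> c < n")
    case True
    then show ?thesis
      by (simp add: coef_eq) (simp add: lin_def fls_X_inv_times_conv_shift)
  next
    case False
    then show ?thesis using assms by (auto simp: coef_outside E_mat_def)
  qed
qed

lemma lin_entry_nth:
  fixes w :: "real fls"
  shows "fls_nth ((fls_X_inv * fls_const e + fls_const a) * w) k = e * fls_nth w (k + 1) + a * fls_nth w k"
    and "fls_nth (w * (fls_X_inv * fls_const e + fls_const a)) k = fls_nth w (k + 1) * e + fls_nth w k * a"
proof -
  show *: "fls_nth ((fls_X_inv * fls_const e + fls_const a) * w) k = e * fls_nth w (k + 1) + a * fls_nth w k"
  proof -
    have "fls_nth (fls_X_inv * (fls_const e * w)) k = e * fls_nth w (k + 1)"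
      by (simp only: fls_X_inv_times_conv_shift(1) fls_shift_nth fls_mult_const_nth)
    then show ?thesis by (simp only: distrib_right mult.assoc fls_plus_nth fls_mult_const_nth)
  qed
  show "fls_nth (w * (fls_X_inv * fls_const e + fls_const a)) k = fls_nth w (k + 1) * e + fls_nth w k * a"
    using * by (simp only: mult.commute)
qed

lemma coef_lin_mult:
  assumes W: "W \<in> carrier_mat n n" and A: "\<And>r c. \<not> (r < n \<and> c < n) \<Longrightarrow> A r c = 0" and n: "n \<ge> 1"
  shows "coef n (lin n A * W) m = mm n (E_mat n) (coef n W (m - 1)) + mm n A (coef n W m)"
    and "coef n (W * lin n A) m = mm n (coef n W (m - 1)) (E_mat n) + mm n (coef n W m) A"
proof -
  have cW: "lin n A * W \<in> carrier_mat n n" "W * lin n A \<in> carrier_mat n n"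
    using W by (auto intro: mult_carrier_mat[of _ n n _ n])
  show "coef n (lin n A * W) m = mm n (E_mat n) (coef n W (m - 1)) + mm n A (coef n W m)"
  proof (intro ext)
    fix r c
    show "coef n (lin n A * W) m r c = (mm n (E_mat n) (coef n W (m - 1)) + mm n A (coef n W m)) r c"
    proof (cases "r < n \<and> c < n")
      case True
      then show ?thesis
        unfolding coef_eq[OF cW(1) conjunct1[OF True] conjunct2[OF True]]
          mat_mult_index[OF lin_carrier W conjunct1[OF True] conjunct2[OF True]]
        by (simp add: mm_def coef_eq[OF W] fls_nth_sum lin_def lin_entry_nth sum.distrib)
    next
      case False
      then show ?thesis using A n by (auto simp: coef_outside mm_def E_mat_def intro!: sum.neutral)
    qed
  qed
  show "coef n (W * lin n A) m = mm n (coef n W (m - 1)) (E_mat n) + mm n (coef n W m) A"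
  proof (intro ext)
    fix r c
    show "coef n (W * lin n A) m r c = (mm n (coef n W (m - 1)) (E_mat n) + mm n (coef n W m) A) r c"
    proof (cases "r < n \<and> c < n")
      case True
      then show ?thesis
        unfolding coef_eq[OF cW(2) conjunct1[OF True] conjunct2[OF True]]
          mat_mult_index[OF W lin_carrier conjunct1[OF True] conjunct2[OF True]]
        by (simp add: mm_def coef_eq[OF W] fls_nth_sum lin_def lin_entry_nth sum.distrib)
    next
      case False
      then show ?thesis using A n by (auto simp: coef_outside mm_def E_mat_def intro!: sum.neutral)
    qed
  qed
qed

lemma L_series_lin: "L_series n u x = lin n (B_mat n (\<lambda>i. u i x) 0)"
proof (rule eq_matI)
  fix r c assume "r < dim_row (lin n (B_mat n (\<lambda>i. u i x) 0))" "c < dim_col (lin n (B_mat n (\<lambda>i. u i x) 0))"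
  then have rc: "r < n" "c < n" by (auto simp: lin_def)
  have "L_series n u x $$ (r, c) = J_series n $$ (r, c) + u_series n u x $$ (r, c)"
    by (rule index_add_mat(1)) (use rc carrier_matD[OF u_series_carrier] in auto)
  also have "\<dots> = lin n (B_mat n (\<lambda>i. u i x) 0) $$ (r, c)"
    using rc by (auto simp: lin_def J_series_def u_series_def B_mat_def E_mat_def)
  finally show "L_series n u x $$ (r, c) = lin n (B_mat n (\<lambda>i. u i x) 0) $$ (r, c)" .
qed (use carrier_matD[OF L_series_carrier[of n u x]] carrier_matD[OF lin_carrier] in simp_all)

definition dmat :: "(real \<Rightarrow> nat \<Rightarrow> nat \<Rightarrow> real) \<Rightarrow> real \<Rightarrow> nat \<Rightarrow> nat \<Rightarrow> real" where
  "dmat A x r c = deriv (\<lambda>y. A y r c) x"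

abbreviation smooth_mat :: "(real \<Rightarrow> nat \<Rightarrow> nat \<Rightarrow> real) \<Rightarrow> bool" where
  "smooth_mat A \<equiv> \<forall>r c. smooth_fun_on UNIV (\<lambda>x. A x r c)"

lemma coef_mD:
  assumes "smat n W"
  shows "coef n (mD n W x) m = dmat (\<lambda>y. coef n (W y) m) x"
proof (intro ext)
  fix r c
  show "coef n (mD n W x) m r c = dmat (\<lambda>y. coef n (W y) m) x r c"
  proof (cases "r < n \<and> c < n")
    case True
    have "coef n (mD n W x) m r c = fls_nth (mD n W x $$ (r, c)) (- m)"
      using True by (simp add: coef_eq)
    also have "\<dots> = deriv (\<lambda>y. fls_nth (W y $$ (r, c)) (- m)) x"
      using True assms by (simp add: fls_nth_fD smat_def)
    also have "(\<lambda>y. fls_nth (W y $$ (r, c)) (- m)) = (\<lambda>y. coef n (W y) m r c)"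
      using True assms by (simp add: coef_eq)
    finally show ?thesis by (simp add: dmat_def)
  next
    case False
    then show ?thesis by (simp add: dmat_def coef_outside)
  qed
qed

lemma coef_smooth:
  assumes "smat n W"
  shows "smooth_mat (\<lambda>x. coef n (W x) m)"
proof (intro allI)
  fix r c
  show "smooth_fun_on UNIV (\<lambda>x. coef n (W x) m r c)"
  proof (cases "r < n \<and> c < n")
    case True
    then have "(\<lambda>y. coef n (W y) m r c) = (\<lambda>y. fls_nth (W y $$ (r, c)) (- m))"
      using assms by (simp add: coef_eq)
    then show ?thesis using True assms by (simp add: smat_def sfls_smooth)
  qed (simp add: coef_outside)
qed

lemma coef_add:
  assumes "A \<in> carrier_mat n n" "B \<in> carrier_mat n n"
  shows "coef n (A + B) m = coef n A m + coef n B m"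
proof (intro ext)
  fix r c
  show "coef n (A + B) m r c = (coef n A m + coef n B m) r c"
    using assms by (cases "r < n \<and> c < n") (simp_all add: coef_eq coef_outside)
qed

lemma mat_eq_coefI:
  assumes "A \<in> carrier_mat n n" "B \<in> carrier_mat n n" "\<And>m. coef n A m = coef n B m"
  shows "A = B"
proof (intro eq_matI fls_eqI)
  fix r c i assume "r < dim_row B" "c < dim_col B"
  then have "r < n" "c < n" using assms by auto
  then show "fls_nth (A $$ (r, c)) i = fls_nth (B $$ (r, c)) i"
    using assms(3)[of "- i"] coef_eq[OF assms(1), of r c "- i"] coef_eq[OF assms(2), of r c "- i"] by simp
qed (use assms in auto)

lemma B_mat_outside: "\<not> (r < n \<and> c < n) \<Longrightarrow> B_mat n u l r c = 0"
  by (auto simp: B_mat_def)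

text \<open>Cutting off negative powers and multiplying by \<lambda> commute only up to boundary
  terms of degree -1 and j. This is the source of the coefficients of degree -1 in the identities
  for polynomial parts.\<close>

lemma telescope_powers:
  fixes Q :: "int \<Rightarrow> real"
  shows "(\<Sum>m\<le>j. Q (int m - 1) * l ^ m) - l * (\<Sum>m\<le>j. Q (int m) * l ^ m) = Q (- 1) - Q (int j) * l ^ Suc j"
  by (induction j) (simp_all add: algebra_simps)

lemma mm_sum_right: "mm n A (\<lambda>s c. \<Sum>m\<in>I. X m s c * w m) r c = (\<Sum>m\<in>I. mm n A (X m) r c * w m)"
proof -
  have "mm n A (\<lambda>s c. \<Sum>m\<in>I. X m s c * w m) r c = (\<Sum>s<n. \<Sum>m\<in>I. A r s * X m s c * w m)"
    by (simp add: mm_def sum_distrib_left mult.assoc)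
  then show ?thesis by (subst (asm) sum.swap) (simp add: mm_def sum_distrib_right)
qed

lemma mm_sum_left: "mm n (\<lambda>s c. \<Sum>m\<in>I. X m s c * w m) A r c = (\<Sum>m\<in>I. mm n (X m) A r c * w m)"
proof -
  have "mm n (\<lambda>s c. \<Sum>m\<in>I. X m s c * w m) A r c = (\<Sum>s<n. \<Sum>m\<in>I. X m r s * A s c * w m)"
    by (simp add: mm_def sum_distrib_left sum_distrib_right mult_ac)
  then show ?thesis by (subst (asm) sum.swap) (simp add: mm_def sum_distrib_right)
qed

lemma mm_scale_left: "mm n (\<lambda>r c. a * A r c) B r c = a * mm n A B r c"
  and mm_scale_right: "mm n A (\<lambda>r c. a * B r c) r c = a * mm n A B r c"
  by (simp_all add: mm_def sum_distrib_left algebra_simps)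

text \<open>The polynomial part of a relation between Laurent series, one of whose factors is linear in \<open>\<lambda>\<close>.\<close>

lemma polynomial_part:
  fixes A A' R :: "int \<Rightarrow> nat \<Rightarrow> nat \<Rightarrow> real" and l :: real
  assumes rec: "\<And>m. R m + (mm n E (A (m - 1)) + mm n G (A m)) = mm n (A' (m - 1)) E + mm n (A' m) H"
    and top: "A (int j + 1) = 0" "A' (int j + 1) = 0" "R (int j + 1) = 0"
  defines "S \<equiv> \<lambda>r c. \<Sum>m\<le>j. A (int m) r c * l ^ m" and "S' \<equiv> \<lambda>r c. \<Sum>m\<le>j. A' (int m) r c * l ^ m"
  shows "(\<lambda>r c. \<Sum>m\<le>j. R (int m) r c * l ^ m) + mm n (G + (\<lambda>r c. l * E r c)) S - mm n S' (H + (\<lambda>r c. l * E r c)) =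
    mm n (A' (-1)) E - mm n E (A (-1))"
proof (intro ext)
  fix r c
  define Q where "Q m = mm n (A' m) E r c - mm n E (A m) r c" for m
  \<comment> \<open>The relation one degree above the top, where only the terms with E
    survive.\<close>
  have "Q (int j) = 0"
    using fun_cong[OF fun_cong[OF rec[of "int j + 1"], of r], of c] by (simp add: Q_def top mm_def)
  have X: "R m r c + mm n G (A m) r c - mm n (A' m) H r c = Q (m - 1)" for m
    using fun_cong[OF fun_cong[OF rec[of m], of r], of c] by (simp add: Q_def)
  have "((\<lambda>r c. \<Sum>m\<le>j. R (int m) r c * l ^ m) + mm n (G + (\<lambda>r c. l * E r c)) S - mm n S' (H + (\<lambda>r c. l * E r c))) r c =
     (\<Sum>m\<le>j. R (int m) r c * l ^ m)
      + ((\<Sum>m\<le>j. mm n G (A (int m)) r c * l ^ m) + l * (\<Sum>m\<le>j. mm n E (A (int m)) r c * l ^ m))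
      - ((\<Sum>m\<le>j. mm n (A' (int m)) H r c * l ^ m) + l * (\<Sum>m\<le>j. mm n (A' (int m)) E r c * l ^ m))"
    unfolding S_def S'_def
    by (simp add: mm_add_left mm_add_right mm_scale_left mm_scale_right mm_sum_left mm_sum_right)
  also have "\<dots> = (\<Sum>m\<le>j. (R (int m) r c + mm n G (A (int m)) r c - mm n (A' (int m)) H r c) * l ^ m)
      - l * (\<Sum>m\<le>j. Q (int m) * l ^ m)"
    by (simp add: Q_def algebra_simps sum.distrib sum_subtractf sum_distrib_left)
  also have "\<dots> = Q (-1)"
    unfolding X telescope_powers using \<open>Q (int j) = 0\<close> by simp
  finally show "((\<lambda>r c. \<Sum>m\<le>j. R (int m) r c * l ^ m) + mm n (G + (\<lambda>r c. l * E r c)) S - mm n S' (H + (\<lambda>r c. l * E r c))) r c =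
      (mm n (A' (-1)) E - mm n E (A (-1))) r c" by (simp add: Q_def)
qed

text \<open>
  A matrix whose commutator with \<open>\<partial>\<^sub>x + b + u\<close> lies in \<open>V\<^sub>n\<close> is determined by its first column: each
  further column is the image of the previous one under \<open>\<partial>\<^sub>x + b + u\<close>.
\<close>

primrec zcol :: "nat \<Rightarrow> (real \<Rightarrow> nat \<Rightarrow> nat \<Rightarrow> real) \<Rightarrow> (real \<Rightarrow> nat \<Rightarrow> real) \<Rightarrow> nat \<Rightarrow> real \<Rightarrow> nat \<Rightarrow> real" where
  "zcol n B a 0 = a"
| "zcol n B a (Suc c) = (\<lambda>x r. deriv (\<lambda>y. zcol n B a c y r) x + mv n (B x) (zcol n B a c x) r)"

lemma smooth_mv:
  "smooth_mat A \<Longrightarrow> (\<And>s. smooth_fun_on UNIV (\<lambda>x. v x s)) \<Longrightarrow> smooth_fun_on UNIV (\<lambda>x. mv n (A x) (v x) r)"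
  unfolding mv_def by (intro smooth_fun_on_sum smooth_fun_on_mult) auto

lemma smooth_zcol:
  assumes "smooth_mat B" "\<And>r. smooth_fun_on UNIV (\<lambda>x. a x r)"
  shows "smooth_fun_on UNIV (\<lambda>x. zcol n B a c x r)"
proof (induction c arbitrary: r)
  case (Suc c)
  then show ?case using assms by (auto intro!: smooth_fun_on_add smooth_deriv smooth_mv)
qed (use assms in simp)

lemma b_plus_u_carrier [simp]: "b_plus_u n u x \<in> carrier_mat n n"
  by (simp add: b_plus_u_def)

lemma fm_b_plus_u: "fm n (b_plus_u n u x) = B_mat n (\<lambda>i. u i x) 0"
  by (intro ext) (auto simp: fm_def b_plus_u_def B_mat_def)

lemma V_space_iff:
  "X \<in> V_space n \<longleftrightarrow> X \<in> carrier_mat n n \<and> (\<forall>r<n. \<forall>c<n. c \<noteq> n - 1 \<or> r = n - 1 \<longrightarrow> X $$ (r, c) = 0)"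
proof
  assume "X \<in> V_space n"
  then show "X \<in> carrier_mat n n \<and> (\<forall>r<n. \<forall>c<n. c \<noteq> n - 1 \<or> r = n - 1 \<longrightarrow> X $$ (r, c) = 0)"
    by (auto simp: V_space_def)
next
  assume X: "X \<in> carrier_mat n n \<and> (\<forall>r<n. \<forall>c<n. c \<noteq> n - 1 \<or> r = n - 1 \<longrightarrow> X $$ (r, c) = 0)"
  have "X = mat1 n (\<lambda>i j. if j = n \<and> i < n then X $$ (i - 1, n - 1) else 0)"
  proof (rule eq_matI)
    fix r c assume "r < dim_row (mat1 n (\<lambda>i j. if j = n \<and> i < n then X $$ (i - 1, n - 1) else 0))"
      "c < dim_col (mat1 n (\<lambda>i j. if j = n \<and> i < n then X $$ (i - 1, n - 1) else 0))"
    then have "r < n" "c < n" by (auto simp: mat1_def)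
    then show "X $$ (r, c) = mat1 n (\<lambda>i j. if j = n \<and> i < n then X $$ (i - 1, n - 1) else 0) $$ (r, c)"
      using X by (cases "c = n - 1"; cases "r = n - 1") auto
  qed (use X in \<open>auto simp: mat1_def\<close>)
  then show "X \<in> V_space n" unfolding V_space_def using X by fast
qed

lemma commutator_index:
  assumes M: "\<And>y. M y \<in> carrier_mat n n" and rc: "r < n" "c < n"
  shows "(mat_deriv n M x + (b_plus_u n u x * M x - M x * b_plus_u n u x)) $$ (r, c) =
    (dmat (\<lambda>y. fm n (M y)) x + mm n (B_mat n (\<lambda>i. u i x) 0) (fm n (M x))
      - mm n (fm n (M x)) (B_mat n (\<lambda>i. u i x) 0)) r c"
proof -
  have p: "b_plus_u n u x * M x \<in> carrier_mat n n" "M x * b_plus_u n u x \<in> carrier_mat n n"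
    using M[of x] by (auto intro: mult_carrier_mat[of _ n n _ n])
  have "(mat_deriv n M x + (b_plus_u n u x * M x - M x * b_plus_u n u x)) $$ (r, c) =
      mat_deriv n M x $$ (r, c) + ((b_plus_u n u x * M x) $$ (r, c) - (M x * b_plus_u n u x) $$ (r, c))"
    using p rc by (simp del: index_mult_mat)
  also have "(b_plus_u n u x * M x) $$ (r, c) = fm n (b_plus_u n u x * M x) r c" using rc by (simp add: fm_def)
  also have "(M x * b_plus_u n u x) $$ (r, c) = fm n (M x * b_plus_u n u x) r c" using rc by (simp add: fm_def)
  also have "mat_deriv n M x $$ (r, c) = dmat (\<lambda>y. fm n (M y)) x r c"
    using rc by (simp add: mat_deriv_def dmat_def fm_def)
  finally show ?thesis
    using M[of x] by (simp add: fm_mult fm_b_plus_u)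
qed

section \<open>Existence and uniqueness of \<zeta>\<close>

definition is_zeta :: "nat \<Rightarrow> nat \<Rightarrow> (nat \<Rightarrow> real \<Rightarrow> real) \<Rightarrow> (real \<Rightarrow> real mat) \<Rightarrow> bool" where
  "is_zeta n j u \<zeta> \<longleftrightarrow>
     (\<forall>x. \<zeta> x \<in> carrier_mat n n) \<and>
     (\<forall>r<n. \<forall>c<n. smooth_fun_on UNIV (\<lambda>x. \<zeta> x $$ (r, c))) \<and>
     (\<forall>x. \<forall>r<n. \<forall>c\<le>r. \<zeta> x $$ (r, c) = 0) \<and>
     (\<forall>x. mat_deriv n (\<lambda>y. Y_coeff n j 0 u y - \<zeta> y) x
        + (b_plus_u n u x * (Y_coeff n j 0 u x - \<zeta> x)
           - (Y_coeff n j 0 u x - \<zeta> x) * b_plus_u n u x) \<in> V_space n)"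

lemma smooth_B_mat: "smooth_u n u \<Longrightarrow> smooth_mat (\<lambda>x. B_mat n (\<lambda>i. u i x) l)"
proof (intro allI)
  fix r c assume u: "smooth_u n u"
  have "(\<lambda>x. B_mat n (\<lambda>i. u i x) l r c) = (\<lambda>x. B_mat n (\<lambda>i. 0) l r c + (if c = n - 1 \<and> r < n - 1 then u (Suc r) x else 0))"
    by (intro ext) (auto simp: B_mat_def)
  moreover have "smooth_fun_on UNIV (\<lambda>x. if c = n - 1 \<and> r < n - 1 then u (Suc r) x else 0)"
    using u by (cases "c = n - 1 \<and> r < n - 1") auto
  ultimately show "smooth_fun_on UNIV (\<lambda>x. B_mat n (\<lambda>i. u i x) l r c)"
    by (simp add: smooth_fun_on_add)
qed

context
  fixes n j :: nat and u :: "nat \<Rightarrow> real \<Rightarrow> real"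
  assumes n: "n \<ge> 2" and u: "smooth_u n u"
begin

lemma is_Y_series: "is_Y n u (Y_series n u)"
proof -
  obtain P Q where "smat n P" "smat n Q" "\<forall>x. P x * Q x = 1\<^sub>m n" "\<forall>x. Q x * P x = 1\<^sub>m n"
    "intertwines n (\<lambda>x. J_series n) (L_series n u) P" "intertwines n (L_series n u) (\<lambda>x. J_series n) Q"
    "Y_series n u = (\<lambda>x. Q x * J_series n * P x)" and *: "is_Y n u (Y_series n u)"
    by (rule Y_series_dressing[of n u, OF n u]) (rule that)
  show ?thesis by (rule *)
qed

lemma smat_Y_series: "smat n (Y_series n u)"
  by (rule is_Y_smat(1)[OF is_Y_series])

abbreviation (input) A_coef :: "int \<Rightarrow> real \<Rightarrow> nat \<Rightarrow> nat \<Rightarrow> real" where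
  "A_coef m x \<equiv> coef n (Y_series n u x ^\<^sub>m j) m"

lemma Y_coeff_coef: "fm n (Y_coeff n j m u x) = A_coef m x"
  by (simp add: coef_def Y_coeff_def)

lemma Y_pow_degree:
  assumes "r < n" "c < n" "i < - int k"
  shows "fls_nth ((Y_series n u x ^\<^sub>m k) $$ (r, c)) i = 0"
  using assms
proof (induction k arbitrary: c i)
  case 0
  then show ?case using carrier_matD[OF smat_carrier[OF smat_Y_series]] by auto
next
  case (Suc k)
  let ?Y = "Y_series n u x"
  have c: "?Y \<in> carrier_mat n n" by (rule smat_carrier[OF smat_Y_series])
  have "fls_nth ((?Y ^\<^sub>m k) $$ (r, s) * ?Y $$ (s, c)) i = 0" if "s < n" for s
  proof -
    have "fls_nth (?Y $$ (s, c)) i = 0" if "i < -1" for i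
      using is_Y_smat(2)[OF is_Y_series, of x] that \<open>s < n\<close> Suc.prems unfolding lead_J_def by auto
    then show ?thesis
      using fls_times_nth_bounds[of "- int k" "(?Y ^\<^sub>m k) $$ (r, s)" "-1" "?Y $$ (s, c)" i]
        Suc.IH[OF Suc.prems(1) that] Suc.prems by simp
  qed
  then show ?case
    unfolding pow_mat.simps mat_mult_index[OF pow_carrier_mat[OF c] c Suc.prems(1,2)]
    by (simp add: fls_nth_sum)
qed

lemma A_coef_zero: "m > int j \<Longrightarrow> A_coef m x = 0"
proof (intro ext)
  fix r c assume "m > int j"
  then show "A_coef m x r c = 0 r c"
    using Y_pow_degree[of r c "- m" j x] smat_carrier[OF smat_pow[OF smat_Y_series]]
    by (cases "r < n \<and> c < n") (simp_all add: coef_eq coef_outside)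
qed

lemma A_coef_smooth: "smooth_mat (A_coef m)"
  by (rule coef_smooth[OF smat_pow[OF smat_Y_series]])

lemma intertwines_Y_series: "intertwines n (L_series n u) (L_series n u) (Y_series n u)"
  unfolding intertwines_iff_lam_coeff[OF smat_Y_series] using is_Y_series by (simp add: is_Y_def)

lemma A_coef_rec:
  "dmat (A_coef m) x + (mm n (E_mat n) (A_coef (m - 1) x) + mm n (B_mat n (\<lambda>i. u i x) 0) (A_coef m x)) =
   mm n (A_coef (m - 1) x) (E_mat n) + mm n (A_coef m x) (B_mat n (\<lambda>i. u i x) 0)"
proof -
  let ?W = "\<lambda>x. Y_series n u x ^\<^sub>m j"
  have s: "smat n ?W" by (rule smat_pow[OF smat_Y_series])
  note c = smat_carrier[OF s, of x]
  have "mD n ?W x + L_series n u x * ?W x = ?W x * L_series n u x"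
    using intertwines_pow[OF smat_Y_series _ intertwines_Y_series, of j] by (simp add: intertwines_def)
  then have "coef n (mD n ?W x + L_series n u x * ?W x) m = coef n (?W x * L_series n u x) m" by simp
  then show ?thesis
    using n c unfolding L_series_lin
    by (simp add: coef_add mult_carrier_mat[of _ n n] coef_mD[OF s] coef_lin_mult B_mat_outside)
qed

text \<open>Strict triangularity of \<zeta> fixes the first column of the difference, and
  \<open>zcol\<close> generates the others. The result departs from \<open>Y_coeff n j 0 u\<close>
  only above the diagonal: on and below it both satisfy the same column recursion, because the terms
  with \<open>E_mat n\<close> in \<open>A_coef_rec\<close> touch only row 0 and the last
  column.\<close>

lemma is_zeta_zeta: "is_zeta n j u (zeta n j u)"
proof -
  define B where "B x = B_mat n (\<lambda>i. u i x) 0" for x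
  define z where "z = zcol n B (\<lambda>x r. A_coef 0 x r 0)"
  note Aout = coef_outside[of _ n]
  have sB: "smooth_mat B" unfolding B_def by (rule smooth_B_mat[OF u])
  have sz: "smooth_fun_on UNIV (\<lambda>x. z c x r)" for c r
    unfolding z_def by (rule smooth_zcol[OF sB]) (use A_coef_smooth in auto)
  have cY: "Y_coeff n j 0 u x \<in> carrier_mat n n" for x
    unfolding Y_coeff_def by (rule lam_coeff_carrier[OF smat_carrier[OF smat_pow[OF smat_Y_series]]])
  have Yi: "Y_coeff n j 0 u x $$ (r, c) = A_coef 0 x r c" if "r < n" "c < n" for x r c
    using Y_coeff_coef[of 0 x] that by (auto simp: fm_def fun_eq_iff split: if_splits)
  have D: "deriv (\<lambda>y. A_coef 0 y r c - z c y r) x = deriv (\<lambda>y. A_coef 0 y r c) x - deriv (\<lambda>y. z c y r) x" for r c x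
    by (intro DERIV_imp_deriv DERIV_diff smooth_has_deriv[of UNIV] sz UNIV_I) (use A_coef_smooth in auto)
  have strict: "A_coef 0 x r c - z c x r = 0" if "c \<le> r" "r < n" for r c x
    using that
  proof (induction c arbitrary: r x)
    case 0
    then show ?case by (simp add: z_def)
  next
    case (Suc c)
    have "A_coef 0 x r (Suc c) = deriv (\<lambda>y. A_coef 0 y r c) x + mm n (B x) (A_coef 0 x) r c"
      using fun_cong[OF fun_cong[OF A_coef_rec[of 0 x], of r], of c] Suc.prems n
      by (simp add: mm_E mm_E_right mm_B_right dmat_def B_def)
    then have "A_coef 0 x r (Suc c) - z (Suc c) x r = deriv (\<lambda>y. A_coef 0 y r c - z c y r) x
        + (mm n (B x) (A_coef 0 x) r c - mm n (B x) (\<lambda>s _. z c x s) r c)"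
      unfolding D by (simp add: z_def mv_def mm_def)
    moreover have "(\<lambda>y. A_coef 0 y r c - z c y r) = (\<lambda>y. 0)" using Suc by auto
    moreover have "mm n (B x) (A_coef 0 x) r c - mm n (B x) (\<lambda>s _. z c x s) r c = 0"
      unfolding B_def using Suc.prems Suc.IH[of "r - 1" x] Suc.IH[of "n - 1" x]
      by (simp add: mm_B_left)
    ultimately show ?case by simp
  qed
  define Z where "Z x = (\<lambda>r c. if r < n \<and> c < n then z c x r else 0)" for x
  have sZ: "smooth_mat Z"
  proof (intro allI)
    fix r c show "smooth_fun_on UNIV (\<lambda>x. Z x r c)"
      by (cases "r < n \<and> c < n") (auto simp: Z_def sz)
  qed
  have dcol: "(dmat Z x + mm n (B x) (Z x) - mm n (Z x) (B x)) r c = 0" if "r < n" "Suc c < n" for x r c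
  proof -
    have "mm n (Z x) (B x) r c = deriv (\<lambda>y. z c y r) x + mv n (B x) (z c x) r"
      unfolding B_def using that by (simp add: mm_B_right Z_def) (simp add: z_def B_def)
    moreover have "mm n (B x) (Z x) r c = mv n (B x) (z c x) r"
      unfolding mm_def mv_def using that by (intro sum.cong) (auto simp: Z_def)
    ultimately show ?thesis using that by (simp add: dmat_def Z_def)
  qed
  have trace_comm: "(\<Sum>r<n. mm n X W r r) = (\<Sum>r<n. mm n W X r r)" for X W :: "nat \<Rightarrow> nat \<Rightarrow> real"
    unfolding mm_def by (subst sum.swap) (simp add: mult.commute)
  have dtrace: "deriv (\<lambda>y. \<Sum>r<n. X y r r) x = (\<Sum>r<n. dmat X x r r)" if "smooth_mat X" for X x
    unfolding dmat_def by (intro DERIV_imp_deriv DERIV_sum smooth_has_deriv[of UNIV]) (use that in auto)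
  \<comment> \<open>The bottom right entry, which the column recursion does not reach, comes from
    the trace. Commutators have trace 0, and Z has the same diagonal as \<open>A_coef 0\<close>,
    whose trace is constant in x by \<open>A_coef_rec\<close>; the other diagonal entries are 0
    already.\<close>
  have last: "(dmat Z x + mm n (B x) (Z x) - mm n (Z x) (B x)) (n - 1) (n - 1) = 0" for x
  proof -
    have "(\<Sum>r<n. (dmat Z x + mm n (B x) (Z x) - mm n (Z x) (B x)) r r) =
        (\<Sum>r<n. dmat Z x r r)"
      using trace_comm[of "B x" "Z x"] by (simp add: sum.distrib sum_subtractf)
    also have "\<dots> = deriv (\<lambda>y. \<Sum>r<n. Z y r r) x" by (rule dtrace[OF sZ, symmetric])
    also have "(\<lambda>y. \<Sum>r<n. Z y r r) = (\<lambda>y. \<Sum>r<n. A_coef 0 y r r)"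
    proof (intro ext sum.cong refl)
      fix y r assume "r \<in> {..<n}"
      then show "Z y r r = A_coef 0 y r r" using strict[of r r y] by (simp add: Z_def)
    qed
    also have "deriv (\<lambda>y. \<Sum>r<n. A_coef 0 y r r) x = (\<Sum>r<n. dmat (A_coef 0) x r r)" by (rule dtrace[OF A_coef_smooth])
    also have "\<dots> = 0"
    proof -
      have "(\<Sum>r<n. (dmat (A_coef 0) x + (mm n (E_mat n) (A_coef (- 1) x) + mm n (B x) (A_coef 0 x))) r r) =
        (\<Sum>r<n. (mm n (A_coef (- 1) x) (E_mat n) + mm n (A_coef 0 x) (B x)) r r)"
        using A_coef_rec[of 0 x] by (simp add: B_def)
      then show ?thesis
        using trace_comm[of "B x" "A_coef 0 x"] trace_comm[of "E_mat n" "A_coef (- 1) x"] by (simp add: sum.distrib)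
    qed
    finally have *: "(\<Sum>r<n. (dmat Z x + mm n (B x) (Z x) - mm n (Z x) (B x)) r r) = 0" .
    have "(\<Sum>r<n. (dmat Z x + mm n (B x) (Z x) - mm n (Z x) (B x)) r r) =
        (\<Sum>r<n. if r = n - 1 then (dmat Z x + mm n (B x) (Z x) - mm n (Z x) (B x)) (n - 1) (n - 1) else 0)"
    proof (rule sum.cong)
      fix r assume "r \<in> {..<n}"
      then show "(dmat Z x + mm n (B x) (Z x) - mm n (Z x) (B x)) r r =
          (if r = n - 1 then (dmat Z x + mm n (B x) (Z x) - mm n (Z x) (B x)) (n - 1) (n - 1) else 0)"
        using dcol[of r r x] by auto
    qed simp
    then show ?thesis using * n by simp
  qed
  define \<zeta> where "\<zeta> x = mat n n (\<lambda>(r, c). A_coef 0 x r c - z c x r)" for x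
  have c\<zeta>: "\<zeta> x \<in> carrier_mat n n" for x by (simp add: \<zeta>_def)
  have cM: "Y_coeff n j 0 u x - \<zeta> x \<in> carrier_mat n n" for x by (rule minus_carrier_mat[OF c\<zeta>])
  have fmZ: "fm n (Y_coeff n j 0 u x - \<zeta> x) = Z x" for x
    using cY[of x] by (intro ext) (auto simp: fm_def Z_def Yi \<zeta>_def)
  have "is_zeta n j u \<zeta>"
    unfolding is_zeta_def
  proof (intro conjI allI impI c\<zeta>)
    show "smooth_fun_on UNIV (\<lambda>x. \<zeta> x $$ (r, c))" if "r < n" "c < n" for r c
      using that A_coef_smooth sz by (auto simp: \<zeta>_def intro!: smooth_fun_on_sub)
    show "\<zeta> x $$ (r, c) = 0" if "r < n" "c \<le> r" for x r c
      using strict[OF that(2,1), of x] that by (simp add: \<zeta>_def)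
    show "mat_deriv n (\<lambda>y. Y_coeff n j 0 u y - \<zeta> y) x
        + (b_plus_u n u x * (Y_coeff n j 0 u x - \<zeta> x)
           - (Y_coeff n j 0 u x - \<zeta> x) * b_plus_u n u x) \<in> V_space n" for x
      unfolding V_space_iff
    proof (intro conjI allI impI)
      show "mat_deriv n (\<lambda>y. Y_coeff n j 0 u y - \<zeta> y) x
        + (b_plus_u n u x * (Y_coeff n j 0 u x - \<zeta> x)
           - (Y_coeff n j 0 u x - \<zeta> x) * b_plus_u n u x) \<in> carrier_mat n n"
        by (intro add_carrier_mat minus_carrier_mat mult_carrier_mat[OF cM b_plus_u_carrier])
      fix r c assume "r < n" "c < n" "c \<noteq> n - 1 \<or> r = n - 1"
      then have "(dmat Z x + mm n (B x) (Z x) - mm n (Z x) (B x)) r c = 0"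
        using dcol[of r c x] last[of x] by (cases "c = n - 1") auto
      then show "(mat_deriv n (\<lambda>y. Y_coeff n j 0 u y - \<zeta> y) x
        + (b_plus_u n u x * (Y_coeff n j 0 u x - \<zeta> x)
           - (Y_coeff n j 0 u x - \<zeta> x) * b_plus_u n u x)) $$ (r, c) = 0"
        using commutator_index[where M = "\<lambda>y. Y_coeff n j 0 u y - \<zeta> y" and u = u and x = x, OF cM \<open>r < n\<close> \<open>c < n\<close>] by (simp only: fmZ B_def)
    qed
  qed
  moreover have "\<zeta>' = \<zeta>" if \<zeta>': "is_zeta n j u \<zeta>'" for \<zeta>'
  proof -
    have c': "\<zeta>' x \<in> carrier_mat n n" for x using \<zeta>' by (simp add: is_zeta_def)
    have cM': "Y_coeff n j 0 u x - \<zeta>' x \<in> carrier_mat n n" for x by (rule minus_carrier_mat[OF c'])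
    define M where "M x = fm n (Y_coeff n j 0 u x - \<zeta>' x)" for x
    have Mi: "M x r c = A_coef 0 x r c - \<zeta>' x $$ (r, c)" if "r < n" "c < n" for x r c
      using that c'[of x] by (simp add: M_def fm_def Yi)
    have "M x r c = z c x r" if "r < n" "c < n" for x r c
      using that
    proof (induction c arbitrary: r x)
      case 0
      have "\<forall>x. \<forall>r<n. \<forall>c\<le>r. \<zeta>' x $$ (r, c) = 0" using \<zeta>' unfolding is_zeta_def by blast
      then show ?case using 0 n by (simp add: z_def Mi)
    next
      case (Suc c)
      have "(mat_deriv n (\<lambda>y. Y_coeff n j 0 u y - \<zeta>' y) x
        + (b_plus_u n u x * (Y_coeff n j 0 u x - \<zeta>' x)
           - (Y_coeff n j 0 u x - \<zeta>' x) * b_plus_u n u x)) $$ (r, c) = 0"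
        using \<zeta>' Suc.prems unfolding is_zeta_def V_space_iff by auto
      then have "(dmat M x + mm n (B x) (M x) - mm n (M x) (B x)) r c = 0"
        using commutator_index[where M = "\<lambda>y. Y_coeff n j 0 u y - \<zeta>' y" and c = c and u = u and x = x, OF cM' \<open>r < n\<close>] Suc.prems by (simp add: M_def[abs_def] B_def)
      then have "M x r (Suc c) = deriv (\<lambda>y. M y r c) x + mm n (B x) (M x) r c"
        using Suc.prems unfolding B_def by (simp add: mm_B_right dmat_def)
      also have "mm n (B x) (M x) r c = mv n (B x) (z c x) r"
        unfolding mm_def mv_def using Suc by (intro sum.cong) auto
      also have "(\<lambda>y. M y r c) = (\<lambda>y. z c y r)" using Suc by auto
      finally show ?case by (simp add: z_def)
    qed
    then have "\<zeta>' x $$ (r, c) = A_coef 0 x r c - z c x r" if "r < n" "c < n" for x r c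
      using Mi[OF that, of x] that by simp
    then show ?thesis using carrier_matD[OF c'] by (intro ext eq_matI) (auto simp: \<zeta>_def)
  qed
  ultimately have "(THE \<zeta>. is_zeta n j u \<zeta>) = \<zeta>" by (intro the_equality)
  then have "zeta n j u = \<zeta>" unfolding zeta_def is_zeta_def .
  then show ?thesis using \<open>is_zeta n j u \<zeta>\<close> by simp
qed

end

section \<open>Z at a real value of \<lambda>\<close>

definition Zf :: "nat \<Rightarrow> nat \<Rightarrow> (nat \<Rightarrow> real \<Rightarrow> real) \<Rightarrow> real \<Rightarrow> real \<Rightarrow> nat \<Rightarrow> nat \<Rightarrow> real" where
  "Zf n j u l x = fm n (Z_at n j u l x)"

definition zetaf :: "nat \<Rightarrow> nat \<Rightarrow> (nat \<Rightarrow> real \<Rightarrow> real) \<Rightarrow> real \<Rightarrow> nat \<Rightarrow> nat \<Rightarrow> real" where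
  "zetaf n j u x = fm n (zeta n j u x)"

definition Sf :: "nat \<Rightarrow> nat \<Rightarrow> (nat \<Rightarrow> real \<Rightarrow> real) \<Rightarrow> real \<Rightarrow> real \<Rightarrow> nat \<Rightarrow> nat \<Rightarrow> real" where
  "Sf n j u l x r c = (\<Sum>m\<le>j. coef n (Y_series n u x ^\<^sub>m j) (int m) r c * l ^ m)"

lemma Zf_outside: "\<not> (r < n \<and> c < n) \<Longrightarrow> Zf n j u l x r c = 0"
  by (auto simp: Zf_def fm_def)

context
  fixes n j :: nat and u :: "nat \<Rightarrow> real \<Rightarrow> real"
  assumes n: "n \<ge> 2" and u: "smooth_u n u"
begin

lemma zeta_carrier: "zeta n j u x \<in> carrier_mat n n"
  using is_zeta_zeta[OF n u] by (simp add: is_zeta_def)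

lemma Z_at_carrier: "Z_at n j u l x \<in> carrier_mat n n"
  unfolding Z_at_def by (rule minus_carrier_mat[OF zeta_carrier])

lemma zetaf_strict: "c \<le> r \<Longrightarrow> zetaf n j u x r c = 0"
  using is_zeta_zeta[OF n u, of j] by (simp add: is_zeta_def zetaf_def fm_def)

lemma zetaf_smooth: "smooth_mat (zetaf n j u)"
proof (intro allI)
  fix r c show "smooth_fun_on UNIV (\<lambda>x. zetaf n j u x r c)"
    using is_zeta_zeta[OF n u, of j]
    by (cases "r < n \<and> c < n") (auto simp: is_zeta_def zetaf_def fm_def)
qed

lemma Zf_eq: "Zf n j u l x = Sf n j u l x - zetaf n j u x"
proof (intro ext)
  fix r c
  show "Zf n j u l x r c = (Sf n j u l x - zetaf n j u x) r c"
  proof (cases "r < n \<and> c < n")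
    case True
    have "Y_coeff n j i u x $$ (r, c) = coef n (Y_series n u x ^\<^sub>m j) i r c" for i
      using True by (simp add: coef_def fm_def Y_coeff_def)
    then show ?thesis
      using True carrier_matD[OF zeta_carrier, of x] by (simp add: Zf_def Sf_def zetaf_def fm_def Z_at_def)
  qed (auto simp: Zf_def zetaf_def Sf_def fm_def coef_outside)
qed

lemma Sf_smooth: "smooth_mat (Sf n j u l)"
  unfolding Sf_def
  by (intro allI smooth_fun_on_sum smooth_fun_on_mult) (use A_coef_smooth[OF n u] in auto)

lemma Zf_smooth: "smooth_mat (Zf n j u l)"
  unfolding Zf_eq using Sf_smooth zetaf_smooth by (auto intro: smooth_fun_on_sub)

text \<open>Strict upper triangularity empties the last row and the first column, so products with
  \<zeta> do not see the \<lambda>-term of a matrix linear in \<lambda>.\<close>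

lemma E_zetaf: "mm n (E_mat n) (zetaf n j u x) = 0" "mm n (zetaf n j u x) (E_mat n) = 0"
proof (intro ext)
  fix r c
  have "zetaf n j u x (n - 1) c = 0"
    using zetaf_strict[of c "n - 1"] by (cases "c \<le> n - 1") (use n in \<open>simp_all add: zetaf_def fm_def\<close>)
  then show "mm n (E_mat n) (zetaf n j u x) r c = 0 r c"
    using n by (simp add: mm_E)
next
  show "mm n (zetaf n j u x) (E_mat n) = 0"
    using n by (intro ext) (simp add: mm_E_right zetaf_strict)
qed

abbreviation (input) Bx :: "real \<Rightarrow> real \<Rightarrow> nat \<Rightarrow> nat \<Rightarrow> real" where
  "Bx l x \<equiv> B_mat n (\<lambda>i. u i x) l"

lemma dmat_Sf: "dmat (Sf n j u l) x r c = (\<Sum>m\<le>j. dmat (\<lambda>x. coef n (Y_series n u x ^\<^sub>m j) (int m)) x r c * l ^ m)"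
proof -
  have "((\<lambda>x. Sf n j u l x r c) has_real_derivative
     (\<Sum>m\<le>j. deriv (\<lambda>x. coef n (Y_series n u x ^\<^sub>m j) (int m) r c) x * l ^ m)) (at x)"
    unfolding Sf_def
    by (intro DERIV_sum DERIV_cmult_right smooth_has_deriv[of UNIV]) (use A_coef_smooth[OF n u] in auto)
  from DERIV_imp_deriv[OF this] show ?thesis by (simp add: dmat_def)
qed

lemma Sf_commutator:
  "dmat (Sf n j u l) x + mm n (Bx l x) (Sf n j u l x) - mm n (Sf n j u l x) (Bx l x) =
    mm n (coef n (Y_series n u x ^\<^sub>m j) (-1)) (E_mat n) - mm n (E_mat n) (coef n (Y_series n u x ^\<^sub>m j) (-1))"
proof -
  note top = A_coef_zero[OF n u, of j "int j + 1"]
  have "dmat (\<lambda>x. coef n (Y_series n u x ^\<^sub>m j) (int j + 1)) x = 0"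
    using top by (intro ext) (simp add: dmat_def)
  from polynomial_part[where R = "\<lambda>m. dmat (\<lambda>x. coef n (Y_series n u x ^\<^sub>m j) m) x"
      and A = "\<lambda>m. coef n (Y_series n u x ^\<^sub>m j) m" and A' = "\<lambda>m. coef n (Y_series n u x ^\<^sub>m j) m"
      and E = "E_mat n" and G = "Bx 0 x" and H = "Bx 0 x" and n = n and l = l,
      OF A_coef_rec[OF n u, of j] top top this]
  have "(\<lambda>r c. \<Sum>m\<le>j. dmat (\<lambda>x. coef n (Y_series n u x ^\<^sub>m j) (int m)) x r c * l ^ m)
      + mm n (Bx 0 x + (\<lambda>r c. l * E_mat n r c)) (\<lambda>r c. \<Sum>m\<le>j. coef n (Y_series n u x ^\<^sub>m j) (int m) r c * l ^ m)
      - mm n (\<lambda>r c. \<Sum>m\<le>j. coef n (Y_series n u x ^\<^sub>m j) (int m) r c * l ^ m) (Bx 0 x + (\<lambda>r c. l * E_mat n r c)) =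
    mm n (coef n (Y_series n u x ^\<^sub>m j) (-1)) (E_mat n) - mm n (E_mat n) (coef n (Y_series n u x ^\<^sub>m j) (-1))"
    by auto
  moreover have "(\<lambda>r c. \<Sum>m\<le>j. dmat (\<lambda>x. coef n (Y_series n u x ^\<^sub>m j) (int m)) x r c * l ^ m) = dmat (Sf n j u l) x"
    by (intro ext) (simp add: dmat_Sf)
  moreover have "(\<lambda>r c. \<Sum>m\<le>j. coef n (Y_series n u x ^\<^sub>m j) (int m) r c * l ^ m) = Sf n j u l x"
    by (intro ext) (simp add: Sf_def)
  ultimately show ?thesis
    using B_mat_lam[of n "\<lambda>i. u i x" l] n by simp
qed

text \<open>The polynomial part contributes only boundary terms of degree -1 and \<zeta> annihilates
  \<open>e\<^sub>1\<^sub>n\<close>, so no \<lambda> remains. Along the flow this common value turns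
  out to be the time derivative of b + u.\<close>

lemma Zf_commutator:
  "dmat (Zf n j u l) x + mm n (Bx l x) (Zf n j u l x) - mm n (Zf n j u l x) (Bx l x) =
   dmat (Zf n j u 0) x + mm n (Bx 0 x) (Zf n j u 0 x) - mm n (Zf n j u 0 x) (Bx 0 x)"
proof -
  have d: "dmat (Zf n j u l) x = dmat (Sf n j u l) x - dmat (zetaf n j u) x" for l
    unfolding Zf_eq[abs_def] dmat_def
    by (intro ext) (simp, intro DERIV_imp_deriv DERIV_diff smooth_has_deriv[of UNIV],
      use Sf_smooth zetaf_smooth in auto)
  have 1: "mm n (Bx l x) (zetaf n j u x) = mm n (Bx 0 x) (zetaf n j u x)"
    and 2: "mm n (zetaf n j u x) (Bx l x) = mm n (zetaf n j u x) (Bx 0 x)" for l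
  proof -
    have b: "Bx l x = Bx 0 x + (\<lambda>r c. l * E_mat n r c)" using n by (intro B_mat_lam) simp
    show "mm n (Bx l x) (zetaf n j u x) = mm n (Bx 0 x) (zetaf n j u x)"
      by (subst b, intro ext) (simp add: mm_add_left mm_scale_left E_zetaf)
    show "mm n (zetaf n j u x) (Bx l x) = mm n (zetaf n j u x) (Bx 0 x)"
      by (subst b, intro ext) (simp add: mm_add_right mm_scale_right E_zetaf)
  qed
  have "dmat (Zf n j u l) x + mm n (Bx l x) (Zf n j u l x) - mm n (Zf n j u l x) (Bx l x) =
    (dmat (Sf n j u l) x + mm n (Bx l x) (Sf n j u l x) - mm n (Sf n j u l x) (Bx l x)) -
    (dmat (zetaf n j u) x + mm n (Bx 0 x) (zetaf n j u x) - mm n (zetaf n j u x) (Bx 0 x))" for l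
    unfolding d Zf_eq mm_diff_left mm_diff_right 1[of l] 2[of l] by (simp add: algebra_simps)
  then show ?thesis unfolding Sf_commutator by metis
qed

text \<open>By independence of \<lambda> it suffices to take \<lambda> = 0, where this is the
  defining property of \<zeta>.\<close>

lemma Zf_commutator_V:
  assumes "c \<noteq> n - 1 \<or> r = n - 1"
  shows "(dmat (Zf n j u l) x + mm n (Bx l x) (Zf n j u l x) - mm n (Zf n j u l x) (Bx l x)) r c = 0"
proof (cases "r < n \<and> c < n")
  case True
  define M where "M x = Y_coeff n j 0 u x - zeta n j u x" for x
  have cM: "M x \<in> carrier_mat n n" for x unfolding M_def by (rule minus_carrier_mat[OF zeta_carrier])
  have "Sf n j u 0 x = coef n (Y_series n u x ^\<^sub>m j) 0" for x
    by (intro ext) (simp add: Sf_def power_0_left if_distrib cong: if_cong)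
  moreover have "Y_coeff n j 0 u x \<in> carrier_mat n n" for x
    unfolding Y_coeff_def by (rule lam_coeff_carrier[OF smat_carrier[OF smat_pow[OF smat_Y_series[OF n u]]]])
  ultimately have "fm n (M x) = Zf n j u 0 x" for x
    using carrier_matD[OF zeta_carrier, of x] unfolding Zf_eq M_def
    by (intro ext) (simp add: fm_def coef_def zetaf_def Y_coeff_def)
  then have fmM: "(\<lambda>x. fm n (M x)) = Zf n j u 0" by blast
  have "mat_deriv n M x + (b_plus_u n u x * M x - M x * b_plus_u n u x) \<in> V_space n"
    using is_zeta_zeta[OF n u, of j] unfolding is_zeta_def M_def by blast
  then have "(mat_deriv n M x + (b_plus_u n u x * M x - M x * b_plus_u n u x)) $$ (r, c) = 0"
    using True assms unfolding V_space_iff by auto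
  then have "(dmat (\<lambda>y. fm n (M y)) x + mm n (Bx 0 x) (fm n (M x)) - mm n (fm n (M x)) (Bx 0 x)) r c = 0"
    using commutator_index[where M = M and u = u and x = x, OF cM conjunct1[OF True] conjunct2[OF True]] by simp
  then show ?thesis using fun_cong[OF fmM, of x] by (simp only: fmM Zf_commutator[of l x])
next
  case False
  then show ?thesis by (auto simp: mm_def dmat_def Zf_outside B_mat_outside)
qed

text \<open>Outside its last column the commutator vanishes, so each column of Z arises from the
  previous one by \<partial> + J + u. This carries the flow of \<gamma> over to all columns of the
  frame.\<close>

lemma Zf_column:
  assumes "Suc c < n" "r < n"
  shows "Zf n j u l x r (Suc c) = deriv (\<lambda>y. Zf n j u l y r c) x + mm n (Bx l x) (Zf n j u l x) r c"
  using Zf_commutator_V[of c r l x] assms by (simp add: mm_B_right dmat_def)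

end

text \<open>\<open>F Y\<^sup>j = Yt\<^sup>j F\<close> becomes, for the polynomial parts, an identity up to a term free of \<open>\<lambda>\<close>.\<close>

lemma Zf_gauge:
  fixes u ut :: "nat \<Rightarrow> real \<Rightarrow> real"
  assumes n: "n \<ge> 2" and u: "smooth_u n u" and ut: "smooth_u n ut"
    and F: "smooth_mat F" "\<And>x r c. \<not> (r < n \<and> c < n) \<Longrightarrow> F x r c = 0"
    and int: "\<And>l x. dmat F x + mm n (B_mat n (\<lambda>i. ut i x) l) (F x + (\<lambda>r c. l * E_mat n r c)) =
      mm n (F x + (\<lambda>r c. l * E_mat n r c)) (B_mat n (\<lambda>i. u i x) l)"
  shows "mm n (F x + (\<lambda>r c. l * E_mat n r c)) (Zf n j u l x) - mm n (Zf n j ut l x) (F x + (\<lambda>r c. l * E_mat n r c)) =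
    mm n (F x) (Zf n j u 0 x) - mm n (Zf n j ut 0 x) (F x)"
proof -
  let ?E = "E_mat n" and ?B = "\<lambda>x. B_mat n (\<lambda>i. u i x) 0" and ?Bt = "\<lambda>x. B_mat n (\<lambda>i. ut i x) 0"
  define W where "W x = lin n (F x)" for x
  have cW: "W x \<in> carrier_mat n n" for x by (simp add: W_def)
  have sW: "smat n W"
    unfolding smat_def
  proof (intro conjI allI impI cW)
    fix r c assume "r < n" "c < n"
    then have "(\<lambda>x. W x $$ (r, c)) = (\<lambda>x. fls_X_inv * fls_const (E_mat n r c) + fls_const (F x r c))"
      by (simp add: W_def lin_def)
    then show "sfls (\<lambda>x. W x $$ (r, c))"
      using F(1) by (auto intro!: sfls_add sfls_const sfls_fls_const)
  qed
  have n1: "n \<ge> 1" using n by simp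
  note Bo = B_mat_outside[of _ n]
  have P0: "dmat F x + mm n (?Bt x) (F x) = mm n (F x) (?B x)" for x
  proof -
    have "(\<lambda>r c. 0 * ?E r c) = 0" by (intro ext) simp
    then show ?thesis using int[of x 0] by simp
  qed
  \<comment> \<open>The identity at \<lambda> = 1 minus the one at \<lambda> = 0 isolates the
    coefficient of \<lambda>; the quadratic terms are the same on both sides.\<close>
  have P1: "mm n ?E (F x) + mm n (?Bt x) ?E = mm n (F x) ?E + mm n ?E (?B x)" for x
  proof -
    have "(\<lambda>r c. 1 * ?E r c) = ?E" by simp
    then have "dmat F x + mm n (?Bt x + ?E) (F x + ?E) = mm n (F x + ?E) (?B x + ?E)"
      using int[of x 1] B_mat_lam[OF n1, of _ 1] by simp
    then have "(dmat F x + mm n (?Bt x) (F x)) + (mm n ?E (F x) + mm n (?Bt x) ?E) + mm n ?E ?E =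
        mm n (F x) (?B x) + (mm n (F x) ?E + mm n ?E (?B x)) + mm n ?E ?E"
      by (simp add: mm_add_left mm_add_right algebra_simps)
    then show ?thesis unfolding P0 by simp
  qed
  have dW: "coef n (mD n W x) m = (if m = 0 then dmat F x else 0)" for x m
  proof -
    have "coef n (mD n W x) m = dmat (\<lambda>y. if m = 1 then ?E else if m = 0 then F y else 0) x"
      unfolding coef_mD[OF sW] using coef_lin[OF F(2) n1] by (simp add: W_def)
    then show ?thesis by (cases "m = 1"; cases "m = 0") (auto simp: dmat_def fun_eq_iff)
  qed
  have iw: "intertwines n (L_series n ut) (L_series n u) W"
    unfolding intertwines_def
  proof
    fix x
    have c: "L_series n ut x * W x \<in> carrier_mat n n" "W x * L_series n u x \<in> carrier_mat n n"
      by (rule mult_carrier_mat[OF L_series_carrier cW], rule mult_carrier_mat[OF cW L_series_carrier])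
    show "mD n W x + L_series n ut x * W x = W x * L_series n u x"
    proof (rule mat_eq_coefI)
      fix m :: int
      have W: "coef n (W x) m = (if m = 1 then ?E else if m = 0 then F x else 0)" for m
        using coef_lin[OF F(2) n1] by (simp add: W_def)
      have l: "coef n (L_series n ut x * W x) m = mm n ?E (coef n (W x) (m - 1)) + mm n (?Bt x) (coef n (W x) m)"
        unfolding L_series_lin by (rule coef_lin_mult(1)[OF cW Bo n1])
      have r: "coef n (W x * L_series n u x) m = mm n (coef n (W x) (m - 1)) ?E + mm n (coef n (W x) m) (?B x)"
        unfolding L_series_lin by (rule coef_lin_mult(2)[OF cW Bo n1])
      have z: "mm n X 0 = 0" "mm n 0 X = 0" for X :: "nat \<Rightarrow> nat \<Rightarrow> real"
        by (intro ext; simp add: mm_def)+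
      show "coef n (mD n W x + L_series n ut x * W x) m = coef n (W x * L_series n u x) m"
        unfolding coef_add[OF mD_carrier c(1)] dW l r W
        using P0[of x] P1[of x] by (auto simp: z algebra_simps)
    qed (use c in auto)
  qed
  define Y where "Y = Y_series n u x"
  define Yt where "Yt = Y_series n ut x"
  have cY: "Y \<in> carrier_mat n n" "Yt \<in> carrier_mat n n"
    using smat_carrier[OF smat_Y_series[OF n u]] smat_carrier[OF smat_Y_series[OF n ut]] by (auto simp: Y_def Yt_def)
  note cp = pow_carrier_mat[OF cY(1)] pow_carrier_mat[OF cY(2)]
  have YW: "Yt * W x = W x * Y"
    unfolding Y_def Yt_def by (rule Y_series_intertwine[OF n u ut sW iw])
  have pow: "Yt ^\<^sub>m k * W x = W x * Y ^\<^sub>m k" for k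
  proof (induction k)
    case 0
    then show ?case using cY cW[of x] by simp
  next
    case (Suc k)
    have "Yt ^\<^sub>m Suc k * W x = Yt ^\<^sub>m k * (Yt * W x)"
      using assoc_mult_mat[OF cp(2) cY(2) cW] by simp
    also have "\<dots> = Yt ^\<^sub>m k * W x * Y"
      unfolding YW using assoc_mult_mat[OF cp(2) cW cY(1)] by simp
    also have "\<dots> = W x * Y ^\<^sub>m Suc k"
      unfolding Suc using assoc_mult_mat[OF cW cp(1) cY(1)] by simp
    finally show ?case .
  qed
  have rec: "0 + (mm n ?E (coef n (Y ^\<^sub>m j) (m - 1)) + mm n (F x) (coef n (Y ^\<^sub>m j) m)) =
      mm n (coef n (Yt ^\<^sub>m j) (m - 1)) ?E + mm n (coef n (Yt ^\<^sub>m j) m) (F x)" for m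
    using arg_cong[OF pow[of j], of "\<lambda>A. coef n A m"] coef_lin_mult(1)[where A = "F x" and W = "Y ^\<^sub>m j" and m = m, OF cp(1) F(2) n1]
      coef_lin_mult(2)[where A = "F x" and W = "Yt ^\<^sub>m j" and m = m, OF cp(2) F(2) n1] by (simp add: W_def)
  have S: "mm n (F x + (\<lambda>r c. l * ?E r c)) (Sf n j u l x) - mm n (Sf n j ut l x) (F x + (\<lambda>r c. l * ?E r c)) =
    mm n (coef n (Yt ^\<^sub>m j) (-1)) ?E - mm n ?E (coef n (Y ^\<^sub>m j) (-1))" for l
  proof -
    have "coef n (Y ^\<^sub>m j) (int j + 1) = 0" "coef n (Yt ^\<^sub>m j) (int j + 1) = 0"
      unfolding Y_def Yt_def by (rule A_coef_zero[OF n u], simp, rule A_coef_zero[OF n ut], simp)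
    from polynomial_part[where R = "\<lambda>m. 0" and A = "\<lambda>m. coef n (Y ^\<^sub>m j) m"
      and A' = "\<lambda>m. coef n (Yt ^\<^sub>m j) m" and E = "?E" and G = "F x" and H = "F x" and n = n and l = l,
      OF rec this refl]
    have "mm n (F x + (\<lambda>r c. l * ?E r c)) (\<lambda>r c. \<Sum>m\<le>j. coef n (Y ^\<^sub>m j) (int m) r c * l ^ m)
      - mm n (\<lambda>r c. \<Sum>m\<le>j. coef n (Yt ^\<^sub>m j) (int m) r c * l ^ m) (F x + (\<lambda>r c. l * ?E r c)) =
      mm n (coef n (Yt ^\<^sub>m j) (-1)) ?E - mm n ?E (coef n (Y ^\<^sub>m j) (-1))"
      by (simp add: zero_fun_def[symmetric])
    moreover have "(\<lambda>r c. \<Sum>m\<le>j. coef n (Y ^\<^sub>m j) (int m) r c * l ^ m) = Sf n j u l x"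
      "(\<lambda>r c. \<Sum>m\<le>j. coef n (Yt ^\<^sub>m j) (int m) r c * l ^ m) = Sf n j ut l x"
      by (intro ext; simp add: Sf_def Y_def Yt_def)+
    ultimately show ?thesis by simp
  qed
  have z: "mm n (F x + (\<lambda>r c. l * ?E r c)) (zetaf n j u x) = mm n (F x) (zetaf n j u x)"
    "mm n (zetaf n j ut x) (F x + (\<lambda>r c. l * ?E r c)) = mm n (zetaf n j ut x) (F x)" for l
    by (intro ext; simp add: mm_add_left mm_add_right mm_scale_left mm_scale_right
        E_zetaf[OF n u, of j x] E_zetaf[OF n ut, of j x])+
  have "mm n (F x + (\<lambda>r c. l * ?E r c)) (Zf n j u l x) - mm n (Zf n j ut l x) (F x + (\<lambda>r c. l * ?E r c)) =
      (mm n (coef n (Yt ^\<^sub>m j) (-1)) ?E - mm n ?E (coef n (Y ^\<^sub>m j) (-1))) -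
      (mm n (F x) (zetaf n j u x) - mm n (zetaf n j ut x) (F x))" for l
    unfolding Zf_eq[OF n u] Zf_eq[OF n ut] mm_diff_left mm_diff_right z[of l] S[of l, symmetric]
    by (simp add: algebra_simps)
  from this[of l] this[of 0] have "mm n (F x + (\<lambda>r c. l * ?E r c)) (Zf n j u l x) - mm n (Zf n j ut l x) (F x + (\<lambda>r c. l * ?E r c)) =
      mm n (F x + (\<lambda>r c. 0 * ?E r c)) (Zf n j u 0 x) - mm n (Zf n j ut 0 x) (F x + (\<lambda>r c. 0 * ?E r c))" by simp
  moreover have "F x + (\<lambda>r c. 0 * ?E r c) = F x" by (intro ext) simp
  ultimately show ?thesis by simp
qed

section \<open>The transformation at a fixed time\<close>

text \<open>\<open>Ff n u h x\<close> is \<open>f\<^sub>u\<^sub>,\<^sub>h\<close> at \<open>\<lambda> = 0\<close>, so that \<open>f\<^sub>u\<^sub>,\<^sub>h = Ff n u h x + \<lambda> e\<^sub>1\<^sub>n\<close>.\<close>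

definition wv :: "nat \<Rightarrow> (nat \<Rightarrow> real \<Rightarrow> real) \<Rightarrow> (real \<Rightarrow> real) \<Rightarrow> real \<Rightarrow> nat \<Rightarrow> real" where
  "wv n u h x r = (if r < n then w_fun n u h (Suc r) x else 0)"

text \<open>By the Leibniz rule, column c lists the coefficients of
  \<open>\<partial>\<^sup>c\<close> composed with multiplication by h. \<open>Ff\<close> adds
  \<open>\<partial>\<^sup>c\<^sup>+\<^sup>1\<close>, where \<open>\<partial>\<^sup>n\<close> is
  reduced to lower powers by h*u; its columns thus expand the derivatives of (\<partial> + h)
  applied to a curve of curvature h*u in the frame of that curve.\<close>

definition Hf :: "nat \<Rightarrow> (real \<Rightarrow> real) \<Rightarrow> real \<Rightarrow> nat \<Rightarrow> nat \<Rightarrow> real" where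
  "Hf n h x r c = (if r \<le> c \<and> c < n then real (c choose r) * (deriv ^^ (c - r)) h x else 0)"

definition Ff :: "nat \<Rightarrow> (nat \<Rightarrow> real \<Rightarrow> real) \<Rightarrow> (real \<Rightarrow> real) \<Rightarrow> real \<Rightarrow> nat \<Rightarrow> nat \<Rightarrow> real" where
  "Ff n u h x = B_mat n (\<lambda>i. star_u n h u i x) 0 + Hf n h x"

lemma E_mat_outside: "n \<ge> 1 \<Longrightarrow> \<not> (r < n \<and> c < n) \<Longrightarrow> E_mat n r c = 0"
  by (auto simp: E_mat_def)

definition BT_x :: "nat \<Rightarrow> (nat \<Rightarrow> real \<Rightarrow> real) \<Rightarrow> (real \<Rightarrow> real) \<Rightarrow> real \<Rightarrow> bool" where
  "BT_x n u h k \<longleftrightarrow> (\<forall>x. deriv (w_fun n u h 1) x + h x * w_fun n u h 1 x + u 1 x + k = 0)"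

lemma f_mat_carrier [simp]: "f_mat n u h x l \<in> carrier_mat n n"
  by (simp add: f_mat_def)

lemma fm_f_mat: "n \<ge> 2 \<Longrightarrow> fm n (f_mat n u h x l) = Ff n u h x + (\<lambda>r c. l * E_mat n r c)"
proof (intro ext)
  fix r c assume n: "n \<ge> 2"
  show "fm n (f_mat n u h x l) r c = (Ff n u h x + (\<lambda>r c. l * E_mat n r c)) r c"
  proof (cases "r < n \<and> c < n")
    case True
    then have "fm n (f_mat n u h x l) r c = (if r = 0 \<and> c = n - 1 then l else 0) + (if r = Suc c then 1 else 0)
       + (if r = c then h x else 0)
       + (if r < c \<and> c < n - 1 then real (c choose r) * (deriv ^^ (c - r)) h x else 0)
       + (if r < c \<and> c = n - 1 then u (Suc r) x + s_fun n u h (Suc r) x + real (c choose r) * (deriv ^^ (c - r)) h x else 0)"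
      by (auto simp: fm_def f_mat_def)
    then show ?thesis
      using True by (auto simp: Ff_def B_mat_def Hf_def E_mat_def star_u_def)
  next
    case False
    then show ?thesis using n by (auto simp: fm_def Ff_def B_mat_def Hf_def E_mat_def)
  qed
qed

lemma Ff_outside: "\<not> (r < n \<and> c < n) \<Longrightarrow> Ff n u h x r c = 0"
  by (auto simp: Ff_def B_mat_def Hf_def)

lemma w_fun_rec:
  assumes "Suc i < n" "i \<ge> 1"
  shows "w_fun n u h i x = - deriv (w_fun n u h (Suc i)) x - h x * w_fun n u h (Suc i) x - u (Suc i) x"
proof -
  define m where "m = n - Suc (Suc i)"
  have "n - i = Suc (Suc m)" "n - Suc i = Suc m" "n - Suc m = Suc i" using assms by (auto simp: m_def)
  then show ?thesis by (simp add: w_fun_def)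
qed

lemma w_fun_n: "w_fun n u h n = (\<lambda>x. 1)"
  by (simp add: w_fun_def)

lemma w_fun_n1: "n \<ge> 1 \<Longrightarrow> w_fun n u h (n - 1) = (\<lambda>x. - h x)"
proof -
  assume "n \<ge> 1"
  then have "n - (n - 1) = Suc 0" by simp
  then show ?thesis by (simp add: w_fun_def)
qed

lemma smooth_w_rec:
  assumes u: "smooth_u n u" and h: "smooth_fun_on UNIV h"
  shows "m < n \<Longrightarrow> smooth_fun_on UNIV (w_rec n u h m)"
proof (induction m)
  case (Suc m)
  show ?case
  proof (cases m)
    case 0
    then show ?thesis using h by (simp add: smooth_fun_on_minus)
  next
    case (Suc k)
    then have "smooth_fun_on UNIV (w_rec n u h m)" "n - Suc k \<in> {1..<n}" using Suc.IH Suc.prems by auto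
    then show ?thesis using h u Suc
      by (auto intro!: smooth_fun_on_sub smooth_fun_on_minus smooth_deriv smooth_fun_on_mult)
  qed
qed simp

lemma DERIV_mv:
  assumes "\<And>r c. ((\<lambda>y. A y r c) has_real_derivative A' r c) (at x)" "\<And>r. ((\<lambda>y. v y r) has_real_derivative v' r) (at x)"
  shows "((\<lambda>y. mv n (A y) (v y) r) has_real_derivative (mv n A' (v x) r + mv n (A x) v' r)) (at x)"
proof -
  have "((\<lambda>y. mv n (A y) (v y) r) has_real_derivative (\<Sum>s<n. A x r s * v' s + A' r s * v x s)) (at x)"
    unfolding mv_def by (intro DERIV_sum DERIV_mult' assms)
  then show ?thesis by (simp add: mv_def sum.distrib add.commute)
qed

section \<open>The vector w and the matrix f\<close>

context
  fixes n :: nat and u :: "nat \<Rightarrow> real \<Rightarrow> real" and h :: "real \<Rightarrow> real"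
  assumes n: "n \<ge> 2" and u: "smooth_u n u" and h: "smooth_fun_on UNIV h"
begin

lemma smooth_w_fun: "i \<ge> 1 \<Longrightarrow> smooth_fun_on UNIV (w_fun n u h i)"
  unfolding w_fun_def using n by (intro smooth_w_rec u h) auto

lemma smooth_wv: "smooth_fun_on UNIV (\<lambda>x. wv n u h x r)"
  by (cases "r < n") (auto simp: wv_def smooth_w_fun)

lemma smooth_s_fun: "i \<ge> 1 \<Longrightarrow> smooth_fun_on UNIV (s_fun n u h i)"
  unfolding s_fun_def[abs_def]
  by (intro smooth_fun_on_sub smooth_deriv smooth_fun_on_sum smooth_fun_on_mult smooth_w_fun smooth_funpow_deriv h) auto

lemma smooth_star_u: "smooth_u n (star_u n h u)"
proof
  fix i assume i: "i \<in> {1..<n}"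
  then have "star_u n h u i = (\<lambda>x. u i x + s_fun n u h i x)" by (auto simp: star_u_def)
  then show "smooth_fun_on UNIV (star_u n h u i)"
    using i u smooth_s_fun by (auto intro: smooth_fun_on_add)
qed

lemma smooth_Hf: "smooth_mat (Hf n h)"
proof (intro allI)
  fix r c show "smooth_fun_on UNIV (\<lambda>x. Hf n h x r c)"
    by (cases "r \<le> c \<and> c < n") (auto simp: Hf_def intro!: smooth_fun_on_mult smooth_funpow_deriv h)
qed

lemma smooth_Ff: "smooth_mat (Ff n u h)"
  unfolding Ff_def using smooth_B_mat[OF smooth_star_u, of 0] smooth_Hf
  by (auto intro: smooth_fun_on_add)

lemma wv_last: "wv n u h x (n - 1) = 1"
  using n by (simp add: wv_def w_fun_n)

lemma deriv_wv: "r < n \<Longrightarrow> deriv (\<lambda>y. wv n u h y r) x = deriv (w_fun n u h (Suc r)) x"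
  by (simp add: wv_def[abs_def])

text \<open>The recursion for w, its start w_(n-1) = -h and the Riccati equation are the rows of one
  linear system (\<partial> + J + u) w = -h w at \<lambda> = k.\<close>

lemma wv_eq:
  assumes "BT_x n u h k"
  shows "deriv (\<lambda>y. wv n u h y r) x + mv n (B_mat n (\<lambda>i. u i x) k) (wv n u h x) r + h x * wv n u h x r = 0"
proof (cases "r < n")
  case True
  have m: "mv n (B_mat n (\<lambda>i. u i x) k) (wv n u h x) r =
      (if r = 0 then k else wv n u h x (r - 1)) + (if r < n - 1 then u (Suc r) x else 0)"
    using mv_B[OF True] wv_last by simp
  consider "r = 0" | "r = n - 1" "r > 0" | "0 < r" "r < n - 1" using True n by linarith
  then show ?thesis
  proof cases
    case 1
    then show ?thesis using assms n m True unfolding BT_x_def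
      by (simp add: deriv_wv) (simp add: wv_def algebra_simps)
  next
    case 2
    have "w_fun n u h r = (\<lambda>x. - h x)" using w_fun_n1[of n u h] n 2 by simp
    moreover have "wv n u h x (r - 1) = w_fun n u h (Suc (r - 1)) x" using True by (simp add: wv_def)
    moreover have "Suc (r - 1) = r" using 2 by simp
    ultimately have "wv n u h x (r - 1) = - h x" by metis
    moreover have "(\<lambda>y. wv n u h y r) = (\<lambda>y. 1)" using wv_last 2 by simp
    moreover from this have "wv n u h x r = 1" by metis
    ultimately show ?thesis using 2(2) unfolding m by (simp add: 2(1))
  next
    case 3
    then have "w_fun n u h r x = - deriv (w_fun n u h (Suc r)) x - h x * w_fun n u h (Suc r) x - u (Suc r) x"
      by (intro w_fun_rec) auto
    then show ?thesis using 3 m True by (simp add: deriv_wv) (simp add: wv_def)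
  qed
next
  case False
  then show ?thesis by (simp add: wv_def mv_def B_mat_outside)
qed

text \<open>\<open>s_fun\<close> is made so that the binomial sums in each row cancel. What is left
  of a row is the system \<open>wv_eq\<close>, apart from the \<lambda> and the k of row 0.\<close>

lemma Ff_wv:
  assumes "BT_x n u h k"
  shows "mv n (Ff n u h x + (\<lambda>r c. l * E_mat n r c)) (wv n u h x) r = (if r = 0 then l - k else 0)"
proof (cases "r < n")
  case True
  let ?w = "wv n u h x"
  have E: "mv n (\<lambda>r c. l * E_mat n r c) ?w r = (if r = 0 then l else 0)"
    using mm_E[of n "\<lambda>s _. ?w s" r] n wv_last[of x] by (simp add: mv_def mm_def sum_distrib_left[symmetric] mult.assoc)
  have H: "mv n (Hf n h x) ?w r = h x * ?w r + (\<Sum>c = Suc r..<n. real (c choose r) * (deriv ^^ (c - r)) h x * ?w c)"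
  proof -
    have "mv n (Hf n h x) ?w r = (\<Sum>c = r..<n. real (c choose r) * (deriv ^^ (c - r)) h x * ?w c)"
      unfolding mv_def by (intro sum.mono_neutral_cong_right) (auto simp: Hf_def)
    then show ?thesis using True by (simp add: sum.atLeast_Suc_lessThan)
  qed
  have B: "mv n (B_mat n (\<lambda>i. star_u n h u i x) 0) ?w r =
      (if r = 0 then 0 else ?w (r - 1)) + (if r < n - 1 then star_u n h u (Suc r) x else 0)"
    using mv_B[OF True] wv_last by simp
  have s: "star_u n h u (Suc r) x = u (Suc r) x + deriv (\<lambda>y. wv n u h y r) x
      - (\<Sum>c = Suc r..<n. real (c choose r) * (deriv ^^ (c - r)) h x * ?w c)" if "r < n - 1"
  proof -
    have "(\<Sum>m = Suc r + 1..n. real ((m - 1) choose (Suc r - 1)) * w_fun n u h m x * (deriv ^^ (m - Suc r)) h x) =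
        (\<Sum>c = Suc r..<n. real (c choose r) * (deriv ^^ (c - r)) h x * ?w c)"
      by (rule sum.reindex_bij_witness[of _ Suc "\<lambda>m. m - 1"]) (auto simp: wv_def)
    then show ?thesis using that True by (simp add: star_u_def s_fun_def deriv_wv)
  qed
  have "mv n (Ff n u h x + (\<lambda>r c. l * E_mat n r c)) ?w r =
      mv n (B_mat n (\<lambda>i. star_u n h u i x) 0) ?w r + mv n (Hf n h x) ?w r + (if r = 0 then l else 0)"
    by (simp add: Ff_def mv_add_left E)
  moreover have "deriv (\<lambda>y. wv n u h y r) x + ((if r = 0 then k else ?w (r - 1)) + (if r < n - 1 then u (Suc r) x else 0)) + h x * ?w r = 0"
    using wv_eq[OF assms, of r x] unfolding mv_B[OF True] wv_last by (simp only: mult_1_right)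
  moreover have "deriv (\<lambda>y. wv n u h y r) x = 0 \<and>
      (\<Sum>c = Suc r..<n. real (c choose r) * (deriv ^^ (c - r)) h x * ?w c) = 0 \<and> r \<noteq> 0" if "\<not> r < n - 1"
  proof -
    have r: "r = n - 1" using that True by simp
    then have "(\<lambda>y. wv n u h y r) = (\<lambda>y. 1)" using wv_last by simp
    then show ?thesis using n that by simp
  qed
  ultimately have *: "mv n (Ff n u h x + (\<lambda>r c. l * E_mat n r c)) ?w r =
      (if r = 0 then 0 else ?w (r - 1)) + (if r < n - 1 then star_u n h u (Suc r) x else 0)
      + (h x * ?w r + (\<Sum>c = Suc r..<n. real (c choose r) * (deriv ^^ (c - r)) h x * ?w c)) + (if r = 0 then l else 0)"
    and **: "deriv (\<lambda>y. wv n u h y r) x + ((if r = 0 then k else ?w (r - 1)) + (if r < n - 1 then u (Suc r) x else 0)) + h x * ?w r = 0"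
    and ***: "\<not> r < n - 1 \<Longrightarrow> deriv (\<lambda>y. wv n u h y r) x = 0 \<and>
      (\<Sum>c = Suc r..<n. real (c choose r) * (deriv ^^ (c - r)) h x * ?w c) = 0 \<and> r \<noteq> 0"
    unfolding B H by blast+
  show ?thesis
  proof (cases "r < n - 1")
    case True
    then show ?thesis using ** unfolding * s[OF True] by (cases "r = 0") auto
  next
    case False
    then show ?thesis using ** ***[OF False] unfolding * by auto
  qed
next
  case False
  then show ?thesis using n by (auto simp: mv_def Ff_outside E_mat_def)
qed

text \<open>
  Both sides agree in all columns but the last; the last column is treated by applying them to \<open>w\<close>,
  whose last component is 1.
\<close>

lemma Ff_intertwine:
  assumes BT: "BT_x n u h k"
  shows "dmat (Ff n u h) x + mm n (B_mat n (\<lambda>i. star_u n h u i x) l) (Ff n u h x + (\<lambda>r c. l * E_mat n r c)) =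
      mm n (Ff n u h x + (\<lambda>r c. l * E_mat n r c)) (B_mat n (\<lambda>i. u i x) l)"
proof -
  define F where "F = Ff n u h x + (\<lambda>r c. l * E_mat n r c)"
  define Bt where "Bt = B_mat n (\<lambda>i. star_u n h u i x) l"
  define B where "B = B_mat n (\<lambda>i. u i x) l"
  define X where "X = dmat (Ff n u h) x + mm n Bt F - mm n F B"
  let ?w = "wv n u h x"
  have F: "F = Bt + Hf n h x"
    using B_mat_lam[of n "\<lambda>i. star_u n h u i x" l] n by (simp add: F_def Ff_def Bt_def algebra_simps)
  have DH: "deriv (\<lambda>y. Hf n h y r c) x = (if r \<le> c \<and> c < n then real (c choose r) * (deriv ^^ (Suc c - r)) h x else 0)" for r c
  proof (cases "r \<le> c \<and> c < n")
    case True
    have "((\<lambda>y. real (c choose r) * (deriv ^^ (c - r)) h y) has_real_derivative real (c choose r) * deriv ((deriv ^^ (c - r)) h) x) (at x)"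
      by (intro DERIV_cmult smooth_has_deriv[of UNIV] smooth_funpow_deriv h) auto
    from DERIV_imp_deriv[OF this] show ?thesis using True by (simp add: Hf_def Suc_diff_le)
  next
    case False
    then have "(\<lambda>y. Hf n h y r c) = (\<lambda>y. 0)" by (auto simp: Hf_def)
    then show ?thesis using False by (simp only: deriv_const if_False)
  qed
  have col: "X r c = 0" if rc: "r < n" "Suc c < n" for r c
  proof -
    have cn: "c \<noteq> n - 1" "c < n - 1" using rc by auto
    have 1: "(\<lambda>y. Ff n u h y r c) = (\<lambda>y. (if r = Suc c then 1 else 0) + Hf n h y r c)"
      using rc cn by (intro ext) (simp add: Ff_def B_mat_def)
    have 2: "((\<lambda>y. (if r = Suc c then 1 else 0) + Hf n h y r c) has_real_derivative 0 + deriv (\<lambda>y. Hf n h y r c) x) (at x)"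
      by (intro DERIV_add DERIV_const smooth_has_deriv[of UNIV]) (use smooth_Hf in auto)
    have d: "dmat (Ff n u h) x r c = deriv (\<lambda>y. Hf n h y r c) x"
      unfolding dmat_def 1 using DERIV_imp_deriv[OF 2] by simp
    have "mm n Bt F r c = Bt r (Suc c) + mm n Bt (Hf n h x) r c"
      unfolding F mm_add_right using mm_B_right[OF rc(2,1)] by (simp add: Bt_def)
    also have "mm n Bt (Hf n h x) r c = (if r = 0 then 0 else Hf n h x (r - 1) c)"
      unfolding Bt_def using rc cn by (simp add: mm_B_left[OF rc(1)] Hf_def)
    finally have "mm n Bt F r c = Bt r (Suc c) + (if r = 0 then 0 else Hf n h x (r - 1) c)" .
    moreover have "mm n F B r c = Bt r (Suc c) + Hf n h x r (Suc c)"
      unfolding B_def mm_B_right[OF rc(2,1)] F by simp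
    ultimately have X: "X r c = deriv (\<lambda>y. Hf n h y r c) x + (if r = 0 then 0 else Hf n h x (r - 1) c) - Hf n h x r (Suc c)"
      by (simp add: X_def d)
    show ?thesis
    proof (cases r)
      case 0
      then show ?thesis using rc unfolding X DH by (simp add: Hf_def)
    next
      case (Suc p)
      \<comment> \<open>The three terms of X cancel by Pascal's rule; the cases distinguish which
        entries of \<open>Hf\<close> vanish.\<close>
      consider "p < c" | "p = c" | "p > c" by linarith
      then show ?thesis
        using rc Suc unfolding X DH by cases (simp_all add: Hf_def Suc_diff_le algebra_simps)
    qed
  qed
  have w': "((\<lambda>y. wv n u h y r) has_real_derivative deriv (\<lambda>y. wv n u h y r) x) (at x)" for r
    by (intro smooth_has_deriv[of UNIV] smooth_wv) auto
  have Bl: "mv n B ?w r = mv n (B_mat n (\<lambda>i. u i x) k) ?w r + (if r = 0 then l - k else 0)" for r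
  proof (cases "r < n")
    case True
    then show ?thesis unfolding B_def using wv_last by (simp add: mv_B)
  qed (use n in \<open>auto simp: B_def mv_def B_mat_outside\<close>)
  have dw: "(\<lambda>r. deriv (\<lambda>y. wv n u h y r) x) = (\<lambda>r. (if r = 0 then l - k else 0) - mv n B ?w r - h x * ?w r)"
  proof
    fix r show "deriv (\<lambda>y. wv n u h y r) x = (if r = 0 then l - k else 0) - mv n B ?w r - h x * ?w r"
      using wv_eq[OF BT, of r x] unfolding Bl by simp
  qed
  have Fw: "mv n F ?w r = (if r = 0 then l - k else 0)" for r
    unfolding F_def by (rule Ff_wv[OF BT])
  have e0: "mv n A (\<lambda>r. if r = 0 then a else 0) r = a * A r 0" for A a r
  proof -
    have "mv n A (\<lambda>r. if r = 0 then a else 0) r = (\<Sum>s<n. if s = 0 then a * A r 0 else 0)"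
      unfolding mv_def by (intro sum.cong) auto
    then show ?thesis using n by simp
  qed
  \<comment> \<open>Differentiate F w = (l - k) e_1 in x and eliminate w' through
    \<open>wv_eq\<close>. The first columns of F and \<open>Bt\<close> differ by h e_1, which the
    term -h w compensates.\<close>
  have Xw: "mv n X ?w r = 0" for r
  proof -
    have F': "((\<lambda>y. (Ff n u h y + (\<lambda>r c. l * E_mat n r c)) r c) has_real_derivative dmat (Ff n u h) x r c) (at x)" for r c
    proof -
      have "((\<lambda>y. Ff n u h y r c + l * E_mat n r c) has_real_derivative deriv (\<lambda>y. Ff n u h y r c) x + 0) (at x)"
        by (intro DERIV_add DERIV_const smooth_has_deriv[of UNIV]) (use smooth_Ff in auto)
      then show ?thesis by (simp add: dmat_def)
    qed
    from DERIV_mv[where n = n and r = r and x = x and A = "\<lambda>y. Ff n u h y + (\<lambda>r c. l * E_mat n r c)"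
        and A' = "dmat (Ff n u h) x" and v = "wv n u h" and v' = "\<lambda>r. deriv (\<lambda>y. wv n u h y r) x", OF F' w']
    have "((\<lambda>y. if r = 0 then l - k else 0) has_real_derivative
        mv n (dmat (Ff n u h) x) ?w r + mv n F (\<lambda>r. deriv (\<lambda>y. wv n u h y r) x) r) (at x)"
      unfolding Ff_wv[OF BT] F_def .
    then have a1: "mv n (dmat (Ff n u h) x) ?w r + mv n F (\<lambda>r. deriv (\<lambda>y. wv n u h y r) x) r = 0"
      by (rule DERIV_unique[OF _ DERIV_const])
    have a2: "mv n F (\<lambda>r. deriv (\<lambda>y. wv n u h y r) x) r =
        mv n F (\<lambda>r. if r = 0 then l - k else 0) r - mv n F (mv n B ?w) r - h x * mv n F ?w r"
    proof -
      have "(\<lambda>r. (if r = 0 then l - k else 0) - mv n B ?w r - h x * ?w r) =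
          (\<lambda>r. if r = 0 then l - k else 0) - mv n B ?w - (\<lambda>r. h x * ?w r)" by (simp add: fun_eq_iff)
      then show ?thesis unfolding dw by (simp add: mv_diff_right mv_scale)
    qed
    have a3: "mv n X ?w r = mv n (dmat (Ff n u h) x) ?w r + mv n Bt (mv n F ?w) r - mv n F (mv n B ?w) r"
      by (simp add: X_def mv_add_left mv_diff_left mv_mm)
    have "mv n F ?w = (\<lambda>r. if r = 0 then l - k else 0)"
      by (rule ext) (rule Fw)
    then have a4: "mv n Bt (mv n F ?w) r = (l - k) * Bt r 0"
      by (simp only: e0)
    have a5: "F r 0 = Bt r 0 + (if r = 0 then h x else 0)"
      using n by (simp add: F Hf_def)
    have "mv n X ?w r = (l - k) * Bt r 0 - (l - k) * F r 0 + h x * (if r = 0 then l - k else 0)"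
      using a1 a2 a3 unfolding a4 e0 Fw by linarith
    then show ?thesis unfolding a5 by (cases "r = 0") (simp_all add: algebra_simps)
  qed
  have "X r c = 0" for r c
  proof (cases "r < n \<and> c < n")
    case True
    show ?thesis
    proof (cases "Suc c < n")
      case False
      then have c: "c = n - 1" using True by arith
      have "mv n X ?w r = (\<Sum>s<n. if s = n - 1 then X r (n - 1) * ?w (n - 1) else 0)"
        unfolding mv_def using col True by (intro sum.cong) auto
      then show ?thesis using Xw[of r] n wv_last c by simp
    qed (use col True in auto)
  next
    case False
    then show ?thesis
      using n by (auto simp: X_def dmat_def Ff_outside mm_def Bt_def B_def F_def E_mat_outside B_mat_outside)
  qed
  then have "X = 0" by (simp add: fun_eq_iff)
  then show ?thesis by (simp add: X_def F_def Bt_def B_def)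
qed

lemma Ff_last_row: "mv n (Ff n u h x) v (n - 1) = v (n - 2) + h x * v (n - 1)"
proof -
  have "Ff n u h x (n - 1) s = (if s = n - 2 then 1 else 0) + (if s = n - 1 then h x else 0)" if "s < n" for s
    using that n by (auto simp: Ff_def B_mat_def Hf_def)
  then have "mv n (Ff n u h x) v (n - 1) = (\<Sum>s<n. (if s = n - 2 then v s else 0) + (if s = n - 1 then h x * v s else 0))"
    unfolding mv_def using n by (intro sum.cong) auto
  then show ?thesis using n by (simp add: sum.distrib)
qed

text \<open>Row r of the system expresses entry r - 1 through entry r, so the last entry determines
  all others, and row 0 becomes the Riccati equation. This recognises the vector of the second
  transformation without computing from the definition of w.\<close>

lemma w_fun_unique:
  assumes v: "\<And>x. v x (n - 1) = 1"
    and eq: "\<And>x r. r < n \<Longrightarrow> deriv (\<lambda>y. v y r) x + mv n (B_mat n (\<lambda>i. u i x) k) (v x) r + h x * v x r = 0"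
  shows "r < n \<Longrightarrow> v x r = wv n u h x r" "BT_x n u h k"
proof -
  have m: "deriv (\<lambda>y. v y r) x + ((if r = 0 then k else v x (r - 1)) + (if r < n - 1 then u (Suc r) x else 0)) + h x * v x r = 0"
    if "r < n" for x r
    using eq[OF that, of x] unfolding mv_B[OF that] v by (simp only: mult_1_right)
  have *: "m < n \<Longrightarrow> v x (n - Suc m) = w_fun n u h (n - m) x" for m x
  proof (induction m arbitrary: x)
    case 0
    then show ?case using v by (simp add: w_fun_n)
  next
    case (Suc m)
    define r where "r = n - Suc m"
    have r: "0 < r" "r < n" "n - Suc (Suc m) = r - 1" "n - m = Suc r" using Suc.prems by (auto simp: r_def)
    have vr: "(\<lambda>y. v y r) = w_fun n u h (Suc r)" by (rule ext) (rule Suc.IH[OF Suc_lessD[OF Suc.prems], folded r_def, unfolded r(4)])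
    have "v x (r - 1) = - deriv (\<lambda>y. v y r) x - (if r < n - 1 then u (Suc r) x else 0) - h x * v x r"
      using m[OF r(2), of x] r by simp
    also have "\<dots> = w_fun n u h r x"
    proof (cases "r < n - 1")
      case True
      then show ?thesis using w_fun_rec[of r n u h x] r vr fun_cong[OF vr, of x] by simp
    next
      case False
      then have "r = n - 1" using r by simp
      moreover from this have "(\<lambda>y. v y r) = (\<lambda>y. 1)" using v by simp
      ultimately show ?thesis using w_fun_n1[of n u h] n v[of x] by simp
    qed
    finally show ?case unfolding r(3) r_def[symmetric] .
  qed
  show 1: "v x r = wv n u h x r" if "r < n" for r x
    using *[of "n - Suc r" x] that by (simp add: wv_def Suc_diff_Suc)
  have e: "(\<lambda>y. v y 0) = w_fun n u h 1" using 1[of 0] n by (auto simp: wv_def)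
  show "BT_x n u h k" unfolding BT_x_def
  proof
    fix x
    have "v x 0 = w_fun n u h 1 x" using fun_cong[OF e, of x] .
    moreover have "deriv (w_fun n u h 1) x + (k + u 1 x) + h x * v x 0 = 0"
      using m[of 0 x] n unfolding e by simp
    ultimately show "deriv (w_fun n u h 1) x + h x * w_fun n u h 1 x + u 1 x + k = 0"
      by simp
  qed
qed

text \<open>The identity matrix with its last column replaced by w has determinant 1 and turns the
  last column of f into -k e_1; the remaining minor is unitriangular. Hence the normalisation of d
  by (-1)^n k, which gives the new frame determinant 1.\<close>

lemma det_f_mat:
  assumes BT: "BT_x n u h k"
  shows "det (f_mat n u h x 0) = (-1) ^ n * k"
proof -
  let ?A = "f_mat n u h x 0"
  define W where "W = mat n n (\<lambda>(r, c). if c = n - 1 then wv n u h x r else if r = c then 1 else 0)"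
  have cW: "W \<in> carrier_mat n n" by (simp add: W_def)
  define M where "M = mat n n (\<lambda>(r, c). if c = n - 1 then (if r = 0 then - k else 0) else ?A $$ (r, c))"
  have cM: "M \<in> carrier_mat n n" by (simp add: M_def)
  have A: "?A $$ (r, c) = Ff n u h x r c" if "r < n" "c < n" for r c
  proof -
    have "fm n ?A r c = Ff n u h x r c" using n by (simp add: fm_f_mat)
    then show ?thesis using that by (simp add: fm_def)
  qed
  have "?A * W = M"
  proof (rule eq_matI)
    fix r c assume "r < dim_row M" "c < dim_col M"
    then have rc: "r < n" "c < n" by (auto simp: M_def)
    have "(?A * W) $$ (r, c) = (\<Sum>s<n. Ff n u h x r s * W $$ (s, c))"
      unfolding mat_mult_index[OF f_mat_carrier cW rc] using rc A by simp
    also have "\<dots> = M $$ (r, c)"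
    proof (cases "c = n - 1")
      case True
      have "(\<Sum>s<n. Ff n u h x r s * W $$ (s, c)) = mv n (Ff n u h x) (wv n u h x) r"
        unfolding mv_def using True rc by (intro sum.cong) (auto simp: W_def)
      also have "\<dots> = (if r = 0 then - k else 0)"
      proof -
        have "Ff n u h x + (\<lambda>r c. 0 * E_mat n r c) = Ff n u h x" by (intro ext) simp
        then show ?thesis using Ff_wv[OF BT, of x 0 r] by simp
      qed
      finally show ?thesis using True rc by (simp add: M_def)
    next
      case False
      have "(\<Sum>s<n. Ff n u h x r s * W $$ (s, c)) = (\<Sum>s<n. if s = c then Ff n u h x r c else 0)"
        using False rc by (intro sum.cong) (auto simp: W_def)
      then show ?thesis using False rc A by (simp add: M_def)
    qed
    finally show "(?A * W) $$ (r, c) = M $$ (r, c)" .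
  qed (use carrier_matD[OF f_mat_carrier[of n u h x 0]] in \<open>simp_all add: W_def M_def\<close>)
  moreover have "det W = 1"
  proof -
    have "det W = prod_list (diag_mat W)"
      by (rule det_upper_triangular[OF _ cW]) (use n in \<open>auto simp: upper_triangular_def W_def\<close>)
    also have "diag_mat W = replicate n 1"
      by (rule nth_equalityI) (use wv_last in \<open>auto simp: diag_mat_def W_def\<close>)
    finally show ?thesis by simp
  qed
  moreover have "det M = (-1) ^ n * k"
  proof -
    define N where "N = n - 1"
    let ?D = "mat_delete M 0 N"
    have cD: "?D \<in> carrier_mat N N" using cM by (auto simp: mat_delete_def N_def)
    have D: "?D $$ (r, c) = Ff n u h x (Suc r) c" if "r < N" "c < N" for r c
      using that A[of "Suc r" c] by (auto simp: mat_delete_def M_def N_def)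
    \<comment> \<open>Deleting row 0 moves the subdiagonal ones of f onto the diagonal.\<close>
    have "det ?D = prod_list (diag_mat ?D)"
    proof (rule det_upper_triangular[OF _ cD])
      show "upper_triangular ?D"
        unfolding upper_triangular_def
      proof (intro allI impI)
        fix i j assume "i < dim_row ?D" "j < i"
        then have "i < N" "j < N" "j < i" using carrier_matD[OF cD] by simp_all
        then show "?D $$ (i, j) = 0" by (simp add: D) (simp add: Ff_def B_mat_def Hf_def N_def)
      qed
    qed
    also have "diag_mat ?D = replicate N 1"
    proof (rule nth_equalityI)
      show "length (diag_mat ?D) = length (replicate N (1 :: real))"
        using carrier_matD[OF cD] by (simp add: diag_mat_def)
      fix i assume "i < length (diag_mat ?D)"
      then have i: "i < N" using carrier_matD[OF cD] by (simp add: diag_mat_def)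
      then have "diag_mat ?D ! i = ?D $$ (i, i)" using carrier_matD[OF cD] by (simp add: diag_mat_def)
      also have "\<dots> = 1" using i by (simp add: D) (simp add: Ff_def B_mat_def Hf_def N_def)
      finally show "diag_mat ?D ! i = replicate N 1 ! i" using i by simp
    qed
    finally have "det ?D = 1" by simp
    have "det M = (\<Sum>i<n. M $$ (i, n - 1) * cofactor M i (n - 1))"
      by (rule laplace_expansion_column[OF cM]) (use n in simp)
    also have "\<dots> = (\<Sum>i<n. if i = 0 then - k * cofactor M 0 (n - 1) else 0)"
      by (intro sum.cong) (auto simp: M_def)
    also have "\<dots> = - k * (-1) ^ (n - 1)"
      using n \<open>det ?D = 1\<close> by (simp add: cofactor_def N_def)
    also have "\<dots> = (-1) ^ n * k" using n by (cases n) auto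
    finally show ?thesis .
  qed
  ultimately show ?thesis using det_mult[OF f_mat_carrier cW, of u h x 0] by simp
qed

end

section \<open>Curves and their frames\<close>

lemma DERIV_mm:
  assumes "\<And>r c. ((\<lambda>y. A y r c) has_real_derivative A' r c) (at x)" "\<And>r. ((\<lambda>y. B y r c) has_real_derivative B' r c) (at x)"
  shows "((\<lambda>y. mm n (A y) (B y) r c) has_real_derivative (mm n A' (B x) r c + mm n (A x) B' r c)) (at x)"
proof -
  have "((\<lambda>y. mm n (A y) (B y) r c) has_real_derivative (\<Sum>s<n. A x r s * B' s c + A' r s * B x s c)) (at x)"
    unfolding mm_def by (intro DERIV_sum DERIV_mult' assms)
  then show ?thesis by (simp add: mm_def sum.distrib add.commute)
qed

lemma smooth2_prod:
  "open T \<Longrightarrow> (\<And>i. i \<in> A \<Longrightarrow> smooth2 T (f i)) \<Longrightarrow> smooth2 T (\<lambda>x t. \<Prod>i\<in>A. f i x t)"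
  using smooth_fun_on_prod[OF open_UNIV_Times, of T A "\<lambda>i (x, t). f i x t"]
  by (simp add: case_prod_unfold)

lemma smooth2_det:
  assumes T: "open T" and A: "\<And>x t. A x t \<in> carrier_mat n n"
    and s: "\<And>r c. r < n \<Longrightarrow> c < n \<Longrightarrow> smooth2 T (\<lambda>x t. A x t $$ (r, c))"
  shows "smooth2 T (\<lambda>x t. det (A x t))"
  unfolding det_def'[OF A]
proof (intro smooth2_sum[OF T] smooth2_mult[OF T] smooth2_const[OF T] smooth2_prod[OF T])
  fix p i assume "p \<in> {p. p permutes {0..<n}}" "i \<in> {0..<n}"
  then have "i < n" "p i < n" by (auto simp: permutes_in_image)
  then show "smooth2 T (\<lambda>x t. A x t $$ (i, p i))" by (rule s)
qed

lemma smooth2_adj_mat: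
  assumes T: "open T" and A: "\<And>x t. A x t \<in> carrier_mat n n"
    and s: "\<And>r c. r < n \<Longrightarrow> c < n \<Longrightarrow> smooth2 T (\<lambda>x t. A x t $$ (r, c))"
    and rc: "r < n" "c < n"
  shows "smooth2 T (\<lambda>x t. adj_mat (A x t) $$ (r, c))"
proof -
  have d: "dim_row (A x t) = n" "dim_col (A x t) = n" for x t using A[of x t] by auto
  have "smooth2 T (\<lambda>x t. det (mat_delete (A x t) c r))"
  proof (rule smooth2_det[OF T])
    show "mat_delete (A x t) c r \<in> carrier_mat (n - 1) (n - 1)" for x t
      using A[of x t] by (auto simp: mat_delete_def)
    fix r' c' assume r'c': "r' < n - 1" "c' < n - 1"
    have "(\<lambda>x t. mat_delete (A x t) c r $$ (r', c')) =
        (\<lambda>x t. A x t $$ (if r' < c then r' else Suc r', if c' < r then c' else Suc c'))"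
      using r'c' by (intro ext) (simp add: mat_delete_def d)
    then show "smooth2 T (\<lambda>x t. mat_delete (A x t) c r $$ (r', c'))"
      by (simp only:, intro s) (use r'c' rc in auto)
  qed
  then have "smooth2 T (\<lambda>x t. (-1) ^ (c + r) * det (mat_delete (A x t) c r))"
    by (rule smooth2_mult[OF T smooth2_const[OF T]])
  then show ?thesis using rc by (simp add: adj_mat_def cofactor_def d)
qed

lemma DERIV_det_rows:
  assumes A: "\<And>x. A x \<in> carrier_mat n n"
    and D: "\<And>r c. r < n \<Longrightarrow> c < n \<Longrightarrow> ((\<lambda>y. A y $$ (r, c)) has_real_derivative A' r c) (at x)"
  shows "((\<lambda>y. det (A y)) has_real_derivative
    (\<Sum>i<n. det (mat n n (\<lambda>(r, c). if r = i then A' r c else A x $$ (r, c))))) (at x)"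
proof -
  let ?P = "{p. p permutes {0..<n}}"
  let ?M = "\<lambda>i. mat n n (\<lambda>(r, c). if r = i then A' r c else A x $$ (r, c))"
  have prod: "((\<lambda>y. \<Prod>i = 0..<n. A y $$ (i, p i)) has_real_derivative
      (\<Sum>i = 0..<n. A' i (p i) * (\<Prod>k\<in>{0..<n} - {i}. A x $$ (k, p k)))) (at x)" if "p \<in> ?P" for p
  proof -
    have p: "p i < n" if "i < n" for i using \<open>p \<in> ?P\<close> that by (auto simp: permutes_in_image)
    show ?thesis by (rule has_field_derivative_prod) (use D p in auto)
  qed
  have eq: "A' i (p i) * (\<Prod>k\<in>{0..<n} - {i}. A x $$ (k, p k)) = (\<Prod>k = 0..<n. ?M i $$ (k, p k))"
    if "p \<in> ?P" "i \<in> {0..<n}" for p i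
  proof -
    have p: "p k < n" if "k < n" for k using \<open>p \<in> ?P\<close> that by (auto simp: permutes_in_image)
    have "(\<Prod>k = 0..<n. ?M i $$ (k, p k)) = ?M i $$ (i, p i) * (\<Prod>k\<in>{0..<n} - {i}. ?M i $$ (k, p k))"
      using that(2) by (intro prod.remove) auto
    also have "(\<Prod>k\<in>{0..<n} - {i}. ?M i $$ (k, p k)) = (\<Prod>k\<in>{0..<n} - {i}. A x $$ (k, p k))"
      using p by (intro prod.cong) auto
    finally show ?thesis using that(2) p by simp
  qed
  have "((\<lambda>y. det (A y)) has_real_derivative
      (\<Sum>p\<in>?P. signof p * (\<Sum>i = 0..<n. A' i (p i) * (\<Prod>k\<in>{0..<n} - {i}. A x $$ (k, p k))))) (at x)"
    unfolding det_def'[OF A] by (intro DERIV_sum DERIV_cmult prod)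
  moreover have "(\<Sum>p\<in>?P. signof p * (\<Sum>i = 0..<n. A' i (p i) * (\<Prod>k\<in>{0..<n} - {i}. A x $$ (k, p k)))) =
      (\<Sum>i<n. det (?M i))"
  proof -
    have "(\<Sum>p\<in>?P. signof p * (\<Sum>i = 0..<n. A' i (p i) * (\<Prod>k\<in>{0..<n} - {i}. A x $$ (k, p k)))) =
        (\<Sum>p\<in>?P. \<Sum>i = 0..<n. signof p * (\<Prod>k = 0..<n. ?M i $$ (k, p k)))"
      unfolding sum_distrib_left by (intro sum.cong refl) (simp only: eq)
    also have "\<dots> = (\<Sum>i = 0..<n. \<Sum>p\<in>?P. signof p * (\<Prod>k = 0..<n. ?M i $$ (k, p k)))"
      by (rule sum.swap)
    also have "\<dots> = (\<Sum>i<n. det (?M i))"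
      by (subst det_def'[of _ n]) (simp_all add: lessThan_atLeast0)
    finally show ?thesis .
  qed
  ultimately show ?thesis by simp
qed

section \<open>Frame and curvature of a curve\<close>

lemma frame_carrier [simp]: "frame n \<gamma> x \<in> carrier_mat n n"
  by (simp add: frame_def)

lemma frame_index: "r < n \<Longrightarrow> c < n \<Longrightarrow> frame n \<gamma> x $$ (r, c) = (deriv ^^ c) (\<lambda>y. \<gamma> y $ r) x"
  by (simp add: frame_def)

definition is_curvature :: "nat \<Rightarrow> (real \<Rightarrow> real vec) \<Rightarrow> (nat \<Rightarrow> real \<Rightarrow> real) \<Rightarrow> bool" where
  "is_curvature n \<gamma> u \<longleftrightarrow> (\<forall>i x. i \<notin> {1..<n} \<longrightarrow> u i x = 0) \<and>
     (\<forall>x. \<forall>r<n. (deriv ^^ n) (\<lambda>y. \<gamma> y $ r) x =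
        (\<Sum>i = 1..<n. u i x * (deriv ^^ (i - 1)) (\<lambda>y. \<gamma> y $ r) x))"

text \<open>The difference of two candidates lies in the kernel of the frame, and multiplying by the
  adjugate shows that it is 0.\<close>

lemma curvature_eq:
  assumes n: "n \<ge> 2" and u: "is_curvature n \<gamma> u" and det: "\<And>x. det (frame n \<gamma> x) \<noteq> 0"
  shows "curvature n \<gamma> = u"
proof -
  have "u' = u" if u': "is_curvature n \<gamma> u'" for u'
  proof (intro ext)
    fix i x
    show "u' i x = u i x"
    proof (cases "i \<in> {1..<n}")
      case False
      then show ?thesis using u u' by (simp add: is_curvature_def)
    next
      case True
      let ?G = "frame n \<gamma> x"
      define v where "v s = (if Suc s < n then u' (Suc s) x - u (Suc s) x else 0)" for s
      have Gv: "(\<Sum>s<n. ?G $$ (r, s) * v s) = 0" if "r < n" for r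
      proof -
        have "(\<Sum>s<n. ?G $$ (r, s) * v s) = (\<Sum>s<n - 1. ?G $$ (r, s) * v s)"
          by (rule sum.mono_neutral_right) (auto simp: v_def)
        also have "\<dots> = (\<Sum>i = 1..<n. (u' i x - u i x) * (deriv ^^ (i - 1)) (\<lambda>y. \<gamma> y $ r) x)"
          by (rule sum.reindex_bij_witness[of _ "\<lambda>i. i - 1" Suc]) (use that in \<open>auto simp: v_def frame_index\<close>)
        also have "\<dots> = 0"
          using u u' that by (simp add: is_curvature_def left_diff_distrib sum_subtractf)
        finally show ?thesis .
      qed
      have A: "adj_mat ?G \<in> carrier_mat n n" "adj_mat ?G * ?G = det ?G \<cdot>\<^sub>m 1\<^sub>m n" by (rule adj_mat; simp)+
      define p where "p = i - 1"
      have p: "p < n" "Suc p = i" using True by (auto simp: p_def)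
      have "det ?G * v p = (\<Sum>s<n. (adj_mat ?G * ?G) $$ (p, s) * v s)"
      proof -
        have "(\<Sum>s<n. (adj_mat ?G * ?G) $$ (p, s) * v s) = (\<Sum>s<n. if s = p then det ?G * v p else 0)"
          unfolding A(2) using p by (intro sum.cong) auto
        then show ?thesis using p by simp
      qed
      also have "\<dots> = (\<Sum>s<n. \<Sum>r<n. adj_mat ?G $$ (p, r) * (?G $$ (r, s) * v s))"
        using p by (intro sum.cong refl)
          (simp add: mat_mult_index[OF A(1) frame_carrier] sum_distrib_right mult.assoc del: index_mult_mat)
      also have "\<dots> = (\<Sum>r<n. adj_mat ?G $$ (p, r) * (\<Sum>s<n. ?G $$ (r, s) * v s))"
        by (subst sum.swap) (simp add: sum_distrib_left)
      also have "\<dots> = 0" using Gv by simp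
      finally show ?thesis using det True p by (auto simp: v_def)
    qed
  qed
  then have "(THE u. is_curvature n \<gamma> u) = u" using u by (intro the_equality)
  then show ?thesis by (simp add: curvature_def is_curvature_def)
qed

text \<open>
  The coefficient of \<open>\<gamma>\<^sup>(\<^sup>n\<^sup>-\<^sup>1\<^sup>)\<close> in \<open>\<gamma>\<^sup>(\<^sup>n\<^sup>)\<close> vanishes because it is the logarithmic derivative of the
  determinant of the frame.
\<close>

lemma curvature_adj:
  assumes n: "n \<ge> 2" and \<gamma>: "\<gamma> \<in> central_affine_curves n"
  defines "a \<equiv> \<lambda>i x. if i \<in> {1..<n} then
      (\<Sum>r<n. adj_mat (frame n \<gamma> x) $$ (i - 1, r) * (deriv ^^ n) (\<lambda>y. \<gamma> y $ r) x) else 0"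
  shows "is_curvature n \<gamma> a" "curvature n \<gamma> = a"
proof -
  have smooth: "smooth_fun_on UNIV ((deriv ^^ c) (\<lambda>y. \<gamma> y $ r))" if "r < n" for r c
    using \<gamma> that by (intro smooth_funpow_deriv) (auto simp: central_affine_curves_def)
  have det: "det (frame n \<gamma> x) = 1" for x using \<gamma> by (simp add: central_affine_curves_def)
  define \<alpha> where "\<alpha> i x = (\<Sum>r<n. adj_mat (frame n \<gamma> x) $$ (i, r) * (deriv ^^ n) (\<lambda>y. \<gamma> y $ r) x)" for i x
  have adj: "adj_mat (frame n \<gamma> x) \<in> carrier_mat n n" "frame n \<gamma> x * adj_mat (frame n \<gamma> x) = det (frame n \<gamma> x) \<cdot>\<^sub>m 1\<^sub>m n" for x
    by (rule adj_mat; simp)+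
  have expand: "(deriv ^^ n) (\<lambda>y. \<gamma> y $ r) x = (\<Sum>i<n. \<alpha> i x * (deriv ^^ i) (\<lambda>y. \<gamma> y $ r) x)" if r: "r < n" for r x
  proof -
    let ?G = "frame n \<gamma> x"
    have "(\<Sum>i<n. \<alpha> i x * (deriv ^^ i) (\<lambda>y. \<gamma> y $ r) x) =
        (\<Sum>i<n. \<Sum>s<n. ?G $$ (r, i) * adj_mat ?G $$ (i, s) * (deriv ^^ n) (\<lambda>y. \<gamma> y $ s) x)"
      using r by (intro sum.cong refl) (simp add: \<alpha>_def frame_index sum_distrib_left sum_distrib_right mult_ac)
    also have "\<dots> = (\<Sum>s<n. (?G * adj_mat ?G) $$ (r, s) * (deriv ^^ n) (\<lambda>y. \<gamma> y $ s) x)"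
      using r by (subst sum.swap) (intro sum.cong refl,
        simp add: mat_mult_index[OF frame_carrier adj(1)] sum_distrib_right del: index_mult_mat)
    also have "\<dots> = (\<Sum>s<n. if s = r then (deriv ^^ n) (\<lambda>y. \<gamma> y $ r) x else 0)"
      unfolding adj(2) using r by (intro sum.cong) (auto simp: det)
    finally show ?thesis using r by simp
  qed
  have last: "\<alpha> (n - 1) x = 0" for x
  proof -
    define A where "A y = (frame n \<gamma> y)\<^sup>T" for y
    have cA: "A y \<in> carrier_mat n n" for y by (simp add: A_def)
    have Ai: "A y $$ (r, c) = (deriv ^^ r) (\<lambda>y. \<gamma> y $ c) y" if "r < n" "c < n" for y r c
      using that carrier_matD[OF frame_carrier, of n \<gamma> y] by (simp add: A_def frame_index)
    have "det (A y) = 1" for y using det det_transpose[OF frame_carrier] by (simp add: A_def)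
    then have const: "((\<lambda>y. det (A y)) has_real_derivative 0) (at x)" by simp
    define M where "M i = mat n n (\<lambda>(r, c). if r = i then (deriv ^^ Suc r) (\<lambda>y. \<gamma> y $ c) x else A x $$ (r, c))" for i
    have "((\<lambda>y. det (A y)) has_real_derivative (\<Sum>i<n. det (M i))) (at x)"
      unfolding M_def
    proof (rule DERIV_det_rows[OF cA])
      fix r c assume rc: "r < n" "c < n"
      then have "(\<lambda>y. A y $$ (r, c)) = (deriv ^^ r) (\<lambda>y. \<gamma> y $ c)" by (simp add: Ai)
      then show "((\<lambda>y. A y $$ (r, c)) has_real_derivative (deriv ^^ Suc r) (\<lambda>y. \<gamma> y $ c) x) (at x)"
        using smooth_has_deriv[OF smooth[OF rc(2), of r]] by simp
    qed
    then have "(\<Sum>i<n. det (M i)) = 0" using DERIV_unique const by blast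
    \<comment> \<open>Differentiating row i of the transposed frame yields row i + 1, which is
      already present unless i is the last row.\<close>
    moreover have "det (M i) = 0" if "Suc i < n" for i
    proof (rule det_identical_rows[of _ n i "Suc i"])
      show "Matrix.row (M i) i = Matrix.row (M i) (Suc i)"
        using that by (intro eq_vecI) (auto simp: M_def Ai)
    qed (use that in \<open>auto simp: M_def\<close>)
    then have "(\<Sum>i<n. det (M i)) = (\<Sum>i<n. if i = n - 1 then det (M (n - 1)) else 0)"
      by (intro sum.cong refl) (metis Suc_lessI diff_Suc_1 lessThan_iff)
    moreover have "det (M (n - 1)) = \<alpha> (n - 1) x"
    proof -
      have cM: "M (n - 1) \<in> carrier_mat n n" by (simp add: M_def)
      have "det (M (n - 1)) = (\<Sum>c<n. M (n - 1) $$ (n - 1, c) * cofactor (M (n - 1)) (n - 1) c)"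
        by (rule laplace_expansion_row[OF cM]) (use n in simp)
      also have "\<dots> = (\<Sum>c<n. (deriv ^^ n) (\<lambda>y. \<gamma> y $ c) x * cofactor (frame n \<gamma> x) c (n - 1))"
      proof (intro sum.cong refl arg_cong2[of _ _ _ _ "(*)"])
        fix c assume c: "c \<in> {..<n}"
        have "Suc (n - 1) = n" using n by simp
        then show "M (n - 1) $$ (n - 1, c) = (deriv ^^ n) (\<lambda>y. \<gamma> y $ c) x"
          using c n by (simp add: M_def del: funpow.simps)
        have "mat_delete (M (n - 1)) (n - 1) c = (mat_delete (frame n \<gamma> x) c (n - 1))\<^sup>T"
          using c n carrier_matD[OF frame_carrier, of n \<gamma> x] carrier_matD[OF cM]
          by (intro eq_matI) (auto simp: mat_delete_def M_def Ai frame_index)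
        moreover have "mat_delete (frame n \<gamma> x) c (n - 1) \<in> carrier_mat (n - 1) (n - 1)"
          using carrier_matD[OF frame_carrier, of n \<gamma> x] by (auto simp: mat_delete_def)
        ultimately show "cofactor (M (n - 1)) (n - 1) c = cofactor (frame n \<gamma> x) c (n - 1)"
          by (simp add: cofactor_def det_transpose add.commute)
      qed
      also have "\<dots> = \<alpha> (n - 1) x"
        unfolding \<alpha>_def using n carrier_matD[OF frame_carrier, of n \<gamma> x]
        by (intro sum.cong) (auto simp: adj_mat_def)
      finally show ?thesis .
    qed
    ultimately show ?thesis using n by simp
  qed
  show *: "is_curvature n \<gamma> a"
    unfolding is_curvature_def
  proof (intro conjI allI impI)
    fix x r assume r: "r < n"
    have "(deriv ^^ n) (\<lambda>y. \<gamma> y $ r) x = (\<Sum>i<n. \<alpha> i x * (deriv ^^ i) (\<lambda>y. \<gamma> y $ r) x)"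
      by (rule expand[OF r])
    also have "\<dots> = (\<Sum>i<n - 1. \<alpha> i x * (deriv ^^ i) (\<lambda>y. \<gamma> y $ r) x)"
      using n last by (cases n) auto
    also have "\<dots> = (\<Sum>i = 1..<n. a i x * (deriv ^^ (i - 1)) (\<lambda>y. \<gamma> y $ r) x)"
      by (rule sum.reindex_bij_witness[of _ "\<lambda>i. i - 1" Suc]) (auto simp: a_def \<alpha>_def)
    finally show "(deriv ^^ n) (\<lambda>y. \<gamma> y $ r) x = (\<Sum>i = 1..<n. a i x * (deriv ^^ (i - 1)) (\<lambda>y. \<gamma> y $ r) x)" .
  qed (auto simp: a_def)
  show "curvature n \<gamma> = a"
    by (rule curvature_eq[OF n *]) (simp add: det)
qed

definition Gf :: "nat \<Rightarrow> (real \<Rightarrow> real vec) \<Rightarrow> real \<Rightarrow> nat \<Rightarrow> nat \<Rightarrow> real" where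
  "Gf n \<gamma> x = fm n (frame n \<gamma> x)"

lemma mm_cancel_left:
  assumes "M \<in> carrier_mat n n" "det M \<noteq> 0" "mm n (fm n M) X = mm n (fm n M) Y" "r < n"
  shows "X r c = Y r c"
proof -
  note adj = adj_mat[OF assms(1)]
  have "fm n (adj_mat M * M) = mm n (fm n (adj_mat M)) (fm n M)" by (rule fm_mult[OF adj(1) assms(1)])
  then have *: "mm n (fm n (adj_mat M)) (fm n M) = fm n (det M \<cdot>\<^sub>m 1\<^sub>m n)" using adj(3) by simp
  have id: "mm n (fm n (det M \<cdot>\<^sub>m 1\<^sub>m n)) X r c = det M * X r c" for X
  proof -
    have "mm n (fm n (det M \<cdot>\<^sub>m 1\<^sub>m n)) X r c = (\<Sum>s<n. if s = r then det M * X r c else 0)"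
      unfolding mm_def using assms(4) by (intro sum.cong) (auto simp: fm_def)
    then show ?thesis using assms(4) by simp
  qed
  have "det M * X r c = det M * Y r c"
    unfolding id[symmetric] *[symmetric] mm_assoc assms(3) ..
  then show ?thesis using assms(2) by simp
qed

lemma mm_cancel_right:
  assumes "M \<in> carrier_mat n n" "det M \<noteq> 0" "mm n X (fm n M) = mm n Y (fm n M)" "c < n"
  shows "X r c = Y r c"
proof -
  note adj = adj_mat[OF assms(1)]
  have "fm n (M * adj_mat M) = mm n (fm n M) (fm n (adj_mat M))" by (rule fm_mult[OF assms(1) adj(1)])
  then have *: "mm n (fm n M) (fm n (adj_mat M)) = fm n (det M \<cdot>\<^sub>m 1\<^sub>m n)" using adj(2) by simp
  have id: "mm n X (fm n (det M \<cdot>\<^sub>m 1\<^sub>m n)) r c = det M * X r c" for X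
  proof -
    have "mm n X (fm n (det M \<cdot>\<^sub>m 1\<^sub>m n)) r c = (\<Sum>s<n. if s = c then det M * X r c else 0)"
      unfolding mm_def using assms(4) by (intro sum.cong) (auto simp: fm_def)
    then show ?thesis using assms(4) by simp
  qed
  have "det M * X r c = det M * Y r c"
    unfolding id[symmetric] *[symmetric] mm_assoc[symmetric] assms(3) ..
  then show ?thesis using assms(2) by simp
qed

lemma Gf_column: "Suc c < n \<Longrightarrow> r < n \<Longrightarrow> deriv (\<lambda>y. Gf n \<gamma> y r c) x = Gf n \<gamma> x r (Suc c)"
  by (simp add: Gf_def fm_def frame_index)

lemma dmat_Gf:
  assumes n: "n \<ge> 2" and u: "is_curvature n \<gamma> u"
  shows "dmat (Gf n \<gamma>) x = mm n (Gf n \<gamma> x) (B_mat n (\<lambda>i. u i x) 0)"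
proof (intro ext)
  fix r c
  show "dmat (Gf n \<gamma>) x r c = mm n (Gf n \<gamma> x) (B_mat n (\<lambda>i. u i x) 0) r c"
  proof (cases "r < n \<and> c < n")
    case True
    show ?thesis
    proof (cases "Suc c < n")
      case True
      then show ?thesis using \<open>r < n \<and> c < n\<close> by (simp add: dmat_def Gf_column mm_B_right)
    next
      case False
      then have c: "Suc c = n" using True by simp
      have "dmat (Gf n \<gamma>) x r c = (deriv ^^ n) (\<lambda>y. \<gamma> y $ r) x"
        using True c by (simp add: dmat_def Gf_def fm_def frame_index) (use c in auto)
      also have "\<dots> = (\<Sum>i = 1..<n. u i x * (deriv ^^ (i - 1)) (\<lambda>y. \<gamma> y $ r) x)"
        using u True by (simp add: is_curvature_def)
      also have "\<dots> = (\<Sum>s<n - 1. Gf n \<gamma> x r s * u (Suc s) x)"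
        by (rule sum.reindex_bij_witness[of _ Suc "\<lambda>i. i - 1"]) (use True in \<open>auto simp: Gf_def fm_def frame_index\<close>)
      also have "\<dots> = mm n (Gf n \<gamma> x) (B_mat n (\<lambda>i. u i x) 0) r c"
        unfolding mm_def by (rule sum.mono_neutral_cong_left) (use c n in \<open>auto simp: B_mat_def\<close>)
      finally show ?thesis .
    qed
  next
    case False
    then show ?thesis by (auto simp: dmat_def Gf_def fm_def mm_def B_mat_outside)
  qed
qed

section \<open>The transformation of a flow\<close>

lemma mult_unit_vec_index:
  fixes A :: "real mat"
  assumes "A \<in> carrier_mat n n" "r < n" "0 < n"
  shows "(A *\<^sub>v unit_vec n 0) $ r = A $$ (r, 0)"
  using assms by (simp add: scalar_prod_right_unit)

lemma mat_inv_props: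
  assumes A: "A \<in> carrier_mat n n" and det: "det A \<noteq> 0"
  shows "mat_inv A \<in> carrier_mat n n" "A * mat_inv A = 1\<^sub>m n" "mat_inv A * A = 1\<^sub>m n"
    "adj_mat A = det A \<cdot>\<^sub>m mat_inv A"
proof -
  have "A \<in> Units (ring_mat TYPE(real) n ())" by (rule det_non_zero_imp_unit[OF A det])
  then have "mat_inverse A \<noteq> None" using mat_inverse(1)[OF A, where b = "()"] by blast
  then have "mat_inverse A = Some (mat_inv A)" by (auto simp: mat_inv_def)
  from mat_inverse(2)[OF A this] show *: "mat_inv A \<in> carrier_mat n n" "A * mat_inv A = 1\<^sub>m n" "mat_inv A * A = 1\<^sub>m n"
    by auto
  note adj = adj_mat[OF A]
  have "adj_mat A = (mat_inv A * A) * adj_mat A" using *(3) left_mult_one_mat[OF adj(1)] by simp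
  also have "\<dots> = mat_inv A * (A * adj_mat A)" by (rule assoc_mult_mat[OF *(1) A adj(1)])
  also have "\<dots> = det A \<cdot>\<^sub>m mat_inv A"
    unfolding adj(2) using mult_smult_distrib[OF *(1) one_carrier_mat] right_mult_one_mat[OF *(1)] by simp
  finally show "adj_mat A = det A \<cdot>\<^sub>m mat_inv A" .
qed

text \<open>Zeros propagate upwards from the last entry, because row r of the system contains entry
  r - 1. This is applied to the difference between the time derivative of w and its expected
  value.\<close>

lemma mv_eq_zero:
  assumes n: "n \<ge> 1" and last: "\<And>x. v x (n - 1) = 0"
    and eq: "\<And>x r. r < n \<Longrightarrow> deriv (\<lambda>y. v y r) x + mv n (B_mat n (u x) k) (v x) r + h x * v x r = 0"
  shows "r < n \<Longrightarrow> v x r = (0 :: real)"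
proof -
  have "m < n \<Longrightarrow> v x (n - Suc m) = 0" for m x
  proof (induction m arbitrary: x)
    case 0
    then show ?case using last by simp
  next
    case (Suc m)
    define r where "r = n - Suc m"
    have r: "r < n" "r > 0" "n - Suc (Suc m) = r - 1" using Suc.prems by (auto simp: r_def)
    have z: "v y r = 0" for y by (rule Suc.IH[OF Suc_lessD[OF Suc.prems], folded r_def])
    have "v x (r - 1) = 0"
      using eq[OF r(1), of x] r(2) unfolding mv_B[OF r(1)] last z by (auto split: if_splits)
    then show ?case unfolding r(3) .
  qed
  from this[of "n - Suc r"] show "r < n \<Longrightarrow> v x r = 0" by (simp add: Suc_diff_Suc)
qed

lemma Z_w_last:
  assumes "n \<ge> 1" "Z_at n j u l y \<in> carrier_mat n n"
  shows "(Z_at n j u l y *\<^sub>v w_vec n u h y) $ (n - 1) = mv n (Zf n j u l y) (wv n u h y) (n - 1)"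
proof -
  note c = carrier_matD[OF assms(2)]
  have "(Z_at n j u l y *\<^sub>v w_vec n u h y) $ (n - 1) = (\<Sum>s<n. Z_at n j u l y $$ (n - 1, s) * w_fun n u h (Suc s) y)"
    using assms(1) c by (simp add: scalar_prod_def w_vec_def lessThan_atLeast0)
  also have "\<dots> = mv n (Zf n j u l y) (wv n u h y) (n - 1)"
    unfolding mv_def using assms(1) by (intro sum.cong) (auto simp: Zf_def fm_def wv_def)
  finally show ?thesis .
qed

section \<open>Notation for a curve and its transform\<close>

context
  fixes n j :: nat and \<gamma> :: "real \<Rightarrow> real \<Rightarrow> real vec"
begin

definition uc :: "real \<Rightarrow> nat \<Rightarrow> real \<Rightarrow> real" where
  "uc t = curvature n (\<lambda>x. \<gamma> x t)"

definition Gt :: "real \<Rightarrow> real \<Rightarrow> nat \<Rightarrow> nat \<Rightarrow> real" where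
  "Gt t x = Gf n (\<lambda>y. \<gamma> y t) x"

definition Bt :: "real \<Rightarrow> real \<Rightarrow> real \<Rightarrow> nat \<Rightarrow> nat \<Rightarrow> real" where
  "Bt l t x = B_mat n (\<lambda>i. uc t i x) l"

definition Zt :: "real \<Rightarrow> real \<Rightarrow> real \<Rightarrow> nat \<Rightarrow> nat \<Rightarrow> real" where
  "Zt l t x = Zf n j (uc t) l x"

text \<open>The commutator of \<partial> + b + u with Z at \<lambda> = 0, hence at every \<lambda>;
  for a solution of the flow it is the time derivative of b + u.\<close>

definition Nt :: "real \<Rightarrow> real \<Rightarrow> nat \<Rightarrow> nat \<Rightarrow> real" where
  "Nt t x = dmat (Zt 0 t) x + mm n (Bt 0 t x) (Zt 0 t x) - mm n (Zt 0 t x) (Bt 0 t x)"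

context
  fixes h :: "real \<Rightarrow> real \<Rightarrow> real"
begin

definition Wt :: "real \<Rightarrow> real \<Rightarrow> nat \<Rightarrow> real" where
  "Wt t x = wv n (uc t) (\<lambda>y. h y t) x"

definition Ft :: "real \<Rightarrow> real \<Rightarrow> nat \<Rightarrow> nat \<Rightarrow> real" where
  "Ft t x = Ff n (uc t) (\<lambda>y. h y t) x"

definition Btt :: "real \<Rightarrow> real \<Rightarrow> real \<Rightarrow> nat \<Rightarrow> nat \<Rightarrow> real" where
  "Btt l t x = B_mat n (\<lambda>i. star_u n (\<lambda>y. h y t) (uc t) i x) l"

definition Ztt :: "real \<Rightarrow> real \<Rightarrow> real \<Rightarrow> nat \<Rightarrow> nat \<Rightarrow> real" where
  "Ztt l t x = Zf n j (star_u n (\<lambda>y. h y t) (uc t)) l x"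

text \<open>The scalar c in the evolution w_t = c w - Z(k) w, where it keeps the last entry of w
  equal to 1. The time part of the transformation then reads h_t = -c_x.\<close>

definition ct :: "real \<Rightarrow> real \<Rightarrow> real \<Rightarrow> real" where
  "ct k t x = mv n (Zt k t x) (Wt t x) (n - 1)"

context
  fixes d :: "real mat"
begin

definition bt_frame :: "real \<Rightarrow> real \<Rightarrow> real mat" where
  "bt_frame x t = d * frame n (\<lambda>y. \<gamma> y t) x * mat_inv (f_mat n (uc t) (\<lambda>y. h y t) x 0)"

definition Kt :: "real \<Rightarrow> real \<Rightarrow> nat \<Rightarrow> nat \<Rightarrow> real" where
  "Kt t x = fm n (bt_frame x t)"

definition bt_curve :: "real \<Rightarrow> real \<Rightarrow> real vec" where
  "bt_curve x t = bt_frame x t *\<^sub>v unit_vec n 0"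

end

end

section \<open>Evolution of the frame and of the curvature\<close>

context
  fixes T :: "real set"
  assumes n: "n \<ge> 2" and T: "open T" and sol: "curve_flow_solution n j T \<gamma>"
begin

lemma curve_t: "t \<in> T \<Longrightarrow> (\<lambda>x. \<gamma> x t) \<in> central_affine_curves n"
  using sol by (simp add: curve_flow_solution_def)

lemma det_frame_t: "t \<in> T \<Longrightarrow> det (frame n (\<lambda>x. \<gamma> x t) x) = 1"
  using curve_t by (simp add: central_affine_curves_def)

lemma is_curvature_t: "t \<in> T \<Longrightarrow> is_curvature n (\<lambda>x. \<gamma> x t) (uc t)"
  using curvature_adj[OF n curve_t] by (simp add: uc_def)

lemma smooth2_comp:
  assumes "r < n"
  shows "smooth2 T (\<lambda>x t. (deriv ^^ c) (\<lambda>y. \<gamma> y t $ r) x)"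
proof (rule smooth2_funpow_dx[OF T])
  show "smooth2 T (\<lambda>x t. \<gamma> x t $ r)" using sol assms by (simp add: curve_flow_solution_def)
qed

lemma smooth2_frame: "r < n \<Longrightarrow> c < n \<Longrightarrow> smooth2 T (\<lambda>x t. frame n (\<lambda>y. \<gamma> y t) x $$ (r, c))"
  by (simp only: frame_index) (rule smooth2_comp)

lemma smooth2_Gt: "smooth2 T (\<lambda>x t. Gt t x r c)"
proof (cases "r < n \<and> c < n")
  case True
  then show ?thesis using smooth2_frame[of r c] by (simp add: Gt_def Gf_def fm_def)
next
  case False
  then have "(\<lambda>x t. Gt t x r c) = (\<lambda>x t. 0)" by (auto simp: Gt_def Gf_def fm_def)
  then show ?thesis using smooth2_const[OF T, of 0] by simp
qed

text \<open>A definite description carries no joint smoothness by itself. Through the adjugate of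
  the frame, whose determinant is 1, the curvature becomes a polynomial in x-derivatives of
  \<gamma>.\<close>

lemma smooth2_uc: "smooth2 T (\<lambda>x t. uc t i x)"
proof (rule smooth2_cong[OF T])
  let ?a = "\<lambda>x t. if i \<in> {1..<n} then
      (\<Sum>r<n. adj_mat (frame n (\<lambda>y. \<gamma> y t) x) $$ (i - 1, r) * (deriv ^^ n) (\<lambda>y. \<gamma> y t $ r) x) else 0"
  show "?a x t = uc t i x" if "t \<in> T" for x t
    using curvature_adj(2)[OF n curve_t[OF that]] by (simp add: uc_def)
  show "smooth2 T ?a"
  proof (cases "i \<in> {1..<n}")
    case True
    then have "smooth2 T (\<lambda>x t. \<Sum>r<n. adj_mat (frame n (\<lambda>y. \<gamma> y t) x) $$ (i - 1, r) * (deriv ^^ n) (\<lambda>y. \<gamma> y t $ r) x)"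
      by (intro smooth2_sum[OF T] smooth2_mult[OF T] smooth2_adj_mat[OF T, where n = n] smooth2_frame smooth2_comp) auto
    then show ?thesis using True by simp
  next
    case False
    then show ?thesis using smooth2_const[OF T, of 0] by (simp only: if_False)
  qed
qed

lemma smooth_u_t: "t \<in> T \<Longrightarrow> smooth_u n (uc t)"
  using smooth2_slice[OF T smooth2_uc] by blast

lemma dmat_Gt: "t \<in> T \<Longrightarrow> dmat (Gt t) x = mm n (Gt t x) (Bt 0 t x)"
  using dmat_Gf[OF n is_curvature_t, of t x] by (simp add: Gt_def[abs_def] Bt_def)

lemma Gt_DERIV_x:
  assumes t: "t \<in> T"
  shows "((\<lambda>y. Gt t y r c) has_real_derivative mm n (Gt t x) (Bt 0 t x) r c) (at x)"
proof -
  have "deriv (\<lambda>y. Gt t y r c) x = mm n (Gt t x) (Bt 0 t x) r c"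
    using fun_cong[OF fun_cong[OF dmat_Gt[OF t, of x], of r], of c] by (simp add: dmat_def)
  then show ?thesis using smooth2_DERIV_x[OF T smooth2_Gt t, of r c x] by simp
qed

lemma smooth_Zt: "t \<in> T \<Longrightarrow> smooth_mat (Zt l t)"
  unfolding Zt_def[abs_def] by (rule Zf_smooth[OF n smooth_u_t])

lemma Zt_DERIV_x: "t \<in> T \<Longrightarrow> ((\<lambda>y. Zt l t y r c) has_real_derivative dmat (Zt l t) x r c) (at x)"
  unfolding dmat_def using smooth_Zt by (intro smooth_has_deriv[of UNIV]) auto

lemma Nt_eq: "t \<in> T \<Longrightarrow> dmat (Zt l t) x + mm n (Bt l t x) (Zt l t x) - mm n (Zt l t x) (Bt l t x) = Nt t x"
  unfolding Nt_def Zt_def[abs_def] Bt_def by (rule Zf_commutator[OF n smooth_u_t])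

lemma Nt_outside: "\<not> (r < n \<and> c < n) \<Longrightarrow> Nt t x r c = 0"
  unfolding Nt_def
  using mm_outside[of n "Bt 0 t x" "Zt 0 t x" r c] mm_outside[of n "Zt 0 t x" "Bt 0 t x" r c]
  by (simp add: dmat_def Zt_def Bt_def Zf_outside B_mat_outside)

text \<open>Column 0 is the flow itself. Each further column is the x-derivative of the previous
  one: exchange the two derivatives and use g_x = g (b + u) together with
  \<open>Zf_column\<close>.\<close>

lemma Gt_DERIV_t:
  assumes t: "t \<in> T"
  shows "((\<lambda>s. Gt s x r c) has_real_derivative mm n (Gt t x) (Zt 0 t x) r c) (at t)"
proof (cases "r < n \<and> c < n")
  case False
  then have "mm n (Gt t x) (Zt 0 t x) r c = 0"
    by (intro mm_outside) (auto simp: Gt_def Gf_def fm_def Zt_def Zf_outside)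
  moreover have "(\<lambda>s. Gt s x r c) = (\<lambda>s. 0)" using False by (auto simp: Gt_def Gf_def fm_def)
  ultimately show ?thesis by simp
next
  case True
  then have r: "r < n" by simp
  have "c < n \<Longrightarrow> ((\<lambda>s. Gt s x r c) has_real_derivative mm n (Gt t x) (Zt 0 t x) r c) (at t)" for c x
  proof (induction c arbitrary: x)
    case 0
    let ?M = "frame n (\<lambda>x. \<gamma> x t) x * Z_at n j (uc t) 0 x"
    have cZ: "Z_at n j (uc t) 0 x \<in> carrier_mat n n" by (rule Z_at_carrier[OF n smooth_u_t[OF t]])
    have "((\<lambda>s. \<gamma> x s $ r) has_real_derivative (?M *\<^sub>v unit_vec n 0) $ r) (at t)"
      using sol t r by (simp add: curve_flow_solution_def uc_def)
    moreover have "(?M *\<^sub>v unit_vec n 0) $ r = fm n ?M r 0"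
      using mult_unit_vec_index[OF mult_carrier_mat[OF frame_carrier cZ] r] 0 r by (simp add: fm_def)
    moreover have "fm n ?M = mm n (Gt t x) (Zt 0 t x)"
      unfolding fm_mult[OF frame_carrier cZ] by (simp add: Gt_def Gf_def Zt_def Zf_def)
    moreover have "(\<lambda>s. Gt s x r 0) = (\<lambda>s. \<gamma> x s $ r)"
      using 0 r by (simp add: Gt_def Gf_def fm_def frame_index)
    ultimately show ?case by simp
  next
    case (Suc c)
    have IH: "deriv (\<lambda>s. Gt s y r c) t = mm n (Gt t y) (Zt 0 t y) r c" for y
      using Suc.IH[of y] Suc.prems DERIV_imp_deriv by auto
    have "(\<lambda>s. Gt s x r (Suc c)) = (\<lambda>s. deriv (\<lambda>y. Gt s y r c) x)"
      using Suc.prems r by (auto simp: Gt_def Gf_column)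
    moreover have "((\<lambda>s. deriv (\<lambda>y. Gt s y r c) x) has_real_derivative
        deriv (\<lambda>y. deriv (\<lambda>s. Gt s y r c) t) x) (at t)"
      by (rule smooth2_mixed[OF T smooth2_Gt t])
    moreover have "deriv (\<lambda>y. deriv (\<lambda>s. Gt s y r c) t) x = mm n (Gt t x) (Zt 0 t x) r (Suc c)"
    proof -
      have "((\<lambda>y. mm n (Gt t y) (Zt 0 t y) r c) has_real_derivative
          mm n (mm n (Gt t x) (Bt 0 t x)) (Zt 0 t x) r c + mm n (Gt t x) (dmat (Zt 0 t) x) r c) (at x)"
        by (intro DERIV_mm Gt_DERIV_x Zt_DERIV_x t)
      from DERIV_imp_deriv[OF this]
      have "deriv (\<lambda>y. deriv (\<lambda>s. Gt s y r c) t) x =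
          mm n (Gt t x) (mm n (Bt 0 t x) (Zt 0 t x) + dmat (Zt 0 t) x) r c"
        unfolding IH by (simp add: mm_assoc mm_add_right)
      also have "\<dots> = mm n (Gt t x) (Zt 0 t x) r (Suc c)"
        unfolding mm_def[of n "Gt t x"]
      proof (intro sum.cong refl)
        fix s assume "s \<in> {..<n}"
        then show "Gt t x r s * (mm n (Bt 0 t x) (Zt 0 t x) + dmat (Zt 0 t) x) s c = Gt t x r s * Zt 0 t x s (Suc c)"
          using Zf_column[OF n smooth_u_t[OF t], of c s j 0 x] Suc.prems
          by (simp add: Zt_def[abs_def] Bt_def dmat_def)
      qed
      finally show ?thesis .
    qed
    ultimately show ?case by simp
  qed
  then show ?thesis using True by simp
qed

text \<open>Zero curvature: g_xt = g_tx with g_x = g (b + u) and g_t = g Z leaves the commutator of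
  \<partial> + b + u with Z once the invertible g is cancelled. The \<lambda>-term is constant in t,
  so every l is covered.\<close>

lemma Bt_DERIV_t:
  assumes t: "t \<in> T"
  shows "((\<lambda>s. Bt l s x r c) has_real_derivative Nt t x r c) (at t)"
proof -
  define B' where "B' r c = (if r < n \<and> c < n \<and> c = n - 1 \<and> r < n - 1 then deriv (\<lambda>s. uc s (Suc r) x) t else 0)" for r c
  have B': "((\<lambda>s. Bt l s x r c) has_real_derivative B' r c) (at t)" for r c l
  proof (cases "r < n \<and> c < n \<and> c = n - 1 \<and> r < n - 1")
    case True
    then have "(\<lambda>s. Bt l s x r c) = (\<lambda>s. B_mat n (\<lambda>i. 0) l r c + uc s (Suc r) x)"
      by (auto simp: Bt_def B_mat_def)
    moreover have "((\<lambda>s. B_mat n (\<lambda>i. 0) l r c + uc s (Suc r) x) has_real_derivative 0 + deriv (\<lambda>s. uc s (Suc r) x) t) (at t)"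
      by (intro DERIV_add DERIV_const smooth2_DERIV_t[OF T smooth2_uc t])
    ultimately show ?thesis using True by (simp add: B'_def)
  next
    case False
    then have "(\<lambda>s. Bt l s x r c) = (\<lambda>s. B_mat n (\<lambda>i. 0) l r c)"
      by (auto simp: Bt_def B_mat_def)
    then show ?thesis using False by (auto simp: B'_def)
  qed
  have "mm n (Gt t x) (B' + mm n (Zt 0 t x) (Bt 0 t x)) = mm n (Gt t x) (dmat (Zt 0 t) x + mm n (Bt 0 t x) (Zt 0 t x))"
  proof (intro ext)
    fix r c
    have 1: "((\<lambda>s. mm n (Gt s x) (Bt 0 s x) r c) has_real_derivative
        mm n (mm n (Gt t x) (Zt 0 t x)) (Bt 0 t x) r c + mm n (Gt t x) B' r c) (at t)"
      by (intro DERIV_mm Gt_DERIV_t B' t)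
    have 2: "((\<lambda>y. mm n (Gt t y) (Zt 0 t y) r c) has_real_derivative
        mm n (mm n (Gt t x) (Bt 0 t x)) (Zt 0 t x) r c + mm n (Gt t x) (dmat (Zt 0 t) x) r c) (at x)"
      by (intro DERIV_mm Gt_DERIV_x Zt_DERIV_x t)
    have 3: "((\<lambda>s. deriv (\<lambda>y. Gt s y r c) x) has_real_derivative deriv (\<lambda>y. deriv (\<lambda>s. Gt s y r c) t) x) (at t)"
      by (rule smooth2_mixed[OF T smooth2_Gt t])
    have 4: "deriv (\<lambda>y. deriv (\<lambda>s. Gt s y r c) t) x =
        mm n (mm n (Gt t x) (Bt 0 t x)) (Zt 0 t x) r c + mm n (Gt t x) (dmat (Zt 0 t) x) r c"
      using DERIV_imp_deriv[OF 2] unfolding DERIV_imp_deriv[OF Gt_DERIV_t[OF t]] .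
    have "((\<lambda>s. mm n (Gt s x) (Bt 0 s x) r c) has_real_derivative deriv (\<lambda>y. deriv (\<lambda>s. Gt s y r c) t) x) (at t)"
    proof (rule has_field_derivative_transform_within_open[OF 3 T t])
      show "deriv (\<lambda>y. Gt s y r c) x = mm n (Gt s x) (Bt 0 s x) r c" if "s \<in> T" for s
        by (rule DERIV_imp_deriv[OF Gt_DERIV_x[OF that]])
    qed
    from DERIV_unique[OF 1 this]
    show "mm n (Gt t x) (B' + mm n (Zt 0 t x) (Bt 0 t x)) r c = mm n (Gt t x) (dmat (Zt 0 t) x + mm n (Bt 0 t x) (Zt 0 t x)) r c"
      unfolding 4 by (simp add: mm_add_right mm_assoc)
  qed
  from mm_cancel_left[OF frame_carrier _ this[unfolded Gt_def Gf_def], of r c]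
  have "r < n \<Longrightarrow> B' r c = Nt t x r c"
    using det_frame_t[OF t, of x] by (simp add: Nt_def)
  moreover have "\<not> r < n \<Longrightarrow> B' r c = Nt t x r c"
    using Nt_outside[of r c t x] by (simp add: B'_def)
  ultimately show ?thesis using B'[of l r c] by metis
qed

section \<open>Evolution of w\<close>

context
  fixes k :: real and h :: "real \<Rightarrow> real \<Rightarrow> real"
  assumes BT: "BT_solution n j T (\<lambda>t. curvature n (\<lambda>x. \<gamma> x t)) k h"
begin

lemma smooth2_h: "smooth2 T h"
  using BT by (simp add: BT_solution_def)

lemma smooth_h_t: "t \<in> T \<Longrightarrow> smooth_fun_on UNIV (\<lambda>y. h y t)"
  by (rule smooth2_slice[OF T smooth2_h])

lemma BT_x_t: "t \<in> T \<Longrightarrow> BT_x n (uc t) (\<lambda>y. h y t) k"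
  using BT by (auto simp: BT_solution_def uc_def BT_x_def)

lemma smooth2_w_rec: "m < n \<Longrightarrow> smooth2 T (\<lambda>x t. w_rec n (uc t) (\<lambda>y. h y t) m x)"
proof (induction m)
  case 0
  then show ?case using smooth2_const[OF T] by simp
next
  case (Suc m)
  show ?case
  proof (cases m)
    case 0
    then show ?thesis using smooth2_minus[OF T smooth2_h] by simp
  next
    case (Suc p)
    have IH: "smooth2 T (\<lambda>x t. w_rec n (uc t) (\<lambda>y. h y t) m x)" using Suc.IH Suc.prems by simp
    have "smooth2 T (\<lambda>x t. - deriv (\<lambda>y. w_rec n (uc t) (\<lambda>y. h y t) m y) x
        - h x t * w_rec n (uc t) (\<lambda>y. h y t) m x - uc t (n - Suc p) x)"
      by (intro smooth2_sub[OF T] smooth2_minus[OF T] smooth2_mult[OF T] smooth2_dx[OF T] IH smooth2_h smooth2_uc)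
    then show ?thesis using Suc by simp
  qed
qed

lemma smooth2_w_fun: "i \<ge> 1 \<Longrightarrow> smooth2 T (\<lambda>x t. w_fun n (uc t) (\<lambda>y. h y t) i x)"
  unfolding w_fun_def using n by (intro smooth2_w_rec) auto

lemma smooth2_Wt: "smooth2 T (\<lambda>x t. Wt h t x r)"
  using smooth2_w_fun[of "Suc r"] smooth2_const[OF T, of 0] by (cases "r < n") (simp_all add: Wt_def wv_def)

lemma Wt_last: "Wt h t x (n - 1) = 1"
  using n by (simp add: Wt_def wv_def w_fun_n)

lemma Wt_eq:
  assumes t: "t \<in> T"
  shows "deriv (\<lambda>y. Wt h t y r) x + mv n (Bt k t x) (Wt h t x) r + h x t * Wt h t x r = 0"
  using wv_eq[OF n smooth_u_t[OF t] smooth_h_t[OF t] BT_x_t[OF t], of r x]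
  by (simp add: Wt_def Bt_def)

lemma Wt_DERIV_x:
  assumes t: "t \<in> T"
  shows "((\<lambda>y. Wt h t y r) has_real_derivative - mv n (Bt k t x) (Wt h t x) r - h x t * Wt h t x r) (at x)"
proof -
  have "deriv (\<lambda>y. Wt h t y r) x = - mv n (Bt k t x) (Wt h t x) r - h x t * Wt h t x r"
    using Wt_eq[OF t, of r x] by simp
  then show ?thesis using smooth2_DERIV_x[OF T smooth2_Wt t, of r x] by simp
qed

lemma smooth_ct: "t \<in> T \<Longrightarrow> smooth_fun_on UNIV (ct h k t)"
  unfolding ct_def
  by (intro smooth_mv smooth_Zt smooth2_slice[OF T smooth2_Wt])

lemma h_DERIV_t:
  assumes t: "t \<in> T"
  shows "((\<lambda>s. h x s) has_real_derivative - deriv (ct h k t) x) (at t)"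
proof -
  have "(Z_at n j (uc t) k y *\<^sub>v w_vec n (uc t) (\<lambda>z. h z t) y) $ (n - 1) = ct h k t y" for y
    using Z_w_last[OF _ Z_at_carrier[OF n smooth_u_t[OF t]]] n by (simp add: ct_def Zt_def Wt_def)
  then have "(\<lambda>y. (Z_at n j (uc t) k y *\<^sub>v w_vec n (uc t) (\<lambda>z. h z t) y) $ (n - 1)) = ct h k t" by blast
  then show ?thesis using BT t unfolding BT_solution_def uc_def[symmetric] by auto
qed

text \<open>The defect v = w_t + Z(k) w - c w solves the same linear x-system as w, because u_t is
  the commutator with Z(k) and h_t = -c_x. Its last entry is 0 by the choice of c, so v
  vanishes.\<close>

lemma Wt_DERIV_t:
  assumes t: "t \<in> T"
  shows "((\<lambda>s. Wt h s x r) has_real_derivative ct h k t x * Wt h t x r - mv n (Zt k t x) (Wt h t x) r) (at t)"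
proof -
  define w' where "w' x r = deriv (\<lambda>s. Wt h s x r) t" for x r
  have w': "((\<lambda>s. Wt h s x r) has_real_derivative w' x r) (at t)" for x r
    unfolding w'_def by (rule smooth2_DERIV_t[OF T smooth2_Wt t])
  define v where "v x r = w' x r + mv n (Zt k t x) (Wt h t x) r - ct h k t x * Wt h t x r" for x r
  have last: "v x (n - 1) = 0" for x
  proof -
    have "w' x (n - 1) = 0" unfolding w'_def Wt_last by simp
    then show ?thesis unfolding v_def ct_def Wt_last by simp
  qed
  have ZW: "((\<lambda>y. mv n (Zt k t y) (Wt h t y) r) has_real_derivative
      mv n (dmat (Zt k t) x) (Wt h t x) r + mv n (Zt k t x) (\<lambda>r. - mv n (Bt k t x) (Wt h t x) r - h x t * Wt h t x r) r) (at x)" for x r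
    by (intro DERIV_mv Zt_DERIV_x Wt_DERIV_x t)
  have c': "(ct h k t has_real_derivative deriv (ct h k t) x) (at x)" for x
    by (rule smooth_has_deriv[OF smooth_ct[OF t] UNIV_I])
  have "deriv (\<lambda>y. v y r) x + mv n (Bt k t x) (v x) r + h x t * v x r = 0" for x r
  proof -
    let ?W = "Wt h t x" and ?B = "Bt k t x" and ?Z = "Zt k t x"
    have wx: "((\<lambda>y. w' y r) has_real_derivative deriv (\<lambda>y. w' y r) x) (at x)"
      unfolding w'_def by (rule smooth2_DERIV_x[OF T smooth2_dt[OF T smooth2_Wt] t])
    have "((\<lambda>s. - mv n (Bt k s x) (Wt h s x) r - h x s * Wt h s x r) has_real_derivative
        - (mv n (Nt t x) ?W r + mv n ?B (w' x) r) - (h x t * w' x r + (- deriv (ct h k t) x) * ?W r)) (at t)"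
      by (intro DERIV_diff DERIV_minus DERIV_mv DERIV_mult' Bt_DERIV_t w' h_DERIV_t t)
    moreover have "((\<lambda>s. - mv n (Bt k s x) (Wt h s x) r - h x s * Wt h s x r) has_real_derivative deriv (\<lambda>y. w' y r) x) (at t)"
    proof -
      have 3: "((\<lambda>s. deriv (\<lambda>y. Wt h s y r) x) has_real_derivative deriv (\<lambda>y. w' y r) x) (at t)"
        unfolding w'_def by (rule smooth2_mixed[OF T smooth2_Wt t])
      show ?thesis
      proof (rule has_field_derivative_transform_within_open[OF 3 T t])
        show "deriv (\<lambda>y. Wt h s y r) x = - mv n (Bt k s x) (Wt h s x) r - h x s * Wt h s x r" if "s \<in> T" for s
          by (rule DERIV_imp_deriv[OF Wt_DERIV_x[OF that]])
      qed
    qed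
    ultimately have 1: "deriv (\<lambda>y. w' y r) x =
        - (mv n (Nt t x) ?W r + mv n ?B (w' x) r) - (h x t * w' x r + (- deriv (ct h k t) x) * ?W r)"
      by (rule DERIV_unique[rotated])
    have "((\<lambda>y. v y r) has_real_derivative deriv (\<lambda>y. w' y r) x
        + (mv n (dmat (Zt k t) x) ?W r + mv n ?Z (\<lambda>r. - mv n ?B ?W r - h x t * ?W r) r)
        - (ct h k t x * (- mv n ?B ?W r - h x t * ?W r) + deriv (ct h k t) x * ?W r)) (at x)"
      unfolding v_def by (intro DERIV_add DERIV_diff DERIV_mult' wx ZW c' Wt_DERIV_x t)
    from DERIV_imp_deriv[OF this]
    have 2: "deriv (\<lambda>y. v y r) x = deriv (\<lambda>y. w' y r) x
        + (mv n (dmat (Zt k t) x) ?W r + mv n ?Z (\<lambda>r. - mv n ?B ?W r - h x t * ?W r) r)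
        - (ct h k t x * (- mv n ?B ?W r - h x t * ?W r) + deriv (ct h k t) x * ?W r)" .
    have 3: "mv n ?Z (\<lambda>r. - mv n ?B ?W r - h x t * ?W r) r = - mv n ?Z (mv n ?B ?W) r - h x t * mv n ?Z ?W r"
      by (simp add: mv_def sum_subtractf sum_negf sum_distrib_left algebra_simps)
    have 4: "mv n ?B (v x) r = mv n ?B (w' x) r + mv n ?B (mv n ?Z ?W) r - ct h k t x * mv n ?B ?W r"
    proof -
      have "v x = w' x + mv n ?Z ?W - (\<lambda>r. ct h k t x * ?W r)" by (simp add: v_def fun_eq_iff)
      then show ?thesis by (simp add: mv_add_right mv_diff_right mv_scale)
    qed
    have 5: "mv n (Nt t x) ?W r = mv n (dmat (Zt k t) x) ?W r + mv n ?B (mv n ?Z ?W) r - mv n ?Z (mv n ?B ?W) r"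
      unfolding Nt_eq[OF t, of k x, symmetric] by (simp add: mv_add_left mv_diff_left mv_mm)
    show ?thesis unfolding 2 1 3 4 5 v_def[of x r] by (simp add: algebra_simps)
  qed
  then have z: "r < n \<Longrightarrow> v x r = 0"
    using mv_eq_zero[of n v "\<lambda>x i. uc t i x" k "\<lambda>x. h x t" r x] last n unfolding Bt_def by auto
  show ?thesis
  proof (cases "r < n")
    case True
    then have "w' x r = ct h k t x * Wt h t x r - mv n (Zt k t x) (Wt h t x) r" using z by (simp add: v_def)
    then show ?thesis using w'[of x r] by simp
  next
    case False
    then have "(\<lambda>s. Wt h s x r) = (\<lambda>s. 0)" "mv n (Zt k t x) (Wt h t x) r = 0" "Wt h t x r = 0"
      by (auto simp: Wt_def wv_def mv_def Zt_def Zf_outside)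
    then show ?thesis by simp
  qed
qed

lemma smooth2_star_u: "smooth2 T (\<lambda>x t. star_u n (\<lambda>y. h y t) (uc t) i x)"
proof (cases "i \<in> {1..<n}")
  case True
  have "smooth2 T (\<lambda>x t. uc t i x + (deriv (w_fun n (uc t) (\<lambda>y. h y t) i) x
     - (\<Sum>m = i+1..n. real ((m - 1) choose (i - 1)) * w_fun n (uc t) (\<lambda>y. h y t) m x * (deriv ^^ (m - i)) (\<lambda>y. h y t) x)))"
  proof (intro smooth2_add[OF T] smooth2_sub[OF T] smooth2_sum[OF T] smooth2_mult[OF T] smooth2_const[OF T] smooth2_uc
      smooth2_funpow_dx[OF T] smooth2_h)
    show "smooth2 T (\<lambda>x t. deriv (w_fun n (uc t) (\<lambda>y. h y t) i) x)"
      using smooth2_dx[OF T smooth2_w_fun[of i]] True by simp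
    show "smooth2 T (\<lambda>x t. w_fun n (uc t) (\<lambda>y. h y t) m x)" if "m \<in> {i + 1..n}" for m
      using that by (intro smooth2_w_fun) auto
  qed
  then show ?thesis using True by (simp only: star_u_def s_fun_def if_True)
next
  case False
  then show ?thesis using smooth2_const[OF T, of 0] by (simp only: star_u_def if_False)
qed

lemma smooth2_Ft: "smooth2 T (\<lambda>x t. Ft h t x r c)"
proof -
  have B: "smooth2 T (\<lambda>x t. Btt h 0 t x r c)"
  proof (cases "r < n \<and> c < n \<and> c = n - 1 \<and> r < n - 1")
    case True
    then have "(\<lambda>x t. Btt h 0 t x r c) = (\<lambda>x t. B_mat n (\<lambda>i. 0) 0 r c + star_u n (\<lambda>y. h y t) (uc t) (Suc r) x)"
      by (auto simp: Btt_def B_mat_def)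
    then show ?thesis using smooth2_add[OF T smooth2_const[OF T] smooth2_star_u] by (simp only:)
  next
    case False
    then have "(\<lambda>x t. Btt h 0 t x r c) = (\<lambda>x t. B_mat n (\<lambda>i. 0) 0 r c)"
      by (auto simp: Btt_def B_mat_def)
    then show ?thesis using smooth2_const[OF T] by (simp only:)
  qed
  have H: "smooth2 T (\<lambda>x t. Hf n (\<lambda>y. h y t) x r c)"
  proof (cases "r \<le> c \<and> c < n")
    case True
    then show ?thesis
      using smooth2_mult[OF T smooth2_const[OF T] smooth2_funpow_dx[OF T smooth2_h]] by (simp only: Hf_def if_True simp_thms)
  next
    case False
    then show ?thesis using smooth2_const[OF T, of 0] by (simp only: Hf_def if_False)
  qed
  have "(\<lambda>x t. Ft h t x r c) = (\<lambda>x t. Btt h 0 t x r c + Hf n (\<lambda>y. h y t) x r c)"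
    by (auto simp: Ft_def Ff_def Btt_def)
  then show ?thesis using smooth2_add[OF T B H] by (simp only:)
qed

lemma fm_f_mat_t: "fm n (f_mat n (uc t) (\<lambda>y. h y t) x 0) = Ft h t x"
  by (intro ext) (simp add: fm_f_mat[OF n] Ft_def)

section \<open>The transformed frame and curve\<close>

context
  fixes d :: "real mat"
  assumes d: "d \<in> carrier_mat n n" and det_d: "det d = (-1) ^ n * k" and k: "k \<noteq> 0"
begin

lemma det_f_t: "t \<in> T \<Longrightarrow> det (f_mat n (uc t) (\<lambda>y. h y t) x 0) = (-1) ^ n * k"
  by (rule det_f_mat[OF n smooth_u_t smooth_h_t BT_x_t])

lemma det_f_nz: "t \<in> T \<Longrightarrow> det (f_mat n (uc t) (\<lambda>y. h y t) x 0) \<noteq> 0"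
  using det_f_t k by simp

lemma bt_frame_props:
  assumes t: "t \<in> T"
  shows "bt_frame h d x t \<in> carrier_mat n n" "bt_frame h d x t * f_mat n (uc t) (\<lambda>y. h y t) x 0 = d * frame n (\<lambda>y. \<gamma> y t) x"
    "det (bt_frame h d x t) = 1"
proof -
  let ?f = "f_mat n (uc t) (\<lambda>y. h y t) x 0" and ?g = "frame n (\<lambda>y. \<gamma> y t) x"
  note inv = mat_inv_props[OF f_mat_carrier det_f_nz[OF t, of x]]
  have dg: "d * ?g \<in> carrier_mat n n" using d by simp
  show c: "bt_frame h d x t \<in> carrier_mat n n" unfolding bt_frame_def by (rule mult_carrier_mat[OF dg inv(1)])
  show *: "bt_frame h d x t * ?f = d * ?g"
    unfolding bt_frame_def using assoc_mult_mat[OF dg inv(1) f_mat_carrier] inv(3) right_mult_one_mat[OF dg] by simp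
  have "det (bt_frame h d x t) * det ?f = det d * det ?g"
    using det_mult[OF c f_mat_carrier, of "uc t" "\<lambda>y. h y t" x 0] det_mult[OF d frame_carrier, of "\<lambda>y. \<gamma> y t" x] * by simp
  then show "det (bt_frame h d x t) = 1"
    using det_f_t[OF t, of x] det_frame_t[OF t, of x] det_d k by simp
qed

lemma Kt_Ft:
  assumes t: "t \<in> T"
  shows "mm n (Kt h d t x) (Ft h t x) = mm n (fm n d) (Gt t x)"
  using arg_cong[OF bt_frame_props(2)[OF t, of x], of "fm n"]
  unfolding fm_mult[OF bt_frame_props(1)[OF t] f_mat_carrier] fm_mult[OF d frame_carrier] fm_f_mat_t
  by (simp add: Kt_def Gt_def Gf_def)

lemma smooth2_Kt: "smooth2 T (\<lambda>x t. Kt h d t x r c)"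
proof (cases "r < n \<and> c < n")
  case True
  let ?f = "\<lambda>x t. f_mat n (uc t) (\<lambda>y. h y t) x 0"
  \<comment> \<open>The inverse of f is its adjugate over the constant determinant, hence polynomial
    in jointly smooth entries.\<close>
  have "smooth2 T (\<lambda>x t. \<Sum>s<n. (\<Sum>p<n. d $$ (r, p) * frame n (\<lambda>y. \<gamma> y t) x $$ (p, s)) * (adj_mat (?f x t) $$ (s, c) * (1 / ((-1) ^ n * k))))"
  proof (intro smooth2_sum[OF T] smooth2_mult[OF T] smooth2_const[OF T] smooth2_frame smooth2_adj_mat[OF T, where n = n] f_mat_carrier)
    fix r' c' assume "r' < n" "c' < n"
    then have "(\<lambda>x t. ?f x t $$ (r', c')) = (\<lambda>x t. Ft h t x r' c')"
      unfolding fm_f_mat_t[symmetric] by (simp add: fm_def)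
    then show "smooth2 T (\<lambda>x t. ?f x t $$ (r', c'))" using smooth2_Ft by (simp only:)
  qed (use True in auto)
  then show ?thesis
  proof (rule smooth2_cong[OF T, rotated])
    fix x t assume t: "t \<in> T"
    note inv = mat_inv_props[OF f_mat_carrier det_f_nz[OF t, of x]]
    have dg: "d * frame n (\<lambda>y. \<gamma> y t) x \<in> carrier_mat n n" using d by simp
    have "Kt h d t x r c = (\<Sum>s<n. (d * frame n (\<lambda>y. \<gamma> y t) x) $$ (r, s) * mat_inv (?f x t) $$ (s, c))"
      using True mat_mult_index[OF dg inv(1), of r c] by (simp add: Kt_def fm_def bt_frame_def)
    also have "\<dots> = (\<Sum>s<n. (\<Sum>p<n. d $$ (r, p) * frame n (\<lambda>y. \<gamma> y t) x $$ (p, s)) * (adj_mat (?f x t) $$ (s, c) * (1 / ((-1) ^ n * k))))"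
    proof (intro sum.cong refl arg_cong2[of _ _ _ _ "(*)"])
      fix s assume s: "s \<in> {..<n}"
      then show "(d * frame n (\<lambda>y. \<gamma> y t) x) $$ (r, s) = (\<Sum>p<n. d $$ (r, p) * frame n (\<lambda>y. \<gamma> y t) x $$ (p, s))"
        using True mat_mult_index[OF d frame_carrier, of r s] by simp
      have "adj_mat (?f x t) $$ (s, c) = (-1) ^ n * k * mat_inv (?f x t) $$ (s, c)"
        unfolding inv(4) det_f_t[OF t] using s True inv(1) by simp
      then show "mat_inv (?f x t) $$ (s, c) = adj_mat (?f x t) $$ (s, c) * (1 / ((-1) ^ n * k))"
        using k by simp
    qed
    finally show "(\<Sum>s<n. (\<Sum>p<n. d $$ (r, p) * frame n (\<lambda>y. \<gamma> y t) x $$ (p, s)) * (adj_mat (?f x t) $$ (s, c) * (1 / ((-1) ^ n * k)))) = Kt h d t x r c" ..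
  qed
next
  case False
  then have "(\<lambda>x t. Kt h d t x r c) = (\<lambda>x t. 0)" by (auto simp: Kt_def fm_def)
  then show ?thesis using smooth2_const[OF T, of 0] by simp
qed

lemma Ft_DERIV_x: "t \<in> T \<Longrightarrow> ((\<lambda>y. Ft h t y r c) has_real_derivative dmat (Ft h t) x r c) (at x)"
  unfolding dmat_def by (rule smooth2_DERIV_x[OF T smooth2_Ft])

lemma Kt_DERIV_x':
  "t \<in> T \<Longrightarrow> ((\<lambda>y. Kt h d t y r c) has_real_derivative dmat (Kt h d t) x r c) (at x)"
  unfolding dmat_def by (rule smooth2_DERIV_x[OF T smooth2_Kt])

lemma Ft_intertwine:
  assumes t: "t \<in> T"
  shows "dmat (Ft h t) x + mm n (Btt h l t x) (Ft h t x + (\<lambda>r c. l * E_mat n r c)) = mm n (Ft h t x + (\<lambda>r c. l * E_mat n r c)) (Bt l t x)"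
  using Ff_intertwine[OF n smooth_u_t[OF t] smooth_h_t[OF t] BT_x_t[OF t], of x l]
  by (simp add: Ft_def[abs_def] Btt_def Bt_def)

text \<open>Differentiate K f = d g in x and insert g_x = g (b + u) and the intertwining relation;
  cancelling the invertible f leaves the frame equation of a curve with curvature h*u.\<close>

lemma dmat_Kt:
  assumes t: "t \<in> T" and r: "c < n"
  shows "dmat (Kt h d t) x r c = mm n (Kt h d t x) (Btt h 0 t x) r c"
proof -
  have z: "Ft h t x + (\<lambda>r c. 0 * E_mat n r c) = Ft h t x" by (intro ext) simp
  have "mm n (dmat (Kt h d t) x) (Ft h t x) + mm n (Kt h d t x) (dmat (Ft h t) x) = mm n (fm n d) (mm n (Gt t x) (Bt 0 t x))"
  proof (intro ext)
    fix r c
    have 1: "((\<lambda>y. mm n (Kt h d t y) (Ft h t y) r c) has_real_derivative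
        (mm n (dmat (Kt h d t) x) (Ft h t x) r c + mm n (Kt h d t x) (dmat (Ft h t) x) r c)) (at x)"
      by (intro DERIV_mm Ft_DERIV_x Kt_DERIV_x' t)
    have "((\<lambda>y. mm n (fm n d) (Gt t y) r c) has_real_derivative
        (mm n (\<lambda>_ _. 0) (Gt t x) r c + mm n (fm n d) (mm n (Gt t x) (Bt 0 t x)) r c)) (at x)"
      by (intro DERIV_mm Gt_DERIV_x DERIV_const t)
    from DERIV_unique[OF 1[unfolded Kt_Ft[OF t]] this]
    show "(mm n (dmat (Kt h d t) x) (Ft h t x) + mm n (Kt h d t x) (dmat (Ft h t) x)) r c = mm n (fm n d) (mm n (Gt t x) (Bt 0 t x)) r c"
      by (simp add: mm_def)
  qed
  also have "\<dots> = mm n (Kt h d t x) (mm n (Ft h t x) (Bt 0 t x))"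
    unfolding mm_assoc[symmetric] Kt_Ft[OF t] ..
  also have "mm n (Ft h t x) (Bt 0 t x) = dmat (Ft h t) x + mm n (Btt h 0 t x) (Ft h t x)"
    using Ft_intertwine[OF t, of x 0] unfolding z by simp
  finally have "mm n (dmat (Kt h d t) x) (Ft h t x) + mm n (Kt h d t x) (dmat (Ft h t) x) =
      mm n (Kt h d t x) (dmat (Ft h t) x) + mm n (mm n (Kt h d t x) (Btt h 0 t x)) (Ft h t x)"
    unfolding mm_add_right mm_assoc .
  then have "mm n (dmat (Kt h d t) x) (Ft h t x) = mm n (mm n (Kt h d t x) (Btt h 0 t x)) (Ft h t x)"
    by (metis add.commute add_left_cancel)
  then have "mm n (dmat (Kt h d t) x) (fm n (f_mat n (uc t) (\<lambda>y. h y t) x 0)) =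
      mm n (mm n (Kt h d t x) (Btt h 0 t x)) (fm n (f_mat n (uc t) (\<lambda>y. h y t) x 0))"
    unfolding fm_f_mat_t .
  from mm_cancel_right[OF f_mat_carrier det_f_nz[OF t] this r] show ?thesis .
qed

lemma bt_curve_index: "t \<in> T \<Longrightarrow> r < n \<Longrightarrow> bt_curve h d x t $ r = Kt h d t x r 0"
  unfolding bt_curve_def using mult_unit_vec_index[OF bt_frame_props(1)] n by (simp add: Kt_def fm_def)

lemma bt_curve_deriv:
  assumes t: "t \<in> T" and r: "r < n"
  shows "c < n \<Longrightarrow> (deriv ^^ c) (\<lambda>y. bt_curve h d y t $ r) = (\<lambda>x. Kt h d t x r c)"
proof (induction c)
  case 0
  then show ?case using bt_curve_index[OF t r] by (simp add: fun_eq_iff)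
next
  case (Suc c)
  have "deriv (\<lambda>x. Kt h d t x r c) x = Kt h d t x r (Suc c)" for x
    using dmat_Kt[OF t, of c x r] Suc.prems r mm_B_right[of c n r "Kt h d t x"]
    by (simp add: dmat_def Btt_def)
  moreover have "(deriv ^^ c) (\<lambda>y. bt_curve h d y t $ r) = (\<lambda>x. Kt h d t x r c)" using Suc by simp
  ultimately show ?case by (intro ext) simp
qed

lemma frame_bt_curve:
  assumes t: "t \<in> T"
  shows "frame n (\<lambda>y. bt_curve h d y t) x = bt_frame h d x t"
proof (rule eq_matI)
  fix r c assume "r < dim_row (bt_frame h d x t)" "c < dim_col (bt_frame h d x t)"
  then have "r < n" "c < n" using bt_frame_props(1)[OF t, of x] by auto
  then show "frame n (\<lambda>y. bt_curve h d y t) x $$ (r, c) = bt_frame h d x t $$ (r, c)"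
    by (simp add: frame_index bt_curve_deriv[OF t] Kt_def fm_def)
qed (use bt_frame_props(1)[OF t, of x] carrier_matD[OF frame_carrier, of n "\<lambda>y. bt_curve h d y t" x] in auto)

lemma curvature_bt_curve:
  assumes t: "t \<in> T"
  shows "curvature n (\<lambda>y. bt_curve h d y t) = star_u n (\<lambda>y. h y t) (uc t)"
proof (rule curvature_eq[OF n])
  show "det (frame n (\<lambda>y. bt_curve h d y t) x) \<noteq> 0" for x
    unfolding frame_bt_curve[OF t] using bt_frame_props(3)[OF t] by simp
  show "is_curvature n (\<lambda>y. bt_curve h d y t) (star_u n (\<lambda>y. h y t) (uc t))"
    unfolding is_curvature_def
  proof (intro conjI allI impI)
    fix x r assume r: "r < n"
    have "Suc (n - 1) = n" using n by simp
    then have "(deriv ^^ n) (\<lambda>y. bt_curve h d y t $ r) x = deriv ((deriv ^^ (n - 1)) (\<lambda>y. bt_curve h d y t $ r)) x"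
      by (metis funpow.simps(2) o_apply)
    also have "\<dots> = dmat (Kt h d t) x r (n - 1)"
      using bt_curve_deriv[OF t r, of "n - 1"] n by (simp add: dmat_def)
    also have "\<dots> = mm n (Kt h d t x) (Btt h 0 t x) r (n - 1)"
      by (rule dmat_Kt[OF t]) (use n in simp)
    also have "\<dots> = (\<Sum>s<n - 1. Kt h d t x r s * star_u n (\<lambda>y. h y t) (uc t) (Suc s) x)"
      unfolding mm_def Btt_def by (rule sum.mono_neutral_cong_right) (use n in \<open>auto simp: B_mat_def\<close>)
    also have "\<dots> = (\<Sum>i = 1..<n. star_u n (\<lambda>y. h y t) (uc t) i x * (deriv ^^ (i - 1)) (\<lambda>y. bt_curve h d y t $ r) x)"
      by (rule sum.reindex_bij_witness[of _ "\<lambda>i. i - 1" Suc]) (auto simp: bt_curve_deriv[OF t r])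
    finally show "(deriv ^^ n) (\<lambda>y. bt_curve h d y t $ r) x =
        (\<Sum>i = 1..<n. star_u n (\<lambda>y. h y t) (uc t) i x * (deriv ^^ (i - 1)) (\<lambda>y. bt_curve h d y t $ r) x)" .
  qed (auto simp: star_u_def)
qed

lemma Zt_gauge:
  assumes t: "t \<in> T"
  shows "mm n (Ft h t x + (\<lambda>r c. l * E_mat n r c)) (Zt l t x) - mm n (Ztt h l t x) (Ft h t x + (\<lambda>r c. l * E_mat n r c)) =
    mm n (Ft h t x) (Zt 0 t x) - mm n (Ztt h 0 t x) (Ft h t x)"
proof -
  note a = smooth_u_t[OF t] smooth_h_t[OF t]
  show ?thesis
    unfolding Zt_def Ztt_def
  proof (rule Zf_gauge[OF n a(1) smooth_star_u[OF n a]])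
    show "smooth_mat (Ft h t)" unfolding Ft_def[abs_def] by (rule smooth_Ff[OF n a])
    show "\<not> (r < n \<and> c < n) \<Longrightarrow> Ft h t x r c = 0" for x r c unfolding Ft_def by (rule Ff_outside)
    show "dmat (Ft h t) x + mm n (B_mat n (\<lambda>i. star_u n (\<lambda>y. h y t) (uc t) i x) l) (Ft h t x + (\<lambda>r c. l * E_mat n r c)) =
      mm n (Ft h t x + (\<lambda>r c. l * E_mat n r c)) (B_mat n (\<lambda>i. uc t i x) l)" for l x
      using Ft_intertwine[OF t, of x l] by (simp add: Btt_def Bt_def)
  qed
qed

lemma Ft_Wt: "t \<in> T \<Longrightarrow> mv n (Ft h t x + (\<lambda>r c. l * E_mat n r c)) (Wt h t x) r = (if r = 0 then l - k else 0)"
  unfolding Ft_def Wt_def by (rule Ff_wv[OF n smooth_u_t smooth_h_t BT_x_t])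

text \<open>At \<lambda> = k the vector w lies in the kernel of f, so the gauge identity loses its
  term with the transformed Z(k). At \<lambda> = 0 one has f w = -k e_1, which produces the first
  column of the transformed Z(0). The vector on the left is the one that g multiplies in the time
  derivative of g w.\<close>

lemma Ft_Zt_Wt:
  assumes t: "t \<in> T"
  shows "mv n (Ft h t x) (\<lambda>s. mv n (Zt 0 t x) (Wt h t x) s + (ct h k t x * Wt h t x s - mv n (Zt k t x) (Wt h t x) s)) r = - k * Ztt h 0 t x r 0"
proof -
  let ?W = "Wt h t x" and ?F = "Ft h t x"
  have z: "?F + (\<lambda>r c. 0 * E_mat n r c) = ?F" by (intro ext) simp
  have FW: "mv n (?F + (\<lambda>r c. l * E_mat n r c)) ?W = (\<lambda>r. if r = 0 then l - k else 0)" for l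
    by (rule ext) (rule Ft_Wt[OF t])
  have "mv n (mm n (?F + (\<lambda>r c. k * E_mat n r c)) (Zt k t x) - mm n (Ztt h k t x) (?F + (\<lambda>r c. k * E_mat n r c))) ?W r =
      mv n (mm n ?F (Zt 0 t x) - mm n (Ztt h 0 t x) ?F) ?W r"
    unfolding Zt_gauge[OF t] ..
  then have "mv n ?F (mv n (Zt k t x) ?W) r + (if r = 0 then k * ct h k t x else 0) =
      mv n ?F (mv n (Zt 0 t x) ?W) r - (- k * Ztt h 0 t x r 0)"
    unfolding mv_diff_left mv_mm FW
    using FW[of 0] unfolding z by (cases "r = 0") (simp_all add: mv_add_left mv_E_l[OF order_trans[OF one_le_numeral n]] mv_first[OF order_trans[OF one_le_numeral n]] ct_def)
  moreover have "mv n ?F (\<lambda>s. mv n (Zt 0 t x) ?W s + (ct h k t x * ?W s - mv n (Zt k t x) ?W s)) r =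
      mv n ?F (mv n (Zt 0 t x) ?W) r + (ct h k t x * mv n ?F ?W r - mv n ?F (mv n (Zt k t x) ?W) r)"
    by (simp add: mv_def sum.distrib sum_subtractf sum_distrib_left algebra_simps)
  moreover have "mv n ?F ?W r = (if r = 0 then - k else 0)"
    using FW[of 0] unfolding z by simp
  ultimately show ?thesis by (cases "r = 0") (simp_all add: algebra_simps)
qed

text \<open>Apply K f = d g to w, where f w = -k e_1.\<close>

lemma Kt_first: "t \<in> T \<Longrightarrow> - k * Kt h d t x r 0 = mv n (fm n d) (mv n (Gt t x) (Wt h t x)) r"
proof -
  assume t: "t \<in> T"
  have z: "Ft h t x + (\<lambda>r c. 0 * E_mat n r c) = Ft h t x" by (intro ext) simp
  have "mv n (Ft h t x) (Wt h t x) = (\<lambda>r. if r = 0 then - k else 0)"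
  proof
    fix r show "mv n (Ft h t x) (Wt h t x) r = (if r = 0 then - k else 0)"
      using Ft_Wt[OF t, of x 0 r] unfolding z by simp
  qed
  then have "mv n (Kt h d t x) (mv n (Ft h t x) (Wt h t x)) r = - k * Kt h d t x r 0"
    by (simp only: mv_first[OF order_trans[OF one_le_numeral n]])
  then show ?thesis unfolding mv_mm[symmetric] Kt_Ft[OF t] by simp
qed

text \<open>Differentiating d g w in place of d g times the inverse of f avoids a time derivative of
  f, which is not yet known here.\<close>

lemma Kt_first_DERIV_t:
  assumes t: "t \<in> T"
  shows "((\<lambda>s. Kt h d s x r 0) has_real_derivative mm n (Kt h d t x) (Ztt h 0 t x) r 0) (at t)"
proof -
  let ?v = "\<lambda>s. mv n (Zt 0 t x) (Wt h t x) s + (ct h k t x * Wt h t x s - mv n (Zt k t x) (Wt h t x) s)"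
  have GW: "((\<lambda>s. mv n (Gt s x) (Wt h s x) r) has_real_derivative mv n (Gt t x) ?v r) (at t)" for r
  proof -
    have "((\<lambda>s. mv n (Gt s x) (Wt h s x) r) has_real_derivative
        mv n (mm n (Gt t x) (Zt 0 t x)) (Wt h t x) r + mv n (Gt t x) (\<lambda>s. ct h k t x * Wt h t x s - mv n (Zt k t x) (Wt h t x) s) r) (at t)"
      by (intro DERIV_mv Gt_DERIV_t Wt_DERIV_t t)
    moreover have "?v = mv n (Zt 0 t x) (Wt h t x) + (\<lambda>s. ct h k t x * Wt h t x s - mv n (Zt k t x) (Wt h t x) s)"
      by (simp add: fun_eq_iff)
    ultimately show ?thesis by (simp add: mv_add_right mv_mm)
  qed
  have "((\<lambda>s. mv n (fm n d) (mv n (Gt s x) (Wt h s x)) r) has_real_derivative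
      mv n (\<lambda>_ _. 0) (mv n (Gt t x) (Wt h t x)) r + mv n (fm n d) (mv n (Gt t x) ?v) r) (at t)"
    by (intro DERIV_mv DERIV_const GW)
  moreover have "mv n (\<lambda>_ _. 0) (mv n (Gt t x) (Wt h t x)) r = 0" by (simp add: mv_def)
  moreover have "mv n (fm n d) (mv n (Gt t x) ?v) r = mv n (Kt h d t x) (mv n (Ft h t x) ?v) r"
    unfolding mv_mm[symmetric] Kt_Ft[OF t] ..
  moreover have "mv n (Ft h t x) ?v = (\<lambda>r. - k * Ztt h 0 t x r 0)"
    by (rule ext) (rule Ft_Zt_Wt[OF t])
  ultimately have "((\<lambda>s. mv n (fm n d) (mv n (Gt s x) (Wt h s x)) r) has_real_derivative
      mv n (Kt h d t x) (\<lambda>r. - k * Ztt h 0 t x r 0) r) (at t)" by simp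
  then have "((\<lambda>s. - (1 / k) * mv n (fm n d) (mv n (Gt s x) (Wt h s x)) r) has_real_derivative
      - (1 / k) * mv n (Kt h d t x) (\<lambda>r. - k * Ztt h 0 t x r 0) r) (at t)"
    by (rule DERIV_cmult)
  then have "((\<lambda>s. Kt h d s x r 0) has_real_derivative - (1 / k) * mv n (Kt h d t x) (\<lambda>r. - k * Ztt h 0 t x r 0) r) (at t)"
  proof (rule has_field_derivative_transform_within_open[OF _ T t])
    show "- (1 / k) * mv n (fm n d) (mv n (Gt s x) (Wt h s x)) r = Kt h d s x r 0" if "s \<in> T" for s
      using Kt_first[OF that, of x r] k by (simp add: field_simps)
  qed
  moreover have "- (1 / k) * mv n (Kt h d t x) (\<lambda>r. - k * Ztt h 0 t x r 0) r = mm n (Kt h d t x) (Ztt h 0 t x) r 0"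
    unfolding mv_scale using k by (simp add: mv_def mm_def)
  ultimately show ?thesis by simp
qed

theorem flow_bt_curve: "curve_flow_solution n j T (bt_curve h d)"
  unfolding curve_flow_solution_def
proof (intro conjI ballI allI impI)
  fix r assume r: "r < n"
  have "smooth2 T (\<lambda>x t. bt_curve h d x t $ r)"
    by (rule smooth2_cong[OF T _ smooth2_Kt[of r 0]]) (use bt_curve_index r in auto)
  then show "smooth_fun_on (UNIV \<times> T) (\<lambda>(x, t). bt_curve h d x t $ r)" .
next
  fix t assume t: "t \<in> T"
  show "(\<lambda>x. bt_curve h d x t) \<in> central_affine_curves n"
    unfolding central_affine_curves_def
  proof (intro CollectI conjI allI impI)
    fix x
    have c: "bt_curve h d x t \<in> carrier_vec n" unfolding bt_curve_def using bt_frame_props(1)[OF t, of x] by (intro mult_mat_vec_carrier) auto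
    then show "bt_curve h d x t \<in> carrier_vec n" .
    show "bt_curve h d x t \<noteq> 0\<^sub>v n"
    proof
      assume 0: "bt_curve h d x t = 0\<^sub>v n"
      have K0: "Kt h d t x r 0 = 0" for r
        using bt_curve_index[OF t, of r x] 0 by (cases "r < n") (auto simp: Kt_def fm_def)
      have "mm n (fm n (bt_frame h d x t)) (\<lambda>r c. if r = 0 then 1 else 0) = mm n (fm n (bt_frame h d x t)) (\<lambda>r c :: nat. 0)"
      proof (intro ext)
        fix r c :: nat
        show "mm n (fm n (bt_frame h d x t)) (\<lambda>r c. if r = 0 then 1 else 0) r c = mm n (fm n (bt_frame h d x t)) (\<lambda>r c :: nat. 0) r c"
          using mv_first[OF order_trans[OF one_le_numeral n], of "Kt h d t x" 1 r] K0 by (simp add: mm_def mv_def Kt_def)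
      qed
      from mm_cancel_left[OF bt_frame_props(1)[OF t] _ this, where r = 0] show False
        using bt_frame_props(3)[OF t, of x] n by simp
    qed
    show "det (frame n (\<lambda>x. bt_curve h d x t) x) = 1" unfolding frame_bt_curve[OF t] by (rule bt_frame_props(3)[OF t])
  next
    fix r assume r: "r < n"
    have "smooth2 T (\<lambda>x t. bt_curve h d x t $ r)"
      by (rule smooth2_cong[OF T _ smooth2_Kt[of r 0]]) (use bt_curve_index r in auto)
    then show "smooth_fun_on UNIV (\<lambda>x. bt_curve h d x t $ r)" by (rule smooth2_slice[OF T _ t])
  qed
next
  fix t x r assume t: "t \<in> T" and r: "r < n"
  have cZ: "Z_at n j (star_u n (\<lambda>y. h y t) (uc t)) 0 x \<in> carrier_mat n n"
    by (rule Z_at_carrier[OF n smooth_star_u[OF n smooth_u_t[OF t] smooth_h_t[OF t]]])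
  have "(bt_frame h d x t * Z_at n j (star_u n (\<lambda>y. h y t) (uc t)) 0 x *\<^sub>v unit_vec n 0) $ r = mm n (Kt h d t x) (Ztt h 0 t x) r 0"
    using mult_unit_vec_index[OF mult_carrier_mat[OF bt_frame_props(1)[OF t] cZ] r] n r
      fun_cong[OF fun_cong[OF fm_mult[OF bt_frame_props(1)[OF t, of x] cZ], of r], of 0]
    by (simp add: fm_def[of n "_ * _"] Kt_def Ztt_def Zf_def)
  then show "((\<lambda>s. bt_curve h d x s $ r) has_real_derivative
      (frame n (\<lambda>x. bt_curve h d x t) x * Z_at n j (curvature n (\<lambda>x. bt_curve h d x t)) 0 x *\<^sub>v unit_vec n 0) $ r) (at t)"
    unfolding frame_bt_curve[OF t] curvature_bt_curve[OF t]
    by (simp only:) (rule has_field_derivative_transform_within_open[OF Kt_first_DERIV_t[OF t] T t], simp add: bt_curve_index r)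
qed

end

end

end

end

section \<open>Permutability\<close>

text \<open>Curves are compared only at times in T; as T is open, their time derivatives there agree
  too.\<close>

lemma curve_flow_solution_cong:
  assumes T: "open T" and eq: "\<And>x t. t \<in> T \<Longrightarrow> \<gamma> x t = \<gamma>' x t" and sol: "curve_flow_solution n j T \<gamma>"
  shows "curve_flow_solution n j T \<gamma>'"
proof -
  have e: "(\<lambda>x. \<gamma>' x t) = (\<lambda>x. \<gamma> x t)" if "t \<in> T" for t using eq[OF that] by auto
  show ?thesis
    unfolding curve_flow_solution_def
  proof (intro conjI ballI allI impI)
    fix r assume "r < n"
    then have "smooth2 T (\<lambda>x t. \<gamma> x t $ r)" using sol by (simp add: curve_flow_solution_def)
    then show "smooth2 T (\<lambda>x t. \<gamma>' x t $ r)" by (rule smooth2_cong[OF T, rotated]) (simp add: eq)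
  next
    fix t assume "t \<in> T"
    then show "(\<lambda>x. \<gamma>' x t) \<in> central_affine_curves n" using sol e by (simp add: curve_flow_solution_def)
  next
    fix t x r assume t: "t \<in> T" and r: "r < n"
    have D: "((\<lambda>s. \<gamma> x s $ r) has_real_derivative
        (frame n (\<lambda>x. \<gamma> x t) x * Z_at n j (curvature n (\<lambda>x. \<gamma> x t)) 0 x *\<^sub>v unit_vec n 0) $ r) (at t)"
      using sol t r by (simp add: curve_flow_solution_def)
    show "((\<lambda>s. \<gamma>' x s $ r) has_real_derivative
        (frame n (\<lambda>x. \<gamma>' x t) x * Z_at n j (curvature n (\<lambda>x. \<gamma>' x t)) 0 x *\<^sub>v unit_vec n 0) $ r) (at t)"
      unfolding e[OF t]
      by (rule has_field_derivative_transform_within_open[OF D T t]) (simp add: eq)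
  qed
qed

lemma BT_solution_cong:
  assumes "\<And>t. t \<in> T \<Longrightarrow> u t = u' t" "BT_solution n j T u k h"
  shows "BT_solution n j T u' k h"
  using assms unfolding BT_solution_def by simp

section \<open>The second transformation\<close>

context
  fixes n j :: nat and T :: "real set" and \<gamma> :: "real \<Rightarrow> real \<Rightarrow> real vec"
    and k1 k2 :: real and h1 h2 ht :: "real \<Rightarrow> real \<Rightarrow> real" and d1 :: "real mat"
  assumes n: "n \<ge> 2" and T: "open T" and sol: "curve_flow_solution n j T \<gamma>"
    and BT1: "BT_solution n j T (\<lambda>t. curvature n (\<lambda>x. \<gamma> x t)) k1 h1"
    and BT2: "BT_solution n j T (\<lambda>t. curvature n (\<lambda>x. \<gamma> x t)) k2 h2"
    and d1: "d1 \<in> carrier_mat n n" and det_d1: "det d1 = (-1) ^ n * k1" and k1: "k1 \<noteq> 0"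
    and ne: "\<And>x t. t \<in> T \<Longrightarrow> h1 x t \<noteq> h2 x t"
    and ht: "\<And>x t. t \<in> T \<Longrightarrow> ht x t = h2 x t + deriv (\<lambda>y. h1 y t - h2 y t) x / (h1 x t - h2 x t)"
begin

abbreviation (input) "curve1 \<equiv> bt_curve n \<gamma> h1 d1"
abbreviation (input) "u1 t \<equiv> star_u n (\<lambda>y. h1 y t) (uc n \<gamma> t)"
abbreviation (input) "F1 t x \<equiv> Ft n \<gamma> h1 t x"
abbreviation (input) "K1 t x \<equiv> Kt n \<gamma> h1 d1 t x"
abbreviation (input) "W2 t x \<equiv> Wt n \<gamma> h2 t x"
abbreviation (input) "F1l l t x \<equiv> Ft n \<gamma> h1 t x + (\<lambda>r c. l * E_mat n r c)"
abbreviation (input) "q x t \<equiv> h1 x t - h2 x t"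
abbreviation (input) "Z1 l t x \<equiv> Ztt n j \<gamma> h1 l t x"

lemmas flow1 = flow_bt_curve[OF n T sol BT1 d1 det_d1 k1]
lemmas curvature1 = curvature_bt_curve[OF n T sol BT1 d1 det_d1 k1]
lemmas frame1 = frame_bt_curve[OF n T sol BT1 d1 det_d1 k1]
lemmas u_smooth = smooth_u_t[OF n T sol]

lemma u1_smooth: "t \<in> T \<Longrightarrow> smooth_u n (u1 t)"
  by (rule smooth_star_u[OF n u_smooth smooth_h_t[OF n T sol BT1]])

lemma Gt1: "t \<in> T \<Longrightarrow> Gt n curve1 t x = K1 t x"
  by (simp add: Gt_def Gf_def frame1 Kt_def)

lemma uc1: "t \<in> T \<Longrightarrow> uc n curve1 t = u1 t"
  by (simp add: uc_def curvature1)

lemma Zt1: "t \<in> T \<Longrightarrow> Zt n j curve1 l t x = Z1 l t x"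
  by (simp add: Zt_def Ztt_def uc1)

lemma smooth2_q: "smooth2 T q"
  by (rule smooth2_sub[OF T smooth2_h[OF n T sol BT1] smooth2_h[OF n T sol BT2]])

lemma q_nz: "t \<in> T \<Longrightarrow> q x t \<noteq> 0"
  using ne by simp

lemma smooth2_ht: "smooth2 T ht"
proof (rule smooth2_cong[OF T])
  show "smooth2 T (\<lambda>x t. h2 x t + deriv (\<lambda>y. q y t) x / q x t)"
    by (intro smooth2_add[OF T] smooth2_divide[OF T] smooth2_dx[OF T] smooth2_q smooth2_h[OF n T sol BT2] q_nz)
qed (simp add: ht)

definition yv :: "real \<Rightarrow> real \<Rightarrow> nat \<Rightarrow> real" where
  "yv t x = mv n (F1l k2 t x) (W2 t x)"

text \<open>The last row of f ends with the entries 1 and h1, and the last two entries of the second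
  vector are -h2 and 1.\<close>

lemma yv_last:
  assumes t: "t \<in> T"
  shows "yv t x (n - 1) = q x t"
proof -
  have "mv n (F1 t x) (W2 t x) (n - 1) = W2 t x (n - 2) + h1 x t * W2 t x (n - 1)"
    unfolding Ft_def by (rule Ff_last_row[OF n u_smooth[OF t] smooth_h_t[OF n T sol BT1 t]])
  moreover have "W2 t x (n - 2) = - h2 x t"
  proof -
    have "Suc (n - 2) = n - 1" using n by simp
    then show ?thesis using w_fun_n1[of n "uc n \<gamma> t" "\<lambda>y. h2 y t"] n by (simp add: Wt_def wv_def)
  qed
  moreover have "mv n (\<lambda>r c. k2 * E_mat n r c) (W2 t x) (n - 1) = 0"
    using mv_E_l[OF order_trans[OF one_le_numeral n], of k2 "W2 t x"] n by simp
  ultimately show ?thesis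
    using Wt_last[OF n T sol BT2, of t x] by (simp add: yv_def mv_add_left)
qed

text \<open>f intertwines the two connections at every \<lambda>, so it maps the solution for u at
  \<lambda> = k2 to one for h1*u at the same \<lambda>, with the same scalar factor -h2.\<close>

lemma yv_DERIV_x:
  assumes t: "t \<in> T"
  shows "((\<lambda>y. yv t y r) has_real_derivative - mv n (Btt n \<gamma> h1 k2 t x) (yv t x) r - h2 x t * yv t x r) (at x)"
proof -
  let ?B = "Bt n \<gamma> k2 t x"
  have F: "((\<lambda>y. (F1l k2 t y) r c) has_real_derivative dmat (F1 t) x r c) (at x)" for r c
  proof -
    have "((\<lambda>y. F1 t y r c + k2 * E_mat n r c) has_real_derivative dmat (F1 t) x r c + 0) (at x)"
      by (intro DERIV_add DERIV_const Ft_DERIV_x[OF n T sol BT1 d1 det_d1 k1 t])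
    then show ?thesis by simp
  qed
  have 1: "((\<lambda>y. yv t y r) has_real_derivative mv n (dmat (F1 t) x) (W2 t x) r
      + mv n (F1l k2 t x) (\<lambda>r. - mv n ?B (W2 t x) r - h2 x t * W2 t x r) r) (at x)"
    unfolding yv_def by (rule DERIV_mv[where A = "\<lambda>y. F1l k2 t y" and v = "W2 t", OF F Wt_DERIV_x[OF n T sol BT2 t]])
  have 2: "mv n (F1l k2 t x) (\<lambda>r. - mv n ?B (W2 t x) r - h2 x t * W2 t x r) r =
      - mv n (F1l k2 t x) (mv n ?B (W2 t x)) r - h2 x t * yv t x r"
    unfolding yv_def by (simp add: mv_def sum_subtractf sum_negf sum_distrib_left algebra_simps sum.distrib)
  have 3: "mv n (dmat (F1 t) x) (W2 t x) r + mv n (Btt n \<gamma> h1 k2 t x) (yv t x) r = mv n (F1l k2 t x) (mv n ?B (W2 t x)) r"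
  proof -
    have "mv n (dmat (F1 t) x + mm n (Btt n \<gamma> h1 k2 t x) (F1l k2 t x)) (W2 t x) r = mv n (mm n (F1l k2 t x) ?B) (W2 t x) r"
      unfolding Ft_intertwine[OF n T sol BT1 d1 det_d1 k1 t] ..
    then show ?thesis by (simp add: mv_add_left mv_mm yv_def)
  qed
  have "mv n (dmat (F1 t) x) (W2 t x) r + mv n (F1l k2 t x) (\<lambda>r. - mv n ?B (W2 t x) r - h2 x t * W2 t x r) r =
      - mv n (Btt n \<gamma> h1 k2 t x) (yv t x) r - h2 x t * yv t x r"
    using 2 3 by linarith
  with 1 show ?thesis by (simp only:)
qed

text \<open>Division by h1 - h2 restores the last entry 1. In the linear system it adds the
  logarithmic derivative of h1 - h2 to h2, which is the origin of the formula for
  \<open>ht\<close>.\<close>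

definition vv :: "real \<Rightarrow> real \<Rightarrow> nat \<Rightarrow> real" where
  "vv t x r = yv t x r / q x t"

lemma vv_eq:
  assumes t: "t \<in> T"
  shows "deriv (\<lambda>y. vv t y r) x + mv n (B_mat n (\<lambda>i. u1 t i x) k2) (vv t x) r + ht x t * vv t x r = 0"
proof -
  have alg: "((- m - h * y) * p - y * p') / (p * p) + m / p + (h + p' / p) * (y / p) = 0" if "p \<noteq> 0" for m h y p p' :: real
    using that by (simp add: field_simps)
  have qx: "((\<lambda>y. q y t) has_real_derivative deriv (\<lambda>y. q y t) x) (at x)"
    by (rule smooth2_DERIV_x[OF T smooth2_q t])
  let ?y' = "- mv n (Btt n \<gamma> h1 k2 t x) (yv t x) r - h2 x t * yv t x r"
  have "((\<lambda>y. vv t y r) has_real_derivative (?y' * q x t - yv t x r * deriv (\<lambda>y. q y t) x) / (q x t * q x t)) (at x)"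
    unfolding vv_def by (rule DERIV_divide[OF yv_DERIV_x[OF t] qx q_nz[OF t]])
  from DERIV_imp_deriv[OF this]
  have 1: "deriv (\<lambda>y. vv t y r) x = (?y' * q x t - yv t x r * deriv (\<lambda>y. q y t) x) / (q x t * q x t)" .
  have 2: "mv n (B_mat n (\<lambda>i. u1 t i x) k2) (vv t x) r = mv n (Btt n \<gamma> h1 k2 t x) (yv t x) r / q x t"
    unfolding Btt_def vv_def by (simp add: mv_def sum_divide_distrib)
  show ?thesis
    unfolding 1 2 ht[OF t] unfolding vv_def by (rule alg[OF q_nz[OF t]])
qed

lemma vv_wv:
  assumes t: "t \<in> T"
  shows "r < n \<Longrightarrow> vv t x r = wv n (u1 t) (\<lambda>y. ht y t) x r" "BT_x n (u1 t) (\<lambda>y. ht y t) k2"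
proof -
  have last: "vv t x (n - 1) = 1" for x
    using yv_last[OF t] q_nz[OF t, of x] by (simp add: vv_def)
  note w = w_fun_unique[where v = "vv t" and k = k2, OF n u1_smooth[OF t] smooth2_slice[OF T smooth2_ht t] last vv_eq[OF t]]
  show "r < n \<Longrightarrow> vv t x r = wv n (u1 t) (\<lambda>y. ht y t) x r" by (rule w(1))
  show "BT_x n (u1 t) (\<lambda>y. ht y t) k2" by (rule w(2))
qed

text \<open>Both frames are now known to follow their flows: differentiate K f = d1 g in t and
  cancel K.\<close>

lemma Ft_DERIV_t:
  assumes t: "t \<in> T"
  shows "((\<lambda>s. F1 s x r c) has_real_derivative (mm n (F1 t x) (Zt n j \<gamma> 0 t x) - mm n (Z1 0 t x) (F1 t x)) r c) (at t)"
proof -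
  define F' where "F' r c = deriv (\<lambda>s. F1 s x r c) t" for r c
  have F': "((\<lambda>s. F1 s x r c) has_real_derivative F' r c) (at t)" for r c
    unfolding F'_def by (rule smooth2_DERIV_t[OF T smooth2_Ft[OF n T sol BT1] t])
  have Kt: "((\<lambda>s. K1 s x r c) has_real_derivative mm n (K1 t x) (Z1 0 t x) r c) (at t)" for r c
  proof -
    have "((\<lambda>s. Gt n curve1 s x r c) has_real_derivative mm n (K1 t x) (Z1 0 t x) r c) (at t)"
      using Gt_DERIV_t[OF n T flow1 t, of x r c] by (simp add: Gt1[OF t] Zt1[OF t])
    then show ?thesis
      by (rule has_field_derivative_transform_within_open[OF _ T t]) (simp add: Gt1)
  qed
  have "mm n (K1 t x) (F' + mm n (Z1 0 t x) (F1 t x)) = mm n (K1 t x) (mm n (F1 t x) (Zt n j \<gamma> 0 t x))"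
  proof (intro ext)
    fix r c
    have "((\<lambda>s. mm n (K1 s x) (F1 s x) r c) has_real_derivative
        mm n (mm n (K1 t x) (Z1 0 t x)) (F1 t x) r c + mm n (K1 t x) F' r c) (at t)"
      by (intro DERIV_mm Kt F')
    moreover have "((\<lambda>s. mm n (fm n d1) (Gt n \<gamma> s x) r c) has_real_derivative
        mm n (\<lambda>_ _. 0) (Gt n \<gamma> t x) r c + mm n (fm n d1) (mm n (Gt n \<gamma> t x) (Zt n j \<gamma> 0 t x)) r c) (at t)"
      by (intro DERIV_mm DERIV_const Gt_DERIV_t[OF n T sol t])
    then have "((\<lambda>s. mm n (K1 s x) (F1 s x) r c) has_real_derivative
        mm n (\<lambda>_ _. 0) (Gt n \<gamma> t x) r c + mm n (fm n d1) (mm n (Gt n \<gamma> t x) (Zt n j \<gamma> 0 t x)) r c) (at t)"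
      by (rule has_field_derivative_transform_within_open[OF _ T t]) (simp add: Kt_Ft[OF n T sol BT1 d1 det_d1 k1])
    ultimately have "mm n (mm n (K1 t x) (Z1 0 t x)) (F1 t x) r c + mm n (K1 t x) F' r c =
        mm n (\<lambda>_ _. 0) (Gt n \<gamma> t x) r c + mm n (fm n d1) (mm n (Gt n \<gamma> t x) (Zt n j \<gamma> 0 t x)) r c"
      by (rule DERIV_unique)
    also have "mm n (\<lambda>_ _. 0) (Gt n \<gamma> t x) r c = 0" by (simp add: mm_def)
    also have "mm n (fm n d1) (mm n (Gt n \<gamma> t x) (Zt n j \<gamma> 0 t x)) = mm n (K1 t x) (mm n (F1 t x) (Zt n j \<gamma> 0 t x))"
      unfolding mm_assoc[symmetric] Kt_Ft[OF n T sol BT1 d1 det_d1 k1 t] ..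
    finally show "mm n (K1 t x) (F' + mm n (Z1 0 t x) (F1 t x)) r c = mm n (K1 t x) (mm n (F1 t x) (Zt n j \<gamma> 0 t x)) r c"
      by (simp add: mm_add_right mm_assoc)
  qed
  then have e: "r < n \<Longrightarrow> (F' + mm n (Z1 0 t x) (F1 t x)) r c = mm n (F1 t x) (Zt n j \<gamma> 0 t x) r c"
    using mm_cancel_left[OF bt_frame_props(1)[OF n T sol BT1 d1 det_d1 k1 t]] bt_frame_props(3)[OF n T sol BT1 d1 det_d1 k1 t, of x]
    unfolding Kt_def by (metis zero_neq_one)
  show ?thesis
  proof (cases "r < n")
    case True
    then have "F' r c = (mm n (F1 t x) (Zt n j \<gamma> 0 t x) - mm n (Z1 0 t x) (F1 t x)) r c" using e by simp
    then show ?thesis using F'[of r c] by simp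
  next
    case False
    then have "(\<lambda>s. F1 s x r c) = (\<lambda>s. 0)" "(mm n (F1 t x) (Zt n j \<gamma> 0 t x) - mm n (Z1 0 t x) (F1 t x)) r c = 0"
      by (auto simp: mm_def Ft_def Ff_outside Ztt_def Zf_outside)
    then show ?thesis by simp
  qed
qed

text \<open>Take the last entry of the time derivative of \<open>yv\<close>: the gauge identity
  exchanges f Z for the transformed Z times f at \<lambda> = k2, and the evolution of the second
  vector brings in the scalar c.\<close>

lemma Zt_vv_last:
  assumes t: "t \<in> T"
  shows "mv n (Z1 k2 t x) (vv t x) (n - 1) = ct n j \<gamma> h2 k2 t x - deriv (\<lambda>s. q x s) t / q x t"
proof -
  let ?D = "mm n (F1 t x) (Zt n j \<gamma> 0 t x) - mm n (Z1 0 t x) (F1 t x)" and ?c = "ct n j \<gamma> h2 k2 t x"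
    and ?Z = "Zt n j \<gamma> k2 t x"
  have F: "((\<lambda>s. (F1l k2 s x) r c) has_real_derivative ?D r c) (at t)" for r c
  proof -
    have "((\<lambda>s. F1 s x r c + k2 * E_mat n r c) has_real_derivative ?D r c + 0) (at t)"
      by (intro DERIV_add DERIV_const Ft_DERIV_t[OF t])
    then show ?thesis by simp
  qed
  have "((\<lambda>s. yv s x (n - 1)) has_real_derivative mv n ?D (W2 t x) (n - 1)
      + mv n (F1l k2 t x) (\<lambda>r. ?c * W2 t x r - mv n ?Z (W2 t x) r) (n - 1)) (at t)"
    unfolding yv_def by (rule DERIV_mv[where A = "\<lambda>s. F1l k2 s x" and v = "\<lambda>s. W2 s x", OF F Wt_DERIV_t[OF n T sol BT2 t]])
  moreover have "mv n ?D (W2 t x) (n - 1) = mv n (F1l k2 t x) (mv n ?Z (W2 t x)) (n - 1) - mv n (Z1 k2 t x) (yv t x) (n - 1)"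
    unfolding Zt_gauge[OF n T sol BT1 d1 det_d1 k1 t, of x k2, symmetric] mv_diff_left mv_mm yv_def by simp
  moreover have "mv n (F1l k2 t x) (\<lambda>r. ?c * W2 t x r - mv n ?Z (W2 t x) r) (n - 1) =
      ?c * yv t x (n - 1) - mv n (F1l k2 t x) (mv n ?Z (W2 t x)) (n - 1)"
    unfolding yv_def by (simp add: mv_def sum_subtractf sum_distrib_left algebra_simps sum.distrib)
  ultimately have "((\<lambda>s. yv s x (n - 1)) has_real_derivative ?c * q x t - mv n (Z1 k2 t x) (yv t x) (n - 1)) (at t)"
    unfolding yv_last[OF t] by simp
  then have "((\<lambda>s. q x s) has_real_derivative ?c * q x t - mv n (Z1 k2 t x) (yv t x) (n - 1)) (at t)"
    by (rule has_field_derivative_transform_within_open[OF _ T t]) (rule yv_last)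
  from DERIV_imp_deriv[OF this]
  have "deriv (\<lambda>s. q x s) t = ?c * q x t - mv n (Z1 k2 t x) (yv t x) (n - 1)" .
  moreover have "mv n (Z1 k2 t x) (vv t x) (n - 1) = mv n (Z1 k2 t x) (yv t x) (n - 1) / q x t"
    unfolding vv_def by (simp add: mv_def sum_divide_distrib)
  ultimately show ?thesis using q_nz[OF t, of x] by (simp add: field_simps)
qed

text \<open>The time derivative of \<open>ht\<close> differs from -c_x by (q_x / q)_t, and the
  required right-hand side differs from -c_x by (q_t / q)_x; both are the mixed derivative of log
  |q|. The x-part is contained in \<open>vv_wv\<close>.\<close>

lemma BT_permuted: "BT_solution n j T u1 k2 ht"
  unfolding BT_solution_def
proof (intro conjI ballI allI)
  show "smooth2 T ht" by (rule smooth2_ht)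
next
  fix t x assume t: "t \<in> T"
  show "deriv (w_fun n (u1 t) (\<lambda>y. ht y t) 1) x + ht x t * w_fun n (u1 t) (\<lambda>y. ht y t) 1 x + u1 t 1 x + k2 = 0"
    using vv_wv(2)[OF t] unfolding BT_x_def by blast
next
  fix t x assume t: "t \<in> T"
  let ?qt = "\<lambda>y. deriv (\<lambda>s. q y s) t" and ?qx = "\<lambda>s. deriv (\<lambda>y. q y s) x" and ?c = "ct n j \<gamma> h2 k2 t"
  have "(Z_at n j (u1 t) k2 y *\<^sub>v w_vec n (u1 t) (\<lambda>z. ht z t) y) $ (n - 1) = ?c y - ?qt y / q y t" for y
  proof -
    have "(Z_at n j (u1 t) k2 y *\<^sub>v w_vec n (u1 t) (\<lambda>z. ht z t) y) $ (n - 1) =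
        mv n (Z1 k2 t y) (wv n (u1 t) (\<lambda>z. ht z t) y) (n - 1)"
      using Z_w_last[OF _ Z_at_carrier[OF n u1_smooth[OF t]]] n
      by (simp add: Ztt_def)
    also have "\<dots> = mv n (Z1 k2 t y) (vv t y) (n - 1)"
      unfolding mv_def using vv_wv(1)[OF t] by (intro sum.cong) auto
    finally show ?thesis unfolding Zt_vv_last[OF t] .
  qed
  then have e: "(\<lambda>y. (Z_at n j (u1 t) k2 y *\<^sub>v w_vec n (u1 t) (\<lambda>z. ht z t) y) $ (n - 1)) = (\<lambda>y. ?c y - ?qt y / q y t)"
    by blast
  have c': "(?c has_real_derivative deriv ?c x) (at x)"
    by (rule smooth_has_deriv[OF smooth_ct[OF n T sol BT2 t] UNIV_I])
  have qtx: "(?qt has_real_derivative deriv ?qt x) (at x)"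
    by (rule smooth2_DERIV_x[OF T smooth2_dt[OF T smooth2_q] t])
  have qx: "((\<lambda>y. q y t) has_real_derivative ?qx t) (at x)"
    by (rule smooth2_DERIV_x[OF T smooth2_q t])
  have qt: "((\<lambda>s. q x s) has_real_derivative ?qt x) (at t)"
    by (rule smooth2_DERIV_t[OF T smooth2_q t])
  have qxt: "(?qx has_real_derivative deriv ?qt x) (at t)"
    by (rule smooth2_mixed[OF T smooth2_q t])
  have "((\<lambda>y. ?c y - ?qt y / q y t) has_real_derivative
      deriv ?c x - (deriv ?qt x * q x t - ?qt x * ?qx t) / (q x t * q x t)) (at x)"
    by (intro DERIV_diff DERIV_divide c' qtx qx q_nz t)
  from DERIV_imp_deriv[OF this]
  have 1: "deriv (\<lambda>y. ?c y - ?qt y / q y t) x = deriv ?c x - (deriv ?qt x * q x t - ?qt x * ?qx t) / (q x t * q x t)" .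
  have "((\<lambda>s. h2 x s + ?qx s / q x s) has_real_derivative
      - deriv ?c x + (deriv ?qt x * q x t - ?qx t * ?qt x) / (q x t * q x t)) (at t)"
    by (intro DERIV_add DERIV_divide h_DERIV_t[OF n T sol BT2] qxt qt q_nz t)
  then have "((\<lambda>s. ht x s) has_real_derivative
      - deriv ?c x + (deriv ?qt x * q x t - ?qx t * ?qt x) / (q x t * q x t)) (at t)"
    by (rule has_field_derivative_transform_within_open[OF _ T t]) (simp add: ht)
  then show "((\<lambda>s. ht x s) has_real_derivative
      - deriv (\<lambda>y. (Z_at n j (u1 t) k2 y *\<^sub>v w_vec n (u1 t) (\<lambda>z. ht z t) y) $ (n - 1)) x) (at t)"
    unfolding e 1 by (simp add: mult.commute)
qed

lemma BT_flow1: "BT_solution n j T (\<lambda>t. curvature n (\<lambda>x. curve1 x t)) k2 ht"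
  by (rule BT_solution_cong[OF _ BT_permuted]) (simp add: curvature1)

section \<open>The twice transformed curve\<close>

context
  fixes d2 :: "real mat"
  assumes d2: "d2 \<in> carrier_mat n n" and det_d2: "det d2 = (-1) ^ n * k2" and k2: "k2 \<noteq> 0"
begin

abbreviation (input) "curve12 \<equiv> bt_curve n curve1 ht d2"

lemma flow_permuted: "curve_flow_solution n j T curve12"
  by (rule flow_bt_curve[OF n T flow1 BT_flow1 d2 det_d2 k2])

lemma star_permuted: "star_curve n d2 ht curve1 x t = curve12 x t"
  by (simp add: star_curve_def bt_curve_def bt_frame_def uc_def)

lemma permuted_curve_eq:
  assumes t: "t \<in> T"
  shows "curve12 x t = (d2 * bt_frame n \<gamma> h1 d1 x t * mat_inv (f_mat n (u1 t) (\<lambda>y. ht y t) x 0)) *\<^sub>v unit_vec n 0"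
  by (simp add: bt_curve_def[of n curve1] bt_frame_def[of n curve1] frame1[OF t] uc1[OF t])

text \<open>Symmetric in the two transformations up to the order of the factors \<open>d1\<close> and \<open>d2\<close>.\<close>

lemma permuted_curve_index:
  assumes t: "t \<in> T" and r: "r < n"
  shows "curve12 x t $ r = (mv n (fm n (d2 * d1)) (mv n (Gt n \<gamma> t x) (Wt n \<gamma> h1 t x)) r / k1
      - mv n (fm n (d2 * d1)) (mv n (Gt n \<gamma> t x) (Wt n \<gamma> h2 t x)) r / k2) / q x t"
proof -
  let ?G = "Gt n \<gamma> t x" and ?W1 = "Wt n \<gamma> h1 t x" and ?K = "K1 t x"
  have "- k2 * curve12 x t $ r = mv n (fm n d2) (mv n (Gt n curve1 t x) (Wt n curve1 ht t x)) r"
    using Kt_first[OF n T flow1 BT_flow1 d2 det_d2 k2 t, of x r]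
      bt_curve_index[OF n T flow1 BT_flow1 d2 det_d2 k2 t r, of x] by simp
  also have "mv n (Gt n curve1 t x) (Wt n curve1 ht t x) = mv n ?K (vv t x)"
    unfolding Gt1[OF t] Wt_def uc1[OF t] mv_def
    using vv_wv(1)[OF t] by (intro ext sum.cong) auto
  \<comment> \<open>K f = d1 g absorbs f. The \<lambda>-term of f at k2 turns the second vector into
    k2 e_1, as its last entry is 1, and so adds k2 times the first column of K.\<close>
  also have "\<dots> = (\<lambda>r. (1 / q x t) * (mv n (fm n d1) (mv n ?G (W2 t x)) r + k2 * ?K r 0))"
  proof
    fix r
    have "vv t x = (\<lambda>r. (1 / q x t) * yv t x r)" by (simp add: vv_def fun_eq_iff)
    then have "mv n ?K (vv t x) r = (1 / q x t) * mv n ?K (yv t x) r"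
      by (simp only: mv_scale)
    also have "mv n ?K (yv t x) r = mv n ?K (mv n (F1 t x) (W2 t x)) r + mv n ?K (\<lambda>r. if r = 0 then k2 else 0) r"
      unfolding yv_def mv_add_left mv_add_right mv_E_l[OF order_trans[OF one_le_numeral n]] Wt_last[OF n T sol BT2]
      by (simp only: mult_1_right plus_fun_apply)
    also have "\<dots> = mv n (fm n d1) (mv n ?G (W2 t x)) r + k2 * ?K r 0"
      unfolding mv_mm[symmetric] Kt_Ft[OF n T sol BT1 d1 det_d1 k1 t] mv_first[OF order_trans[OF one_le_numeral n]] ..
    finally show "mv n ?K (vv t x) r = (1 / q x t) * (mv n (fm n d1) (mv n ?G (W2 t x)) r + k2 * ?K r 0)" .
  qed
  finally have main: "- k2 * curve12 x t $ r =
      mv n (fm n d2) (\<lambda>r. (1 / q x t) * (mv n (fm n d1) (mv n ?G (W2 t x)) r + k2 * ?K r 0)) r" .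
  \<comment> \<open>The first column of K is the once transformed curve, written through the first
    vector.\<close>
  have K0: "?K r 0 = - (1 / k1) * mv n (fm n d1) (mv n ?G ?W1) r" for r
    unfolding Kt_first[OF n T sol BT1 d1 det_d1 k1 t, symmetric] using k1 by simp
  have M: "fm n (d2 * d1) = mm n (fm n d2) (fm n d1)" by (rule fm_mult[OF d2 d1])
  have lin: "mv n A (\<lambda>r. a * (y r + b * (c * z r))) r = a * (mv n A y r + (b * c) * mv n A z r)" for A a b c y z
    by (simp add: mv_def sum.distrib sum_distrib_left algebra_simps)
  have "curve12 x t $ r = (- k2 * curve12 x t $ r) * (- 1 / k2)" using k2 by simp
  also have "\<dots> = (mv n (fm n (d2 * d1)) (mv n ?G ?W1) r / k1 - mv n (fm n (d2 * d1)) (mv n ?G (W2 t x)) r / k2) / q x t"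
    unfolding main K0 lin M mv_mm using k1 k2 q_nz[OF t, of x] by (simp add: field_simps)
  finally show ?thesis .
qed

end

end

text \<open>Two instances of the second transformation with the indices exchanged. Their curves
  carry the factors d2 d1 and d1 d2, so they are identified when d1 and d2 commute; each of them
  solves the flow in any case.\<close>

theorem theorem4p5:
  fixes n j :: nat and T :: "real set" and \<gamma> :: "real \<Rightarrow> real \<Rightarrow> real vec"
    and k1 k2 :: real and d1 d2 :: "real mat" and h1 h2 :: "real \<Rightarrow> real \<Rightarrow> real"
  defines "u \<equiv> \<lambda>t. curvature n (\<lambda>x. \<gamma> x t)"
    and "g \<equiv> \<lambda>x t. frame n (\<lambda>y. \<gamma> y t) x"
    and "ht1 \<equiv> \<lambda>x t. h1 x t + deriv (\<lambda>y. h1 y t - h2 y t) x / (h1 x t - h2 x t)"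
    and "ht2 \<equiv> \<lambda>x t. h2 x t + deriv (\<lambda>y. h1 y t - h2 y t) x / (h1 x t - h2 x t)"
  defines "g1 \<equiv> \<lambda>x t. d1 * g x t * mat_inv (f_mat n (u t) (\<lambda>y. h1 y t) x 0)"
    and "g2 \<equiv> \<lambda>x t. d2 * g x t * mat_inv (f_mat n (u t) (\<lambda>y. h2 y t) x 0)"
  defines "\<gamma>1 \<equiv> \<lambda>x t. g1 x t *\<^sub>v unit_vec n 0"
    and "\<gamma>2 \<equiv> \<lambda>x t. g2 x t *\<^sub>v unit_vec n 0"
  defines "\<gamma>12 \<equiv> \<lambda>x t. (d2 * g1 x t
             * mat_inv (f_mat n (star_u n (\<lambda>y. h1 y t) (u t)) (\<lambda>y. ht2 y t) x 0)) *\<^sub>v unit_vec n 0"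
    and "\<gamma>21 \<equiv> \<lambda>x t. (d1 * g2 x t
             * mat_inv (f_mat n (star_u n (\<lambda>y. h2 y t) (u t)) (\<lambda>y. ht1 y t) x 0)) *\<^sub>v unit_vec n 0"
  assumes "n \<ge> 2" and "j \<ge> 1" and "j mod n \<noteq> 0" and "open T"
    and "curve_flow_solution n j T \<gamma>"
    and "k1 \<noteq> 0" and "k2 \<noteq> 0"
    and "d1 \<in> carrier_mat n n" and "invertible_mat d1" and "det d1 = (-1) ^ n * k1"
    and "d2 \<in> carrier_mat n n" and "invertible_mat d2" and "det d2 = (-1) ^ n * k2"
    and "BT_solution n j T u k1 h1" and "BT_solution n j T u k2 h2"
    and "\<forall>x. \<forall>t\<in>T. h1 x t \<noteq> h2 x t"
  shows "(\<forall>x. \<forall>t\<in>T. star_curve n d2 ht2 \<gamma>1 x t = \<gamma>12 x t \<and> star_curve n d1 ht1 \<gamma>2 x t = \<gamma>21 x t)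
    \<and> (d1 * d2 = d2 * d1 \<longrightarrow> (\<forall>x. \<forall>t\<in>T. \<gamma>12 x t = \<gamma>21 x t))
    \<and> curve_flow_solution n j T \<gamma>12
    \<and> curve_flow_solution n j T \<gamma>21"
proof -
  note n = \<open>n \<ge> 2\<close> and T = \<open>open T\<close> and sol = \<open>curve_flow_solution n j T \<gamma>\<close>
    and k1 = \<open>k1 \<noteq> 0\<close> and k2 = \<open>k2 \<noteq> 0\<close>
    and d1 = \<open>d1 \<in> carrier_mat n n\<close> and d2 = \<open>d2 \<in> carrier_mat n n\<close>
    and det1 = \<open>det d1 = (-1) ^ n * k1\<close> and det2 = \<open>det d2 = (-1) ^ n * k2\<close>
  have BT1: "BT_solution n j T (\<lambda>t. curvature n (\<lambda>x. \<gamma> x t)) k1 h1"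
    and BT2: "BT_solution n j T (\<lambda>t. curvature n (\<lambda>x. \<gamma> x t)) k2 h2"
    using \<open>BT_solution n j T u k1 h1\<close> \<open>BT_solution n j T u k2 h2\<close> by (simp_all add: u_def)
  have ne: "h1 x t \<noteq> h2 x t" "h2 x t \<noteq> h1 x t" if "t \<in> T" for x t
    using \<open>\<forall>x. \<forall>t\<in>T. h1 x t \<noteq> h2 x t\<close> that by metis+
  have ht2: "ht2 x t = h2 x t + deriv (\<lambda>y. h1 y t - h2 y t) x / (h1 x t - h2 x t)" for x t
    by (simp add: ht2_def)
  \<comment> \<open>The quotient is unchanged when h1 and h2 are exchanged, so \<open>ht1\<close>
    has the form that the exchanged instance requires.\<close>
  have ht1: "ht1 x t = h1 x t + deriv (\<lambda>y. h2 y t - h1 y t) x / (h2 x t - h1 x t)" if "t \<in> T" for x t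
  proof -
    have "((\<lambda>y. h1 y t - h2 y t) has_real_derivative deriv (\<lambda>y. h1 y t) x - deriv (\<lambda>y. h2 y t) x) (at x)"
      and "((\<lambda>y. h2 y t - h1 y t) has_real_derivative deriv (\<lambda>y. h2 y t) x - deriv (\<lambda>y. h1 y t) x) (at x)"
      by (intro DERIV_diff smooth_has_deriv[OF _ UNIV_I] smooth_h_t[OF n T sol BT1 that] smooth_h_t[OF n T sol BT2 that])+
    from this[THEN DERIV_imp_deriv] show ?thesis
      unfolding ht1_def by (metis minus_diff_eq minus_divide_divide)
  qed
  note c1 = n T sol BT1 BT2 d1 det1 k1 ne(1) ht2
  note c2 = n T sol BT2 BT1 d2 det2 k2 ne(2) ht1
  have u: "u t = uc n \<gamma> t" for t by (simp add: u_def uc_def)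
  have g1: "g1 x t = bt_frame n \<gamma> h1 d1 x t" for x t
    by (simp add: g1_def g_def u bt_frame_def)
  have g2: "g2 x t = bt_frame n \<gamma> h2 d2 x t" for x t
    by (simp add: g2_def g_def u bt_frame_def)
  have \<gamma>1: "\<gamma>1 = bt_curve n \<gamma> h1 d1"
    by (intro ext) (simp add: \<gamma>1_def g1 bt_curve_def)
  have \<gamma>2: "\<gamma>2 = bt_curve n \<gamma> h2 d2"
    by (intro ext) (simp add: \<gamma>2_def g2 bt_curve_def)
  have \<gamma>12: "bt_curve n \<gamma>1 ht2 d2 x t = \<gamma>12 x t" if "t \<in> T" for x t
    unfolding \<gamma>1 \<gamma>12_def g1 u by (rule permuted_curve_eq[OF c1 d2 det2 k2 that])
  have \<gamma>21: "bt_curve n \<gamma>2 ht1 d1 x t = \<gamma>21 x t" if "t \<in> T" for x t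
    unfolding \<gamma>2 \<gamma>21_def g2 u by (rule permuted_curve_eq[OF c2 d1 det1 k1 that])
  have "star_curve n d2 ht2 \<gamma>1 x t = \<gamma>12 x t" if "t \<in> T" for x t
    using star_permuted[OF c1 d2 det2 k2, of x t] \<gamma>12[OF that, of x] by (simp add: \<gamma>1)
  moreover have "star_curve n d1 ht1 \<gamma>2 x t = \<gamma>21 x t" if "t \<in> T" for x t
    using star_permuted[OF c2 d1 det1 k1, of x t] \<gamma>21[OF that, of x] by (simp add: \<gamma>2)
  moreover have flow: "curve_flow_solution n j T \<gamma>12" "curve_flow_solution n j T \<gamma>21"
    using curve_flow_solution_cong[OF T _ flow_permuted[OF c1 d2 det2 k2], of \<gamma>12]
      curve_flow_solution_cong[OF T _ flow_permuted[OF c2 d1 det1 k1], of \<gamma>21] \<gamma>12 \<gamma>21 by (simp_all add: \<gamma>1 \<gamma>2)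
  moreover have "\<gamma>12 x t = \<gamma>21 x t" if comm: "d1 * d2 = d2 * d1" and t: "t \<in> T" for x t
  proof (rule eq_vecI)
    have dims: "dim_vec (\<gamma>12 x t) = n" "dim_vec (\<gamma>21 x t) = n"
      using d1 d2 by (simp_all add: \<gamma>12_def \<gamma>21_def g1_def g2_def)
    then show "dim_vec (\<gamma>12 x t) = dim_vec (\<gamma>21 x t)" by simp
    fix r assume "r < dim_vec (\<gamma>21 x t)"
    then have r: "r < n" using dims by simp
    have alg: "(a / k1 - b / k2) / (p - s) = (b / k2 - a / k1) / (s - p)" for a b p s :: real
      by (metis minus_diff_eq minus_divide_divide)
    have i1: "bt_curve n (bt_curve n \<gamma> h1 d1) ht2 d2 x t $ r =
        (mv n (fm n (d2 * d1)) (mv n (Gt n \<gamma> t x) (Wt n \<gamma> h1 t x)) r / k1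
          - mv n (fm n (d2 * d1)) (mv n (Gt n \<gamma> t x) (Wt n \<gamma> h2 t x)) r / k2) / (h1 x t - h2 x t)"
      by (rule permuted_curve_index[OF c1 d2 det2 k2 t r])
    have i2: "bt_curve n (bt_curve n \<gamma> h2 d2) ht1 d1 x t $ r =
        (mv n (fm n (d1 * d2)) (mv n (Gt n \<gamma> t x) (Wt n \<gamma> h2 t x)) r / k2
          - mv n (fm n (d1 * d2)) (mv n (Gt n \<gamma> t x) (Wt n \<gamma> h1 t x)) r / k1) / (h2 x t - h1 x t)"
      by (rule permuted_curve_index[OF c2 d1 det1 k1 t r])
    show "\<gamma>12 x t $ r = \<gamma>21 x t $ r"
      unfolding \<gamma>12[OF t, symmetric] \<gamma>21[OF t, symmetric] unfolding \<gamma>1 \<gamma>2 i1 i2 comm by (rule alg)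
  qed
  ultimately show ?thesis by blast
qed

end
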